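(* For all $\pi_p$-processes $P$ and $Q$: (1) if $P\sqsubseteq_{pmay}Q$ then $P\sqsubseteq_SQ$; (2) if $P\sqsubseteq_{pmust}Q$ then $P\sqsubseteq_{FS}Q$.
   Context: Fix a countably infinite set of names $a,b,x,y,\dots$; $\bar a$ is the co-name of $a$, and $\mu$ ranges over names and co-names. Processes of the probabilistic $\pi$-calculus $\pi_p$ are given by $P ::= s \mid P\oplus_p P$ with $p\in(0,1]$, and state-based processes by $s ::= 0 \mid a(x).P \mid \bar a x.P \mid [x=y]s \mid [x\neq y]s \mid s+s \mid s\,|\,s \mid \nu x.s$; $a(x)$ and $\nu x$ bind $x$, terms are identified up to $\alpha$-conversion, and $fn,bn,n$ denote free, bound and all names. $S_p$ is the set of state-based processes. A distribution $\Delta$ is a finitely supported probability distribution on $S_p$; $\mathrm{supp}\,\Delta=\{s\mid\Delta(s)>0\}$, $\overline{s}$ is the point distribution at $s$, $fn(\Delta)=\bigcup_{s\in\mathrm{supp}\,\Delta}fn(s)$, and $\sum_i p_i\cdot\Delta_i$ denotes a convex combination. Interpretation: $[\![s]\!]=\overline s$, $[\![P\oplus_pQ]\!]=p\cdot[\![P]\!]+(1-p)\cdot[\![Q]\!]$; also $[\![P|Q]\!]=[\![P]\!]|[\![Q]\!]$ and $[\![\nu x.P]\!]=\nu x.[\![P]\!]$, where on distributions $(\Delta_1|\Delta_2)(s_1|s_2)=\Delta_1(s_1)\Delta_2(s_2)$ (0 on states not of this form), $(\nu x.\Delta)(\nu x.s)=\Delta(s)$ (0 elsewhere), and $\Delta[y/x](s)=\sum\{\Delta(s')\mid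 s'[y/x]=s\}$. Actions: $\tau$, bound input $a(x)$, free output $\bar ax$, bound output $\bar a(x)$. The late transition relation $s\xrightarrow{\alpha}\Delta$ is the least relation such that: $a(x).P\xrightarrow{a(x)}[\![P]\!]$, $\bar ax.P\xrightarrow{\bar ax}[\![P]\!]$; if $s\xrightarrow{\alpha}\Delta$ then $s+t\xrightarrow{\alpha}\Delta$, $t+s\xrightarrow{\alpha}\Delta$, $[x=x]s\xrightarrow{\alpha}\Delta$, and $[x\ne y]s\xrightarrow{\alpha}\Delta$ if $x\neq y$; if $s\xrightarrow{\alpha}\Delta$ and $bn(\alpha)\cap fn(t)=\emptyset$ then $s|t\xrightarrow{\alpha}\Delta|\overline t$ and $t|s\xrightarrow{\alpha}\overline t|\Delta$; if $s\xrightarrow{a(x)}\Delta_1$ and $t\xrightarrow{\bar ay}\Delta_2$ then $s|t\xrightarrow{\tau}\Delta_1[y/x]|\Delta_2$ and $t|s\xrightarrow{\tau}\Delta_2|\Delta_1[y/x]$; if $s\xrightarrow{a(w)}\Delta_1$ and $t\xrightarrow{\bar a(w)}\Delta_2$ then $s|t\xrightarrow{\tau}\nu w.(\Delta_1|\Delta_2)$ and $t|s\xrightarrow{\tau}\nu w.(\Delta_2|\Delta_1)$; if $s\xrightarrow{\alpha}\Delta$ and $x\notin n(\alpha)$ then $\nu x.s\xrightarrow{\alpha}\nu x.\Delta$; if $s\xrightarrow{\bar xz}\Delta$, $y\ne x$, $y\notin fn(\nu z.s)$ then $\nu z.s\xrightarrow{\bar x(y)}\Delta[y/z]$. Lifting: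 for $\mathcal R\subseteq S_p\times\mathcal D(S_p)$, $\overline{\mathcal R}$ is the smallest relation on distributions with $\overline s\,\overline{\mathcal R}\,\Theta$ whenever $s\mathcal R\Theta$, and $(\sum_{i\in I}p_i\Delta_i)\overline{\mathcal R}(\sum_{i\in I}p_i\Theta_i)$ whenever $\Delta_i\overline{\mathcal R}\Theta_i$ for all $i$ in a finite $I$, $\sum p_i=1$. $\Delta\xrightarrow{\alpha}\Theta$ denotes the lifted transition (bound names chosen in common). $s\xrightarrow{\hat\tau}\Delta$ means $s\xrightarrow{\tau}\Delta$ or $\Delta=\overline s$; $\xRightarrow{\hat\tau}$ is the reflexive-transitive closure of its lifting; for $\alpha\ne\tau$, $\Delta\xRightarrow{\hat\alpha}\Delta'$ iff $\Delta\xRightarrow{\hat\tau}\Delta_1\xrightarrow{\alpha}\Delta_2\xRightarrow{\hat\tau}\Delta'$. $s\Downarrow a$ iff $s\xrightarrow{a(x)}\Delta$ for some $x,\Delta$; $s\Downarrow\bar a$ iff $s\xrightarrow{\bar a(x)}\Delta$ or $s\xrightarrow{\bar ax}\Delta$ for some $x,\Delta$. For a set $X$ of names/co-names, $s\not\Downarrow X$ means $s$ has no $\tau$-transition and no $\mu\in X$ has $s\Downarrow\mu$; $\Delta\not\Downarrow X$ means $s\not\Downarrow X$ for all $s\in\mathrm{supp}\,\Delta$. A relation $\mathcal R\subseteq S_p\times\mathcal D(S_p)$ is a failure simulation if $s\mathcal R\Theta$ implies: (1) if $s\xrightarrow{a(x)}\Delta$ with $x\notin fn(s,\Theta)$, then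 for every name $w$ there are $\Theta_1,\Theta_2,\Theta'$ with $\Theta\xRightarrow{\hat\tau}\Theta_1\xrightarrow{a(x)}\Theta_2$, $\Theta_2[w/x]\xRightarrow{\hat\tau}\Theta'$ and $\Delta[w/x]\overline{\mathcal R}\Theta'$; (2) if $s\xrightarrow{\alpha}\Delta$, $\alpha$ not an input action, then $\Theta\xRightarrow{\hat\alpha}\Theta'$ and $\Delta\overline{\mathcal R}\Theta'$ for some $\Theta'$; (3) if $s\not\Downarrow X$ then $\Theta\xRightarrow{\hat\tau}\Theta'\not\Downarrow X$ for some $\Theta'$. A simulation satisfies (1),(2). $\triangleleft_S$, $\triangleleft_{FS}$ are the largest simulation and failure simulation. $P\sqsubseteq_SQ$ iff $[\![Q]\!]\xRightarrow{\hat\tau}\Theta$ and $[\![P]\!]\overline{\triangleleft_S}\Theta$ for some $\Theta$; $P\sqsubseteq_{FS}Q$ iff $[\![P]\!]\xRightarrow{\hat\tau}\Theta$ and $[\![Q]\!]\overline{\triangleleft_{FS}}\Theta$ for some $\Theta$. Testing: $\omega$ is a distinguished name not occurring in tested processes; a test is a $\pi_p$-process possibly also containing output prefixes on channel $\omega$; $s\xrightarrow{\omega}$ means $s\xrightarrow{\bar\omega b}\Delta$ for some $b,\Delta$. $\mathbb V(s)=\{1\}$ if $s\xrightarrow{\omega}$; $\mathbb V(s)=\bigcup\{\mathbb V(\Delta)\mid s\xrightarrow{\tau}\Delta\}$ if not $s\xrightarrow{\omega}$ but $s$ has a $\tau$-transition; $\mathbb V(s)=\{0\}$ otherwise; $\mathbb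 V(\Delta)=\{\sum_{s\in\mathrm{supp}\,\Delta}\Delta(s)p_s\mid p_s\in\mathbb V(s)\}$. $Apply(T,P)=\mathbb V([\![\nu\vec x.(T|P)]\!])$ with $\vec x$ enumerating $fn(T,P)\setminus\{\omega\}$. For $O_1,O_2\subseteq[0,1]$: $O_1\sqsubseteq_{Ho}O_2$ iff each $o_1\in O_1$ has $o_2\in O_2$ with $o_1\le o_2$; $O_1\sqsubseteq_{Sm}O_2$ iff each $o_2\in O_2$ has $o_1\in O_1$ with $o_1\le o_2$. $P\sqsubseteq_{pmay}Q$ iff $Apply(T,P)\sqsubseteq_{Ho}Apply(T,Q)$ for all tests $T$; $P\sqsubseteq_{pmust}Q$ iff $Apply(T,P)\sqsubseteq_{Sm}Apply(T,Q)$ for all tests $T$.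
   Formalization: In clause (2) a bound output need only be matched when its bound name is fresh for s and Θ (else false: P=νz.āz.0, Q=νz.(āz.0|x̄x.0)); in the bound-output rule for νz.s the restricted name z must differ from the channel x. *)

theory Defs
  imports "HOL-Probability.Probability"
begin

section \<open>Syntax\<close>

text \<open>
  Processes up to \<open>\<alpha>\<close>-conversion are represented by pure de Bruijn terms, so that
  \<open>\<alpha>\<close>-equivalence is equality. Free names and bound indices share the type \<^typ>\<open>nat\<close>: below
  \<open>k\<close> binders, the numbers less than \<open>k\<close> are bound and \<open>n + k\<close> stands for the free name \<open>n\<close>.
  In particular, every term of the datatype is a process. Everything after this section uses the
  named binders \<open>inp a x P\<close>, for \<open>a(x).P\<close>, and \<open>res x s\<close>, for \<open>\<nu>x.s\<close>; the lemmas at the end of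
  this section show that these behave as binders up to \<open>\<alpha>\<close>-conversion.
\<close>

type_synonym name = nat

typedef prob = "{p :: real. 0 < p \<and> p \<le> 1}"
  morphisms real_of_prob Prob
  by (rule exI[of _ 1]) simp

datatype proc =
    Emb state
  | Choice proc prob proc
and state =
    Zero
  | Inp name proc
  | Out name name proc
  | Match name name state
  | Mismatch name name state
  | Sum state state
  | Par state state
  | Res state

text \<open>Extension of a renaming to the scope of one more binder.\<close>

definition lift_ren :: "(name \<Rightarrow> name) \<Rightarrow> name \<Rightarrow> name" where
  "lift_ren f n = (case n of 0 \<Rightarrow> 0 | Suc m \<Rightarrow> Suc (f m))"

primrec ren_proc :: "(name \<Rightarrow> name) \<Rightarrow> proc \<Rightarrow> proc"
  and ren_state :: "(name \<Rightarrow> name) \<Rightarrow> state \<Rightarrow> state" where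
  "ren_proc f (Emb s) = Emb (ren_state f s)"
| "ren_proc f (Choice P p Q) = Choice (ren_proc f P) p (ren_proc f Q)"
| "ren_state f Zero = Zero"
| "ren_state f (Inp a P) = Inp (f a) (ren_proc (lift_ren f) P)"
| "ren_state f (Out a b P) = Out (f a) (f b) (ren_proc f P)"
| "ren_state f (Match a b s) = Match (f a) (f b) (ren_state f s)"
| "ren_state f (Mismatch a b s) = Mismatch (f a) (f b) (ren_state f s)"
| "ren_state f (Sum s t) = Sum (ren_state f s) (ren_state f t)"
| "ren_state f (Par s t) = Par (ren_state f s) (ren_state f t)"
| "ren_state f (Res s) = Res (ren_state (lift_ren f) s)"

primrec fn_proc :: "proc \<Rightarrow> name set"
  and fn_state :: "state \<Rightarrow> name set" where
  "fn_proc (Emb s) = fn_state s"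
| "fn_proc (Choice P p Q) = fn_proc P \<union> fn_proc Q"
| "fn_state Zero = {}"
| "fn_state (Inp a P) = {a} \<union> {n. Suc n \<in> fn_proc P}"
| "fn_state (Out a b P) = {a, b} \<union> fn_proc P"
| "fn_state (Match a b s) = {a, b} \<union> fn_state s"
| "fn_state (Mismatch a b s) = {a, b} \<union> fn_state s"
| "fn_state (Sum s t) = fn_state s \<union> fn_state t"
| "fn_state (Par s t) = fn_state s \<union> fn_state t"
| "fn_state (Res s) = {n. Suc n \<in> fn_state s}"

text \<open>\<open>subst_state y x s\<close> is \<open>s[y/x]\<close>.\<close>

definition subst_proc :: "name \<Rightarrow> name \<Rightarrow> proc \<Rightarrow> proc" where
  "subst_proc y x = ren_proc (id(x := y))"

definition subst_state :: "name \<Rightarrow> name \<Rightarrow> state \<Rightarrow> state" where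
  "subst_state y x = ren_state (id(x := y))"

definition bind_name :: "name \<Rightarrow> name \<Rightarrow> name" where
  "bind_name x n = (if n = x then 0 else Suc n)"

definition inp :: "name \<Rightarrow> name \<Rightarrow> proc \<Rightarrow> state" where
  "inp a x P = Inp a (ren_proc (bind_name x) P)"

definition res :: "name \<Rightarrow> state \<Rightarrow> state" where
  "res x s = Res (ren_state (bind_name x) s)"

lemma lift_ren_simps [simp]: "lift_ren f 0 = 0" "lift_ren f (Suc n) = Suc (f n)"
  by (simp_all add: lift_ren_def)

lemma lift_ren_id [simp]: "lift_ren (\<lambda>n. n) = (\<lambda>n. n)"
  by (rule ext) (simp add: lift_ren_def split: nat.split)

lemma lift_ren_comp: "lift_ren f \<circ> lift_ren g = lift_ren (f \<circ> g)"
  by (rule ext) (simp add: lift_ren_def split: nat.split)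

lemma ren_id [simp]: "ren_proc (\<lambda>n. n) P = P" "ren_state (\<lambda>n. n) s = s"
  by (induction P and s) simp_all

lemma ren_ren:
  "ren_proc f (ren_proc g P) = ren_proc (f \<circ> g) P"
  "ren_state f (ren_state g s) = ren_state (f \<circ> g) s"
  by (induction P and s arbitrary: f g and f g) (simp_all add: lift_ren_comp)

lemma ren_cong:
  "(\<And>n. n \<in> fn_proc P \<Longrightarrow> f n = g n) \<Longrightarrow> ren_proc f P = ren_proc g P"
  "(\<And>n. n \<in> fn_state s \<Longrightarrow> f n = g n) \<Longrightarrow> ren_state f s = ren_state g s"
proof (induction P and s arbitrary: f g and f g)
  case (Emb s)
  show ?case using Emb.IH[of f g] Emb.prems by simp
next
  case (Inp a P)
  have "lift_ren f n = lift_ren g n" if "n \<in> fn_proc P" for n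
    using that Inp.prems by (cases n) simp_all
  then have "ren_proc (lift_ren f) P = ren_proc (lift_ren g) P"
    by (rule Inp.IH[of "lift_ren f" "lift_ren g"])
  then show ?case using Inp.prems[of a] by simp
next
  case (Res s)
  have "lift_ren f n = lift_ren g n" if "n \<in> fn_state s" for n
    using that Res.prems by (cases n) simp_all
  then have "ren_state (lift_ren f) s = ren_state (lift_ren g) s"
    by (rule Res.IH[of "lift_ren f" "lift_ren g"])
  then show ?case by simp
next
  case (Choice P p Q)
  show ?case using Choice.IH[of f g] Choice.prems by simp
next
  case (Out a b P)
  show ?case using Out.IH[of f g] Out.prems by simp
next
  case (Match a b s)
  show ?case using Match.IH[of f g] Match.prems by simp
next
  case (Mismatch a b s)
  show ?case using Mismatch.IH[of f g] Mismatch.prems by simp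
next
  case (Sum s t)
  show ?case using Sum.IH[of f g] Sum.prems by simp
next
  case (Par s t)
  show ?case using Par.IH[of f g] Par.prems by simp
qed simp_all

lemma Suc_in_image_lift_ren: "{n. Suc n \<in> lift_ren f ` A} = f ` {n. Suc n \<in> A}"
proof (intro set_eqI iffI)
  fix n assume "n \<in> {n. Suc n \<in> lift_ren f ` A}"
  then obtain m where m: "m \<in> A" "Suc n = lift_ren f m" by auto
  then show "n \<in> f ` {n. Suc n \<in> A}" by (cases m) auto
next
  fix n assume "n \<in> f ` {n. Suc n \<in> A}"
  then obtain m where "Suc m \<in> A" "n = f m" by auto
  then show "n \<in> {n. Suc n \<in> lift_ren f ` A}"
    using image_eqI[of "Suc n" "lift_ren f" "Suc m" A] by simp
qed

lemma fn_ren: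
  "fn_proc (ren_proc f P) = f ` fn_proc P"
  "fn_state (ren_state f s) = f ` fn_state s"
  by (induction P and s arbitrary: f and f) (simp_all add: image_Un Suc_in_image_lift_ren)

lemma finite_fn [simp]: "finite (fn_proc P)" "finite (fn_state s)"
proof (induction P and s)
  case (Inp a P)
  have "{n. Suc n \<in> fn_proc P} = Suc -` fn_proc P" by auto
  with Inp show ?case by (simp add: finite_vimageI)
next
  case (Res s)
  have "{n. Suc n \<in> fn_state s} = Suc -` fn_state s" by auto
  with Res show ?case by (simp add: finite_vimageI)
qed simp_all

lemma fn_inp [simp]: "fn_state (inp a x P) = {a} \<union> (fn_proc P - {x})"
  by (auto simp: inp_def fn_ren bind_name_def image_iff)

lemma fn_res [simp]: "fn_state (res x s) = fn_state s - {x}"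
  by (auto simp: res_def fn_ren bind_name_def image_iff)

lemma inp_alpha:
  assumes "y \<notin> fn_proc P - {x}"
  shows "inp a y (subst_proc y x P) = inp a x P"
proof -
  have "ren_proc (bind_name y \<circ> id(x := y)) P = ren_proc (bind_name x) P"
    by (rule ren_cong) (use assms in \<open>auto simp: bind_name_def\<close>)
  then show ?thesis by (simp add: inp_def subst_proc_def ren_ren)
qed

lemma res_alpha:
  assumes "y \<notin> fn_state (res x s)"
  shows "res y (subst_state y x s) = res x s"
proof -
  have "ren_state (bind_name y \<circ> id(x := y)) s = ren_state (bind_name x) s"
    by (rule ren_cong) (use assms in \<open>auto simp: bind_name_def\<close>)
  then show ?thesis by (simp add: res_def subst_state_def ren_ren)
qed

lemma inp_inject: "inp a x P = inp b x Q \<longleftrightarrow> a = b \<and> P = Q"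
  and res_inject: "res x s = res x t \<longleftrightarrow> s = t"
proof -
  let ?u = "\<lambda>n. case n of 0 \<Rightarrow> x | Suc m \<Rightarrow> m"
  have eq: "?u \<circ> bind_name x = (\<lambda>n. n)"
    by (auto simp: bind_name_def fun_eq_iff)
  have "ren_proc ?u (ren_proc (bind_name x) P) = P" for P
    unfolding ren_ren eq by simp
  then show "inp a x P = inp b x Q \<longleftrightarrow> a = b \<and> P = Q"
    unfolding inp_def by (metis state.inject(1))
  have "ren_state ?u (ren_state (bind_name x) s) = s" for s
    unfolding ren_ren eq by simp
  then show "res x s = res x t \<longleftrightarrow> s = t"
    unfolding res_def by (metis state.inject(7))
qed

lemma inp_eq_iff:
  "inp a x P = inp b y Q \<longleftrightarrow> a = b \<and> x \<notin> fn_proc Q - {y} \<and> P = subst_proc x y Q"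
proof
  assume eq: "inp a x P = inp b y Q"
  then have ab: "a = b" and
    r: "ren_proc (bind_name x) P = ren_proc (bind_name y) Q"
    by (simp_all add: inp_def)
  have x: "x \<notin> fn_proc Q - {y}"
  proof
    assume "x \<in> fn_proc Q - {y}"
    then have "Suc x \<in> bind_name y ` fn_proc Q"
      by (intro image_eqI[of _ _ x]) (auto simp: bind_name_def)
    also have "bind_name y ` fn_proc Q = bind_name x ` fn_proc P"
      using r fn_ren(1) by metis
    finally show False by (auto simp: bind_name_def split: if_splits)
  qed
  then have "inp b x (subst_proc x y Q) = inp b y Q"
    by (intro inp_alpha) auto
  with eq have "P = subst_proc x y Q"
    using inp_inject by metis
  with ab x show "a = b \<and> x \<notin> fn_proc Q - {y} \<and> P = subst_proc x y Q" by blast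
next
  assume "a = b \<and> x \<notin> fn_proc Q - {y} \<and> P = subst_proc x y Q"
  then show "inp a x P = inp b y Q"
    using inp_alpha[of x Q y b] by auto
qed

lemma res_eq_iff:
  "res x s = res y t \<longleftrightarrow> x \<notin> fn_state t - {y} \<and> s = subst_state x y t"
proof
  assume eq: "res x s = res y t"
  then have x: "x \<notin> fn_state t - {y}"
    by (metis fn_res Diff_iff singletonI)
  then have "res x (subst_state x y t) = res y t"
    by (intro res_alpha) auto
  with eq have "s = subst_state x y t"
    using res_inject by metis
  with x show "x \<notin> fn_state t - {y} \<and> s = subst_state x y t" by blast
next
  assume "x \<notin> fn_state t - {y} \<and> s = subst_state x y t"
  then show "res x s = res y t"
    using res_alpha[of x y t] by auto
qed

lemma Inp_exhaust:
  assumes "Suc x \<notin> fn_proc P"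
  obtains Q where "Inp a P = inp a x Q"
proof
  let ?u = "\<lambda>n. case n of 0 \<Rightarrow> x | Suc m \<Rightarrow> m"
  have "ren_proc (bind_name x \<circ> ?u) P = ren_proc (\<lambda>n. n) P"
    by (rule ren_cong) (use assms in \<open>auto simp: bind_name_def split: nat.splits\<close>)
  then show "Inp a P = inp a x (ren_proc ?u P)"
    by (simp add: inp_def ren_ren)
qed

lemma Res_exhaust:
  assumes "x \<notin> fn_state (Res s)"
  obtains t where "Res s = res x t"
proof
  let ?u = "\<lambda>n. case n of 0 \<Rightarrow> x | Suc m \<Rightarrow> m"
  have "ren_state (bind_name x \<circ> ?u) s = ren_state (\<lambda>n. n) s"
    by (rule ren_cong) (use assms in \<open>auto simp: bind_name_def split: nat.splits\<close>)
  then show "Res s = res x (ren_state ?u s)"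
    by (simp add: res_def ren_ren)
qed

lemma lift_ren_subst_bind_name:
  "lift_ren (id(x := y)) \<circ> bind_name x = bind_name x"
  "z \<noteq> x \<Longrightarrow> z \<noteq> y \<Longrightarrow> lift_ren (id(x := y)) \<circ> bind_name z = bind_name z \<circ> id(x := y)"
  by (simp_all add: fun_eq_iff bind_name_def)

lemma subst_inp:
  "subst_state y x (inp a x P) = inp (if a = x then y else a) x P"
  "z \<noteq> x \<Longrightarrow> z \<noteq> y \<Longrightarrow>
    subst_state y x (inp a z P) = inp (if a = x then y else a) z (subst_proc y x P)"
  by (simp_all add: inp_def subst_state_def subst_proc_def ren_ren lift_ren_subst_bind_name)

lemma subst_res:
  "subst_state y x (res x s) = res x s"
  "z \<noteq> x \<Longrightarrow> z \<noteq> y \<Longrightarrow> subst_state y x (res z s) = res z (subst_state y x s)"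
  by (simp_all add: res_def subst_state_def ren_ren lift_ren_subst_bind_name)


section \<open>Distributions\<close>

text \<open>
  Distributions are of type \<^typ>\<open>state pmf\<close>. This type also contains distributions with infinite
  (countable) support; finiteness of supports is imposed where a distribution is not
  otherwise known to be finitely supported.
\<close>

definition fn_dist :: "state pmf \<Rightarrow> name set" where
  "fn_dist \<Delta> = (\<Union>s\<in>set_pmf \<Delta>. fn_state s)"

definition par_dist :: "state pmf \<Rightarrow> state pmf \<Rightarrow> state pmf" where
  "par_dist \<Delta> \<Theta> = map_pmf (\<lambda>(s, t). Par s t) (pair_pmf \<Delta> \<Theta>)"

definition res_dist :: "name \<Rightarrow> state pmf \<Rightarrow> state pmf" where
  "res_dist x \<Delta> = map_pmf (res x) \<Delta>"

definition subst_dist :: "name \<Rightarrow> name \<Rightarrow> state pmf \<Rightarrow> state pmf" where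
  "subst_dist y x \<Delta> = map_pmf (subst_state y x) \<Delta>"

primrec interp :: "proc \<Rightarrow> state pmf" where
  "interp (Emb s) = return_pmf s"
| "interp (Choice P p Q) =
     bind_pmf (bernoulli_pmf (real_of_prob p)) (\<lambda>b. if b then interp P else interp Q)"

lemma pmf_par_dist: "pmf (par_dist \<Delta> \<Theta>) (Par s t) = pmf \<Delta> s * pmf \<Theta> t"
proof -
  have "inj (\<lambda>(s, t). Par s t)" by (auto simp: inj_on_def)
  from pmf_map_inj'[OF this, of "pair_pmf \<Delta> \<Theta>" "(s, t)"] show ?thesis
    by (simp add: par_dist_def pmf_pair)
qed

lemma pmf_res_dist: "pmf (res_dist x \<Delta>) (res x s) = pmf \<Delta> s"
proof -
  have "inj (res x)" by (auto simp: inj_on_def res_inject)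
  from pmf_map_inj'[OF this] show ?thesis by (simp add: res_dist_def)
qed

lemma pmf_interp_Choice:
  "pmf (interp (Choice P p Q)) s =
    real_of_prob p * pmf (interp P) s + (1 - real_of_prob p) * pmf (interp Q) s"
  using real_of_prob[of p] by (simp add: pmf_bind)

lemma finite_interp: "finite (set_pmf (interp P))"
  by (induction P rule: proc.induct[where ?P2.0 = "\<lambda>_. True"]) (auto simp: set_pmf_bernoulli)


section \<open>Late transitions\<close>

datatype act =
    Tau
  | AInp name name  \<comment> \<open>\<open>a(x)\<close>\<close>
  | AOut name name  \<comment> \<open>free output\<close>
  | BOut name name  \<comment> \<open>bound output\<close>

primrec bn :: "act \<Rightarrow> name set" where
  "bn Tau = {}"
| "bn (AInp a x) = {x}"
| "bn (AOut a x) = {}"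
| "bn (BOut a x) = {x}"

primrec names_act :: "act \<Rightarrow> name set" where
  "names_act Tau = {}"
| "names_act (AInp a x) = {a, x}"
| "names_act (AOut a x) = {a, x}"
| "names_act (BOut a x) = {a, x}"

text \<open>
  In rule \<open>Open\<close>, the condition \<open>z \<noteq> x\<close> spells out that the bound name \<open>z\<close> is distinct from the
  free name \<open>x\<close> of the label; a restricted channel is not observable. It makes \<open>y \<noteq> x\<close> redundant.
\<close>

inductive late_trans :: "state \<Rightarrow> act \<Rightarrow> state pmf \<Rightarrow> bool" where
  Inp: "late_trans (inp a x P) (AInp a x) (interp P)"
| Out: "late_trans (Out a x P) (AOut a x) (interp P)"
| SumL: "late_trans s \<alpha> \<Delta> \<Longrightarrow> late_trans (Sum s t) \<alpha> \<Delta>"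
| SumR: "late_trans s \<alpha> \<Delta> \<Longrightarrow> late_trans (Sum t s) \<alpha> \<Delta>"
| Match: "late_trans s \<alpha> \<Delta> \<Longrightarrow> late_trans (Match x x s) \<alpha> \<Delta>"
| Mismatch: "late_trans s \<alpha> \<Delta> \<Longrightarrow> x \<noteq> y \<Longrightarrow> late_trans (Mismatch x y s) \<alpha> \<Delta>"
| ParL: "late_trans s \<alpha> \<Delta> \<Longrightarrow> bn \<alpha> \<inter> fn_state t = {} \<Longrightarrow>
    late_trans (Par s t) \<alpha> (par_dist \<Delta> (return_pmf t))"
| ParR: "late_trans s \<alpha> \<Delta> \<Longrightarrow> bn \<alpha> \<inter> fn_state t = {} \<Longrightarrow>
    late_trans (Par t s) \<alpha> (par_dist (return_pmf t) \<Delta>)"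
| ComL: "late_trans s (AInp a x) \<Delta>\<^sub>1 \<Longrightarrow> late_trans t (AOut a y) \<Delta>\<^sub>2 \<Longrightarrow>
    late_trans (Par s t) Tau (par_dist (subst_dist y x \<Delta>\<^sub>1) \<Delta>\<^sub>2)"
| ComR: "late_trans s (AInp a x) \<Delta>\<^sub>1 \<Longrightarrow> late_trans t (AOut a y) \<Delta>\<^sub>2 \<Longrightarrow>
    late_trans (Par t s) Tau (par_dist \<Delta>\<^sub>2 (subst_dist y x \<Delta>\<^sub>1))"
| CloseL: "late_trans s (AInp a w) \<Delta>\<^sub>1 \<Longrightarrow> late_trans t (BOut a w) \<Delta>\<^sub>2 \<Longrightarrow>
    late_trans (Par s t) Tau (res_dist w (par_dist \<Delta>\<^sub>1 \<Delta>\<^sub>2))"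
| CloseR: "late_trans s (AInp a w) \<Delta>\<^sub>1 \<Longrightarrow> late_trans t (BOut a w) \<Delta>\<^sub>2 \<Longrightarrow>
    late_trans (Par t s) Tau (res_dist w (par_dist \<Delta>\<^sub>2 \<Delta>\<^sub>1))"
| Res: "late_trans s \<alpha> \<Delta> \<Longrightarrow> x \<notin> names_act \<alpha> \<Longrightarrow> late_trans (res x s) \<alpha> (res_dist x \<Delta>)"
| Open: "late_trans s (AOut x z) \<Delta> \<Longrightarrow> z \<noteq> x \<Longrightarrow> y \<noteq> x \<Longrightarrow> y \<notin> fn_state (res z s) \<Longrightarrow>
    late_trans (res z s) (BOut x y) (subst_dist y z \<Delta>)"


section \<open>Lifting and weak transitions\<close>

text \<open>
  A convex combination \<open>\<Sum>i\<in>I. p i \<cdot> \<Delta> i\<close> over a finite \<open>I\<close> is \<^term>\<open>bind_pmf p \<Delta>\<close> for a finitely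
  supported \<open>p\<close>; indices of weight \<open>0\<close> contribute nothing and are left out.
\<close>

inductive lift_rel :: "(state \<Rightarrow> state pmf \<Rightarrow> bool) \<Rightarrow> state pmf \<Rightarrow> state pmf \<Rightarrow> bool"
  for R :: "state \<Rightarrow> state pmf \<Rightarrow> bool" where
  point: "R s \<Theta> \<Longrightarrow> lift_rel R (return_pmf s) \<Theta>"
| convex: "finite (set_pmf p) \<Longrightarrow> (\<And>i. i \<in> set_pmf p \<Longrightarrow> lift_rel R (\<Delta> i) (\<Theta> i)) \<Longrightarrow>
    lift_rel R (bind_pmf (p :: nat pmf) \<Delta>) (bind_pmf p \<Theta>)"

definition dist_trans :: "state pmf \<Rightarrow> act \<Rightarrow> state pmf \<Rightarrow> bool" where
  "dist_trans \<Delta> \<alpha> \<Theta> \<longleftrightarrow> lift_rel (\<lambda>s \<Theta>. late_trans s \<alpha> \<Theta>) \<Delta> \<Theta>"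

definition tau_hat :: "state \<Rightarrow> state pmf \<Rightarrow> bool" where
  "tau_hat s \<Delta> \<longleftrightarrow> late_trans s Tau \<Delta> \<or> \<Delta> = return_pmf s"

definition weak_tau :: "state pmf \<Rightarrow> state pmf \<Rightarrow> bool" where
  "weak_tau = (lift_rel tau_hat)\<^sup>*\<^sup>*"

definition weak :: "state pmf \<Rightarrow> act \<Rightarrow> state pmf \<Rightarrow> bool" where
  "weak \<Delta> \<alpha> \<Delta>' \<longleftrightarrow>
    (if \<alpha> = Tau then weak_tau \<Delta> \<Delta>'
     else \<exists>\<Delta>\<^sub>1 \<Delta>\<^sub>2. weak_tau \<Delta> \<Delta>\<^sub>1 \<and> dist_trans \<Delta>\<^sub>1 \<alpha> \<Delta>\<^sub>2 \<and> weak_tau \<Delta>\<^sub>2 \<Delta>')"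

lemma lift_rel_mono:
  assumes "lift_rel R \<Delta> \<Theta>" and "\<And>s \<Theta>. R s \<Theta> \<Longrightarrow> R' s \<Theta>"
  shows "lift_rel R' \<Delta> \<Theta>"
  using assms(1)
proof induction
  case (point s \<Theta>)
  then show ?case by (intro lift_rel.point assms(2))
next
  case (convex p \<Delta> \<Theta>)
  show ?case by (rule lift_rel.convex) (fact convex.hyps(1) convex.IH)+
qed


section \<open>Simulations and failure simulations\<close>

text \<open>Names and co-names.\<close>

datatype port = Name name | Coname name

primrec barb :: "state \<Rightarrow> port \<Rightarrow> bool" where
  "barb s (Name a) \<longleftrightarrow> (\<exists>x \<Delta>. late_trans s (AInp a x) \<Delta>)"
| "barb s (Coname a) \<longleftrightarrow> (\<exists>x \<Delta>. late_trans s (BOut a x) \<Delta> \<or> late_trans s (AOut a x) \<Delta>)"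

definition refuses :: "state \<Rightarrow> port set \<Rightarrow> bool" where
  "refuses s X \<longleftrightarrow> (\<nexists>\<Delta>. late_trans s Tau \<Delta>) \<and> (\<forall>\<mu>\<in>X. \<not> barb s \<mu>)"

definition refuses_dist :: "state pmf \<Rightarrow> port set \<Rightarrow> bool" where
  "refuses_dist \<Delta> X \<longleftrightarrow> (\<forall>s\<in>set_pmf \<Delta>. refuses s X)"

text \<open>
  As for inputs, the bound name of a bound output is taken to be fresh for both
  sides: a name that is free in \<open>\<Theta>\<close> could not be used by \<open>\<Theta>\<close> as a bound name.
\<close>

definition simulates :: "(state \<Rightarrow> state pmf \<Rightarrow> bool) \<Rightarrow> state \<Rightarrow> state pmf \<Rightarrow> bool" where
  "simulates R s \<Theta> \<longleftrightarrow>
     (\<forall>a x \<Delta>. late_trans s (AInp a x) \<Delta> \<longrightarrow> x \<notin> fn_state s \<union> fn_dist \<Theta> \<longrightarrow>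
       (\<forall>w. \<exists>\<Theta>\<^sub>1 \<Theta>\<^sub>2 \<Theta>'. weak_tau \<Theta> \<Theta>\<^sub>1 \<and> dist_trans \<Theta>\<^sub>1 (AInp a x) \<Theta>\<^sub>2 \<and>
          weak_tau (subst_dist w x \<Theta>\<^sub>2) \<Theta>' \<and> lift_rel R (subst_dist w x \<Delta>) \<Theta>')) \<and>
     (\<forall>\<alpha> \<Delta>. late_trans s \<alpha> \<Delta> \<longrightarrow> (\<nexists>a x. \<alpha> = AInp a x) \<longrightarrow>
       bn \<alpha> \<inter> (fn_state s \<union> fn_dist \<Theta>) = {} \<longrightarrow>
       (\<exists>\<Theta>'. weak \<Theta> \<alpha> \<Theta>' \<and> lift_rel R \<Delta> \<Theta>'))"

text \<open>Finiteness of supports says that \<open>R\<close> relates states to distributions.\<close>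

definition simulation :: "(state \<Rightarrow> state pmf \<Rightarrow> bool) \<Rightarrow> bool" where
  "simulation R \<longleftrightarrow> (\<forall>s \<Theta>. R s \<Theta> \<longrightarrow> finite (set_pmf \<Theta>) \<and> simulates R s \<Theta>)"

definition failure_simulation :: "(state \<Rightarrow> state pmf \<Rightarrow> bool) \<Rightarrow> bool" where
  "failure_simulation R \<longleftrightarrow> (\<forall>s \<Theta>. R s \<Theta> \<longrightarrow> finite (set_pmf \<Theta>) \<and> simulates R s \<Theta> \<and>
     (\<forall>X. refuses s X \<longrightarrow> (\<exists>\<Theta>'. weak_tau \<Theta> \<Theta>' \<and> refuses_dist \<Theta>' X)))"

definition sim :: "state \<Rightarrow> state pmf \<Rightarrow> bool" where
  "sim s \<Theta> \<longleftrightarrow> (\<exists>R. simulation R \<and> R s \<Theta>)"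

definition fsim :: "state \<Rightarrow> state pmf \<Rightarrow> bool" where
  "fsim s \<Theta> \<longleftrightarrow> (\<exists>R. failure_simulation R \<and> R s \<Theta>)"

lemma simulates_mono:
  assumes "simulates R s \<Theta>" and "\<And>s \<Theta>. R s \<Theta> \<Longrightarrow> R' s \<Theta>"
  shows "simulates R' s \<Theta>"
proof -
  have "lift_rel R \<Delta> \<Theta>' \<Longrightarrow> lift_rel R' \<Delta> \<Theta>'" for \<Delta> \<Theta>'
    by (erule lift_rel_mono) (rule assms(2))
  with assms(1) show ?thesis unfolding simulates_def by meson
qed

lemma sim_greatest: "simulation sim" "simulation R \<Longrightarrow> R \<le> sim"
proof -
  have le: "R s \<Theta> \<Longrightarrow> sim s \<Theta>" if "simulation R" for R s \<Theta>
    unfolding sim_def by (rule exI[of _ R]) (use that in simp)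
  then show "simulation R \<Longrightarrow> R \<le> sim"
    by (intro predicate2I)
  show "simulation sim"
    unfolding simulation_def[of sim]
  proof (intro allI impI)
    fix s \<Theta> assume "sim s \<Theta>"
    then obtain R where R: "simulation R" "R s \<Theta>"
      unfolding sim_def by (elim exE conjE)
    note * = R(1)[unfolded simulation_def, rule_format, OF R(2)]
    have "simulates R s \<Theta>"
      using * by simp
    then have "simulates sim s \<Theta>"
      by (rule simulates_mono) (rule le[OF R(1)])
    with * show "finite (set_pmf \<Theta>) \<and> simulates sim s \<Theta>"
      by simp
  qed
qed

lemma fsim_greatest: "failure_simulation fsim" "failure_simulation R \<Longrightarrow> R \<le> fsim"
proof -
  have le: "R s \<Theta> \<Longrightarrow> fsim s \<Theta>" if "failure_simulation R" for R s \<Theta>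
    unfolding fsim_def by (rule exI[of _ R]) (use that in simp)
  then show "failure_simulation R \<Longrightarrow> R \<le> fsim"
    by (intro predicate2I)
  show "failure_simulation fsim"
    unfolding failure_simulation_def[of fsim]
  proof (intro allI impI)
    fix s \<Theta> assume "fsim s \<Theta>"
    then obtain R where R: "failure_simulation R" "R s \<Theta>"
      unfolding fsim_def by (elim exE conjE)
    note * = R(1)[unfolded failure_simulation_def, rule_format, OF R(2)]
    have "simulates R s \<Theta>"
      using * by simp
    then have "simulates fsim s \<Theta>"
      by (rule simulates_mono) (rule le[OF R(1)])
    with * show "finite (set_pmf \<Theta>) \<and> simulates fsim s \<Theta> \<and>
        (\<forall>X. refuses s X \<longrightarrow> (\<exists>\<Theta>'. weak_tau \<Theta> \<Theta>' \<and> refuses_dist \<Theta>' X))"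
      by simp
  qed
qed

definition sim_preorder :: "proc \<Rightarrow> proc \<Rightarrow> bool" (infix "\<sqsubseteq>\<^sub>S" 50) where
  "P \<sqsubseteq>\<^sub>S Q \<longleftrightarrow> (\<exists>\<Theta>. weak_tau (interp Q) \<Theta> \<and> lift_rel sim (interp P) \<Theta>)"

definition fsim_preorder :: "proc \<Rightarrow> proc \<Rightarrow> bool" (infix "\<sqsubseteq>\<^sub>F\<^sub>S" 50) where
  "P \<sqsubseteq>\<^sub>F\<^sub>S Q \<longleftrightarrow> (\<exists>\<Theta>. weak_tau (interp P) \<Theta> \<and> lift_rel fsim (interp Q) \<Theta>)"


section \<open>Testing preorders\<close>

text \<open>
  In a test, \<open>\<omega>\<close> occurs only in output prefixes on channel \<open>\<omega>\<close>. The object of such a prefix may be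
  any name, including \<open>\<omega>\<close> itself. This is needed: success is a free output \<open>\<omega>\<close>-transition, and
  in \<open>apply_test\<close> every free name except \<open>\<omega>\<close> is restricted, so that an \<open>\<omega>\<close>-output of any
  other name is a bound one there.
\<close>

primrec test_proc :: "name \<Rightarrow> proc \<Rightarrow> bool"
  and test_state :: "name \<Rightarrow> state \<Rightarrow> bool" where
  "test_proc \<omega> (Emb s) \<longleftrightarrow> test_state \<omega> s"
| "test_proc \<omega> (Choice P p Q) \<longleftrightarrow> test_proc \<omega> P \<and> test_proc \<omega> Q"
| "test_state \<omega> Zero \<longleftrightarrow> True"
| "test_state \<omega> (Inp a P) \<longleftrightarrow> a \<noteq> \<omega> \<and> test_proc (Suc \<omega>) P"
| "test_state \<omega> (Out a b P) \<longleftrightarrow> (b = \<omega> \<longrightarrow> a = \<omega>) \<and> test_proc \<omega> P"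
| "test_state \<omega> (Match a b s) \<longleftrightarrow> a \<noteq> \<omega> \<and> b \<noteq> \<omega> \<and> test_state \<omega> s"
| "test_state \<omega> (Mismatch a b s) \<longleftrightarrow> a \<noteq> \<omega> \<and> b \<noteq> \<omega> \<and> test_state \<omega> s"
| "test_state \<omega> (Sum s t) \<longleftrightarrow> test_state \<omega> s \<and> test_state \<omega> t"
| "test_state \<omega> (Par s t) \<longleftrightarrow> test_state \<omega> s \<and> test_state \<omega> t"
| "test_state \<omega> (Res s) \<longleftrightarrow> test_state (Suc \<omega>) s"

definition succeeds :: "name \<Rightarrow> state \<Rightarrow> bool" where
  "succeeds \<omega> s \<longleftrightarrow> (\<exists>b \<Delta>. late_trans s (AOut \<omega> b) \<Delta>)"

text \<open>
  \<open>outcome_state \<omega> s r\<close> means \<open>r \<in> \<V>(s)\<close> and \<open>outcome_dist \<omega> \<Delta> r\<close> means \<open>r \<in> \<V>(\<Delta>)\<close>. The recursion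
  defining \<open>\<V>\<close> is well-founded because there are no infinite sequences of transitions.
\<close>

inductive outcome_state :: "name \<Rightarrow> state \<Rightarrow> real \<Rightarrow> bool"
  and outcome_dist :: "name \<Rightarrow> state pmf \<Rightarrow> real \<Rightarrow> bool" for \<omega> :: name where
  success: "succeeds \<omega> s \<Longrightarrow> outcome_state \<omega> s 1"
| step: "\<not> succeeds \<omega> s \<Longrightarrow> late_trans s Tau \<Delta> \<Longrightarrow> outcome_dist \<omega> \<Delta> r \<Longrightarrow> outcome_state \<omega> s r"
| fail: "\<not> succeeds \<omega> s \<Longrightarrow> (\<nexists>\<Delta>. late_trans s Tau \<Delta>) \<Longrightarrow> outcome_state \<omega> s 0"
| average: "(\<And>s. s \<in> set_pmf \<Delta> \<Longrightarrow> outcome_state \<omega> s (p s)) \<Longrightarrow>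
    outcome_dist \<omega> \<Delta> (\<Sum>s\<in>set_pmf \<Delta>. pmf \<Delta> s * p s)"

definition outcomes_state :: "name \<Rightarrow> state \<Rightarrow> real set" where
  "outcomes_state \<omega> s = {r. outcome_state \<omega> s r}"

definition outcomes_dist :: "name \<Rightarrow> state pmf \<Rightarrow> real set" where
  "outcomes_dist \<omega> \<Delta> = {r. outcome_dist \<omega> \<Delta> r}"

lemma outcomes_state_eq:
  "outcomes_state \<omega> s =
    (if succeeds \<omega> s then {1}
     else if \<exists>\<Delta>. late_trans s Tau \<Delta> then \<Union>{outcomes_dist \<omega> \<Delta> |\<Delta>. late_trans s Tau \<Delta>}
     else {0})"
  unfolding outcomes_state_def outcomes_dist_def
  by (auto simp: outcome_state.simps[of \<omega> s]) blast

lemma outcomes_dist_eq: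
  "outcomes_dist \<omega> \<Delta> =
    {\<Sum>s\<in>set_pmf \<Delta>. pmf \<Delta> s * p s |p. \<forall>s\<in>set_pmf \<Delta>. p s \<in> outcomes_state \<omega> s}"
  unfolding outcomes_state_def outcomes_dist_def outcome_dist.simps[of \<omega> \<Delta>]
  by blast

text \<open>
  \<open>\<lbrakk>\<nu>x\<^sub>1\<dots>x\<^sub>n.(T | P)\<rbrakk> = \<nu>x\<^sub>1\<dots>x\<^sub>n.(\<lbrakk>T\<rbrakk> | \<lbrakk>P\<rbrakk>)\<close>, where \<open>x\<^sub>1, \<dots>, x\<^sub>n\<close> are the free names
  of \<open>T\<close> and \<open>P\<close> except \<open>\<omega>\<close>, in increasing order.
\<close>

definition apply_test :: "name \<Rightarrow> proc \<Rightarrow> proc \<Rightarrow> real set" where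
  "apply_test \<omega> T P = outcomes_dist \<omega>
     (foldr res_dist (sorted_list_of_set (fn_proc T \<union> fn_proc P - {\<omega>}))
       (par_dist (interp T) (interp P)))"

definition hoare_le :: "real set \<Rightarrow> real set \<Rightarrow> bool" where
  "hoare_le O\<^sub>1 O\<^sub>2 \<longleftrightarrow> (\<forall>o\<^sub>1\<in>O\<^sub>1. \<exists>o\<^sub>2\<in>O\<^sub>2. o\<^sub>1 \<le> o\<^sub>2)"

definition smyth_le :: "real set \<Rightarrow> real set \<Rightarrow> bool" where
  "smyth_le O\<^sub>1 O\<^sub>2 \<longleftrightarrow> (\<forall>o\<^sub>2\<in>O\<^sub>2. \<exists>o\<^sub>1\<in>O\<^sub>1. o\<^sub>1 \<le> o\<^sub>2)"

definition pmay :: "name \<Rightarrow> proc \<Rightarrow> proc \<Rightarrow> bool" where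
  "pmay \<omega> P Q \<longleftrightarrow> (\<forall>T. test_proc \<omega> T \<longrightarrow> hoare_le (apply_test \<omega> T P) (apply_test \<omega> T Q))"

definition pmust :: "name \<Rightarrow> proc \<Rightarrow> proc \<Rightarrow> bool" where
  "pmust \<omega> P Q \<longleftrightarrow> (\<forall>T. test_proc \<omega> T \<longrightarrow> smyth_le (apply_test \<omega> T P) (apply_test \<omega> T Q))"

end

theory Submission
  imports Defs
begin

text \<open>
  Every state \<open>s\<close> has a characteristic test. It is a tree that probes, at its leaves, each
  obligation that \<open>s\<close> puts on a distribution simulating it. Its leaves are not successes but
  addresses, so a run yields a distribution over leaves, and the run of \<open>s\<close> itself yields a target
  distribution. Any run against \<open>\<Theta>\<close> that stays below this target on all leaves is forced to match
  the moves of \<open>s\<close>. To match a distribution, the test ticks into one of several branches, and each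
  branch gives half of its weight to a leaf of its own: as the weights sum to 1, staying below the
  target fixes the weights of the branches.

  An ordinary test arises by letting leaf \<open>p\<close> succeed with probability \<open>h p\<close>, which makes the
  outcome the scalar product of \<open>h\<close> with the distribution over leaves. The testing preorder provides
  for each \<open>h\<close> a run whose reward is at most that of the target; there are only finitely many runs,
  so a minimax argument turns this into one convex combination of runs below the target
    for all leaves at
  once. In the \<open>may\<close> case the inequality is reversed, but tests without refusals never deadlock, so
  that \<open>1 - h\<close> can be used in place of \<open>h\<close>.
\<close>


section \<open>Transitions as functions\<close>

text \<open>Two obstacles shape the development. Bound names: a late transition exists once per
  admissible bound name, and an input must be matched for every received name. Transitions are
  therefore also given as finite sets of derivatives in which index 0 stays open. One open
  derivative, together with its instances at the finitely many known names, stands for all received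
  names, because both kinds of simulation are stable under bijective renaming. Control of the test:
  the calculus has no internal prefix, yet a test must move on its own, be it to choose a branch or
  to escape a deadlock. Each test therefore runs beside a clock, a chain of outputs on a fresh
  channel, and a tick is an input on that channel. A tick also follows every comparison of a
  received name, since only a state may stand under a match, and a prefix is what leads back to
  probabilistic processes. Runs are kept apart from the rewards of their leaves: templates contain
  no success actions, so one finite set of runs serves all \<open>h\<close>, as the minimax argument
  requires.\<close>

abbreviation ren_dist :: "(name \<Rightarrow> name) \<Rightarrow> state pmf \<Rightarrow> state pmf" where
  "ren_dist f \<equiv> map_pmf (ren_state f)"

text \<open>Opens the innermost binder with \<open>x\<close>, as \<open>bind_name x\<close> closes
  it. It is not injective, since 0 and \<open>Suc x\<close> both go to \<open>x\<close>.\<close>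

definition inst :: "name \<Rightarrow> name \<Rightarrow> name" where
  "inst x n = (case n of 0 \<Rightarrow> x | Suc m \<Rightarrow> m)"

text \<open>Exchanges the two innermost binders. When an action with a bound name passes a
  restriction, its derivative has the name of the action at 0 and the restricted name at 1, while
  the \<open>Res\<close> put back around it must bind the latter.\<close>

definition swap :: "name \<Rightarrow> name" where
  "swap n = (if n = 0 then 1 else if n = 1 then 0 else n)"

lemma inst_simps [simp]: "inst x 0 = x" "inst x (Suc n) = n"
  by (simp_all add: inst_def)

lemma inst_bind_name: "inst y \<circ> bind_name x = id(x := y)"
  by (auto simp: bind_name_def fun_eq_iff)

lemma bind_name_inst: "n \<noteq> Suc x \<Longrightarrow> bind_name x (inst x n) = n"
  by (cases n) (auto simp: bind_name_def)

lemma inst_Suc: "inst x \<circ> Suc = id"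
  by (auto simp: fun_eq_iff)

lemma lift_ren_Suc: "lift_ren f \<circ> Suc = Suc \<circ> f"
  by (auto simp: fun_eq_iff)

lemma inj_lift_ren: "inj f \<Longrightarrow> inj (lift_ren f)"
  by (rule injI) (auto simp: lift_ren_def inj_eq split: nat.splits)

lemma inj_bind_name: "inj (bind_name x)"
  by (auto simp: inj_def bind_name_def split: if_splits)

lemma ren_id' [simp]: "ren_state id s = s" "ren_proc id P = P"
  unfolding id_def by (rule ren_id)+

lemma ren_par_dist: "ren_dist f (par_dist \<Delta> \<Theta>) = par_dist (ren_dist f \<Delta>) (ren_dist f \<Theta>)"
  by (simp add: par_dist_def map_pair[symmetric] map_pmf_comp case_prod_beta)

lemma ren_dist_comp: "ren_dist f (ren_dist g \<Delta>) = ren_dist (f \<circ> g) \<Delta>"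
  by (simp add: map_pmf_comp ren_ren)

lemma ren_dist_cong:
  "(\<And>n. n \<in> fn_dist \<Delta> \<Longrightarrow> f n = g n) \<Longrightarrow> ren_dist f \<Delta> = ren_dist g \<Delta>"
  by (intro map_pmf_cong refl ren_cong(2)) (auto simp: fn_dist_def)

lemma ren_dist_id [simp]: "ren_dist id \<Delta> = \<Delta>"
  by (simp add: map_pmf_idI)

lemma fn_ren_dist [simp]: "fn_dist (ren_dist f \<Delta>) = f ` fn_dist \<Delta>"
  by (auto simp: fn_dist_def fn_ren)

lemma fn_par_dist [simp]: "fn_dist (par_dist \<Delta> \<Theta>) = fn_dist \<Delta> \<union> fn_dist \<Theta>"
  using set_pmf_not_empty[of \<Delta>] set_pmf_not_empty[of \<Theta>]
  by (auto simp: fn_dist_def par_dist_def)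

lemma fn_return_pmf [simp]: "fn_dist (return_pmf s) = fn_state s"
  by (simp add: fn_dist_def)

lemma fn_map_Res [simp]: "fn_dist (map_pmf Res \<Delta>) = {n. Suc n \<in> fn_dist \<Delta>}"
  by (auto simp: fn_dist_def)

lemma fn_interp: "fn_dist (interp P) \<subseteq> fn_proc P"
  by (induction P rule: proc.induct[where ?P2.0 = "\<lambda>_. True"])
    (fastforce simp: fn_dist_def split: if_splits)+

lemma interp_ren: "interp (ren_proc f P) = ren_dist f (interp P)"
  by (induction P rule: proc.induct[where ?P2.0 = "\<lambda>_. True"])
    (auto simp: map_bind_pmf intro!: bind_pmf_cong)

lemma par_dist_return: "par_dist (return_pmf s) (return_pmf t) = return_pmf (Par s t)"
  by (simp add: par_dist_def pair_return_pmf1)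

text \<open>A pair \<open>(a, D)\<close> stands for all transitions \<open>a(x)\<close> that differ
  only in \<open>x\<close>: in \<open>D\<close>, index 0 is the received name and every other name
  is shifted by one. So these sets are finite, whereas \<open>late_trans\<close> has infinitely many
  labels for one input.\<close>

primrec ins :: "state \<Rightarrow> (name \<times> state pmf) set" where
  "ins Zero = {}"
| "ins (Inp a P) = {(a, interp P)}"
| "ins (Out a b P) = {}"
| "ins (Match a b s) = (if a = b then ins s else {})"
| "ins (Mismatch a b s) = (if a = b then {} else ins s)"
| "ins (Sum s t) = ins s \<union> ins t"
| "ins (Par s t) =
    (\<lambda>(a, D). (a, par_dist D (return_pmf (ren_state Suc t)))) ` ins s \<union>
    (\<lambda>(a, D). (a, par_dist (return_pmf (ren_state Suc s)) D)) ` ins t"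
| "ins (Res s) = {(a, map_pmf Res (ren_dist swap D)) |a D. (Suc a, D) \<in> ins s}"

primrec outs :: "state \<Rightarrow> (name \<times> name \<times> state pmf) set" where
  "outs Zero = {}"
| "outs (Inp a P) = {}"
| "outs (Out a b P) = {(a, b, interp P)}"
| "outs (Match a b s) = (if a = b then outs s else {})"
| "outs (Mismatch a b s) = (if a = b then {} else outs s)"
| "outs (Sum s t) = outs s \<union> outs t"
| "outs (Par s t) =
    (\<lambda>(a, b, D). (a, b, par_dist D (return_pmf t))) ` outs s \<union>
    (\<lambda>(a, b, D). (a, b, par_dist (return_pmf s) D)) ` outs t"
| "outs (Res s) = {(a, b, map_pmf Res D) |a b D. (Suc a, Suc b, D) \<in> outs s}"

text \<open>As for inputs, index 0 of the derivative is the bound object. In the first set for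
  \<open>Res\<close> the extruded name already is index 0, so that opening the scope leaves the
  derivative as it is.\<close>

primrec bouts :: "state \<Rightarrow> (name \<times> state pmf) set" where
  "bouts Zero = {}"
| "bouts (Inp a P) = {}"
| "bouts (Out a b P) = {}"
| "bouts (Match a b s) = (if a = b then bouts s else {})"
| "bouts (Mismatch a b s) = (if a = b then {} else bouts s)"
| "bouts (Sum s t) = bouts s \<union> bouts t"
| "bouts (Par s t) =
    (\<lambda>(a, D). (a, par_dist D (return_pmf (ren_state Suc t)))) ` bouts s \<union>
    (\<lambda>(a, D). (a, par_dist (return_pmf (ren_state Suc s)) D)) ` bouts t"
| "bouts (Res s) = {(a, D) |a D. (Suc a, 0, D) \<in> outs s} \<union>
    {(a, map_pmf Res (ren_dist swap D)) |a D. (Suc a, D) \<in> bouts s}"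

text \<open>An input meets a free output by opening its derivative with the object. It meets a bound
  output by putting both derivatives, which share index 0, under one new restriction.\<close>

definition coms :: "state \<Rightarrow> state \<Rightarrow> state pmf set" where
  "coms s t =
    {par_dist (ren_dist (inst b) D) E |a b D E. (a, D) \<in> ins s \<and> (a, b, E) \<in> outs t} \<union>
    {par_dist E (ren_dist (inst b) D) |a b D E. (a, D) \<in> ins t \<and> (a, b, E) \<in> outs s} \<union>
    {map_pmf Res (par_dist D E) |a D E. (a, D) \<in> ins s \<and> (a, E) \<in> bouts t} \<union>
    {map_pmf Res (par_dist E D) |a D E. (a, D) \<in> ins t \<and> (a, E) \<in> bouts s}"

primrec taus :: "state \<Rightarrow> state pmf set" where
  "taus Zero = {}"
| "taus (Inp a P) = {}"
| "taus (Out a b P) = {}"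
| "taus (Match a b s) = (if a = b then taus s else {})"
| "taus (Mismatch a b s) = (if a = b then {} else taus s)"
| "taus (Sum s t) = taus s \<union> taus t"
| "taus (Par s t) =
    (\<lambda>D. par_dist D (return_pmf t)) ` taus s \<union>
    (\<lambda>D. par_dist (return_pmf s) D) ` taus t \<union> coms s t"
| "taus (Res s) = map_pmf Res ` taus s"

section \<open>Derivatives under injective renaming\<close>

lemma ren_map_Res: "ren_dist f (map_pmf Res D) = map_pmf Res (ren_dist (lift_ren f) D)"
  by (simp add: map_pmf_comp)

lemma swap_lift_ren: "lift_ren (lift_ren f) \<circ> swap = swap \<circ> lift_ren (lift_ren f)"
  by (auto simp: fun_eq_iff swap_def lift_ren_def split: nat.splits)

lemma ren_Res_swap: "ren_dist (lift_ren f) (map_pmf Res (ren_dist swap D)) =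
    map_pmf Res (ren_dist swap (ren_dist (lift_ren (lift_ren f)) D))"
  by (simp only: ren_map_Res ren_dist_comp swap_lift_ren)

lemma lift_ren_eq_Suc_iff: "lift_ren f a = Suc b \<longleftrightarrow> (\<exists>c. a = Suc c \<and> b = f c)"
  and lift_ren_eq_0_iff: "lift_ren f a = 0 \<longleftrightarrow> a = 0"
  by (cases a; auto)+

text \<open>Common core of the \<open>Res\<close> cases for inputs and bound outputs. Removing a
  binder from the channel commutes with renaming because \<open>lift_ren f\<close> reaches a
  successor only from a successor; the assumption is the commutation on the side of the
  derivatives.\<close>

lemma lift_ren_image_unbind:
  assumes "\<And>D. K (H D) = F (K D)"
  shows "{(a, K D) |a D. (Suc a, D) \<in> (\<lambda>(a, D). (lift_ren f a, H D)) ` S} =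
    (\<lambda>(a, D). (f a, F D)) ` {(a, K D) |a D. (Suc a, D) \<in> S}" (is "?L = ?R")
proof (intro set_eqI iffI)
  fix x assume "x \<in> ?L"
  then obtain a D b E where "x = (a, K D)" "(b, E) \<in> S" "lift_ren f b = Suc a" "D = H E" by auto
  then show "x \<in> ?R" by (force simp: lift_ren_eq_Suc_iff assms)
next
  fix x assume "x \<in> ?R"
  then obtain a D where "x = (f a, K (H D))" "(Suc a, D) \<in> S" by (auto simp: assms)
  then show "x \<in> ?L" by force
qed

lemma ren_shift: "ren_state (lift_ren f) (ren_state Suc t) = ren_state Suc (ren_state f t)"
  by (simp add: ren_ren lift_ren_Suc)

lemma ren_inst: "ren_dist f (ren_dist (inst b) D) = ren_dist (inst (f b)) (ren_dist (lift_ren f) D)"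
proof -
  have "f \<circ> inst b = inst (f b) \<circ> lift_ren f"
    by (auto simp: fun_eq_iff inst_def lift_ren_def split: nat.split)
  then show ?thesis by (simp add: ren_dist_comp)
qed

text \<open>Injectivity keeps every \<open>Match\<close> and \<open>Mismatch\<close> decided as
  before; a renaming that identifies names could switch summands on or off.\<close>

lemma ins_ren: "inj f \<Longrightarrow> ins (ren_state f s) = (\<lambda>(a, D). (f a, ren_dist (lift_ren f) D)) ` ins s"
proof (induction s arbitrary: f rule: state.induct[where ?P1.0 = "\<lambda>_. True"])
  case (Res s)
  have "ins (ren_state (lift_ren f) s) = (\<lambda>(a, D). (lift_ren f a,
    ren_dist (lift_ren (lift_ren f)) D)) ` ins s"
    by (rule Res.IH) (rule inj_lift_ren[OF Res.prems])
  then show ?case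
    by (simp only: ren_state.simps ins.simps lift_ren_image_unbind ren_Res_swap)
qed (auto simp: interp_ren ren_par_dist ren_shift image_Un image_image case_prod_beta inj_eq)

lemma outs_ren: "inj f \<Longrightarrow> outs (ren_state f s) = (\<lambda>(a, b, D). (f a, f b, ren_dist f D)) ` outs s"
proof (induction s arbitrary: f rule: state.induct[where ?P1.0 = "\<lambda>_. True"])
  case (Res s)
  have eq: "outs (ren_state (lift_ren f) s) =
      (\<lambda>(a, b, D). (lift_ren f a, lift_ren f b, ren_dist (lift_ren f) D)) ` outs s"
    by (rule Res.IH) (rule inj_lift_ren[OF Res.prems])
  show ?case (is "?L = ?R")
  proof (intro set_eqI iffI)
    fix x assume "x \<in> ?L"
    then obtain a b D where "x = (a, b, map_pmf Res D)" "(Suc a, Suc b,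
      D) \<in> outs (ren_state (lift_ren f) s)" by auto
    then obtain c d E where "x = (f c, f d, map_pmf Res (ren_dist (lift_ren f) E))"
      "(Suc c, Suc d, E) \<in> outs s"
      unfolding eq by (auto simp: lift_ren_eq_Suc_iff eq_commute[of "Suc _"])
    then show "x \<in> ?R" by (force simp: ren_map_Res simp del: map_pmf_comp)
  next
    fix x assume "x \<in> ?R"
    then obtain a b D where "x = (f a, f b, map_pmf Res (ren_dist (lift_ren f) D))"
      "(Suc a, Suc b, D) \<in> outs s"
      by (auto simp: ren_map_Res simp del: map_pmf_comp)
    moreover from this have "(Suc (f a), Suc (f b), ren_dist (lift_ren f) D) \<in> outs (ren_state
      (lift_ren f) s)"
      unfolding eq by force
    ultimately show "x \<in> ?L" by auto
  qed
qed (auto simp: interp_ren ren_par_dist ren_shift image_Un image_image case_prod_beta inj_eq)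

lemma bouts_ren: "inj f \<Longrightarrow> bouts (ren_state f s) = (\<lambda>(a, D). (f a,
  ren_dist (lift_ren f) D)) ` bouts s"
proof (induction s arbitrary: f rule: state.induct[where ?P1.0 = "\<lambda>_. True"])
  case (Res s)
  have 1: "bouts (ren_state (lift_ren f) s) = (\<lambda>(a, D). (lift_ren f a,
    ren_dist (lift_ren (lift_ren f)) D)) ` bouts s"
    by (rule Res.IH) (rule inj_lift_ren[OF Res.prems])
  have 2: "outs (ren_state (lift_ren f) s) =
      (\<lambda>(a, b, D). (lift_ren f a, lift_ren f b, ren_dist (lift_ren f) D)) ` outs s"
    by (rule outs_ren) (rule inj_lift_ren[OF Res.prems])
  have "{(a, D) |a D. (Suc a, 0, D) \<in> outs (ren_state (lift_ren f) s)} =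
      (\<lambda>(a, D). (f a, ren_dist (lift_ren f) D)) ` {(a, D) |a D. (Suc a, 0, D) \<in> outs s}" (is "?L =
        ?R")
  proof (intro set_eqI iffI)
    fix x assume "x \<in> ?L"
    then obtain a D where "x = (a, D)" "(Suc a, 0, D) \<in> outs (ren_state (lift_ren f) s)" by auto
    then obtain c E where "x = (f c, ren_dist (lift_ren f) E)" "(Suc c, 0, E) \<in> outs s"
      unfolding 2 by (auto simp: lift_ren_eq_Suc_iff lift_ren_eq_0_iff eq_commute[of
        "Suc _"] eq_commute[of 0])
    then show "x \<in> ?R" by force
  next
    fix x assume "x \<in> ?R"
    then obtain a D where "x = (f a, ren_dist (lift_ren f) D)" "(Suc a, 0, D) \<in> outs s" by auto
    then show "x \<in> ?L" unfolding 2 by force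
  qed
  moreover have "{(a, map_pmf Res (ren_dist swap D)) |a D. (Suc a,
    D) \<in> bouts (ren_state (lift_ren f) s)} =
     (\<lambda>(a, D). (f a, ren_dist (lift_ren f) D)) ` {(a, map_pmf Res (ren_dist swap D)) |a D. (Suc a,
       D) \<in> bouts s}"
    by (simp only: 1 lift_ren_image_unbind ren_Res_swap)
  ultimately show ?case by (simp add: image_Un del: map_pmf_comp)
qed (auto simp: interp_ren ren_par_dist ren_shift image_Un image_image case_prod_beta inj_eq)

text \<open>Channels that agree after an injective renaming agreed before, so no new communication
  arises.\<close>

lemma coms_ren:
  assumes f: "inj f"
  shows "coms (ren_state f s) (ren_state f t) = ren_dist f ` coms s t"
proof (intro set_eqI iffI)
  fix X assume "X \<in> coms (ren_state f s) (ren_state f t)"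
  then show "X \<in> ren_dist f ` coms s t"
    unfolding coms_def ins_ren[OF f] outs_ren[OF f] bouts_ren[OF f] Un_iff
  proof (elim disjE, goal_cases)
    case 1
    then obtain a b D E where "(a, D) \<in> ins s" "(a, b, E) \<in> outs t"
        "X = par_dist (ren_dist (inst (f b)) (ren_dist (lift_ren f) D)) (ren_dist f E)"
      by (clarsimp simp: inj_eq[OF f]; blast)
    then show ?case unfolding ren_par_dist[symmetric] ren_inst[symmetric] by blast
  next
    case 2
    then obtain a b D E where "(a, D) \<in> ins t" "(a, b, E) \<in> outs s"
        "X = par_dist (ren_dist f E) (ren_dist (inst (f b)) (ren_dist (lift_ren f) D))"
      by (clarsimp simp: inj_eq[OF f]; blast)
    then show ?case unfolding ren_par_dist[symmetric] ren_inst[symmetric] by blast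
  next
    case 3
    then obtain a D E where "(a, D) \<in> ins s" "(a, E) \<in> bouts t"
        "X = map_pmf Res (par_dist (ren_dist (lift_ren f) D) (ren_dist (lift_ren f) E))"
      by (clarsimp simp: inj_eq[OF f]; blast)
    then show ?case unfolding ren_par_dist[symmetric] ren_map_Res[symmetric] by blast
  next
    case 4
    then obtain a D E where "(a, D) \<in> ins t" "(a, E) \<in> bouts s"
        "X = map_pmf Res (par_dist (ren_dist (lift_ren f) E) (ren_dist (lift_ren f) D))"
      by (clarsimp simp: inj_eq[OF f]; blast)
    then show ?case unfolding ren_par_dist[symmetric] ren_map_Res[symmetric] by blast
  qed
next
  have I: "(f a, ren_dist (lift_ren f) D) \<in> ins (ren_state f s)" if "(a, D) \<in> ins s" for a D s
    unfolding ins_ren[OF f] by (rule image_eqI[OF _ that]) simp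
  have B: "(f a, ren_dist (lift_ren f) D) \<in> bouts (ren_state f s)" if "(a, D) \<in> bouts s" for a D s
    unfolding bouts_ren[OF f] by (rule image_eqI[OF _ that]) simp
  have O: "(f a, f b, ren_dist f D) \<in> outs (ren_state f s)" if "(a, b, D) \<in> outs s" for a b D s
    unfolding outs_ren[OF f] by (rule image_eqI[OF _ that]) simp
  fix X assume "X \<in> ren_dist f ` coms s t"
  then obtain Y where Y: "Y \<in> coms s t" and X: "X = ren_dist f Y" by blast
  from Y show "X \<in> coms (ren_state f s) (ren_state f t)"
    unfolding coms_def Un_iff X
  proof (elim disjE, goal_cases)
    case 1
    then obtain a b D E where "Y = par_dist (ren_dist (inst b) D) E" and *: "(a, D) \<in> ins s"
      "(a, b, E) \<in> outs t"
      by blast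
    then have "ren_dist f Y = par_dist (ren_dist (inst (f b)) (ren_dist (lift_ren f) D)) (ren_dist
      f E)"
      by (simp only: ren_par_dist ren_inst)
    with I[OF *(1)] O[OF *(2)] show ?case by blast
  next
    case 2
    then obtain a b D E where "Y = par_dist E (ren_dist (inst b) D)" and *: "(a, D) \<in> ins t"
      "(a, b, E) \<in> outs s"
      by blast
    then have "ren_dist f Y = par_dist (ren_dist f E) (ren_dist (inst (f b)) (ren_dist (lift_ren f)
      D))"
      by (simp only: ren_par_dist ren_inst)
    with I[OF *(1)] O[OF *(2)] show ?case by blast
  next
    case 3
    then obtain a D E where "Y = map_pmf Res (par_dist D E)" and *: "(a, D) \<in> ins s"
      "(a, E) \<in> bouts t"
      by blast
    then have "ren_dist f Y = map_pmf Res (par_dist (ren_dist (lift_ren f) D) (ren_dist (lift_ren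
      f) E))"
      by (simp only: ren_par_dist ren_map_Res)
    with I[OF *(1)] B[OF *(2)] show ?case by blast
  next
    case 4
    then obtain a D E where "Y = map_pmf Res (par_dist E D)" and *: "(a, D) \<in> ins t"
      "(a, E) \<in> bouts s"
      by blast
    then have "ren_dist f Y = map_pmf Res (par_dist (ren_dist (lift_ren f) E) (ren_dist (lift_ren
      f) D))"
      by (simp only: ren_par_dist ren_map_Res)
    with I[OF *(1)] B[OF *(2)] show ?case by blast
  qed
qed

lemma taus_ren: "inj f \<Longrightarrow> taus (ren_state f s) = ren_dist f ` taus s"
proof (induction s arbitrary: f rule: state.induct[where ?P1.0 = "\<lambda>_. True"])
  case (Res s)
  then show ?case by (simp add: inj_lift_ren image_image ren_map_Res del: map_pmf_comp)
qed (auto simp: interp_ren ren_par_dist ren_shift image_Un image_image case_prod_beta inj_eq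
  coms_ren)


section \<open>Agreement with the late transition relation\<close>

lemma fn_outs: "(a, b, D) \<in> outs s \<Longrightarrow> a \<in> fn_state s \<and> b \<in> fn_state s \<and> fn_dist D \<subseteq> fn_state s"
proof (induction s arbitrary: a b D rule: state.induct[where ?P1.0 = "\<lambda>_. True"])
  case (Out x1 x2 x3)
  then show ?case using fn_interp[of x3] by auto
next
  case (Match x y s)
  from Match.IH[of a b D] Match.prems show ?case by (auto split: if_splits)
next
  case (Mismatch x y s)
  from Mismatch.IH[of a b D] Mismatch.prems show ?case by (auto split: if_splits)
next
  case (Sum s t)
  then show ?case by (fastforce simp del: insert_iff)
next
  case (Par s t)
  then show ?case by fastforce
next
  case (Res s)
  then show ?case by fastforce
qed simp_all

text \<open>The open index survives a restriction: \<open>swap\<close> moves it to 1, and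
  \<open>Res\<close> lowers it to 0 again.\<close>

lemma fn_map_Res_swap:
  assumes "fn_dist E \<subseteq> insert 0 (Suc ` A)"
  shows "fn_dist (map_pmf Res (ren_dist swap E)) \<subseteq> insert 0 (Suc ` {n. Suc n \<in> A})"
proof
  fix n assume "n \<in> fn_dist (map_pmf Res (ren_dist swap E))"
  then obtain m where m: "m \<in> fn_dist E" "swap m = Suc n" by (auto simp del: map_pmf_comp)
  show "n \<in> insert 0 (Suc ` {n. Suc n \<in> A})"
  proof (cases n)
    case (Suc k)
    then have "m = Suc n" using m(2) by (auto simp: swap_def split: if_splits)
    with Suc m(1) assms show ?thesis by auto
  qed simp
qed

lemma fn_ins: "(a, D) \<in> ins s \<Longrightarrow> a \<in> fn_state s \<and> fn_dist D \<subseteq> insert 0 (Suc ` fn_state s)"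
proof (induction s arbitrary: a D rule: state.induct[where ?P1.0 = "\<lambda>_. True"])
  case (Inp b P)
  have "n \<in> insert 0 (Suc ` {n. Suc n \<in> fn_proc P})" if "n \<in> fn_proc P" for n
    using that by (cases n) auto
  with Inp subsetD[OF fn_interp[of P]] show ?case by auto
next
  case (Match x y s)
  from Match.IH[of a D] Match.prems show ?case by (auto split: if_splits)
next
  case (Mismatch x y s)
  from Mismatch.IH[of a D] Mismatch.prems show ?case by (auto split: if_splits)
next
  case (Sum s t)
  from Sum.IH(1)[of a D] Sum.IH(2)[of a D] Sum.prems show ?case by auto
next
  case (Par s t)
  then obtain E where "(a, E) \<in> ins s \<and> D = par_dist E (return_pmf (ren_state Suc t)) \<or>
      (a, E) \<in> ins t \<and> D = par_dist (return_pmf (ren_state Suc s)) E" by auto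
  with Par.IH(1)[of a E] Par.IH(2)[of a E] show ?case by (auto simp: fn_ren image_Un)
next
  case (Res s)
  then obtain E where E: "D = map_pmf Res (ren_dist swap E)" "(Suc a, E) \<in> ins s"
    by (auto simp del: map_pmf_comp)
  with Res.IH have "Suc a \<in> fn_state s" "fn_dist E \<subseteq> insert 0 (Suc ` fn_state s)" by blast+
  then show ?case using fn_map_Res_swap[of E "fn_state s"] unfolding E(1) by simp
qed simp_all

lemma fn_bouts: "(a, D) \<in> bouts s \<Longrightarrow> a \<in> fn_state s \<and> fn_dist D \<subseteq> insert 0 (Suc ` fn_state s)"
proof (induction s arbitrary: a D rule: state.induct[where ?P1.0 = "\<lambda>_. True"])
  case (Match x y s)
  from Match.IH[of a D] Match.prems show ?case by (auto split: if_splits)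
next
  case (Mismatch x y s)
  from Mismatch.IH[of a D] Mismatch.prems show ?case by (auto split: if_splits)
next
  case (Sum s t)
  from Sum.IH(1)[of a D] Sum.IH(2)[of a D] Sum.prems show ?case by auto
next
  case (Par s t)
  then obtain E where "(a, E) \<in> bouts s \<and> D = par_dist E (return_pmf (ren_state Suc t)) \<or>
      (a, E) \<in> bouts t \<and> D = par_dist (return_pmf (ren_state Suc s)) E" by auto
  with Par.IH(1)[of a E] Par.IH(2)[of a E] show ?case by (auto simp: fn_ren image_Un)
next
  case (Res s)
  then consider "(Suc a, 0, D) \<in> outs s"
    | E where "D = map_pmf Res (ren_dist swap E)" "(Suc a, E) \<in> bouts s"
    by (auto simp del: map_pmf_comp)
  then show ?case
  proof cases
    case 1
    have "n \<in> insert 0 (Suc ` {n. Suc n \<in> fn_state s})" if "n \<in> fn_state s" for n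
      using that by (cases n) auto
    with fn_outs[OF 1] show ?thesis by auto
  next
    case (2 E)
    with Res.IH have "Suc a \<in> fn_state s" "fn_dist E \<subseteq> insert 0 (Suc ` fn_state s)" by blast+
    then show ?thesis using fn_map_Res_swap[of E "fn_state s"] unfolding 2(1) by simp
  qed
qed simp_all

lemma fn_coms: "D \<in> coms s t \<Longrightarrow> fn_dist D \<subseteq> fn_state s \<union> fn_state t"
  unfolding coms_def
  by (auto simp: inst_def split: nat.splits dest!: fn_ins fn_outs fn_bouts) (blast | fastforce)+

lemma fn_taus: "D \<in> taus s \<Longrightarrow> fn_dist D \<subseteq> fn_state s"
proof (induction s arbitrary: D rule: state.induct[where ?P1.0 = "\<lambda>_. True"])
  case (Match x y s)
  from Match.IH[of D] Match.prems show ?case by (auto split: if_splits)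
next
  case (Mismatch x y s)
  from Mismatch.IH[of D] Mismatch.prems show ?case by (auto split: if_splits)
next
  case (Sum s t)
  then show ?case by (fastforce simp del: insert_iff)
next
  case (Par s t)
  then show ?case using fn_coms by fastforce
next
  case (Res s)
  then show ?case by fastforce
qed simp_all

lemma inst_bind_id [simp]: "ren_dist (inst x) (ren_dist (bind_name x) D) = D"
proof -
  have "id(x := x) = id" by auto
  then show ?thesis by (simp only: ren_dist_comp inst_bind_name ren_dist_id)
qed

text \<open>Only 0 and \<open>Suc x\<close> are sent to \<open>x\<close> by \<open>inst x\<close>;
  excluding the latter makes closing with \<open>bind_name x\<close> undo the opening.\<close>

lemma ren_bind_inst: "Suc x \<notin> fn_dist D \<Longrightarrow> ren_dist (bind_name x) (ren_dist (inst x) D) = D"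
  unfolding ren_dist_comp
  by (rule trans[OF ren_dist_cong[of _ _ id] ren_dist_id]) (metis bind_name_inst comp_apply
    id_apply)

lemma Suc_notin_fn_ins: "(a, D) \<in> ins s \<Longrightarrow> x \<notin> fn_state s \<Longrightarrow> Suc x \<notin> fn_dist D"
  and Suc_notin_fn_bouts: "(a, D) \<in> bouts s \<Longrightarrow> x \<notin> fn_state s \<Longrightarrow> Suc x \<notin> fn_dist D"
  using fn_ins fn_bouts by blast+

lemma ren_bind_fresh: "x \<notin> fn_state t \<Longrightarrow> ren_state (bind_name x) t = ren_state Suc t"
  by (rule ren_cong) (auto simp: bind_name_def)

text \<open>Closing a name outside or inside a restriction yields the two binders in opposite order,
  which \<open>swap\<close> corrects.\<close>

lemma ren_bind_res: 
  assumes "x \<noteq> y"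
  shows "ren_dist (bind_name y) (res_dist x D) =
    map_pmf Res (ren_dist swap (ren_dist (lift_ren (bind_name x)) (ren_dist (bind_name y) D)))"
proof -
  have "lift_ren (bind_name y) \<circ> bind_name x = swap \<circ> lift_ren (bind_name x) \<circ> bind_name y"
    using assms by (auto simp: fun_eq_iff bind_name_def swap_def)
  then show ?thesis
    by (simp add: res_dist_def map_pmf_comp res_def ren_ren comp_assoc)
qed

lemma res_dist_conv: "res_dist x D = map_pmf Res (ren_dist (bind_name x) D)"
  by (simp add: res_dist_def res_def[abs_def] map_pmf_comp)

lemma ins_res: "(a, D) \<in> ins s \<Longrightarrow> a \<noteq> x \<Longrightarrow>
    (a, map_pmf Res (ren_dist swap (ren_dist (lift_ren (bind_name x)) D))) \<in> ins (res x s)"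
proof -
  assume *: "(a, D) \<in> ins s" "a \<noteq> x"
  have "(bind_name x a, ren_dist (lift_ren (bind_name x)) D) \<in> ins (ren_state (bind_name x) s)"
    unfolding ins_ren[OF inj_bind_name] by (rule image_eqI[OF _ *(1)]) simp
  with *(2) show ?thesis
    unfolding res_def by (auto simp: bind_name_def simp del: map_pmf_comp)
qed

lemma bouts_res: "(a, D) \<in> bouts s \<Longrightarrow> a \<noteq> x \<Longrightarrow>
    (a, map_pmf Res (ren_dist swap (ren_dist (lift_ren (bind_name x)) D))) \<in> bouts (res x s)"
proof -
  assume *: "(a, D) \<in> bouts s" "a \<noteq> x"
  have "(bind_name x a, ren_dist (lift_ren (bind_name x)) D) \<in> bouts (ren_state (bind_name x) s)"
    unfolding bouts_ren[OF inj_bind_name] by (rule image_eqI[OF _ *(1)]) simp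
  with *(2) show ?thesis
    unfolding res_def by (auto simp: bind_name_def simp del: map_pmf_comp)
qed

lemma outs_bind_name: "(a, b, D) \<in> outs s \<Longrightarrow>
    (bind_name x a, bind_name x b, ren_dist (bind_name x) D) \<in> outs (ren_state (bind_name x) s)"
  unfolding outs_ren[OF inj_bind_name] by (rule image_eqI) auto

lemma outs_res: "(a, b, D) \<in> outs s \<Longrightarrow> a \<noteq> x \<Longrightarrow> b \<noteq> x \<Longrightarrow> (a, b, res_dist x D) \<in> outs (res x s)"
  using outs_bind_name[of a b D s x]
  by (auto simp: res_def res_dist_conv bind_name_def simp del: map_pmf_comp)

lemma open_res: "(a, x, D) \<in> outs s \<Longrightarrow> a \<noteq> x \<Longrightarrow> (a, ren_dist (bind_name x) D) \<in> bouts (res x s)"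
  using outs_bind_name[of a x D s x] by (auto simp: res_def bind_name_def)

lemma taus_res: "taus (res x s) = res_dist x ` taus s"
  by (simp add: res_def taus_ren inj_bind_name image_image res_dist_conv del: map_pmf_comp)

text \<open>Closing the derivative over the bound name of the label forgets which name was chosen,
  and so turns every labelled transition into an entry of the derivative sets.\<close>

lemma late_trans_sound:
  "late_trans s \<alpha> \<Delta> \<Longrightarrow> (case \<alpha> of Tau \<Rightarrow> \<Delta> \<in> taus s
    | AInp a x \<Rightarrow> (a, ren_dist (bind_name x) \<Delta>) \<in> ins s
    | AOut a b \<Rightarrow> (a, b, \<Delta>) \<in> outs s
    | BOut a x \<Rightarrow> (a, ren_dist (bind_name x) \<Delta>) \<in> bouts s)"
proof (induction rule: late_trans.induct)
  case (Inp a x P)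
  then show ?case by (simp add: inp_def interp_ren)
next
  case (ParL s \<alpha> \<Delta> t)
  then show ?case
    by (cases \<alpha>) (force simp: ren_par_dist ren_bind_fresh)+
next
  case (ParR s \<alpha> \<Delta> t)
  then show ?case
    by (cases \<alpha>) (force simp: ren_par_dist ren_bind_fresh)+
next
  case (ComL s a x \<Delta>\<^sub>1 t y \<Delta>\<^sub>2)
  have "subst_dist y x \<Delta>\<^sub>1 = ren_dist (inst y) (ren_dist (bind_name x) \<Delta>\<^sub>1)"
    unfolding ren_dist_comp inst_bind_name by (simp add: subst_dist_def subst_state_def[abs_def])
  with ComL have "par_dist (subst_dist y x \<Delta>\<^sub>1) \<Delta>\<^sub>2 \<in> coms s t" 
    unfolding coms_def by (auto simp del: map_pmf_comp)
  then show ?case by simp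
next
  case (ComR s a x \<Delta>\<^sub>1 t y \<Delta>\<^sub>2)
  have "subst_dist y x \<Delta>\<^sub>1 = ren_dist (inst y) (ren_dist (bind_name x) \<Delta>\<^sub>1)"
    unfolding ren_dist_comp inst_bind_name by (simp add: subst_dist_def subst_state_def[abs_def])
  with ComR have "par_dist \<Delta>\<^sub>2 (subst_dist y x \<Delta>\<^sub>1) \<in> coms t s"
    unfolding coms_def by (auto simp del: map_pmf_comp)
  then show ?case by simp
next
  case (CloseL s a w \<Delta>\<^sub>1 t \<Delta>\<^sub>2)
  then have "res_dist w (par_dist \<Delta>\<^sub>1 \<Delta>\<^sub>2) \<in> coms s t"
    unfolding coms_def res_dist_conv ren_par_dist by auto
  then show ?case by simp
next
  case (CloseR s a w \<Delta>\<^sub>1 t \<Delta>\<^sub>2)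
  then have "res_dist w (par_dist \<Delta>\<^sub>2 \<Delta>\<^sub>1) \<in> coms t s"
    unfolding coms_def res_dist_conv ren_par_dist by auto
  then show ?case by simp
next
  case (Res s \<alpha> \<Delta> x)
  then show ?case
    by (cases \<alpha>) (auto simp: taus_res ren_bind_res ins_res bouts_res outs_res simp del:
      map_pmf_comp)
next
  case (Open s x z \<Delta> y)
  \<comment> \<open>Since \<open>y\<close> is fresh, renaming \<open>z\<close> to \<open>y\<close>
    and then closing over \<open>y\<close> is the same as closing over \<open>z\<close> at
    once.\<close>
  have "ren_dist (bind_name y) (subst_dist y z \<Delta>) = ren_dist (bind_name y \<circ> id(z := y)) \<Delta>"
    by (simp add: subst_dist_def subst_state_def map_pmf_comp ren_ren)
  also have "\<dots> = ren_dist (bind_name z) \<Delta>"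
    by (rule ren_dist_cong) (use Open fn_outs[of x z \<Delta> s] in \<open>auto simp: bind_name_def\<close>)
  finally show ?case using Open open_res[of x z \<Delta> s] by simp
qed (auto split: act.splits)

lemma ex_fresh: "finite (A :: name set) \<Longrightarrow> \<exists>x. x \<notin> A"
  by (rule ex_new_if_finite) simp_all

lemma size_ren [simp]:
  "size (ren_proc f P) = size P"
  "size (ren_state f s) = size s"
  by (induction P and s arbitrary: f and f) simp_all

lemma inst_shift [simp]: "ren_state (inst x) (ren_state Suc t) = t"
  by (simp add: ren_ren inst_Suc)

text \<open>The induction is on size and not on structure, because the rule \<open>Res\<close>
  speaks of a named restriction \<open>res y t0\<close>, and \<open>t0\<close> is a renaming of the
  de Bruijn body, not a subterm. The four kinds of transition are treated together because
  communications are built from the other three.\<close>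

lemma late_trans_complete:
  "(\<forall>D. D \<in> taus s \<longrightarrow> late_trans s Tau D) \<and>
   (\<forall>a b D. (a, b, D) \<in> outs s \<longrightarrow> late_trans s (AOut a b) D) \<and>
   (\<forall>a x D. (a, D) \<in> ins s \<longrightarrow> x \<notin> fn_state s \<longrightarrow> late_trans s (AInp a x) (ren_dist (inst x) D)) \<and>
   (\<forall>a x D. (a, D) \<in> bouts s \<longrightarrow> x \<notin> fn_state s \<longrightarrow> late_trans s (BOut a x) (ren_dist (inst x) D))"
  (is "?tau s \<and> ?out s \<and> ?in s \<and> ?bout s")
proof (induction "size s" arbitrary: s rule: less_induct)
  case less
  note IH = less.hyps
  show ?case
  proof (cases s)
    case Zero
    then show ?thesis by simp
  next
    case (Inp b P)
    have "late_trans s (AInp b x) (ren_dist (inst x) (interp P))" if "x \<notin> fn_state s" for x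
    proof -
      have "Suc x \<notin> fn_proc P" using that Inp by auto
      then obtain Q where Q: "Inp b P = inp b x Q" by (rule Inp_exhaust)
      then have "interp P = ren_dist (bind_name x) (interp Q)" by (simp add: inp_def interp_ren)
      then have "ren_dist (inst x) (interp P) = interp Q"
        by simp
      with Q Inp show ?thesis by (simp add: late_trans.Inp)
    qed
    with Inp show ?thesis by auto
  next
    case (Out b c P)
    then show ?thesis by (auto intro: late_trans.Out)
  next
    case (Match a b t)
    with IH[of t] show ?thesis by (auto intro: late_trans.Match)
  next
    case (Mismatch a b t)
    with IH[of t] show ?thesis by (auto intro: late_trans.Mismatch)
  next
    case (Sum t u)
    with IH[of t] IH[of u] show ?thesis by (auto intro: late_trans.SumL late_trans.SumR)
  next
    case (Par t u)
    have t: "?tau t" "?out t" "?in t" "?bout t" and u: "?tau u" "?out u" "?in u" "?bout u"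
      using IH[of t] IH[of u] Par by simp_all
    have com: "late_trans (Par t u) Tau D" if D: "D \<in> coms t u" for D
    proof -
      \<comment> \<open>One name fresh for both sides serves as the bound name in every kind of
        communication; with a free output it is substituted away again.\<close>
      obtain x where x: "x \<notin> fn_state t \<union> fn_state u" using ex_fresh[of "fn_state t \<union> fn_state u"]
        by auto
      have sub: "ren_dist (inst b) D = subst_dist b x (ren_dist (inst x) D)" if "Suc x \<notin> fn_dist D"
        for b D
      proof -
        have "subst_dist b x (ren_dist (inst x) D) = ren_dist (inst b) (ren_dist (bind_name x)
          (ren_dist (inst x) D))"
          unfolding ren_dist_comp comp_assoc[symmetric] inst_bind_name
          by (simp add: subst_dist_def subst_state_def map_pmf_comp ren_ren)
        then show ?thesis unfolding ren_bind_inst[OF that] by (rule sym)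
      qed
      have cl: "map_pmf Res (par_dist E F) = res_dist x (par_dist (ren_dist (inst x) E) (ren_dist
        (inst x) F))"
        if "Suc x \<notin> fn_dist E" "Suc x \<notin> fn_dist F" for E F
        unfolding res_dist_conv ren_par_dist ren_bind_inst[OF that(1)] ren_bind_inst[OF that(2)] ..
      from D show ?thesis
        unfolding coms_def Un_iff
      proof (elim disjE, goal_cases)
        case 1
        then obtain a b E F where D: "D = par_dist (ren_dist (inst b) E) F" and *: "(a, E) \<in> ins t"
          "(a, b, F) \<in> outs u"
          by blast
        have xt: "x \<notin> fn_state t" using x by simp
        have "late_trans t (AInp a x) (ren_dist (inst x) E)" "late_trans u (AOut a b) F"
          using t(3) u(2) * xt by blast+
        then have "late_trans (Par t u) Tau (par_dist (subst_dist b x (ren_dist (inst x) E)) F)"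
          by (rule ComL)
        with D show ?thesis by (simp only: sub[OF Suc_notin_fn_ins[OF *(1) xt], symmetric])
      next
        case 2
        then obtain a b E F where D: "D = par_dist F (ren_dist (inst b) E)" and *: "(a, E) \<in> ins u"
          "(a, b, F) \<in> outs t"
          by blast
        have xu: "x \<notin> fn_state u" using x by simp
        have "late_trans u (AInp a x) (ren_dist (inst x) E)" "late_trans t (AOut a b) F"
          using u(3) t(2) * xu by blast+
        then have "late_trans (Par t u) Tau (par_dist F (subst_dist b x (ren_dist (inst x) E)))"
          by (rule ComR)
        with D show ?thesis by (simp only: sub[OF Suc_notin_fn_ins[OF *(1) xu], symmetric])
      next
        case 3
        then obtain a E F where D: "D = map_pmf Res (par_dist E F)" and *: "(a, E) \<in> ins t"
          "(a, F) \<in> bouts u"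
          by blast
        have "D = res_dist x (par_dist (ren_dist (inst x) E) (ren_dist (inst x) F))"
          unfolding D using x by (intro cl Suc_notin_fn_ins[OF *(1)] Suc_notin_fn_bouts[OF *(2)])
            auto
        moreover have "late_trans t (AInp a x) (ren_dist (inst x) E)"
          "late_trans u (BOut a x) (ren_dist (inst x) F)"
          using t(3) u(4) * x by blast+
        ultimately show ?thesis using CloseL by simp
      next
        case 4
        then obtain a E F where D: "D = map_pmf Res (par_dist F E)" and *: "(a, E) \<in> ins u"
          "(a, F) \<in> bouts t"
          by blast
        have "D = res_dist x (par_dist (ren_dist (inst x) F) (ren_dist (inst x) E))"
          unfolding D using x by (intro cl Suc_notin_fn_ins[OF *(1)] Suc_notin_fn_bouts[OF *(2)])
            auto
        moreover have "late_trans u (AInp a x) (ren_dist (inst x) E)"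
          "late_trans t (BOut a x) (ren_dist (inst x) F)"
          using u(3) t(4) * x by blast+
        ultimately show ?thesis using CloseR by simp
      qed
    qed
    have "?tau (Par t u)"
      using t(1) u(1) com by (auto intro: ParL[where \<alpha> = Tau, simplified] ParR[where \<alpha> = Tau,
        simplified])
    moreover have "?out (Par t u)"
      using t(2) u(2) by (auto intro: ParL[where \<alpha> = "AOut a b" for a b, simplified] ParR[where \<alpha> =
        "AOut a b" for a b, simplified])
    moreover have "?in (Par t u)"
      using t(3) u(3) by (auto simp: ren_par_dist simp del: map_pmf_comp
        intro!: ParL[where \<alpha> = "AInp a b" for a b, simplified] ParR[where \<alpha> = "AInp a b"
          for a b, simplified])
    moreover have "?bout (Par t u)"
      using t(4) u(4) by (auto simp: ren_par_dist simp del: map_pmf_comp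
        intro!: ParL[where \<alpha> = "BOut a b" for a b, simplified] ParR[where \<alpha> = "BOut a b"
          for a b, simplified])
    ultimately show ?thesis using Par by simp
  next
    case (Res t)
    \<comment> \<open>A named presentation of the restriction whose bound name avoids a given finite
      set, in particular the bound name of the action.\<close>
    have rep: "\<exists>y t0. y \<notin> A \<and> t = ren_state (bind_name y) t0 \<and> s = res y t0 \<and> size t0 < size s"
      if "finite A" for A
    proof -
      obtain y where y: "y \<notin> A \<union> fn_state (Res t)" using ex_fresh[of
        "A \<union> fn_state (Res t)"] \<open>finite A\<close> finite_fn(2)[of "Res t"] by blast
      then obtain t0 where "Res t = res y t0" using Res_exhaust by blast
      then have "t = ren_state (bind_name y) t0" "s = res y t0" using Res by (simp_all add: res_def)
      with y Res show ?thesis by (intro exI[of _ y] exI[of _ t0]) simp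
    qed
    have in_out: "ren_dist (inst x) (map_pmf Res (ren_dist swap (ren_dist (lift_ren (bind_name y))
      F))) =
        res_dist y (ren_dist (inst x) F)" if "Suc x \<notin> fn_dist F" "y \<noteq> x" for x y F
    proof -
      have "map_pmf Res (ren_dist swap (ren_dist (lift_ren (bind_name y)) F)) =
          ren_dist (bind_name x) (res_dist y (ren_dist (inst x) F))"
        unfolding ren_bind_res[OF that(2)] ren_bind_inst[OF that(1)] ..
      then show ?thesis
        by simp
    qed
    have "?tau s"
    proof (intro allI impI)
      fix D assume D: "D \<in> taus s"
      obtain y t0 where t0: "t = ren_state (bind_name y) t0" "s = res y t0" "size t0 < size s"
        using rep[of "{}"] by blast
      from D obtain E where "E \<in> taus t0" "D = res_dist y E" unfolding t0(2) taus_res by blast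
      with IH[OF t0(3)] show "late_trans s Tau D" unfolding t0(2) by (auto intro: late_trans.Res)
    qed
    moreover have "?out s"
    proof (intro allI impI)
      fix a b D assume "(a, b, D) \<in> outs s"
      then obtain E where E: "D = map_pmf Res E" "(Suc a, Suc b, E) \<in> outs t"
        using Res by auto
      obtain y t0 where t0: "t = ren_state (bind_name y) t0" "s = res y t0" "size t0 < size s"
        using rep[of "{}"] by blast
      from E(2) obtain c d F where "(c, d, F) \<in> outs t0" "Suc a = bind_name y c"
        "Suc b = bind_name y d" "E = ren_dist (bind_name y) F"
        unfolding t0 outs_ren[OF inj_bind_name] by auto
      then have "(a, b, F) \<in> outs t0" "a \<noteq> y" "b \<noteq> y" "D = res_dist y F"
        using E by (auto simp: bind_name_def res_dist_conv simp del: map_pmf_comp split: if_splits)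
      with IH[OF t0(3)] show "late_trans s (AOut a b) D" unfolding t0(2)
        by (auto intro: late_trans.Res)
    qed
    moreover have "?in s"
    proof (intro allI impI)
      fix a x D assume "(a, D) \<in> ins s" and x: "x \<notin> fn_state s"
      then obtain E where E: "D = map_pmf Res (ren_dist swap E)" "(Suc a, E) \<in> ins t"
        using Res by (auto simp del: map_pmf_comp)
      obtain y t0 where y: "y \<noteq> x" and t0: "t = ren_state (bind_name y) t0" "s = res y t0"
        "size t0 < size s"
        using rep[of "{x}"] by blast
      from E(2) obtain c F where "(c, F) \<in> ins t0" "Suc a = bind_name y c"
        "E = ren_dist (lift_ren (bind_name y)) F"
        unfolding t0 ins_ren[OF inj_bind_name] by auto
      then have F: "(a, F) \<in> ins t0" "a \<noteq> y" "E = ren_dist (lift_ren (bind_name y)) F"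
        by (auto simp: bind_name_def split: if_splits)
      have x0: "x \<notin> fn_state t0" using x y unfolding t0(2) by auto
      have "ren_dist (inst x) D = res_dist y (ren_dist (inst x) F)"
        unfolding E F(3) by (rule in_out[OF Suc_notin_fn_ins[OF F(1) x0] y])
      with IH[OF t0(3)] F x0 y show "late_trans s (AInp a x) (ren_dist (inst x) D)"
        unfolding t0(2) by (auto intro!: late_trans.Res simp del: map_pmf_comp)
    qed
    moreover have "?bout s"
    proof (intro allI impI)
      fix a x D assume aD: "(a, D) \<in> bouts s" and x: "x \<notin> fn_state s"
      obtain y t0 where y: "y \<noteq> x" and t0: "t = ren_state (bind_name y) t0" "s = res y t0"
        "size t0 < size s"
        using rep[of "{x}"] by blast
      have x0: "x \<notin> fn_state t0" using x y unfolding t0(2) by auto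
      from aD Res consider "(Suc a, 0, D) \<in> outs t"
        | E where "D = map_pmf Res (ren_dist swap E)" "(Suc a, E) \<in> bouts t"
        by (auto simp del: map_pmf_comp)
      then show "late_trans s (BOut a x) (ren_dist (inst x) D)"
      proof cases
        case 1
        then obtain c d F where "(c, d, F) \<in> outs t0" "Suc a = bind_name y c" "0 = bind_name y d"
          "D = ren_dist (bind_name y) F"
          unfolding t0 outs_ren[OF inj_bind_name] by auto
        then have F: "(a, y, F) \<in> outs t0" "a \<noteq> y" "D = ren_dist (bind_name y) F"
          by (auto simp: bind_name_def split: if_splits)
        have "ren_dist (inst x) D = subst_dist x y F"
          unfolding F(3) ren_dist_comp inst_bind_name by (simp add: subst_dist_def
            subst_state_def[abs_def])
        moreover have "late_trans (res y t0) (BOut a x) (subst_dist x y F)"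
          using IH[OF t0(3)] F x0 fn_outs[OF F(1)] by (intro Open) auto
        ultimately show ?thesis unfolding t0(2) by simp
      next
        case (2 E)
        from 2(2) obtain c F where "(c, F) \<in> bouts t0" "Suc a = bind_name y c"
          "E = ren_dist (lift_ren (bind_name y)) F"
          unfolding t0 bouts_ren[OF inj_bind_name] by auto
        then have F: "(a, F) \<in> bouts t0" "a \<noteq> y" "E = ren_dist (lift_ren (bind_name y)) F"
          by (auto simp: bind_name_def split: if_splits)
        have "ren_dist (inst x) D = res_dist y (ren_dist (inst x) F)"
          unfolding 2(1) F(3) by (rule in_out[OF Suc_notin_fn_bouts[OF F(1) x0] y])
        with IH[OF t0(3)] F x0 y show ?thesis
          unfolding t0(2) by (auto intro!: late_trans.Res simp del: map_pmf_comp)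
      qed
    qed
    ultimately show ?thesis by blast
  qed
qed

lemma late_trans_Tau_iff: "late_trans s Tau D \<longleftrightarrow> D \<in> taus s"
  using late_trans_sound[of s Tau D] late_trans_complete by auto

lemma late_trans_AOut_iff: "late_trans s (AOut a b) D \<longleftrightarrow> (a, b, D) \<in> outs s"
  using late_trans_sound[of s "AOut a b" D] late_trans_complete by auto

lemma late_trans_AInpD:
  assumes "late_trans s (AInp a x) D"
  obtains E where "(a, E) \<in> ins s" "D = ren_dist (inst x) E"
  using late_trans_sound[OF assms] inst_bind_id by fastforce

lemma late_trans_BOutD:
  assumes "late_trans s (BOut a x) D"
  obtains E where "(a, E) \<in> bouts s" "D = ren_dist (inst x) E"
  using late_trans_sound[OF assms] inst_bind_id by fastforce

lemma late_trans_AInpI: "(a, D) \<in> ins s \<Longrightarrow> x \<notin> fn_state s \<Longrightarrow>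
  late_trans s (AInp a x) (ren_dist (inst x) D)"
  and late_trans_BOutI: "(a, D) \<in> bouts s \<Longrightarrow> x \<notin> fn_state s \<Longrightarrow>
    late_trans s (BOut a x) (ren_dist (inst x) D)"
  using late_trans_complete by blast+

section \<open>Barbs, refusals and success in terms of derivatives\<close>

lemma barb_iff:
  "barb s (Name a) \<longleftrightarrow> (\<exists>D. (a, D) \<in> ins s)"
  "barb s (Coname a) \<longleftrightarrow> (\<exists>b D. (a, b, D) \<in> outs s) \<or> (\<exists>D. (a, D) \<in> bouts s)"
proof -
  obtain x where x: "x \<notin> fn_state s" using ex_fresh[OF finite_fn(2)] by blast
  show "barb s (Name a) \<longleftrightarrow> (\<exists>D. (a, D) \<in> ins s)"
    using late_trans_AInpI[OF _ x] by (auto elim!: late_trans_AInpD)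
  show "barb s (Coname a) \<longleftrightarrow> (\<exists>b D. (a, b, D) \<in> outs s) \<or> (\<exists>D. (a, D) \<in> bouts s)"
    using late_trans_BOutI[OF _ x] by (auto simp: late_trans_AOut_iff elim!: late_trans_BOutD;
      blast)
qed

lemma refuses_iff: "refuses s X \<longleftrightarrow> taus s = {} \<and> (\<forall>\<mu>\<in>X. \<not> barb s \<mu>)"
  by (auto simp: refuses_def late_trans_Tau_iff)

lemma succeeds_iff: "succeeds \<omega> s \<longleftrightarrow> (\<exists>b D. (\<omega>, b, D) \<in> outs s)"
  by (simp add: succeeds_def late_trans_AOut_iff)

section \<open>Termination and finite branching\<close>

lemma size_interp: "t \<in> set_pmf (interp P) \<Longrightarrow> size t < size P"
  by (induction P arbitrary: t rule: proc.induct[where ?P2.0 =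
    "\<lambda>_. True"]) (fastforce split: if_splits)+

lemma set_par_dist: "u \<in> set_pmf (par_dist D E) \<longleftrightarrow> (\<exists>s t. u = Par s t \<and> s \<in> set_pmf D \<and>
  t \<in> set_pmf E)"
  by (force simp: par_dist_def)

lemma size_outs: "(a, b, D) \<in> outs s \<Longrightarrow> t \<in> set_pmf D \<Longrightarrow> size t < size s"
proof (induction s arbitrary: a b D t rule: state.induct[where ?P1.0 = "\<lambda>_. True"])
  case (Out a b P)
  then show ?case using size_interp[of t P] by auto
qed (fastforce simp: set_par_dist less_Suc_eq split: if_splits)+

lemma size_ins: "(a, D) \<in> ins s \<Longrightarrow> t \<in> set_pmf D \<Longrightarrow> size t < size s"
proof (induction s arbitrary: a D t rule: state.induct[where ?P1.0 = "\<lambda>_. True"])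
  case (Inp a P)
  then show ?case using size_interp[of t P] by auto
qed (fastforce simp: set_par_dist less_Suc_eq split: if_splits)+

lemma size_bouts: "(a, D) \<in> bouts s \<Longrightarrow> t \<in> set_pmf D \<Longrightarrow> size t < size s"
proof (induction s arbitrary: a D t rule: state.induct[where ?P1.0 = "\<lambda>_. True"])
  case (Res s)
  then show ?case by (fastforce dest: size_outs)
qed (fastforce simp: set_par_dist less_Suc_eq split: if_splits)+

text \<open>Each partner loses at least one, which pays for the new \<open>Par\<close> and for the
  \<open>Res\<close> of a closed scope. The strict decrease for a parallel composition then comes
  from the outer \<open>Par\<close> of its source.\<close>

lemma size_coms: "D \<in> coms s t \<Longrightarrow> u \<in> set_pmf D \<Longrightarrow> size u \<le> size s + size t"
  unfolding coms_def
  by (fastforce simp: set_par_dist dest: size_ins size_outs size_bouts)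

lemma size_taus: "D \<in> taus s \<Longrightarrow> t \<in> set_pmf D \<Longrightarrow> size t < size s"
proof (induction s arbitrary: D t rule: state.induct[where ?P1.0 = "\<lambda>_. True"])
  case (Par s1 s2)
  then show ?case using size_coms[of D s1 s2 t] by (fastforce simp: set_par_dist)
qed (fastforce simp: set_par_dist less_Suc_eq split: if_splits)+

lemma finite_outs: "finite (outs s)"
proof (induction s rule: state.induct[where ?P1.0 = "\<lambda>_. True"])
  case (Res s)
  have "outs (Res s) \<subseteq> (\<lambda>(a, b, D). (a - 1, b - 1, map_pmf Res D)) ` outs s" by force
  with Res show ?case by (rule_tac finite_surj)
qed simp_all

lemma finite_ins: "finite (ins s)"
proof (induction s rule: state.induct[where ?P1.0 = "\<lambda>_. True"])
  case (Res s)
  have "ins (Res s) \<subseteq> (\<lambda>(a, D). (a - 1, map_pmf Res (ren_dist swap D))) ` ins s" by force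
  with Res show ?case by (rule_tac finite_surj)
qed simp_all

lemma finite_bouts: "finite (bouts s)"
proof (induction s rule: state.induct[where ?P1.0 = "\<lambda>_. True"])
  case (Res s)
  have "bouts (Res s) \<subseteq> (\<lambda>(a, D). (a - 1, map_pmf Res (ren_dist swap D))) ` bouts s \<union>
      (\<lambda>(a, b, D). (a - 1, D)) ` outs s" by force
  then show ?case by (rule finite_subset) (use Res finite_outs[of s] in simp)
qed simp_all

lemma finite_coms: "finite (coms s t)"
proof -
  have "coms s t \<subseteq>
     (\<lambda>((a, D), (c, b, E)). par_dist (ren_dist (inst b) D) E) ` (ins s \<times> outs t) \<union>
     (\<lambda>((a, D), (c, b, E)). par_dist E (ren_dist (inst b) D)) ` (ins t \<times> outs s) \<union>
     (\<lambda>((a, D), (c, E)). map_pmf Res (par_dist D E)) ` (ins s \<times> bouts t) \<union>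
     (\<lambda>((a, D), (c, E)). map_pmf Res (par_dist E D)) ` (ins t \<times> bouts s)"
    unfolding coms_def by (intro Un_mono; force)
  then show ?thesis by (rule finite_subset) (simp add: finite_ins finite_outs finite_bouts)
qed

lemma finite_taus: "finite (taus s)"
  by (induction s rule: state.induct[where ?P1.0 = "\<lambda>_. True"]) (simp_all add: finite_coms)

lemma finite_par_dist [simp]: "finite (set_pmf D) \<Longrightarrow> finite (set_pmf E) \<Longrightarrow>
  finite (set_pmf (par_dist D E))"
  by (simp add: par_dist_def)

lemma fin_outs: "(a, b, D) \<in> outs s \<Longrightarrow> finite (set_pmf D)"
  by (induction s arbitrary: a b D rule: state.induct[where ?P1.0 = "\<lambda>_. True"])
    (fastforce simp: finite_interp split: if_splits)+

lemma fin_ins: "(a, D) \<in> ins s \<Longrightarrow> finite (set_pmf D)"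
  by (induction s arbitrary: a D rule: state.induct[where ?P1.0 = "\<lambda>_. True"])
    (fastforce simp: finite_interp split: if_splits)+

lemma fin_bouts: "(a, D) \<in> bouts s \<Longrightarrow> finite (set_pmf D)"
proof (induction s arbitrary: a D rule: state.induct[where ?P1.0 = "\<lambda>_. True"])
  case (Res s)
  then show ?case by (fastforce dest: fin_outs)
qed (fastforce split: if_splits)+

lemma fin_taus: "D \<in> taus s \<Longrightarrow> finite (set_pmf D)"
proof (induction s arbitrary: D rule: state.induct[where ?P1.0 = "\<lambda>_. True"])
  case (Par s t)
  have "finite (set_pmf D)" if "D \<in> coms s t"
    using that unfolding coms_def by (fastforce dest: fin_ins fin_outs fin_bouts)
  with Par show ?case by auto
qed (fastforce split: if_splits)+


section \<open>Lifting, weak transitions and renaming\<close>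

text \<open>The definition of lifting indexes convex combinations by numbers; a finite support of
  any type embeds into them.\<close>

lemma lift_rel_bind:
  fixes p :: "'i pmf"
  assumes fin: "finite (set_pmf p)" and R: "\<And>i. i \<in> set_pmf p \<Longrightarrow> lift_rel R (\<Delta> i) (\<Theta> i)"
  shows "lift_rel R (bind_pmf p \<Delta>) (bind_pmf p \<Theta>)"
proof -
  obtain e :: "'i \<Rightarrow> nat" where e: "inj_on e (set_pmf p)"
    using finite_imp_inj_to_nat_seg[OF fin] by blast
  define d where "d = inv_into (set_pmf p) e"
  have d: "i \<in> set_pmf p \<Longrightarrow> d (e i) = i" for i unfolding d_def by (rule inv_into_f_f[OF e])
  have "bind_pmf p F = bind_pmf (map_pmf e p) (F \<circ> d)" for F :: "'i \<Rightarrow> state pmf"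
    by (simp add: bind_map_pmf d cong: bind_pmf_cong)
  moreover have "lift_rel R (bind_pmf (map_pmf e p) (\<Delta> \<circ> d)) (bind_pmf (map_pmf e p) (\<Theta> \<circ> d))"
    by (rule lift_rel.convex) (use fin d R in auto)
  ultimately show ?thesis by metis
qed

text \<open>Lifting as a finitely supported distribution on pairs of a state and its partner. One
  state may occur with several partners, so the partner is not a function of the state.\<close>

lemma lift_rel_coupling:
  "lift_rel R \<Delta> \<Theta> \<longleftrightarrow> (\<exists>q. finite (set_pmf q) \<and> \<Delta> = map_pmf fst q \<and> \<Theta> = bind_pmf q snd \<and>
    (\<forall>(s, \<Xi>)\<in>set_pmf q. R s \<Xi>))"
proof
  assume "lift_rel R \<Delta> \<Theta>"
  then show "\<exists>q. finite (set_pmf q) \<and> \<Delta> = map_pmf fst q \<and> \<Theta> = bind_pmf q snd \<and>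
    (\<forall>(s, \<Xi>)\<in>set_pmf q. R s \<Xi>)"
  proof induction
    case (point s \<Theta>)
    then show ?case by (intro exI[of _ "return_pmf (s, \<Theta>)"]) (simp add: bind_return_pmf)
  next
    case (convex p \<Delta> \<Theta>)
    then obtain q where q: "\<And>i. i \<in> set_pmf p \<Longrightarrow> finite (set_pmf (q i)) \<and> \<Delta> i = map_pmf fst (q i) \<and>
        \<Theta> i = bind_pmf (q i) snd \<and> (\<forall>(s, \<Xi>)\<in>set_pmf (q i). R s \<Xi>)" by metis
    show ?case
      by (intro exI[of _ "bind_pmf p q"])
        (use q convex.hyps(1) in \<open>auto simp: map_bind_pmf bind_assoc_pmf cong: bind_pmf_cong\<close>)
  qed
next
  assume "\<exists>q. finite (set_pmf q) \<and> \<Delta> = map_pmf fst q \<and> \<Theta> = bind_pmf q snd \<and>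
    (\<forall>(s, \<Xi>)\<in>set_pmf q. R s \<Xi>)"
  then obtain q where q: "finite (set_pmf q)" "\<Delta> = map_pmf fst q" "\<Theta> = bind_pmf q snd"
    "\<And>s \<Xi>. (s, \<Xi>) \<in> set_pmf q \<Longrightarrow> R s \<Xi>" by blast
  have "lift_rel R (bind_pmf q (\<lambda>x. return_pmf (fst x))) (bind_pmf q snd)"
    by (rule lift_rel_bind[OF q(1)], rule lift_rel.point, rule q(4)) simp
  then show "lift_rel R \<Delta> \<Theta>" using q by (simp add: map_pmf_def)
qed

lemma lift_rel_image_finite:
  "lift_rel R \<Delta> \<Theta> \<Longrightarrow> (\<And>s \<Xi>. R s \<Xi> \<Longrightarrow> finite (set_pmf \<Xi>)) \<Longrightarrow> finite (set_pmf \<Theta>)"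
  by (fastforce simp: lift_rel_coupling)

lemma lift_rel_fn:
  assumes "lift_rel R \<Delta> \<Theta>" and R: "\<And>s \<Xi>. s \<in> set_pmf \<Delta> \<Longrightarrow> R s \<Xi> \<Longrightarrow> fn_dist \<Xi> \<subseteq> F (fn_state s)"
    and "mono F"
  shows "fn_dist \<Theta> \<subseteq> F (fn_dist \<Delta>)"
proof
  fix n assume "n \<in> fn_dist \<Theta>"
  moreover obtain q where q: "\<Delta> = map_pmf fst q" "\<Theta> = bind_pmf q snd"
    "\<And>s \<Xi>. (s, \<Xi>) \<in> set_pmf q \<Longrightarrow> R s \<Xi>" using assms(1) by (auto simp: lift_rel_coupling)
  ultimately obtain s \<Xi> where s: "(s, \<Xi>) \<in> set_pmf q" "n \<in> fn_dist \<Xi>"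
    unfolding fn_dist_def set_bind_pmf by fastforce
  then have sD: "s \<in> set_pmf \<Delta>" unfolding q(1) by force
  then have "n \<in> F (fn_state s)" using R q(3)[OF s(1)] s(2) by blast
  moreover have "fn_state s \<subseteq> fn_dist \<Delta>" using sD by (auto simp: fn_dist_def)
  ultimately show "n \<in> F (fn_dist \<Delta>)" using \<open>mono F\<close> by (blast dest: monoD)
qed

lemma lift_rel_ren:
  assumes "lift_rel R \<Delta> \<Theta>" and R: "\<And>s \<Xi>. s \<in> set_pmf \<Delta> \<Longrightarrow> R s \<Xi> \<Longrightarrow> R' (ren_state f s) (ren_dist g \<Xi>)"
  shows "lift_rel R' (ren_dist f \<Delta>) (ren_dist g \<Theta>)"
proof -
  obtain q where q: "finite (set_pmf q)" "\<Delta> = map_pmf fst q" "\<Theta> = bind_pmf q snd"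
    "\<And>s \<Xi>. (s, \<Xi>) \<in> set_pmf q \<Longrightarrow> R s \<Xi>" using assms(1) by (auto simp: lift_rel_coupling)
  have "lift_rel R' (bind_pmf q (\<lambda>x. return_pmf (ren_state f (fst x)))) (bind_pmf q (\<lambda>x.
    ren_dist g (snd x)))"
    by (rule lift_rel_bind[OF q(1)]) (use q in \<open>force intro!: lift_rel.point R\<close>)
  then show ?thesis unfolding q(2,3) by (simp add: map_bind_pmf map_pmf_comp) (simp add:
    map_pmf_def)
qed

section \<open>Weak internal moves\<close>

lemma tau_hat_iff: "tau_hat s \<Delta> \<longleftrightarrow> \<Delta> \<in> taus s \<or> \<Delta> = return_pmf s"
  by (simp add: tau_hat_def late_trans_Tau_iff)

lemma lift_tau_hat_refl: "finite (set_pmf \<Delta>) \<Longrightarrow> lift_rel tau_hat \<Delta> \<Delta>"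
  using lift_rel_bind[of \<Delta> tau_hat return_pmf return_pmf]
  by (simp add: tau_hat_iff bind_return_pmf' lift_rel.point)

lemma weak_tau_refl [simp]: "weak_tau \<Delta> \<Delta>"
  by (simp add: weak_tau_def)

lemma weak_tau_trans [trans]: "weak_tau \<Delta> \<Theta> \<Longrightarrow> weak_tau \<Theta> \<Xi> \<Longrightarrow> weak_tau \<Delta> \<Xi>"
  unfolding weak_tau_def by (rule rtranclp_trans)

lemma weak_tau_step: "\<Delta> \<in> taus s \<Longrightarrow> weak_tau (return_pmf s) \<Delta>"
  unfolding weak_tau_def by (rule r_into_rtranclp) (auto simp: tau_hat_iff intro: lift_rel.point)

lemma weak_tau_induct [consumes 1, case_names refl step]:
  assumes "weak_tau \<Delta> \<Theta>" "P \<Delta>"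
    "\<And>\<Theta> \<Xi>. weak_tau \<Delta> \<Theta> \<Longrightarrow> lift_rel tau_hat \<Theta> \<Xi> \<Longrightarrow> P \<Theta> \<Longrightarrow> P \<Xi>"
  shows "P \<Theta>"
  using assms unfolding weak_tau_def by (induction rule: rtranclp_induct) blast+

lemma weak_tau_finite: "weak_tau \<Delta> \<Theta> \<Longrightarrow> finite (set_pmf \<Delta>) \<Longrightarrow> finite (set_pmf \<Theta>)"
proof (induction rule: weak_tau_induct)
  case (step \<Theta> \<Xi>)
  show ?case by (rule lift_rel_image_finite[OF step(2)]) (auto simp: tau_hat_iff dest: fin_taus)
qed

lemma weak_tau_fn: "weak_tau \<Delta> \<Theta> \<Longrightarrow> fn_dist \<Theta> \<subseteq> fn_dist \<Delta>"
proof (induction rule: weak_tau_induct)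
  case (step \<Theta> \<Xi>)
  have "fn_dist \<Xi> \<subseteq> id (fn_dist \<Theta>)"
    by (rule lift_rel_fn[OF step(2)]) (auto simp: tau_hat_iff mono_def dest: fn_taus)
  with step.IH show ?case by simp
qed simp

text \<open>The components may need different numbers of steps. They are run to completion one after
  another while all others idle, which \<open>tau_hat\<close> permits.\<close>

lemma weak_tau_bind:
  fixes p :: "'i pmf"
  assumes fin: "finite (set_pmf p)" and \<Theta>: "\<And>i. i \<in> set_pmf p \<Longrightarrow> finite (set_pmf (\<Theta> i))"
    and w: "\<And>i. i \<in> set_pmf p \<Longrightarrow> weak_tau (\<Theta> i) (\<Theta>' i)"
  shows "weak_tau (bind_pmf p \<Theta>) (bind_pmf p \<Theta>')"
proof -
  have \<Theta>': "finite (set_pmf (\<Theta>' i))" if "i \<in> set_pmf p" for i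
    using weak_tau_finite[OF w \<Theta>] that by blast
  have "weak_tau (bind_pmf p \<Theta>) (bind_pmf p (\<lambda>i. if i \<in> A then \<Theta>' i else \<Theta> i))"
    if "A \<subseteq> set_pmf p" for A
    using finite_subset[OF that fin] that
  proof (induction A)
    case empty
    then show ?case by simp
  next
    case (insert j A)
    \<comment> \<open>The stage at which the components in \<open>A\<close> have finished, component
      \<open>j\<close> has reached \<open>X\<close>, and the others have not started.\<close>
    define F where "F X = (\<lambda>i. if i = j then X else if i \<in> A then \<Theta>' i else \<Theta> i)" for X
    have "weak_tau (bind_pmf p (F (\<Theta> j))) (bind_pmf p (F Y))" if "weak_tau (\<Theta> j) Y" for Y
      using that
    proof (induction rule: weak_tau_induct)
      case (step X Y)
      have "lift_rel tau_hat (bind_pmf p (F X)) (bind_pmf p (F Y))"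
        by (rule lift_rel_bind[OF fin]) (auto simp: F_def step intro!: lift_tau_hat_refl \<Theta> \<Theta>')
      with step(3) show ?case unfolding weak_tau_def by (rule rtranclp.rtrancl_into_rtrancl)
    qed simp
    from this[of "\<Theta>' j"] have "weak_tau (bind_pmf p (F (\<Theta> j))) (bind_pmf p (F (\<Theta>' j)))"
      using insert.prems w by simp
    moreover have "F (\<Theta> j) = (\<lambda>i. if i \<in> A then \<Theta>' i else \<Theta> i)"
      "F (\<Theta>' j) = (\<lambda>i. if i \<in> insert j A then \<Theta>' i else \<Theta> i)"
      using insert.hyps by (auto simp: F_def)
    ultimately show ?case using insert by (auto intro: weak_tau_trans)
  qed
  from this[of "set_pmf p"] show ?thesis by (simp cong: bind_pmf_cong)
qed

lemma weak_tau_ren: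
  assumes f: "inj f"
  shows "weak_tau \<Delta> \<Theta> \<Longrightarrow> weak_tau (ren_dist f \<Delta>) (ren_dist f \<Theta>)"
proof (induction rule: weak_tau_induct)
  case (step \<Theta> \<Xi>)
  have "lift_rel tau_hat (ren_dist f \<Theta>) (ren_dist f \<Xi>)"
    by (rule lift_rel_ren[OF step(2)]) (auto simp: tau_hat_iff taus_ren[OF f])
  with step(3) show ?case unfolding weak_tau_def by (rule rtranclp.rtrancl_into_rtrancl)
qed simp

section \<open>Renaming of labelled transitions, simulations and refusals\<close>

primrec ren_act :: "(name \<Rightarrow> name) \<Rightarrow> act \<Rightarrow> act" where
  "ren_act f Tau = Tau"
| "ren_act f (AInp a x) = AInp (f a) (f x)"
| "ren_act f (AOut a x) = AOut (f a) (f x)"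
| "ren_act f (BOut a x) = BOut (f a) (f x)"

lemma lift_ren_bind_name: "inj f \<Longrightarrow> lift_ren f \<circ> bind_name x = bind_name (f x) \<circ> f"
  by (auto simp: fun_eq_iff bind_name_def inj_eq)

lemma ren_res: "inj f \<Longrightarrow> ren_state f (res x s) = res (f x) (ren_state f s)"
  and ren_inp: "inj f \<Longrightarrow> ren_state f (inp a x P) = inp (f a) (f x) (ren_proc f P)"
  by (simp_all add: res_def inp_def ren_ren lift_ren_bind_name)

lemma ren_res_dist: "inj f \<Longrightarrow> ren_dist f (res_dist x D) = res_dist (f x) (ren_dist f D)"
  by (simp add: res_dist_def map_pmf_comp ren_res)

lemma ren_subst_dist: "inj f \<Longrightarrow> ren_dist f (subst_dist y x D) =
  subst_dist (f y) (f x) (ren_dist f D)"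
proof -
  assume "inj f"
  then have "f \<circ> id(x := y) = id(f x := f y) \<circ> f" by (auto simp: fun_eq_iff inj_eq)
  then show ?thesis by (simp add: subst_dist_def subst_state_def map_pmf_comp ren_ren)
qed

lemma bn_ren_act: "bn (ren_act f \<alpha>) = f ` bn \<alpha>" and names_ren_act:
  "names_act (ren_act f \<alpha>) = f ` names_act \<alpha>"
  by (cases \<alpha>; simp)+

lemma late_trans_ren:
  assumes f: "inj f"
  shows "late_trans s \<alpha> \<Delta> \<Longrightarrow> late_trans (ren_state f s) (ren_act f \<alpha>) (ren_dist f \<Delta>)"
proof (induction rule: late_trans.induct)
  case (Inp a x P)
  then show ?case using late_trans.Inp by (simp add: ren_inp[OF f] interp_ren[symmetric])
next
  case (Out a x P)
  then show ?case using late_trans.Out by (simp add: interp_ren[symmetric])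
next
  case (SumL s \<alpha> \<Delta> t)
  then show ?case by (simp add: late_trans.SumL)
next
  case (SumR s \<alpha> \<Delta> t)
  then show ?case by (simp add: late_trans.SumR)
next
  case (Match s \<alpha> \<Delta> x)
  then show ?case by (simp add: late_trans.Match)
next
  case (Mismatch s \<alpha> \<Delta> x y)
  then show ?case by (simp add: late_trans.Mismatch inj_eq[OF f])
next
  case (ParL s \<alpha> \<Delta> t)
  then have "bn (ren_act f \<alpha>) \<inter> fn_state (ren_state f t) = {}"
    unfolding bn_ren_act fn_ren by (simp add: image_Int[OF f, symmetric])
  with ParL show ?case by (simp add: ren_par_dist late_trans.ParL)
next
  case (ParR s \<alpha> \<Delta> t)
  then have "bn (ren_act f \<alpha>) \<inter> fn_state (ren_state f t) = {}"
    unfolding bn_ren_act fn_ren by (simp add: image_Int[OF f, symmetric])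
  with ParR show ?case by (simp add: ren_par_dist late_trans.ParR)
next
  case (ComL s a x \<Delta>\<^sub>1 t y \<Delta>\<^sub>2)
  then show ?case using late_trans.ComL by (simp add: ren_par_dist ren_subst_dist[OF f])
next
  case (ComR s a x \<Delta>\<^sub>1 t y \<Delta>\<^sub>2)
  then show ?case using late_trans.ComR by (simp add: ren_par_dist ren_subst_dist[OF f])
next
  case (CloseL s a x \<Delta>\<^sub>1 t \<Delta>\<^sub>2)
  then show ?case using late_trans.CloseL by (simp add: ren_par_dist ren_res_dist[OF f])
next
  case (CloseR s a x \<Delta>\<^sub>1 t \<Delta>\<^sub>2)
  then show ?case using late_trans.CloseR by (simp add: ren_par_dist ren_res_dist[OF f])
next
  case (Res s \<alpha> \<Delta> x)
  then have "f x \<notin> names_act (ren_act f \<alpha>)"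
    unfolding names_ren_act by (simp add: inj_image_mem_iff[OF f])
  with Res show ?case by (simp add: ren_res[OF f] ren_res_dist[OF f] late_trans.Res)
next
  case (Open s x z \<Delta> y)
  have "f y \<notin> fn_state (ren_state f (res z s))"
    unfolding fn_ren using Open by (simp only: inj_image_mem_iff[OF f]) simp
  then have "late_trans (res (f z) (ren_state f s)) (BOut (f x) (f y)) (subst_dist (f y) (f z)
    (ren_dist f \<Delta>))"
    using Open by (intro late_trans.Open) (simp_all add: inj_eq[OF f] ren_res[OF f])
  then show ?case by (simp add: ren_res[OF f] ren_subst_dist[OF f])
qed

lemma dist_trans_ren: "inj f \<Longrightarrow> dist_trans \<Delta> \<alpha> \<Theta> \<Longrightarrow> dist_trans (ren_dist f \<Delta>) (ren_act f \<alpha>) (ren_dist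
  f \<Theta>)"
  unfolding dist_trans_def by (erule lift_rel_ren) (rule late_trans_ren)

lemma weak_ren:
  assumes f: "inj f" and w: "weak \<Delta> \<alpha> \<Theta>"
  shows "weak (ren_dist f \<Delta>) (ren_act f \<alpha>) (ren_dist f \<Theta>)"
proof (cases "\<alpha> = Tau")
  case True
  with w show ?thesis by (simp add: weak_def weak_tau_ren[OF f])
next
  case False
  then have "ren_act f \<alpha> \<noteq> Tau" by (cases \<alpha>) auto
  with False w show ?thesis unfolding weak_def by (metis weak_tau_ren[OF f] dist_trans_ren[OF f])
qed

primrec ren_port :: "(name \<Rightarrow> name) \<Rightarrow> port \<Rightarrow> port" where
  "ren_port f (Name a) = Name (f a)"
| "ren_port f (Coname a) = Coname (f a)"

text \<open>Turns the named substitution in the input clause into opening the derivative directly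
  with the received name.\<close>

lemma subst_dist_inst: "Suc x \<notin> fn_dist D \<Longrightarrow> subst_dist w x (ren_dist (inst x) D) =
  ren_dist (inst w) D"
proof -
  assume x: "Suc x \<notin> fn_dist D"
  have "subst_dist w x (ren_dist (inst x) D) = ren_dist (inst w \<circ> bind_name x) (ren_dist (inst x)
    D)"
    unfolding inst_bind_name by (simp add: subst_dist_def subst_state_def[abs_def])
  also have "\<dots> = ren_dist (inst w) D"
    unfolding ren_dist_comp[symmetric] ren_bind_inst[OF x] ..
  finally show ?thesis .
qed

context
  fixes f :: "name \<Rightarrow> name" assumes f: "bij f"
begin

private lemma f_inj: "inj f" "inj (inv f)" and f_inv [simp]: "f (inv f n) = n" "inv f (f n) = n"
  using f by (simp_all add: bij_is_inj bij_is_surj surj_f_inv_f surj_imp_inj_inv)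

private lemma ren_inv [simp]: "ren_state (inv f) (ren_state f s) = s"
  "ren_state f (ren_state (inv f) s) = s"
  "ren_dist (inv f) (ren_dist f D) = D" "ren_dist f (ren_dist (inv f) D) = D"
  "ren_act (inv f) (ren_act f \<alpha>) = \<alpha>" "ren_act f (ren_act (inv f) \<alpha>) = \<alpha>"
proof -
  have *: "inv f \<circ> f = id" "f \<circ> inv f = id" by (simp_all add: fun_eq_iff)
  then show "ren_state (inv f) (ren_state f s) = s" "ren_state f (ren_state (inv f) s) = s"
    "ren_dist (inv f) (ren_dist f D) = D" "ren_dist f (ren_dist (inv f) D) = D"
    by (simp_all only: ren_ren ren_dist_comp ren_id' ren_dist_id)
  show "ren_act (inv f) (ren_act f \<alpha>) = \<alpha>" "ren_act f (ren_act (inv f) \<alpha>) = \<alpha>"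
    by (cases \<alpha>; simp)+
qed

text \<open>A move of the renamed state is pulled back along the inverse, matched there and pushed
  forward again; freshness of bound names is transported in the same way.\<close>

lemma simulates_ren:
  assumes "simulates R s \<Theta>" and R: "\<And>s \<Theta>. R s \<Theta> \<Longrightarrow> R' (ren_state f s) (ren_dist f \<Theta>)"
  shows "simulates R' (ren_state f s) (ren_dist f \<Theta>)"
  unfolding simulates_def
proof (intro conjI allI impI)
  fix a x \<Delta> w
  assume tr: "late_trans (ren_state f s) (AInp a x) \<Delta>" and x:
    "x \<notin> fn_state (ren_state f s) \<union> fn_dist (ren_dist f \<Theta>)"
  have "late_trans s (AInp (inv f a) (inv f x)) (ren_dist (inv f) \<Delta>)"
    using late_trans_ren[OF f_inj(2) tr] by simp
  moreover have "inv f x \<notin> fn_state s \<union> fn_dist \<Theta>"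
  proof
    assume "inv f x \<in> fn_state s \<union> fn_dist \<Theta>"
    then have "f (inv f x) \<in> f ` (fn_state s \<union> fn_dist \<Theta>)" by (rule imageI)
    then show False using x by (auto simp: fn_ren)
  qed
  ultimately obtain \<Theta>\<^sub>1 \<Theta>\<^sub>2 \<Theta>' where *: "weak_tau \<Theta> \<Theta>\<^sub>1"
    "dist_trans \<Theta>\<^sub>1 (AInp (inv f a) (inv f x)) \<Theta>\<^sub>2"
    "weak_tau (subst_dist (inv f w) (inv f x) \<Theta>\<^sub>2) \<Theta>'" "lift_rel R (subst_dist (inv f w) (inv f x)
      (ren_dist (inv f) \<Delta>)) \<Theta>'"
    using assms(1) unfolding simulates_def by metis
  show "\<exists>\<Theta>\<^sub>1 \<Theta>\<^sub>2 \<Theta>'. weak_tau (ren_dist f \<Theta>) \<Theta>\<^sub>1 \<and> dist_trans \<Theta>\<^sub>1 (AInp a x) \<Theta>\<^sub>2 \<and>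
      weak_tau (subst_dist w x \<Theta>\<^sub>2) \<Theta>' \<and> lift_rel R' (subst_dist w x \<Delta>) \<Theta>'"
  proof (intro exI conjI)
    show "weak_tau (ren_dist f \<Theta>) (ren_dist f \<Theta>\<^sub>1)" by (rule weak_tau_ren[OF f_inj(1) *(1)])
    show "dist_trans (ren_dist f \<Theta>\<^sub>1) (AInp a x) (ren_dist f \<Theta>\<^sub>2)"
      using dist_trans_ren[OF f_inj(1) *(2)] by simp
    show "weak_tau (subst_dist w x (ren_dist f \<Theta>\<^sub>2)) (ren_dist f \<Theta>')"
      using weak_tau_ren[OF f_inj(1) *(3)] by (simp add: ren_subst_dist[OF f_inj(1)])
    have "lift_rel R' (ren_dist f (subst_dist (inv f w) (inv f x) (ren_dist (inv f) \<Delta>))) (ren_dist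
      f \<Theta>')"
      by (rule lift_rel_ren[OF *(4)]) (rule R)
    then show "lift_rel R' (subst_dist w x \<Delta>) (ren_dist f \<Theta>')"
      by (simp only: ren_subst_dist[OF f_inj(1)] ren_inv f_inv)
  qed
next
  fix \<alpha> \<Delta>
  assume tr: "late_trans (ren_state f s) \<alpha> \<Delta>" and \<alpha>: "\<nexists>a x. \<alpha> = AInp a x"
    and x: "bn \<alpha> \<inter> (fn_state (ren_state f s) \<union> fn_dist (ren_dist f \<Theta>)) = {}"
  have "late_trans s (ren_act (inv f) \<alpha>) (ren_dist (inv f) \<Delta>)"
    using late_trans_ren[OF f_inj(2) tr] by simp
  moreover have "\<nexists>a x. ren_act (inv f) \<alpha> = AInp a x" using \<alpha> by (cases \<alpha>) auto
  moreover have "bn (ren_act (inv f) \<alpha>) \<inter> (fn_state s \<union> fn_dist \<Theta>) = {}"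
  proof -
    have "f ` (bn (ren_act (inv f) \<alpha>) \<inter> (fn_state s \<union> fn_dist \<Theta>)) = {}"
      unfolding image_Int[OF f_inj(1)] bn_ren_act[symmetric] ren_inv using x
        by (simp add: fn_ren image_Un)
    then show ?thesis by simp
  qed
  ultimately obtain \<Theta>' where *: "weak \<Theta> (ren_act (inv f) \<alpha>) \<Theta>'" "lift_rel R (ren_dist (inv f) \<Delta>) \<Theta>'"
    using assms(1) unfolding simulates_def by metis
  have "weak (ren_dist f \<Theta>) \<alpha> (ren_dist f \<Theta>')" using weak_ren[OF f_inj(1) *(1)] by simp
  moreover have "lift_rel R' (ren_dist f (ren_dist (inv f) \<Delta>)) (ren_dist f \<Theta>')"
    by (rule lift_rel_ren[OF *(2)]) (rule R)
  ultimately show "\<exists>\<Theta>'. weak (ren_dist f \<Theta>) \<alpha> \<Theta>' \<and> lift_rel R' \<Delta> \<Theta>'" by (auto simp only: ren_inv)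
qed

lemma barb_ren: "barb (ren_state f s) (ren_port f \<mu>) \<longleftrightarrow> barb s \<mu>"
proof -
  have "(\<exists>D. (f a, D) \<in> ins (ren_state f s)) \<longleftrightarrow> (\<exists>D. (a, D) \<in> ins s)" for a
    by (force simp: ins_ren[OF f_inj(1)] inj_eq[OF f_inj(1)])
  moreover have "(\<exists>D. (f a, D) \<in> bouts (ren_state f s)) \<longleftrightarrow> (\<exists>D. (a, D) \<in> bouts s)" for a
    by (force simp: bouts_ren[OF f_inj(1)] inj_eq[OF f_inj(1)])
  moreover have "(\<exists>b D. (f a, b, D) \<in> outs (ren_state f s)) \<longleftrightarrow> (\<exists>b D. (a, b, D) \<in> outs s)" for a
    by (force simp: outs_ren[OF f_inj(1)] inj_eq[OF f_inj(1)])
  ultimately show ?thesis by (cases \<mu>) (simp_all only: ren_port.simps barb_iff)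
qed

lemma refuses_ren: "refuses (ren_state f s) X \<longleftrightarrow> refuses s {\<mu>. ren_port f \<mu> \<in> X}"
proof -
  have "ren_port f (ren_port (inv f) \<mu>) = \<mu>" for \<mu> by (cases \<mu>) auto
  then have "(\<forall>\<mu>\<in>X. \<not> barb (ren_state f s) \<mu>) \<longleftrightarrow> (\<forall>\<mu>. ren_port f \<mu> \<in> X \<longrightarrow> \<not> barb s \<mu>)"
    by (metis barb_ren)
  then show ?thesis by (simp add: refuses_iff taus_ren[OF f_inj(1)])
qed

end

section \<open>Simulation and failure simulation treated together\<close>

definition psim :: "bool \<Rightarrow> state \<Rightarrow> state pmf \<Rightarrow> bool" where
  "psim must = (if must then fsim else sim)"

definition can_refuse :: "state \<Rightarrow> state pmf \<Rightarrow> bool" where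
  "can_refuse s \<Theta> \<longleftrightarrow> (\<forall>X. refuses s X \<longrightarrow> (\<exists>\<Theta>'. weak_tau \<Theta> \<Theta>' \<and> refuses_dist \<Theta>' X))"

lemma psimD:
  assumes "psim must s \<Theta>"
  shows "finite (set_pmf \<Theta>)" "simulates (psim must) s \<Theta>" "must \<Longrightarrow> can_refuse s \<Theta>"
  using assms sim_greatest(1) fsim_greatest(1)
  unfolding psim_def simulation_def failure_simulation_def can_refuse_def by (auto split: if_splits)

text \<open>Coinduction in which derivatives may fall back on the greatest relation, so that a
  single new pair can be added by checking only its own moves.\<close>

lemma psimI:
  assumes R: "R s \<Theta>" and "\<And>s \<Theta>. R s \<Theta> \<Longrightarrow> finite (set_pmf \<Theta>) \<and> simulates (\<lambda>s \<Theta>. R s \<Theta> \<or>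
    psim must s \<Theta>) s \<Theta> \<and>
      (must \<longrightarrow> can_refuse s \<Theta>)"
  shows "psim must s \<Theta>"
proof -
  let ?R = "\<lambda>s \<Theta>. R s \<Theta> \<or> psim must s \<Theta>"
  have *: "finite (set_pmf \<Theta>) \<and> simulates ?R s \<Theta> \<and> (must \<longrightarrow> can_refuse s \<Theta>)" if "?R s \<Theta>" for s \<Theta>
    using that assms(2)[of s \<Theta>] psimD[of must s \<Theta>] simulates_mono[of "psim must" s \<Theta> ?R] by blast
  show ?thesis
  proof (cases must)
    case True
    have "failure_simulation ?R" unfolding failure_simulation_def using * True
      by (simp add: can_refuse_def)
    then have "?R \<le> fsim" by (rule fsim_greatest(2))
    with R True show ?thesis unfolding psim_def by auto
  next
    case False
    have "simulation ?R" unfolding simulation_def using * by simp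
    then have "?R \<le> sim" by (rule sim_greatest(2))
    with R False show ?thesis unfolding psim_def by auto
  qed
qed

text \<open>Neither relation depends on the identity of names. This lets one generic fresh name
  represent all fresh names when inputs and bound outputs are tested.\<close>

lemma psim_ren:
  assumes f: "bij f" and "psim must s \<Theta>"
  shows "psim must (ren_state f s) (ren_dist f \<Theta>)"
proof (rule psimI[where R = "\<lambda>s' \<Theta>'. \<exists>s \<Theta>. s' = ren_state f s \<and> \<Theta>' = ren_dist f \<Theta> \<and> psim must s \<Theta>"])
  fix s' \<Theta>' assume "\<exists>s \<Theta>. s' = ren_state f s \<and> \<Theta>' = ren_dist f \<Theta> \<and> psim must s \<Theta>"
  then obtain s \<Theta> where *: "s' = ren_state f s" "\<Theta>' = ren_dist f \<Theta>" "psim must s \<Theta>" by blast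
  note ** = psimD[OF *(3)]
  have "can_refuse s' \<Theta>'" if must: must
    unfolding can_refuse_def
  proof (intro allI impI)
    fix X assume "refuses s' X"
    then have "refuses s {\<mu>. ren_port f \<mu> \<in> X}" unfolding * refuses_ren[OF f] .
    then obtain \<Xi> where \<Xi>: "weak_tau \<Theta> \<Xi>" "refuses_dist \<Xi> {\<mu>. ren_port f \<mu> \<in> X}"
      using **(3)[OF must] unfolding can_refuse_def by blast
    have "refuses_dist (ren_dist f \<Xi>) X" using \<Xi>(2) by (simp add: refuses_dist_def refuses_ren[OF
      f])
    with weak_tau_ren[OF bij_is_inj[OF f] \<Xi>(1)] show "\<exists>\<Xi>. weak_tau \<Theta>' \<Xi> \<and> refuses_dist \<Xi> X"
      unfolding * by blast
  qed
  moreover have "simulates (\<lambda>s' \<Theta>'. (\<exists>s \<Theta>. s' = ren_state f s \<and> \<Theta>' = ren_dist f \<Theta> \<and>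
    psim must s \<Theta>) \<or> psim must s' \<Theta>') s' \<Theta>'"
    unfolding * by (rule simulates_ren[OF f **(2)]) blast
  ultimately show "finite (set_pmf \<Theta>') \<and>
      simulates (\<lambda>s' \<Theta>'. (\<exists>s \<Theta>. s' = ren_state f s \<and> \<Theta>' = ren_dist f \<Theta> \<and> psim must s \<Theta>) \<or>
        psim must s' \<Theta>') s' \<Theta>' \<and>
      (must \<longrightarrow> can_refuse s' \<Theta>')"
    using **(1) * by simp
qed (use assms(2) in blast)

definition in_step :: "name \<Rightarrow> state \<Rightarrow> state pmf \<Rightarrow> bool" where
  "in_step a s D \<longleftrightarrow> (a, D) \<in> ins s"
definition out_step :: "name \<Rightarrow> name \<Rightarrow> state \<Rightarrow> state pmf \<Rightarrow> bool" where
  "out_step a b s D \<longleftrightarrow> (a, b, D) \<in> outs s"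
definition bout_step :: "name \<Rightarrow> state \<Rightarrow> state pmf \<Rightarrow> bool" where
  "bout_step a s D \<longleftrightarrow> (a, D) \<in> bouts s"

text \<open>\<open>inst x\<close> identifies 0 with \<open>Suc x\<close>, but when \<open>x\<close>
  is outside \<open>M\<close> it is injective on the names in question, and there it agrees with a
  permutation.\<close>

lemma bij_extends_inst:
  assumes "finite M" "x \<notin> M"
  obtains g where "bij g" "\<And>n. n \<in> insert 0 (Suc ` M) \<Longrightarrow> g n = inst x n"
proof -
  define m where "m = Suc (Max (insert x M))"
  have m: "y < m" if "y \<in> insert x M" for y
    unfolding m_def less_Suc_eq_le by (rule Max_ge) (use that assms(1) in auto)
  \<comment> \<open>The cycle that sends 0 to a number \<open>m\<close> beyond all relevant names
    and lowers the names up to \<open>m\<close> by one; a transposition then exchanges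
    \<open>m\<close> and \<open>x\<close>.\<close>
  define c where "c n = (if n = 0 then m else if n \<le> m then n - 1 else n)" for n
  have "bij c"
  proof (rule o_bij[of "\<lambda>n. if n = m then 0 else if n < m then Suc n else n"])
    show "(\<lambda>n. if n = m then 0 else if n < m then Suc n else n) \<circ> c = id"
      by (auto simp: fun_eq_iff c_def)
    show "c \<circ> (\<lambda>n. if n = m then 0 else if n < m then Suc n else n) = id"
      by (auto simp: fun_eq_iff c_def m_def)
  qed
  moreover have "bij (Transposition.transpose m x)" by simp
  ultimately have "bij (Transposition.transpose m x \<circ> c)" by (rule bij_comp)
  moreover have "(Transposition.transpose m x \<circ> c) n = inst x n" if "n \<in> insert 0 (Suc ` M)" for n
    using that m assms(2) by (force simp: c_def Transposition.transpose_def)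
  ultimately show thesis by (rule that)
qed

text \<open>A name fresh for the whole distribution can be the bound name common to all its
  states.\<close>

lemma lift_rel_in_step:
  assumes "lift_rel (in_step a) \<Theta>\<^sub>1 \<Theta>\<^sub>2" "x \<notin> fn_dist \<Theta>\<^sub>1"
  shows "dist_trans \<Theta>\<^sub>1 (AInp a x) (ren_dist (inst x) \<Theta>\<^sub>2)"
proof -
  have "dist_trans (ren_dist id \<Theta>\<^sub>1) (AInp a x) (ren_dist (inst x) \<Theta>\<^sub>2)"
    unfolding dist_trans_def
    by (rule lift_rel_ren[OF assms(1)]) (use assms(2) in \<open>auto simp: in_step_def fn_dist_def
      intro!: late_trans_AInpI\<close>)
  then show ?thesis by (simp only: ren_dist_id)
qed

lemma lift_rel_bout_step:
  assumes "lift_rel (bout_step a) \<Theta>\<^sub>1 \<Theta>\<^sub>2" "x \<notin> fn_dist \<Theta>\<^sub>1"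
  shows "dist_trans \<Theta>\<^sub>1 (BOut a x) (ren_dist (inst x) \<Theta>\<^sub>2)"
proof -
  have "dist_trans (ren_dist id \<Theta>\<^sub>1) (BOut a x) (ren_dist (inst x) \<Theta>\<^sub>2)"
    unfolding dist_trans_def
    by (rule lift_rel_ren[OF assms(1)]) (use assms(2) in \<open>auto simp: bout_step_def fn_dist_def
      intro!: late_trans_BOutI\<close>)
  then show ?thesis by (simp only: ren_dist_id)
qed

lemma fn_lift_in_step: "lift_rel (in_step a) \<Theta>\<^sub>1 \<Theta>\<^sub>2 \<Longrightarrow> fn_dist \<Theta>\<^sub>2 \<subseteq> insert 0 (Suc ` fn_dist \<Theta>\<^sub>1)"
  by (erule lift_rel_fn[where F = "\<lambda>A. insert 0 (Suc ` A)"]) (auto simp: mono_def in_step_def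
    dest!: fn_ins)

lemma fn_lift_bout_step: "lift_rel (bout_step a) \<Theta>\<^sub>1 \<Theta>\<^sub>2 \<Longrightarrow>
  fn_dist \<Theta>\<^sub>2 \<subseteq> insert 0 (Suc ` fn_dist \<Theta>\<^sub>1)"
  by (erule lift_rel_fn[where F = "\<lambda>A. insert 0 (Suc ` A)"]) (auto simp: mono_def bout_step_def
    dest!: fn_bouts)

lemma fn_lift_out_step: "lift_rel (out_step a b) \<Theta>\<^sub>1 \<Theta>\<^sub>2 \<Longrightarrow> fn_dist \<Theta>\<^sub>2 \<subseteq> fn_dist \<Theta>\<^sub>1"
  by (erule lift_rel_fn[where F = "\<lambda>A. A"]) (auto simp: mono_def out_step_def dest!: fn_outs)

abbreviation after_tau :: "(state pmf \<Rightarrow> bool) \<Rightarrow> state pmf \<Rightarrow> bool" where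
  "after_tau \<Phi> \<Theta> \<equiv> \<exists>\<Theta>'. weak_tau \<Theta> \<Theta>' \<and> \<Phi> \<Theta>'"

abbreviation after_step :: "(state \<Rightarrow> state pmf \<Rightarrow> bool) \<Rightarrow> (state pmf \<Rightarrow> bool) \<Rightarrow> state pmf \<Rightarrow> bool"
  where
  "after_step R \<Phi> \<Theta> \<equiv> \<exists>\<Theta>\<^sub>1 \<Theta>\<^sub>2. weak_tau \<Theta> \<Theta>\<^sub>1 \<and> lift_rel R \<Theta>\<^sub>1 \<Theta>\<^sub>2 \<and> \<Phi> \<Theta>\<^sub>2"

abbreviation simulates_dist :: "bool \<Rightarrow> state pmf \<Rightarrow> state pmf \<Rightarrow> bool" where
  "simulates_dist must \<Delta> \<equiv> after_tau (lift_rel (psim must) \<Delta>)"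

text \<open>Finitely many obligations that cover one unfolding of the simulation. Inputs are checked
  at the known names \<open>N\<close> and once with the received name left as the open index 0,
  which is generic. For refusals it is enough to treat the largest refusal set, that of all ports
  which \<open>s\<close> does not offer.\<close>

definition matches :: "bool \<Rightarrow> name set \<Rightarrow> state \<Rightarrow> state pmf \<Rightarrow> bool" where
  "matches must N s \<Theta> \<longleftrightarrow>
    (\<forall>\<Delta>\<in>taus s. simulates_dist must \<Delta> \<Theta>) \<and>
    (\<forall>(a, b, \<Delta>)\<in>outs s. after_step (out_step a b) (simulates_dist must \<Delta>) \<Theta>) \<and>
    (\<forall>(a, \<Delta>)\<in>bouts s. after_step (bout_step a) (simulates_dist must \<Delta>) \<Theta>) \<and>
    (\<forall>(a, \<Delta>)\<in>ins s. \<forall>w\<in>N. after_step (in_step a)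
      (\<lambda>\<Theta>. simulates_dist must (ren_dist (inst w) \<Delta>) (ren_dist (inst w) \<Theta>)) \<Theta>) \<and>
    (\<forall>(a, \<Delta>)\<in>ins s. after_step (in_step a) (simulates_dist must \<Delta>) \<Theta>) \<and>
    (must \<longrightarrow> taus s = {} \<longrightarrow>
      after_tau (\<lambda>\<Theta>. \<forall>t\<in>set_pmf \<Theta>. taus t = {} \<and> (\<forall>\<mu>. barb t \<mu> \<longrightarrow> barb s \<mu>)) \<Theta>)"

lemma matchesD:
  assumes "matches must N s \<Theta>"
  shows "\<Delta> \<in> taus s \<Longrightarrow> simulates_dist must \<Delta> \<Theta>"
    and "(a, b, \<Delta>) \<in> outs s \<Longrightarrow> after_step (out_step a b) (simulates_dist must \<Delta>) \<Theta>"
    and "(a, \<Delta>) \<in> bouts s \<Longrightarrow> after_step (bout_step a) (simulates_dist must \<Delta>) \<Theta>"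
    and "(a, \<Delta>) \<in> ins s \<Longrightarrow> w \<in> N \<Longrightarrow> after_step (in_step a)
      (\<lambda>\<Theta>. simulates_dist must (ren_dist (inst w) \<Delta>) (ren_dist (inst w) \<Theta>)) \<Theta>"
    and "(a, \<Delta>) \<in> ins s \<Longrightarrow> after_step (in_step a) (simulates_dist must \<Delta>) \<Theta>"
    and "must \<Longrightarrow> taus s = {} \<Longrightarrow>
      after_tau (\<lambda>\<Theta>. \<forall>t\<in>set_pmf \<Theta>. taus t = {} \<and> (\<forall>\<mu>. barb t \<mu> \<longrightarrow> barb s \<mu>)) \<Theta>"
proof -
  note m = assms[unfolded matches_def]
  note m1 = conjunct1[OF m] and r1 = conjunct2[OF m]
  note m2 = conjunct1[OF r1] and r2 = conjunct2[OF r1]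
  note m3 = conjunct1[OF r2] and r3 = conjunct2[OF r2]
  note m4 = conjunct1[OF r3] and r4 = conjunct2[OF r3]
  note m5 = conjunct1[OF r4] and m6 = conjunct2[OF r4]
  show "\<Delta> \<in> taus s \<Longrightarrow> simulates_dist must \<Delta> \<Theta>"
    by (rule bspec[OF m1])
  show "(a, b, \<Delta>) \<in> outs s \<Longrightarrow> after_step (out_step a b) (simulates_dist must \<Delta>) \<Theta>"
    by (drule bspec[OF m2], unfold prod.case)
  show "(a, \<Delta>) \<in> bouts s \<Longrightarrow> after_step (bout_step a) (simulates_dist must \<Delta>) \<Theta>"
    by (drule bspec[OF m3], unfold prod.case)
  show "(a, \<Delta>) \<in> ins s \<Longrightarrow> w \<in> N \<Longrightarrow> after_step (in_step a)
      (\<lambda>\<Theta>. simulates_dist must (ren_dist (inst w) \<Delta>) (ren_dist (inst w) \<Theta>)) \<Theta>"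
    by (drule bspec[OF m4], unfold prod.case, drule (1) bspec)
  show "(a, \<Delta>) \<in> ins s \<Longrightarrow> after_step (in_step a) (simulates_dist must \<Delta>) \<Theta>"
    by (drule bspec[OF m5], unfold prod.case)
  show "must \<Longrightarrow> taus s = {} \<Longrightarrow>
      after_tau (\<lambda>\<Theta>. \<forall>t\<in>set_pmf \<Theta>. taus t = {} \<and> (\<forall>\<mu>. barb t \<mu> \<longrightarrow> barb s \<mu>)) \<Theta>"
    using m6 by iprover
qed

text \<open>A received name outside \<open>N\<close> is new to both sides, so the generic derivative
  is carried over to it by a permutation. The same applies to the name of a bound output.\<close>

lemma psim_if_matches:
  assumes fin: "finite (set_pmf \<Theta>)" "finite N" and N: "fn_state s \<union> fn_dist \<Theta> \<subseteq> N" and m: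
    "matches must N s \<Theta>"
  shows "psim must s \<Theta>"
proof -
  have finfn: "finite (fn_state s \<union> fn_dist \<Theta>)" using finite_subset[OF N fin(2)] .
  \<comment> \<open>Being non-injective, \<open>inst w\<close> cannot be pushed through weak moves
    and simulation; a permutation with the same effect on all names that occur takes its
    place.\<close>
  have open_ren: "simulates_dist must (ren_dist (inst w) \<Delta>) (ren_dist (inst w) \<Theta>\<^sub>2)"
    if w: "w \<notin> fn_state s \<union> fn_dist \<Theta>"
      and fns: "fn_dist \<Theta>\<^sub>2 \<subseteq> insert 0 (Suc ` fn_dist \<Theta>)" "fn_dist \<Delta> \<subseteq> insert 0 (Suc ` fn_state s)"
      and \<Theta>': "weak_tau \<Theta>\<^sub>2 \<Theta>'" "lift_rel (psim must) \<Delta> \<Theta>'" for w \<Theta>\<^sub>2 \<Theta>' \<Delta>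
  proof -
    obtain g where g: "bij g" "\<And>n. n \<in> insert 0 (Suc ` (fn_state s \<union> fn_dist \<Theta>)) \<Longrightarrow> g n = inst w n"
      using bij_extends_inst[OF finfn w] by blast
    have "ren_dist g \<Theta>\<^sub>2 = ren_dist (inst w) \<Theta>\<^sub>2" "ren_dist g \<Delta> = ren_dist (inst w) \<Delta>"
      by (rule ren_dist_cong; rule g(2); use fns in blast)+
    moreover have "weak_tau (ren_dist g \<Theta>\<^sub>2) (ren_dist g \<Theta>')"
      by (rule weak_tau_ren[OF bij_is_inj[OF g(1)] \<Theta>'(1)])
    moreover have "lift_rel (psim must) (ren_dist g \<Delta>) (ren_dist g \<Theta>')"
      by (rule lift_rel_ren[OF \<Theta>'(2)]) (rule psim_ren[OF g(1)])
    ultimately show ?thesis by auto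
  qed
  have step_fn: "fn_dist \<Theta>\<^sub>2 \<subseteq> insert 0 (Suc ` fn_dist \<Theta>)"
    if "weak_tau \<Theta> \<Theta>\<^sub>1" "lift_rel (in_step a) \<Theta>\<^sub>1 \<Theta>\<^sub>2 \<or> lift_rel (bout_step a) \<Theta>\<^sub>1 \<Theta>\<^sub>2"
      for a \<Theta>\<^sub>1 \<Theta>\<^sub>2
  proof -
    have "fn_dist \<Theta>\<^sub>2 \<subseteq> insert 0 (Suc ` fn_dist \<Theta>\<^sub>1)"
      using that(2) fn_lift_in_step fn_lift_bout_step by blast
    with weak_tau_fn[OF that(1)] show ?thesis by blast
  qed
  have sim: "simulates (psim must) s \<Theta>"
    unfolding simulates_def
  proof (intro conjI allI impI)
    fix a x \<Delta> w
    assume "late_trans s (AInp a x) \<Delta>" and x: "x \<notin> fn_state s \<union> fn_dist \<Theta>"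
    then obtain D where D: "(a, D) \<in> ins s" "\<Delta> = ren_dist (inst x) D"
      by (auto elim: late_trans_AInpD)
    have sub: "subst_dist w x (ren_dist (inst x) E) = ren_dist (inst w) E" if "Suc x \<notin> fn_dist E"
      for E
      by (rule subst_dist_inst[OF that])
    have Dx: "Suc x \<notin> fn_dist D" using Suc_notin_fn_ins[OF D(1)] x by blast
    have "after_step (in_step a) (\<lambda>\<Theta>. simulates_dist must (ren_dist (inst w) D) (ren_dist (inst w)
      \<Theta>)) \<Theta>"
    proof (cases "w \<in> N")
      case True
      with m D(1) show ?thesis by (intro matchesD(4))
    next
      case False
      from m D(1) obtain \<Theta>\<^sub>1 \<Theta>\<^sub>2 \<Theta>' where *: "weak_tau \<Theta> \<Theta>\<^sub>1" "lift_rel (in_step a) \<Theta>\<^sub>1 \<Theta>\<^sub>2"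
        "weak_tau \<Theta>\<^sub>2 \<Theta>'" "lift_rel (psim must) D \<Theta>'" by (auto dest: matchesD(5))
      have "fn_dist D \<subseteq> insert 0 (Suc ` fn_state s)" using fn_ins[OF D(1)] by blast
      moreover have "fn_dist \<Theta>\<^sub>2 \<subseteq> insert 0 (Suc ` fn_dist \<Theta>)" using step_fn[OF *(1)] *(2) by blast
      moreover have "w \<notin> fn_state s \<union> fn_dist \<Theta>" using False N by blast
      ultimately obtain \<Xi> where "weak_tau (ren_dist (inst w) \<Theta>\<^sub>2) \<Xi>"
        "lift_rel (psim must) (ren_dist (inst w) D) \<Xi>"
        using open_ren[of w \<Theta>\<^sub>2 D \<Theta>'] *(3,4) by metis
      with *(1,2) show ?thesis by blast
    qed
    then obtain \<Theta>\<^sub>1 \<Theta>\<^sub>2 \<Theta>' where *: "weak_tau \<Theta> \<Theta>\<^sub>1" "lift_rel (in_step a) \<Theta>\<^sub>1 \<Theta>\<^sub>2"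
      "weak_tau (ren_dist (inst w) \<Theta>\<^sub>2) \<Theta>'" "lift_rel (psim must) (ren_dist (inst w) D) \<Theta>'" by blast
    have "x \<notin> fn_dist \<Theta>\<^sub>1" using weak_tau_fn[OF *(1)] x by blast
    with *(2) have "dist_trans \<Theta>\<^sub>1 (AInp a x) (ren_dist (inst x) \<Theta>\<^sub>2)" by (rule lift_rel_in_step)
    moreover have "Suc x \<notin> fn_dist \<Theta>\<^sub>2" using step_fn[OF *(1)] *(2) x by blast
    ultimately show "\<exists>\<Theta>\<^sub>1 \<Theta>\<^sub>2 \<Theta>'. weak_tau \<Theta> \<Theta>\<^sub>1 \<and> dist_trans \<Theta>\<^sub>1 (AInp a x) \<Theta>\<^sub>2 \<and>
      weak_tau (subst_dist w x \<Theta>\<^sub>2) \<Theta>' \<and> lift_rel (psim must) (subst_dist w x \<Delta>) \<Theta>'"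
      using * Dx unfolding D(2) by (metis sub)
  next
    fix \<alpha> \<Delta>
    assume tr: "late_trans s \<alpha> \<Delta>" and \<alpha>: "\<nexists>a x. \<alpha> = AInp a x" and x:
      "bn \<alpha> \<inter> (fn_state s \<union> fn_dist \<Theta>) = {}"
    show "\<exists>\<Theta>'. weak \<Theta> \<alpha> \<Theta>' \<and> lift_rel (psim must) \<Delta> \<Theta>'"
    proof (cases \<alpha>)
      case Tau
      with tr matchesD(1)[OF m] show ?thesis by (auto simp: weak_def late_trans_Tau_iff)
    next
      case (AOut a b)
      with tr m obtain \<Theta>\<^sub>1 \<Theta>\<^sub>2 \<Theta>' where "weak_tau \<Theta> \<Theta>\<^sub>1" "lift_rel (out_step a b) \<Theta>\<^sub>1 \<Theta>\<^sub>2"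
        "weak_tau \<Theta>\<^sub>2 \<Theta>'" "lift_rel (psim must) \<Delta> \<Theta>'" by (auto simp: late_trans_AOut_iff dest:
          matchesD(2))
      moreover have "dist_trans \<Theta>\<^sub>1 \<alpha> \<Theta>\<^sub>2" unfolding dist_trans_def AOut
        by (rule lift_rel_mono[OF calculation(2)]) (simp add: late_trans_AOut_iff out_step_def)
      ultimately show ?thesis using AOut by (auto simp: weak_def)
    next
      case (BOut a x)
      with tr obtain D where D: "(a, D) \<in> bouts s" "\<Delta> = ren_dist (inst x) D"
        by (auto elim: late_trans_BOutD)
      from m D(1) obtain \<Theta>\<^sub>1 \<Theta>\<^sub>2 \<Theta>' where *: "weak_tau \<Theta> \<Theta>\<^sub>1" "lift_rel (bout_step a) \<Theta>\<^sub>1 \<Theta>\<^sub>2"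
        "weak_tau \<Theta>\<^sub>2 \<Theta>'" "lift_rel (psim must) D \<Theta>'" by (auto dest: matchesD(3))
      have x: "x \<notin> fn_state s \<union> fn_dist \<Theta>" using x BOut by auto
      then have "x \<notin> fn_dist \<Theta>\<^sub>1" using weak_tau_fn[OF *(1)] by blast
      with *(2) have tr2: "dist_trans \<Theta>\<^sub>1 (BOut a x) (ren_dist (inst x) \<Theta>\<^sub>2)"
        by (rule lift_rel_bout_step)
      have "fn_dist D \<subseteq> insert 0 (Suc ` fn_state s)" using fn_bouts[OF D(1)] by blast
      moreover have "fn_dist \<Theta>\<^sub>2 \<subseteq> insert 0 (Suc ` fn_dist \<Theta>)" using step_fn[OF *(1)] *(2) by blast
      ultimately obtain \<Xi> where
        "weak_tau (ren_dist (inst x) \<Theta>\<^sub>2) \<Xi>" "lift_rel (psim must) (ren_dist (inst x) D) \<Xi>"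
        using open_ren[of x \<Theta>\<^sub>2 D \<Theta>'] *(3,4) x by metis
      with tr2 *(1) show ?thesis unfolding BOut D(2) by (auto simp: weak_def)
    qed (use \<alpha> in auto)
  qed
  have ref: "can_refuse s \<Theta>" if must: must
    unfolding can_refuse_def
  proof (intro allI impI)
    fix X assume X: "refuses s X"
    then obtain \<Theta>' where "weak_tau \<Theta> \<Theta>'" "\<forall>t\<in>set_pmf \<Theta>'. taus t = {} \<and> (\<forall>\<mu>. barb t \<mu> \<longrightarrow> barb s \<mu>)"
      using matchesD(6)[OF m must] unfolding refuses_iff by blast
    with X show "\<exists>\<Theta>'. weak_tau \<Theta> \<Theta>' \<and> refuses_dist \<Theta>' X" unfolding refuses_dist_def refuses_iff
      by blast
  qed
  have "simulates (\<lambda>s' \<Theta>'. (s' = s \<and> \<Theta>' = \<Theta>) \<or> psim must s' \<Theta>') s \<Theta>"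
    by (rule simulates_mono[OF sim]) simp
  with ref fin(1) show ?thesis
    by (intro psimI[where R = "\<lambda>s' \<Theta>'. s' = s \<and> \<Theta>' = \<Theta>"]) simp_all
qed


section \<open>Test templates\<close>

type_synonym path = "bool list"

text \<open>Syntax trees of tests, with \<open>ptest\<close> on the level of processes and
  \<open>atest\<close> on that of states. A node with two children extends the address by
  \<open>False\<close> or \<open>True\<close>. \<open>RcvEq\<close> and \<open>RcvNew\<close> have
  an implicit second child, a leaf for received names other than the intended ones. Names below
  \<open>SndNew\<close> and \<open>RcvNew\<close> count one more binder, for the new name.\<close>

datatype ptest = Leaf | Mix ptest ptest | Act atest
  and atest = Stop | Plus atest atest | Tick ptest | Snd name name ptest | SndNew name ptest
    | RcvEq name name ptest | RcvNew name "name list" ptest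

text \<open>For \<open>RcvNew\<close> the list must exhaust \<open>N\<close>: a name is recognized
  as new by differing from every name that the tested state may have free.\<close>

primrec uses_ptest :: "ptest \<Rightarrow> name set \<Rightarrow> bool" and uses_atest :: "atest \<Rightarrow> name set \<Rightarrow> bool" where
  "uses_ptest Leaf N \<longleftrightarrow> True"
| "uses_ptest (Mix T U) N \<longleftrightarrow> uses_ptest T N \<and> uses_ptest U N"
| "uses_ptest (Act A) N \<longleftrightarrow> uses_atest A N"
| "uses_atest Stop N \<longleftrightarrow> True"
| "uses_atest (Plus A B) N \<longleftrightarrow> uses_atest A N \<and> uses_atest B N"
| "uses_atest (Tick T) N \<longleftrightarrow> uses_ptest T N"
| "uses_atest (Snd a w T) N \<longleftrightarrow> a \<in> N \<and> w \<in> N \<and> uses_ptest T N"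
| "uses_atest (SndNew a T) N \<longleftrightarrow> a \<in> N \<and> uses_ptest T (insert 0 (Suc ` N))"
| "uses_atest (RcvEq a b T) N \<longleftrightarrow> a \<in> N \<and> b \<in> N \<and> uses_ptest T N"
| "uses_atest (RcvNew a ns T) N \<longleftrightarrow> a \<in> N \<and> set ns = N \<and> uses_ptest T (insert 0 (Suc ` N))"

text \<open>Bounds the ticks along any branch, hence the length of the clock. A reception counts one
  because of the tick after its comparison.\<close>

primrec depth_ptest :: "ptest \<Rightarrow> nat" and depth_atest :: "atest \<Rightarrow> nat" where
  "depth_ptest Leaf = 0"
| "depth_ptest (Mix T U) = max (depth_ptest T) (depth_ptest U)"
| "depth_ptest (Act A) = depth_atest A"
| "depth_atest Stop = 0"
| "depth_atest (Plus A B) = max (depth_atest A) (depth_atest B)"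
| "depth_atest (Tick T) = Suc (depth_ptest T)"
| "depth_atest (Snd a w T) = depth_ptest T"
| "depth_atest (SndNew a T) = depth_ptest T"
| "depth_atest (RcvEq a b T) = Suc (depth_ptest T)"
| "depth_atest (RcvNew a ns T) = Suc (depth_ptest T)"

primrec summands :: "atest \<Rightarrow> (path \<times> atest) set" where
  "summands Stop = {}"
| "summands (Plus A B) = {(False # \<pi>, x) |\<pi> x. (\<pi>, x) \<in> summands A} \<union> {(True # \<pi>, x) |\<pi> x. (\<pi>,
  x) \<in> summands B}"
| "summands (Tick T) = {([], Tick T)}"
| "summands (Snd a w T) = {([], Snd a w T)}"
| "summands (SndNew a T) = {([], SndNew a T)}"
| "summands (RcvEq a b T) = {([], RcvEq a b T)}"
| "summands (RcvNew a ns T) = {([], RcvNew a ns T)}"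

section \<open>Translation of templates into processes\<close>

definition tick :: "name \<Rightarrow> proc \<Rightarrow> state" where
  "tick z P = Inp z (ren_proc Suc P)"

text \<open>Reward 0 needs a case of its own because probabilities of choices are positive. The
  object of the success output is \<omega> itself: every other name is restricted in an application,
  and its output would be a bound one and not count.\<close>

definition leaf_proc :: "name \<Rightarrow> real \<Rightarrow> proc" where
  "leaf_proc \<omega> r = (if r \<le> 0 then Emb Zero else Choice (Emb (Out \<omega> \<omega> (Emb Zero))) (Prob r) (Emb
    Zero))"

primrec mismatches :: "name \<Rightarrow> name list \<Rightarrow> state \<Rightarrow> state" where
  "mismatches c [] s = s"
| "mismatches c (n # ns) s = Mismatch c n (mismatches c ns s)"

primrec matchany :: "name \<Rightarrow> name list \<Rightarrow> state \<Rightarrow> state" where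
  "matchany c [] s = Zero"
| "matchany c (n # ns) s = Sum (Match c n s) (matchany c ns s)"

definition body_eq :: "name \<Rightarrow> name \<Rightarrow> state \<Rightarrow> state \<Rightarrow> state" where
  "body_eq c b s s' = Sum (Match c b s) (Mismatch c b s')"

definition body_new :: "name \<Rightarrow> name list \<Rightarrow> state \<Rightarrow> state \<Rightarrow> state" where
  "body_new c ns s s' = Sum (mismatches c ns s) (matchany c ns s')"

text \<open>Places the rewards \<open>h\<close> at the leaves, narrowing \<open>h\<close> to the
  addresses of a subtree on the way down. In \<open>RcvEq\<close> the continuation ignores the
  received name and is shifted past it; in \<open>RcvNew\<close> it lives below that binder. The
  side leaf of a reception has address \<open>[True]\<close>, as a tick adds nothing to an
  address.\<close>

primrec ptest_proc :: "ptest \<Rightarrow> name \<Rightarrow> name \<Rightarrow> (path \<Rightarrow> real) \<Rightarrow> proc"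
  and atest_state :: "atest \<Rightarrow> name \<Rightarrow> name \<Rightarrow> (path \<Rightarrow> real) \<Rightarrow> state" where
  "ptest_proc Leaf z \<omega> h = leaf_proc \<omega> (h [])"
| "ptest_proc (Mix T U) z \<omega> h = Choice (ptest_proc T z \<omega> (h \<circ> Cons False)) (Prob (1 / 2))
  (ptest_proc U z \<omega> (h \<circ> Cons True))"
| "ptest_proc (Act A) z \<omega> h = Emb (atest_state A z \<omega> h)"
| "atest_state Stop z \<omega> h = Zero"
| "atest_state (Plus A B) z \<omega> h = Sum (atest_state A z \<omega> (h \<circ> Cons False)) (atest_state B z \<omega> (h \<circ>
  Cons True))"
| "atest_state (Tick T) z \<omega> h = tick z (ptest_proc T z \<omega> h)"
| "atest_state (Snd a w T) z \<omega> h = Out a w (ptest_proc T z \<omega> h)"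
| "atest_state (SndNew a T) z \<omega> h = Res (Out (Suc a) 0 (ptest_proc T (Suc z) (Suc \<omega>) h))"
| "atest_state (RcvEq a b T) z \<omega> h = Inp a (Emb (body_eq 0 (Suc b)
      (tick (Suc z) (ren_proc Suc (ptest_proc T z \<omega> (h \<circ> Cons False)))) (tick (Suc z) (leaf_proc
        (Suc \<omega>) (h [True])))))"
| "atest_state (RcvNew a ns T) z \<omega> h = Inp a (Emb (body_new 0 (map Suc ns)
      (tick (Suc z) (ptest_proc T (Suc z) (Suc \<omega>) (h \<circ> Cons False))) (tick (Suc z) (leaf_proc (Suc
        \<omega>) (h [True])))))"

primrec clock :: "name \<Rightarrow> nat \<Rightarrow> state" where
  "clock z 0 = Zero"
| "clock z (Suc j) = Out z z (Emb (clock z j))"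

text \<open>The moves in which the test takes part, read off from the template alone: the address
  chosen, what remains of the template, and the tested side. The flag tells whether a name becomes
  private to both sides, so that a restriction appears around the configuration. A received name
  that fails its comparison leads on to a leaf, so that a wrong communication is recorded and not
  lost.\<close>

inductive comm :: "atest \<Rightarrow> state \<Rightarrow> path \<Rightarrow> ptest \<Rightarrow> bool \<Rightarrow> state pmf \<Rightarrow> bool" for A t where
  tick: "(\<pi>, Tick T) \<in> summands A \<Longrightarrow> comm A t \<pi> T False (return_pmf t)"
| snd: "(\<pi>, Snd a w T) \<in> summands A \<Longrightarrow> (a, D) \<in> ins t \<Longrightarrow> comm A t \<pi> T False (ren_dist (inst w) D)"
| snd_new: "(\<pi>, SndNew a T) \<in> summands A \<Longrightarrow> (a, D) \<in> ins t \<Longrightarrow> comm A t \<pi> T True D"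
| rcv_hit: "(\<pi>, RcvEq a b T) \<in> summands A \<Longrightarrow> (a, b, D) \<in> outs t \<Longrightarrow>
  comm A t (\<pi> @ [False]) (Act (Tick T)) False D"
| rcv_miss: "(\<pi>, RcvEq a b T) \<in> summands A \<Longrightarrow> (a, c, D) \<in> outs t \<Longrightarrow> c \<noteq> b \<Longrightarrow>
  comm A t (\<pi> @ [True]) (Act (Tick Leaf)) False D"
| rcv_open: "(\<pi>, RcvEq a b T) \<in> summands A \<Longrightarrow> (a, D) \<in> bouts t \<Longrightarrow>
  comm A t (\<pi> @ [True]) (Act (Tick Leaf)) True D"
| new_old: "(\<pi>, RcvNew a ns T) \<in> summands A \<Longrightarrow> (a, c, D) \<in> outs t \<Longrightarrow>
  comm A t (\<pi> @ [True]) (Act (Tick Leaf)) False D"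
| new_open: "(\<pi>, RcvNew a ns T) \<in> summands A \<Longrightarrow> (a, D) \<in> bouts t \<Longrightarrow>
  comm A t (\<pi> @ [False]) (Act (Tick T)) True D"

definition config :: "name \<Rightarrow> nat \<Rightarrow> state \<Rightarrow> state \<Rightarrow> state" where
  "config z j u t = Par (Par (clock z j) u) t"

definition config_dist :: "name \<Rightarrow> nat \<Rightarrow> state pmf \<Rightarrow> state pmf \<Rightarrow> state pmf" where
  "config_dist z j U \<Theta> = par_dist (par_dist (return_pmf (clock z j)) U) \<Theta>"

definition shift_name :: "bool \<Rightarrow> name \<Rightarrow> name" where
  "shift_name e = (if e then Suc else id)"

definition shift_names :: "bool \<Rightarrow> name set \<Rightarrow> name set" where
  "shift_names e N = (if e then insert 0 (Suc ` N) else N)"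

definition shift_res :: "bool \<Rightarrow> state \<Rightarrow> state" where
  "shift_res e = (if e then Res else id)"

definition same_trans :: "state \<Rightarrow> state \<Rightarrow> bool" where
  "same_trans s t \<longleftrightarrow> ins s = ins t \<and> outs s = outs t \<and> bouts s = bouts t \<and> taus s = taus t"

text \<open>After a reception the test is not literally a translated template but a sum of decided
  comparisons with the same transitions; hence the second alternative.\<close>

definition implements :: "ptest \<Rightarrow> name \<Rightarrow> name \<Rightarrow> (path \<Rightarrow> real) \<Rightarrow> state pmf \<Rightarrow> bool" where
  "implements T z \<omega> h U \<longleftrightarrow> U = interp (ptest_proc T z \<omega> h) \<or>
    (\<exists>A u. T = Act A \<and> U = return_pmf u \<and> same_trans u (atest_state A z \<omega> h))"

lemma ren_tick: "ren_state f (tick z P) = tick (f z) (ren_proc f P)"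
  by (simp add: tick_def ren_ren lift_ren_Suc)

lemma ren_leaf_proc: "ren_proc f (leaf_proc \<omega> r) = leaf_proc (f \<omega>) r"
  by (simp add: leaf_proc_def)

lemma tick_transitions [simp]: "ins (tick z P) = {(z, ren_dist Suc (interp P))}"
  "outs (tick z P) = {}" "bouts (tick z P) = {}" "taus (tick z P) = {}"
  by (simp_all add: tick_def interp_ren)

lemma ren_mismatches: "ren_state f (mismatches c ns s) =
  mismatches (f c) (map f ns) (ren_state f s)"
  and ren_matchany: "ren_state f (matchany c ns s) = matchany (f c) (map f ns) (ren_state f s)"
  by (induction ns) simp_all

lemma mismatches_transitions [simp]:
  "ins (mismatches c ns s) = (if c \<in> set ns then {} else ins s)"
  "outs (mismatches c ns s) = (if c \<in> set ns then {} else outs s)"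
  "bouts (mismatches c ns s) = (if c \<in> set ns then {} else bouts s)"
  "taus (mismatches c ns s) = (if c \<in> set ns then {} else taus s)"
  by (induction ns) auto

lemma matchany_transitions [simp]:
  "ins (matchany c ns s) = (if c \<in> set ns then ins s else {})"
  "outs (matchany c ns s) = (if c \<in> set ns then outs s else {})"
  "bouts (matchany c ns s) = (if c \<in> set ns then bouts s else {})"
  "taus (matchany c ns s) = (if c \<in> set ns then taus s else {})"
  by (induction ns) auto

lemma same_trans_body_eq: "same_trans (body_eq c b s s') (if c = b then s else s')"
  and same_trans_body_new: "same_trans (body_new c ns s s') (if c \<in> set ns then s' else s)"
  by (auto simp: same_trans_def body_eq_def body_new_def)

lemma ren_inst_Suc [simp]: "ren_proc (inst c) (ren_proc Suc P) = P"
  by (simp add: ren_ren inst_Suc)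

lemma ren_body_eq: "ren_state f (body_eq c b s s') = body_eq (f c) (f b) (ren_state f s) (ren_state
  f s')"
  and ren_body_new: "ren_state f (body_new c ns s s') = body_new (f c) (map f ns) (ren_state f s)
    (ren_state f s')"
  by (simp_all add: body_eq_def body_new_def ren_mismatches ren_matchany)

definition rcv_eq_body :: "name \<Rightarrow> ptest \<Rightarrow> name \<Rightarrow> name \<Rightarrow> (path \<Rightarrow> real) \<Rightarrow> state" where
  "rcv_eq_body b T z \<omega> h = body_eq 0 (Suc b)
      (tick (Suc z) (ren_proc Suc (ptest_proc T z \<omega> (h \<circ> Cons False)))) (tick (Suc z) (leaf_proc
        (Suc \<omega>) (h [True])))"

definition rcv_new_body :: "name list \<Rightarrow> ptest \<Rightarrow> name \<Rightarrow> name \<Rightarrow> (path \<Rightarrow> real) \<Rightarrow> state" where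
  "rcv_new_body ns T z \<omega> h = body_new 0 (map Suc ns)
      (tick (Suc z) (ptest_proc T (Suc z) (Suc \<omega>) (h \<circ> Cons False))) (tick (Suc z) (leaf_proc (Suc
        \<omega>) (h [True])))"

lemma atest_state_Rcv: "atest_state (RcvEq a b T) z \<omega> h = Inp a (Emb (rcv_eq_body b T z \<omega> h))"
  "atest_state (RcvNew a ns T) z \<omega> h = Inp a (Emb (rcv_new_body ns T z \<omega> h))"
  by (simp_all add: rcv_eq_body_def rcv_new_body_def)

lemma same_trans_inst_rcv_eq_body: 
  "same_trans (ren_state (inst c) (rcv_eq_body b T z \<omega> h))
    (if c = b then atest_state (Tick T) z \<omega> (h \<circ> Cons False) else atest_state (Tick Leaf) z \<omega> (h \<circ>
      Cons True))"
  using same_trans_body_eq[of c b "tick z (ptest_proc T z \<omega> (h \<circ> Cons False))"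
    "tick z (leaf_proc \<omega> (h [True]))"]
  by (cases "c = b") (simp_all add: rcv_eq_body_def ren_body_eq ren_tick ren_leaf_proc)

text \<open>With the binder left open, index 0 differs from every shifted name: an extruded name
  never passes the comparison.\<close>

lemma same_trans_rcv_eq_body: "same_trans (rcv_eq_body b T z \<omega> h) (atest_state (Tick Leaf) (Suc z)
  (Suc \<omega>) (h \<circ> Cons True))"
  using same_trans_body_eq[of 0 "Suc b"] by (simp add: rcv_eq_body_def)

lemma same_trans_inst_rcv_new_body:
  "c \<in> set ns \<Longrightarrow> same_trans (ren_state (inst c) (rcv_new_body ns T z \<omega> h)) (atest_state (Tick Leaf)
    z \<omega> (h \<circ> Cons True))"
  using same_trans_body_new[of c ns] by (simp add: rcv_new_body_def ren_body_new ren_tick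
    ren_leaf_proc comp_def)

text \<open>Index 0 is not in the shifted list, so an extruded name passes all mismatches.\<close>

lemma same_trans_rcv_new_body: "same_trans (rcv_new_body ns T z \<omega> h) (atest_state (Tick T) (Suc z)
  (Suc \<omega>) (h \<circ> Cons False))"
  using same_trans_body_new[of 0 "map Suc ns"] by (simp add: rcv_new_body_def image_iff)

lemma mem_summands_Plus: "(\<pi>, x) \<in> summands (Plus A B) \<longleftrightarrow>
    (\<exists>\<rho>. \<pi> = False # \<rho> \<and> (\<rho>, x) \<in> summands A) \<or> (\<exists>\<rho>. \<pi> = True # \<rho> \<and> (\<rho>, x) \<in> summands B)"
  by auto

lemma summands_basic: "(\<pi>, x) \<in> summands A \<Longrightarrow> summands x = {([], x)}"
  by (induction A arbitrary: \<pi> rule: atest.induct[where ?P1.0 = "\<lambda>_. True"]) auto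

text \<open>What a sum offers is collected from its summands, with \<open>h\<close> narrowed along
  the address of each. Internal steps arise only together with the clock or the tested
  state.\<close>

lemma atest_state_transitions:
  "taus (atest_state A z \<omega> h) = {}"
  "(a, w, D) \<in> outs (atest_state A z \<omega> h) \<longleftrightarrow>
    (\<exists>\<pi> T. (\<pi>, Snd a w T) \<in> summands A \<and> D = interp (ptest_proc T z \<omega> (h \<circ> append \<pi>)))"
  "(a, D) \<in> bouts (atest_state A z \<omega> h) \<longleftrightarrow>
    (\<exists>\<pi> T. (\<pi>, SndNew a T) \<in> summands A \<and> D = interp (ptest_proc T (Suc z) (Suc \<omega>) (h \<circ> append \<pi>)))"
  "(a, D) \<in> ins (atest_state A z \<omega> h) \<longleftrightarrow>
    (\<exists>\<pi> T. (\<pi>, Tick T) \<in> summands A \<and> a = z \<and> D = ren_dist Suc (interp (ptest_proc T z \<omega> (h \<circ>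
      append \<pi>)))) \<or>
    (\<exists>\<pi> b T. (\<pi>, RcvEq a b T) \<in> summands A \<and> D = return_pmf (rcv_eq_body b T z \<omega> (h \<circ> append \<pi>))) \<or>
    (\<exists>\<pi> ns T. (\<pi>, RcvNew a ns T) \<in> summands A \<and> D = return_pmf (rcv_new_body ns T z \<omega> (h \<circ> append
      \<pi>)))"
proof -
  have h0 [simp]: "h \<circ> append [] = h" for h :: "path \<Rightarrow> real" by (simp add: fun_eq_iff)
  have h1: "h \<circ> Cons b \<circ> append \<pi> = h \<circ> append (b # \<pi>)" for h :: "path \<Rightarrow> real" and b \<pi>
    by (simp add: fun_eq_iff)
  show "taus (atest_state A z \<omega> h) = {}"
    by (induction A arbitrary: z \<omega> h rule: atest.induct[where ?P1.0 = "\<lambda>_. True"]) simp_all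
  show "(a, w, D) \<in> outs (atest_state A z \<omega> h) \<longleftrightarrow>
    (\<exists>\<pi> T. (\<pi>, Snd a w T) \<in> summands A \<and> D = interp (ptest_proc T z \<omega> (h \<circ> append \<pi>)))"
  proof (induction A arbitrary: h rule: atest.induct[where ?P1.0 = "\<lambda>_. True"])
    case (Plus A B)
    show ?case unfolding atest_state.simps outs.simps Un_iff Plus.IH(1) Plus.IH(2)
      mem_summands_Plus h1 by blast
  qed auto
  show "(a, D) \<in> bouts (atest_state A z \<omega> h) \<longleftrightarrow>
    (\<exists>\<pi> T. (\<pi>, SndNew a T) \<in> summands A \<and> D = interp (ptest_proc T (Suc z) (Suc \<omega>) (h \<circ> append \<pi>)))"
  proof (induction A arbitrary: h rule: atest.induct[where ?P1.0 = "\<lambda>_. True"])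
    case (Plus A B)
    show ?case unfolding atest_state.simps bouts.simps Un_iff Plus.IH(1) Plus.IH(2)
      mem_summands_Plus h1 by blast
  qed auto
  show "(a, D) \<in> ins (atest_state A z \<omega> h) \<longleftrightarrow>
    (\<exists>\<pi> T. (\<pi>, Tick T) \<in> summands A \<and> a = z \<and> D = ren_dist Suc (interp (ptest_proc T z \<omega> (h \<circ>
      append \<pi>)))) \<or>
    (\<exists>\<pi> b T. (\<pi>, RcvEq a b T) \<in> summands A \<and> D = return_pmf (rcv_eq_body b T z \<omega> (h \<circ> append \<pi>))) \<or>
    (\<exists>\<pi> ns T. (\<pi>, RcvNew a ns T) \<in> summands A \<and> D = return_pmf (rcv_new_body ns T z \<omega> (h \<circ> append
      \<pi>)))"
  proof -
    have "(a, D) \<in> ins (atest_state A z \<omega> h) \<longleftrightarrow>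
        (\<exists>\<pi> x. (\<pi>, x) \<in> summands A \<and> (a, D) \<in> ins (atest_state x z \<omega> (h \<circ> append \<pi>)))"
    proof (induction A arbitrary: h rule: atest.induct[where ?P1.0 = "\<lambda>_. True"])
      case (Plus A B)
      show ?case unfolding atest_state.simps ins.simps Un_iff Plus.IH(1) Plus.IH(2)
        mem_summands_Plus h1 by blast
    qed auto
    also have "\<dots> \<longleftrightarrow>
      (\<exists>\<pi> T. (\<pi>, Tick T) \<in> summands A \<and> a = z \<and> D = ren_dist Suc (interp (ptest_proc T z \<omega> (h \<circ>
        append \<pi>)))) \<or>
      (\<exists>\<pi> b T. (\<pi>, RcvEq a b T) \<in> summands A \<and> D = return_pmf (rcv_eq_body b T z \<omega> (h \<circ> append \<pi>)))
        \<or>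
      (\<exists>\<pi> ns T. (\<pi>, RcvNew a ns T) \<in> summands A \<and> D = return_pmf (rcv_new_body ns T z \<omega> (h \<circ> append
        \<pi>)))"
      (is "?L \<longleftrightarrow> ?R")
    proof
      assume ?L
      then obtain \<pi> x where x: "(\<pi>, x) \<in> summands A" "(a,
        D) \<in> ins (atest_state x z \<omega> (h \<circ> append \<pi>))" by blast
      have "([], x) \<in> summands x" using summands_basic[OF x(1)] by simp
      with x show ?R
        by (cases x; clarsimp simp add: atest_state_Rcv simp del: map_pmf_comp
          atest_state.simps(6,7); blast)
    next
      assume ?R
      then show ?L
        by (elim disjE exE conjE)
          (rule exI, rule exI, erule conjI, simp add: atest_state_Rcv del: atest_state.simps(6,7))+
    qed
    finally show ?thesis .
  qed
qed

lemma clock_transitions [simp]: "ins (clock z j) = {}" "bouts (clock z j) = {}"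
  "taus (clock z j) = {}"
  "outs (clock z j) = (case j of 0 \<Rightarrow> {} | Suc i \<Rightarrow> {(z, z, return_pmf (clock z i))})"
  by (cases j; simp)+

lemma ren_clock [simp]: "ren_state f (clock z j) = clock (f z) j"
  by (induction j) simp_all

lemma uses_atest_summands: "uses_atest A N \<Longrightarrow> (\<pi>, x) \<in> summands A \<Longrightarrow> uses_atest x N"
  by (induction A arbitrary: \<pi> rule: atest.induct[where ?P1.0 = "\<lambda>_. True"]) auto

lemma depth_atest_summands: "(\<pi>, x) \<in> summands A \<Longrightarrow> depth_atest x \<le> depth_atest A"
  by (induction A arbitrary: \<pi> rule: atest.induct[where ?P1.0 =
    "\<lambda>_. True"]) (auto simp: max.coboundedI1 max.coboundedI2)

definition fits :: "name set \<Rightarrow> name \<Rightarrow> name \<Rightarrow> state \<Rightarrow> bool" where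
  "fits N z \<omega> t \<longleftrightarrow> z \<notin> N \<and> \<omega> \<notin> N \<and> z \<noteq> \<omega> \<and> fn_state t \<subseteq> N"

lemma ren_config_dist: "ren_dist f (par_dist (return_pmf (clock z j)) U) =
  par_dist (return_pmf (clock (f z) j)) (ren_dist f U)"
  by (simp add: ren_par_dist)

lemma ins_clock_par: "(a, D) \<in> ins (Par (clock z j) u) \<longleftrightarrow>
    (\<exists>E. (a, E) \<in> ins u \<and> D = par_dist (return_pmf (clock (Suc z) j)) E)"
  by auto

lemma bouts_clock_par: "(a, D) \<in> bouts (Par (clock z j) u) \<longleftrightarrow>
    (\<exists>E. (a, E) \<in> bouts u \<and> D = par_dist (return_pmf (clock (Suc z) j)) E)"
  by auto

lemma outs_clock_par: "a \<noteq> z \<Longrightarrow> (a, w, D) \<in> outs (Par (clock z j) u) \<longleftrightarrow>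
    (\<exists>E. (a, w, E) \<in> outs u \<and> D = par_dist (return_pmf (clock z j)) E)"
  by (auto split: nat.splits; force)

text \<open>The channel \<open>z\<close> lies outside \<open>N\<close>, so only a
  \<open>Tick\<close> summand can hear the clock, and each tick uses up one output of it.\<close>

lemma taus_clock_par:
  assumes "same_trans u (atest_state A z \<omega> h)" "uses_atest A N" "z \<notin> N"
  shows "D \<in> taus (Par (clock z j) u) \<longleftrightarrow>
    (\<exists>i \<pi> T. j = Suc i \<and> (\<pi>, Tick T) \<in> summands A \<and> D = par_dist (return_pmf (clock z i)) (interp
      (ptest_proc T z \<omega> (h \<circ> append \<pi>))))"
proof -
  have u: "taus u = {}" "ins u = ins (atest_state A z \<omega> h)" using assms(1)
    by (auto simp: same_trans_def atest_state_transitions(1))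
  have *: "ren_dist (inst x) (ren_dist Suc D) = D" for x D
    by (simp only: ren_dist_comp inst_Suc ren_dist_id)
  have "D \<in> taus (Par (clock z j) u) \<longleftrightarrow>
      (\<exists>i E. j = Suc i \<and> (z, E) \<in> ins u \<and> D = par_dist (return_pmf (clock z i)) (ren_dist (inst z)
        E))"
    by (auto simp: u(1) coms_def split: nat.splits)
  also have "\<dots> \<longleftrightarrow> (\<exists>i \<pi> T. j = Suc i \<and> (\<pi>, Tick T) \<in> summands A \<and>
      D = par_dist (return_pmf (clock z i)) (interp (ptest_proc T z \<omega> (h \<circ> append \<pi>))))"
  proof -
    have "(\<pi>, RcvEq z b T) \<notin> summands A" "(\<pi>, RcvNew z ns T) \<notin> summands A" for \<pi> b ns T
      using uses_atest_summands[OF assms(2), of \<pi>] assms(3) by fastforce+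
    then have "(z, E) \<in> ins u \<longleftrightarrow> (\<exists>\<pi> T. (\<pi>, Tick T) \<in> summands A \<and> E =
      ren_dist Suc (interp (ptest_proc T z \<omega> (h \<circ> append \<pi>))))" for E
      unfolding u(2) atest_state_transitions by simp
    then show ?thesis using * by (simp del: map_pmf_comp) metis
  qed
  finally show ?thesis .
qed

text \<open>The tested state does not know \<open>z\<close> and cannot meddle with the clock, and
  apart from the clock the template communicates only on names in \<open>N\<close>. What remains are
  internal steps of the tested state and the moves of \<open>comm\<close>, with enough of the clock
  left for the rest of the template.\<close>

lemma config_step_cases:
  assumes X: "X \<in> taus (config z j u t)" and fit: "fits N z \<omega> t" and A: "uses_atest A N"
    "depth_atest A \<le> j" "same_trans u (atest_state A z \<omega> h)"
  obtains (tau) \<Delta> where "\<Delta> \<in> taus t" "X = config_dist z j (return_pmf u) \<Delta>"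
  | (comm) \<pi> T e \<Theta> U i where "comm A t \<pi> T e \<Theta>" "implements T (shift_name e z) (shift_name e \<omega>) (h
    \<circ> append \<pi>) U" "depth_ptest T \<le> i"
      "X = map_pmf (shift_res e) (config_dist (shift_name e z) i U \<Theta>)"
proof -
  have z: "z \<notin> N" "z \<notin> fn_state t" and t: "fn_state t \<subseteq> N" using fit by (auto simp: fits_def)
  have u: "ins u = ins (atest_state A z \<omega> h)" "outs u = outs (atest_state A z \<omega> h)"
    "bouts u = bouts (atest_state A z \<omega> h)" using A(3) by (auto simp: same_trans_def)
  note smd = uses_atest_summands[OF A(1)] order_trans[OF depth_atest_summands A(2)]
  have idd: "map_pmf (shift_res False) D = D" "map_pmf (shift_res True) D = map_pmf Res D" for D
    by (simp_all add: shift_res_def)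
  have impl: "implements (Act B) (shift_name e z) (shift_name e \<omega>) (h \<circ> append \<pi>) (return_pmf v)"
    if "same_trans v (atest_state B (shift_name e z) (shift_name e \<omega>) (h \<circ> append \<pi>))" for B e v \<pi>
    using that by (auto simp: implements_def)
  have happ: "h \<circ> append \<pi> \<circ> Cons b = h \<circ> append (\<pi> @ [b])" for \<pi> b by (simp add: fun_eq_iff)
  from X consider
      "\<exists>D\<in>taus (Par (clock z j) u). X = par_dist D (return_pmf t)"
    | "\<exists>\<Delta>\<in>taus t. X = par_dist (return_pmf (Par (clock z j) u)) \<Delta>"
    | "X \<in> coms (Par (clock z j) u) t" unfolding config_def taus.simps(7)[of "Par (clock z j) u"]
      by blast
  then show thesis
  proof cases
    case 1
    then obtain D where D: "D \<in> taus (Par (clock z j) u)" and XD: "X = par_dist D (return_pmf t)"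
      by blast
    from D obtain i \<pi> T where "j = Suc i" and T: "(\<pi>, Tick T) \<in> summands A"
      and "D = par_dist (return_pmf (clock z i)) (interp (ptest_proc T z \<omega> (h \<circ> append \<pi>)))"
      unfolding taus_clock_par[OF A(3,1) z(1)] by blast
    with XD have X: "X = par_dist (par_dist (return_pmf (clock z i)) (interp (ptest_proc T z \<omega> (h \<circ>
      append \<pi>)))) (return_pmf t)"
      by simp
    moreover have "depth_ptest T \<le> i" using smd(2)[OF T] \<open>j = Suc i\<close> by simp
    ultimately show thesis
      using comm.tick[OF T, of t] by (intro that(2)[where e = False and U =
        "interp (ptest_proc T z \<omega> (h \<circ> append \<pi>))"])
        (auto simp: idd config_dist_def shift_name_def implements_def)
  next
    case 2
    then obtain \<Delta> where "\<Delta> \<in> taus t" "X = par_dist (return_pmf (Par (clock z j) u)) \<Delta>" by blast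
    then show thesis by (intro that(1)[of \<Delta>]) (simp_all add: config_dist_def par_dist_return)
  next
    case 3
    then show thesis unfolding coms_def Un_iff
    proof (elim disjE, goal_cases)
      case 1
      then obtain a c D E where X: "X = par_dist (ren_dist (inst c) (par_dist (return_pmf (clock
        (Suc z) j)) D)) E"
        and D: "(a, D) \<in> ins (atest_state A z \<omega> h)" and E: "(a, c, E) \<in> outs t"
        unfolding ins_clock_par u by blast
      have X': "X = config_dist z j (ren_dist (inst c) D) E"
        unfolding X ren_config_dist config_dist_def by simp
      have ac: "a \<in> N" "c \<in> N" using fn_outs[OF E] t by auto
      from D consider \<pi> b T where "(\<pi>, RcvEq a b T) \<in> summands A"
        "D = return_pmf (rcv_eq_body b T z \<omega> (h \<circ> append \<pi>))"
        | \<pi> ns T where "(\<pi>, RcvNew a ns T) \<in> summands A"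
          "D = return_pmf (rcv_new_body ns T z \<omega> (h \<circ> append \<pi>))"
        unfolding atest_state_transitions using z ac by blast
      then show thesis
      proof cases
        case (1 \<pi> b T)
        show thesis
        proof (cases "c = b")
          case True
          from same_trans_inst_rcv_eq_body[of c b T z \<omega> "h \<circ> append \<pi>"] True have
            "same_trans (ren_state (inst c) (rcv_eq_body b T z \<omega> (h \<circ> append \<pi>))) (atest_state
              (Tick T) z \<omega> (h \<circ> append (\<pi> @ [False])))"
            by (simp add: happ)
          with True E smd(2)[OF 1(1)] comm.rcv_hit[OF 1(1), of E t] show thesis
            by (intro that(2)[where e = False and T = "Act (Tick T)" and \<Theta> = E and i = j and \<pi> =
              "\<pi> @ [False]" and U = "ren_dist (inst c) D"])
              (auto simp: idd X' 1 shift_name_def intro!: impl[where e = False,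
                simplified shift_name_def, simplified])
        next
          case False
          from same_trans_inst_rcv_eq_body[of c b T z \<omega> "h \<circ> append \<pi>"] False have
            "same_trans (ren_state (inst c) (rcv_eq_body b T z \<omega> (h \<circ> append \<pi>))) (atest_state
              (Tick Leaf) z \<omega> (h \<circ> append (\<pi> @ [True])))"
            by (simp add: happ)
          with False E smd(2)[OF 1(1)] comm.rcv_miss[OF 1(1) E] show thesis
            by (intro that(2)[where e = False and T = "Act (Tick Leaf)" and \<Theta> = E and i = j and \<pi> =
              "\<pi> @ [True]" and U = "ren_dist (inst c) D"])
              (auto simp: idd X' 1 shift_name_def simp del: atest_state.simps intro!: impl[where e
                = False, simplified shift_name_def, simplified])
        qed
      next
        case (2 \<pi> ns T)
        \<comment> \<open>The object of a free output of the tested state is among the names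
          \<open>N\<close>, so \<open>RcvNew\<close> treats it as old.\<close>
        have "c \<in> set ns" using smd(1)[OF 2(1)] ac by simp
        from same_trans_inst_rcv_new_body[OF this, of T z \<omega> "h \<circ> append \<pi>"] have
          "same_trans (ren_state (inst c) (rcv_new_body ns T z \<omega> (h \<circ> append \<pi>))) (atest_state
            (Tick Leaf) z \<omega> (h \<circ> append (\<pi> @ [True])))"
          by (simp add: happ)
        with E smd(2)[OF 2(1)] comm.new_old[OF 2(1) E] show thesis
          by (intro that(2)[where e = False and T = "Act (Tick Leaf)" and \<Theta> = E and i = j and \<pi> =
            "\<pi> @ [True]" and U = "ren_dist (inst c) D"])
            (auto simp: idd X' 2 shift_name_def simp del: atest_state.simps intro!: impl[where e =
              False, simplified shift_name_def, simplified])
      qed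
    next
      case 2
      then obtain a w D F where X: "X = par_dist F (ren_dist (inst w) D)"
        and D: "(a, D) \<in> ins t" and F: "(a, w, F) \<in> outs (Par (clock z j) u)" by blast
      have "a \<noteq> z" using fn_ins[OF D] z by blast
      then obtain E where E: "(a, w, E) \<in> outs (atest_state A z \<omega> h)"
        "F = par_dist (return_pmf (clock z j)) E"
        using F unfolding outs_clock_par[OF \<open>a \<noteq> z\<close>] u by blast
      then obtain \<pi> T where T: "(\<pi>, Snd a w T) \<in> summands A"
        "E = interp (ptest_proc T z \<omega> (h \<circ> append \<pi>))"
        unfolding atest_state_transitions by blast
      with E X smd(2)[OF T(1)] comm.snd[OF T(1) D] show thesis
        by (intro that(2)[where e = False and T = T and \<Theta> = "ren_dist (inst w) D" and i = j
          and \<pi> = \<pi> and U = E])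
          (auto simp: idd implements_def config_dist_def shift_name_def)
    next
      case 3
      then obtain a D E where X: "X = map_pmf Res (par_dist (par_dist (return_pmf (clock (Suc z)
        j)) D) E)"
        and D: "(a, D) \<in> ins (atest_state A z \<omega> h)" and E: "(a, E) \<in> bouts t"
        unfolding ins_clock_par u by blast
      have X': "X = map_pmf Res (config_dist (Suc z) j D E)" unfolding X config_dist_def by simp
      have ac: "a \<in> N" using fn_bouts[OF E] t by auto
      from D consider \<pi> b T where "(\<pi>, RcvEq a b T) \<in> summands A"
        "D = return_pmf (rcv_eq_body b T z \<omega> (h \<circ> append \<pi>))"
        | \<pi> ns T where "(\<pi>, RcvNew a ns T) \<in> summands A"
          "D = return_pmf (rcv_new_body ns T z \<omega> (h \<circ> append \<pi>))"
        unfolding atest_state_transitions using z ac by blast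
      then show thesis
      proof cases
        case (1 \<pi> b T)
        from same_trans_rcv_eq_body[of b T z \<omega> "h \<circ> append \<pi>"] have
          "same_trans (rcv_eq_body b T z \<omega> (h \<circ> append \<pi>)) (atest_state (Tick Leaf) (Suc z) (Suc \<omega>)
            (h \<circ> append (\<pi> @ [True])))"
          by (simp add: happ)
        with E smd(2)[OF 1(1)] comm.rcv_open[OF 1(1) E] show thesis
          by (intro that(2)[where e = True and T = "Act (Tick Leaf)" and \<Theta> = E and i = j and \<pi> =
            "\<pi> @ [True]" and U = D])
            (auto simp: idd X' 1 shift_name_def simp del: atest_state.simps intro!: impl[where e =
              True, simplified shift_name_def, simplified])
      next
        case (2 \<pi> ns T)
        from same_trans_rcv_new_body[of ns T z \<omega> "h \<circ> append \<pi>"] have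
          "same_trans (rcv_new_body ns T z \<omega> (h \<circ> append \<pi>)) (atest_state (Tick T) (Suc z) (Suc \<omega>)
            (h \<circ> append (\<pi> @ [False])))"
          by (simp add: happ)
        with E smd(2)[OF 2(1)] comm.new_open[OF 2(1) E] show thesis
          by (intro that(2)[where e = True and T = "Act (Tick T)" and \<Theta> = E and i = j and \<pi> =
            "\<pi> @ [False]" and U = D])
            (auto simp: idd X' 2 shift_name_def simp del: atest_state.simps intro!: impl[where e =
              True, simplified shift_name_def, simplified])
      qed
    next
      case 4
      then obtain a D E where X: "X = map_pmf Res (par_dist (par_dist (return_pmf (clock (Suc z)
        j)) E) D)"
        and D: "(a, D) \<in> ins t" and E: "(a, E) \<in> bouts (atest_state A z \<omega> h)"
        unfolding bouts_clock_par u by blast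
      then obtain \<pi> T where T: "(\<pi>, SndNew a T) \<in> summands A"
        "E = interp (ptest_proc T (Suc z) (Suc \<omega>) (h \<circ> append \<pi>))"
        unfolding atest_state_transitions by blast
      with X smd(2)[OF T(1)] comm.snd_new[OF T(1) D] show thesis
        by (intro that(2)[where e = True and T = T and \<Theta> = D and i = j and \<pi> = \<pi> and U = E])
          (auto simp: idd implements_def config_dist_def shift_name_def)
    qed
  qed
qed

lemma config_tau_step: "\<Delta> \<in> taus t \<Longrightarrow> config_dist z j (return_pmf u) \<Delta> \<in> taus (config z j u t)"
  by (simp add: config_def config_dist_def par_dist_return)

lemma implements_Act: "same_trans u (atest_state A z \<omega> h) \<Longrightarrow> implements (Act A) z \<omega> h (return_pmf u)"
  by (auto simp: implements_def)

text \<open>Converse of the case analysis. For a tick, the bound on the depth guarantees that the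
  clock still has an output.\<close>

lemma config_comm_step:
  assumes c: "comm A t \<pi> T e \<Theta>" and fit: "fits N z \<omega> t" and A: "uses_atest A N" "depth_atest A \<le> j"
    "same_trans u (atest_state A z \<omega> h)"
  obtains U i where "implements T (shift_name e z) (shift_name e \<omega>) (h \<circ> append \<pi>) U"
    "depth_ptest T \<le> i"
      "map_pmf (shift_res e) (config_dist (shift_name e z) i U \<Theta>) \<in> taus (config z j u t)"
proof -
  have z: "z \<notin> N" "z \<notin> fn_state t" and t: "fn_state t \<subseteq> N" using fit by (auto simp: fits_def)
  have u: "ins u = ins (atest_state A z \<omega> h)" "outs u = outs (atest_state A z \<omega> h)"
    "bouts u = bouts (atest_state A z \<omega> h)" using A(3) by (auto simp: same_trans_def)
  note smd = uses_atest_summands[OF A(1)] order_trans[OF depth_atest_summands A(2)]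
  have idd [simp]: "shift_res False = id" "shift_res True = Res" "shift_name False = id"
    "shift_name True = Suc" by (simp_all add: shift_res_def shift_name_def)
  have happ: "h \<circ> append \<pi> \<circ> Cons b = h \<circ> append (\<pi> @ [b])" for \<pi> b by (simp add: fun_eq_iff)
  let ?P = "Par (clock z j) u"
  have in_out: "config_dist z j (ren_dist (inst c) D) E \<in> taus (config z j u t)" if
    "(a, D) \<in> ins u" "(a, c, E) \<in> outs t" for a c D E
  proof -
    have "(a, par_dist (return_pmf (clock (Suc z) j)) D) \<in> ins ?P" using that
      unfolding ins_clock_par by blast
    with that(2) have "par_dist (ren_dist (inst c) (par_dist (return_pmf (clock (Suc z) j)) D)) E \<in>
      coms ?P t"
      unfolding coms_def by blast
    then show ?thesis unfolding ren_config_dist config_dist_def config_def by simp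
  qed
  have in_bout: "map_pmf Res (config_dist (Suc z) j D E) \<in> taus (config z j u t)" if
    "(a, D) \<in> ins u" "(a, E) \<in> bouts t" for a D E
  proof -
    have "(a, par_dist (return_pmf (clock (Suc z) j)) D) \<in> ins ?P" using that
      unfolding ins_clock_par by blast
    with that(2) have "map_pmf Res (par_dist (par_dist (return_pmf (clock (Suc z) j)) D) E) \<in> coms
      ?P t"
      unfolding coms_def by blast
    then show ?thesis unfolding config_dist_def config_def by simp
  qed
  have eq_ins: "(a, return_pmf (rcv_eq_body b T z \<omega> (h \<circ> append \<pi>))) \<in> ins u" if
    "(\<pi>, RcvEq a b T) \<in> summands A" for a b T \<pi>
    unfolding u atest_state_transitions using that by blast
  have new_ins: "(a, return_pmf (rcv_new_body ns T z \<omega> (h \<circ> append \<pi>))) \<in> ins u" if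
    "(\<pi>, RcvNew a ns T) \<in> summands A" for a ns T \<pi>
    unfolding u atest_state_transitions using that by blast
  from c show thesis
  proof cases
    case tick
    obtain i where i: "j = Suc i" using smd(2)[OF tick(3)] by (cases j) auto
    have "par_dist (return_pmf (clock z i)) (interp (ptest_proc T z \<omega> (h \<circ> append \<pi>))) \<in> taus ?P"
      unfolding taus_clock_par[OF A(3,1) z(1)] using i tick by blast
    then have "config_dist z i (interp (ptest_proc T z \<omega> (h \<circ> append \<pi>))) (return_pmf t) \<in> taus
      (config z j u t)"
      unfolding config_def config_dist_def by simp
    then show thesis using smd(2)[OF tick(3)] i tick
      by (intro that[of "interp (ptest_proc T z \<omega> (h \<circ> append \<pi>))" i]) (simp_all add:
        implements_def)
  next
    case (snd a w D)
    let ?E = "interp (ptest_proc T z \<omega> (h \<circ> append \<pi>))"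
    have "(a, w, ?E) \<in> outs u" unfolding u atest_state_transitions using snd by blast
    moreover have "a \<noteq> z" using fn_ins[OF snd(4)] z by blast
    ultimately have "(a, w, par_dist (return_pmf (clock z j)) ?E) \<in> outs ?P" using outs_clock_par
      by blast
    with snd(4) have "par_dist (par_dist (return_pmf (clock z j)) ?E) (ren_dist (inst w) D) \<in> coms
      ?P t"
      unfolding coms_def by blast
    then have "config_dist z j ?E (ren_dist (inst w) D) \<in> taus (config z j u t)"
      unfolding config_def config_dist_def by simp
    then show thesis using smd(2)[OF snd(3)] snd
      by (intro that[of ?E j]) (simp_all add: implements_def del: map_pmf_comp)
  next
    case (snd_new a)
    let ?E = "interp (ptest_proc T (Suc z) (Suc \<omega>) (h \<circ> append \<pi>))"
    have "(a, ?E) \<in> bouts u" unfolding u atest_state_transitions using snd_new by blast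
    then have "(a, par_dist (return_pmf (clock (Suc z) j)) ?E) \<in> bouts ?P" using bouts_clock_par
      by blast
    with snd_new have "map_pmf Res (par_dist (par_dist (return_pmf (clock (Suc z) j)) ?E) \<Theta>) \<in> coms
      ?P t"
      unfolding coms_def by blast
    then have "map_pmf Res (config_dist (Suc z) j ?E \<Theta>) \<in> taus (config z j u t)"
      unfolding config_def config_dist_def by simp
    then show thesis using smd(2)[OF snd_new(2)] snd_new
      by (intro that[of ?E j]) (simp_all add: implements_def del: map_pmf_comp)
  next
    case (rcv_hit \<rho> a b T')
    from in_out[OF eq_ins[OF rcv_hit(4)] rcv_hit(5)] same_trans_inst_rcv_eq_body[of b b T' z \<omega>
      "h \<circ> append \<rho>"] smd(2)[OF rcv_hit(4)] rcv_hit
    show thesis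
      by (intro that[of "return_pmf (ren_state (inst b) (rcv_eq_body b T' z \<omega> (h \<circ> append \<rho>)))" j])
        (auto simp: happ simp del: atest_state.simps intro!: implements_Act)
  next
    case (rcv_miss \<rho> a b T' c)
    from in_out[OF eq_ins[OF rcv_miss(4)] rcv_miss(5)] same_trans_inst_rcv_eq_body[of c b T' z \<omega>
      "h \<circ> append \<rho>"] smd(2)[OF rcv_miss(4)] rcv_miss
    show thesis
      by (intro that[of "return_pmf (ren_state (inst c) (rcv_eq_body b T' z \<omega> (h \<circ> append \<rho>)))" j])
        (auto simp: happ simp del: atest_state.simps intro!: implements_Act)
  next
    case (rcv_open \<rho> a b T')
    from in_bout[OF eq_ins[OF rcv_open(4)] rcv_open(5)] same_trans_rcv_eq_body[of b T' z \<omega>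
      "h \<circ> append \<rho>"] smd(2)[OF rcv_open(4)] rcv_open
    show thesis
      by (intro that[of "return_pmf (rcv_eq_body b T' z \<omega> (h \<circ> append \<rho>))" j])
        (auto simp: happ simp del: atest_state.simps intro!: implements_Act)
  next
    case (new_old \<rho> a ns T' c)
    have "c \<in> set ns" using smd(1)[OF new_old(4)] fn_outs[OF new_old(5)] t by auto
    from in_out[OF new_ins[OF new_old(4)] new_old(5)] same_trans_inst_rcv_new_body[OF this,
      of T' z \<omega> "h \<circ> append \<rho>"] smd(2)[OF new_old(4)] new_old
    show thesis
      by (intro that[of "return_pmf (ren_state (inst c) (rcv_new_body ns T' z \<omega> (h \<circ> append \<rho>)))"
        j])
        (auto simp: happ simp del: atest_state.simps intro!: implements_Act)
  next
    case (new_open \<rho> a ns T')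
    from in_bout[OF new_ins[OF new_open(4)] new_open(5)] same_trans_rcv_new_body[of ns T' z \<omega>
      "h \<circ> append \<rho>"] smd(2)[OF new_open(4)] new_open
    show thesis
      by (intro that[of "return_pmf (rcv_new_body ns T' z \<omega> (h \<circ> append \<rho>))" j])
        (auto simp: happ simp del: atest_state.simps intro!: implements_Act)
  qed
qed

lemma comm_uses_ptest: "comm A t \<pi> T e \<Theta> \<Longrightarrow> uses_atest A N \<Longrightarrow> uses_ptest T (shift_names e N)"
  by (induction rule: comm.induct; drule (1) uses_atest_summands[rotated]; simp add:
    shift_names_def)

text \<open>A private name adds index 0 to the known names and shifts the clock and success channels
  along with the others, so both stay fresh.\<close>

lemma comm_fits:
  assumes "comm A t \<pi> T e \<Theta>" "uses_atest A N" "fits N z \<omega> t" "t' \<in> set_pmf \<Theta>"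
  shows "fits (shift_names e N) (shift_name e z) (shift_name e \<omega>) t'"
proof -
  have "fn_dist \<Theta> \<subseteq> shift_names e N"
    using assms(1)
  proof cases
    case (snd a w D)
    then have "w \<in> N" using uses_atest_summands[OF assms(2)] by fastforce
    moreover have "fn_dist D \<subseteq> insert 0 (Suc ` N)" using fn_ins[OF snd(4)] assms(3)
      by (auto simp: fits_def)
    ultimately show ?thesis using snd by (auto simp: shift_names_def)
  qed (use assms(3) in \<open>auto simp: fits_def shift_names_def dest!: fn_ins fn_bouts fn_outs; blast\<close>)+
  then show ?thesis using assms(3,4) by (auto simp: fits_def shift_names_def shift_name_def
    fn_dist_def)
qed

lemma comm_finite: "comm A t \<pi> T e \<Theta> \<Longrightarrow> finite (set_pmf \<Theta>)"
  by (induction rule: comm.induct) (auto dest: fin_ins fin_outs fin_bouts)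

text \<open>\<open>K\<close> is the context of restrictions gathered around a configuration, and
  \<omega> is the number that the success channel \<open>\<omega>0\<close> has below them. The
  second clause fixes the object as \<omega> too, because a restricted object would leave the
  context in a bound output.\<close>

definition observing :: "name \<Rightarrow> name \<Rightarrow> (state \<Rightarrow> state) \<Rightarrow> bool" where
  "observing \<omega>0 \<omega> K \<longleftrightarrow> (\<forall>s. taus (K s) = map_pmf K ` taus s) \<and>
    (\<forall>s D. (\<omega>, \<omega>, D) \<in> outs s \<longrightarrow> succeeds \<omega>0 (K s)) \<and>
    (\<forall>s. succeeds \<omega>0 (K s) \<longrightarrow> (\<exists>b D. (\<omega>, b, D) \<in> outs s))"

lemma observing_id: "observing \<omega> \<omega> id"
  by (auto simp: observing_def succeeds_iff)

lemma observing_Res: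
  assumes "observing \<omega>0 \<omega> K"
  shows "observing \<omega>0 (Suc \<omega>) (K \<circ> Res)"
proof -
  have *: "(\<omega>, b, D) \<in> outs (Res s) \<longleftrightarrow> (\<exists>E. (Suc \<omega>, Suc b, E) \<in> outs s \<and> D = map_pmf Res E)"
    for b D s
    by auto
  show ?thesis
    using assms unfolding observing_def by (simp add: image_image map_pmf_comp comp_def del:
      outs.simps) (metis *)
qed

lemma observing_res:
  assumes "observing \<omega>0 \<omega> K" "x \<noteq> \<omega>"
  shows "observing \<omega>0 \<omega> (K \<circ> res x)"
proof -
  have 1: "(\<omega>, \<omega>, res_dist x D) \<in> outs (res x s)" if "(\<omega>, \<omega>, D) \<in> outs s" for D s
    using outs_res[OF that, of x] assms(2) by blast
  have 2: "\<exists>b D. (\<omega>, b, D) \<in> outs s" if "(\<omega>, b, D) \<in> outs (res x s)" for b D s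
  proof -
    obtain E where "(Suc \<omega>, Suc b, E) \<in> outs (ren_state (bind_name x) s)"
      using \<open>(\<omega>, b, D) \<in> outs (res x s)\<close> by (auto simp: res_def)
    then obtain c d F where "(c, d, F) \<in> outs s" "bind_name x c = Suc \<omega>"
      unfolding outs_ren[OF inj_bind_name] by auto
    then show ?thesis by (auto simp: bind_name_def split: if_splits)
  qed
  have 3: "taus (K (res x s)) = map_pmf (K \<circ> res x) ` taus s" for s
    using assms(1) by (simp add: observing_def taus_res image_image res_dist_def map_pmf_comp
      comp_def)
  show ?thesis unfolding observing_def using assms(1) 1 2 3 unfolding observing_def by (simp, metis)
qed

lemma observing_shift_name: "observing \<omega>0 \<omega> K \<Longrightarrow> observing \<omega>0 (shift_name e \<omega>) (K \<circ> shift_res e)"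
  by (cases e) (simp_all add: shift_name_def shift_res_def observing_Res)

text \<open>The success channel is outside \<open>N\<close>, so neither template nor tested state
  can signal on it. Until a leaf is reached, outcomes are thus determined by internal steps.\<close>

lemma observing_not_succeeds:
  assumes K: "observing \<omega>0 \<omega> K" and fit: "fits N z \<omega> t" and A: "uses_atest A N"
    "same_trans u (atest_state A z \<omega> h)"
  shows "\<not> succeeds \<omega>0 (K (config z j u t))"
proof
  assume "succeeds \<omega>0 (K (config z j u t))"
  then obtain b D where "(\<omega>, b, D) \<in> outs (config z j u t)" using K unfolding observing_def by blast
  then consider E where "(\<omega>, b, E) \<in> outs (Par (clock z j) u)" | E where "(\<omega>, b, E) \<in> outs t"
    unfolding config_def outs.simps(7)[of "Par (clock z j) u" t] by (auto simp del: outs.simps)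
  then show False
  proof cases
    case 1
    then obtain E where "(\<omega>, b, E) \<in> outs (atest_state A z \<omega> h)"
      using outs_clock_par[of \<omega> z] fit A(2) by (metis fits_def same_trans_def)
    then obtain \<pi> T where "(\<pi>, Snd \<omega> b T) \<in> summands A" unfolding atest_state_transitions by blast
    from uses_atest_summands[OF A(1) this] fit show False by (simp add: fits_def)
  next
    case 2
    with fn_outs[OF 2] fit show False by (auto simp: fits_def)
  qed
qed

lemma observing_leaf_succeeds:
  assumes "observing \<omega>0 \<omega> K"
  shows "succeeds \<omega>0 (K (config z j (Out \<omega> \<omega> P) t))"
proof -
  have "\<exists>D. (\<omega>, \<omega>, D) \<in> outs (config z j (Out \<omega> \<omega> P) t)"
    by (auto simp: config_def image_iff Bex_def)
  with assms show ?thesis unfolding observing_def by blast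
qed


section \<open>Runs of a template and outcomes of its instances\<close>

abbreviation coin :: "bool pmf" where "coin \<equiv> bernoulli_pmf (1 / 2)"

definition pre :: "path \<Rightarrow> path option pmf \<Rightarrow> path option pmf" where
  "pre \<pi> = map_pmf (map_option (append \<pi>))"

text \<open>The coin follows \<open>interp\<close>, where \<open>True\<close> selects the left
  component, whereas addresses in the left component begin with \<open>False\<close>.\<close>

definition mix :: "path option pmf \<Rightarrow> path option pmf \<Rightarrow> path option pmf" where
  "mix \<mu> \<nu> = bind_pmf coin (\<lambda>b. if b then pre [False] \<mu> else pre [True] \<nu>)"

text \<open>A run resolves all nondeterminism of template and tested state. It yields a distribution
  over leaf addresses, with \<open>None\<close> for getting stuck before a leaf. Neither the clock
  and success channels nor the rewards enter.\<close>

inductive run_ptest :: "ptest \<Rightarrow> state \<Rightarrow> path option pmf \<Rightarrow> bool"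
  and run_atest :: "atest \<Rightarrow> state \<Rightarrow> path option pmf \<Rightarrow> bool" where
  leaf: "run_ptest Leaf t (return_pmf (Some []))"
| mix: "run_ptest T t \<mu> \<Longrightarrow> run_ptest U t \<nu> \<Longrightarrow> run_ptest (Mix T U) t (mix \<mu> \<nu>)"
| act: "run_atest A t \<mu> \<Longrightarrow> run_ptest (Act A) t \<mu>"
| tau: "\<Delta> \<in> taus t \<Longrightarrow> (\<And>t'. t' \<in> set_pmf \<Delta> \<Longrightarrow> run_atest A t' (f t')) \<Longrightarrow> run_atest A t (bind_pmf \<Delta> f)"
| comm: "comm A t \<pi> T e \<Theta> \<Longrightarrow> (\<And>t'. t' \<in> set_pmf \<Theta> \<Longrightarrow> run_ptest T t' (f t')) \<Longrightarrow>
  run_atest A t (pre \<pi> (bind_pmf \<Theta> f))"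
| dead: "taus t = {} \<Longrightarrow> (\<nexists>\<pi> T e \<Theta>. comm A t \<pi> T e \<Theta>) \<Longrightarrow> run_atest A t (return_pmf None)"

abbreviation expectation :: "'a pmf \<Rightarrow> ('a \<Rightarrow> real) \<Rightarrow> real" where
  "expectation p f \<equiv> measure_pmf.expectation p f"

definition reward :: "(path \<Rightarrow> real) \<Rightarrow> path option pmf \<Rightarrow> real" where
  "reward h \<mu> = expectation \<mu> (case_option 0 h)"

section \<open>Expected rewards of runs\<close>

lemma expectation_bind:
  assumes "finite (set_pmf p)" "\<And>i. i \<in> set_pmf p \<Longrightarrow> finite (set_pmf (F i))"
  shows "expectation (bind_pmf p F) f = expectation p (\<lambda>i. expectation (F i) f)"
  using pmf_expectation_bind[OF assms(1), of F p f] assms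
  by (simp add: integral_measure_pmf[OF assms(1), of p])

lemma expectation_cong: "(\<And>i. i \<in> set_pmf p \<Longrightarrow> f i = g i) \<Longrightarrow> expectation p f = expectation p g"
  by (intro integral_cong_AE) (auto simp: AE_measure_pmf_iff)

lemma expectation_mono:
  assumes "finite (set_pmf p)" "\<And>i. i \<in> set_pmf p \<Longrightarrow> f i \<le> (g i :: real)"
  shows "expectation p f \<le> expectation p g"
  using assms by (intro integral_mono_AE) (auto simp: AE_measure_pmf_iff
    integrable_measure_pmf_finite)

lemma expectation_sum: "finite (set_pmf p) \<Longrightarrow> (\<Sum>s\<in>set_pmf p. pmf p s * f s) = expectation p f"
  by (simp add: integral_measure_pmf[of "set_pmf p"])

lemma reward_bind:
  "finite (set_pmf p) \<Longrightarrow> (\<And>i. i \<in> set_pmf p \<Longrightarrow> finite (set_pmf (F i))) \<Longrightarrow>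
    reward h (bind_pmf p F) = expectation p (\<lambda>i. reward h (F i))"
  unfolding reward_def by (rule expectation_bind)

lemma reward_pre: "reward h (pre \<pi> \<mu>) = reward (h \<circ> append \<pi>) \<mu>"
  unfolding reward_def pre_def integral_map_pmf
  by (rule expectation_cong) (simp split: option.split)

lemma finite_pre [simp]: "finite (set_pmf (pre \<pi> \<mu>)) \<longleftrightarrow> finite (set_pmf \<mu>)"
  unfolding pre_def set_map_pmf
  by (rule finite_image_iff, rule inj_on_subset[OF option.inj_map subset_UNIV]) (simp add: inj_def)

lemma reward_mix: "finite (set_pmf \<mu>) \<Longrightarrow> finite (set_pmf \<nu>) \<Longrightarrow>
    reward h (mix \<mu> \<nu>) = (reward (h \<circ> Cons False) \<mu> + reward (h \<circ> Cons True) \<nu>) / 2"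
  unfolding mix_def by (subst reward_bind) (auto simp: reward_pre comp_def field_simps)

lemma reward_return [simp]: "reward h (return_pmf None) = 0" "reward h (return_pmf (Some p)) = h p"
  by (simp_all add: reward_def)

lemma finite_mix [simp]: "finite (set_pmf \<mu>) \<Longrightarrow> finite (set_pmf \<nu>) \<Longrightarrow> finite (set_pmf (mix \<mu> \<nu>))"
  by (simp add: mix_def)

lemma run_finite: "run_ptest T t \<mu> \<Longrightarrow> finite (set_pmf \<mu>)" "run_atest A t \<mu> \<Longrightarrow> finite (set_pmf \<mu>)"
  by (induction rule: run_ptest_run_atest.inducts) (auto dest: fin_taus comm_finite)

text \<open>Only internal steps of the tested state can precede the deadlock, and an average of
  point distributions at \<open>None\<close> is again one.\<close>

lemma run_atest_Stop: "run_atest Stop t \<nu> \<Longrightarrow> \<nu> = return_pmf None"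
proof -
  have "run_ptest T t \<mu> \<Longrightarrow> True" "run_atest A t \<nu> \<Longrightarrow> A = Stop \<longrightarrow> \<nu> = return_pmf None" for T A t \<mu> \<nu>
  proof (induction rule: run_ptest_run_atest.inducts)
    case (tau \<Delta> t A f)
    then show ?case by (auto simp: map_pmf_const[symmetric] map_pmf_def cong: bind_pmf_cong)
  next
    case (comm A t \<pi> T e \<Theta> f)
    have False if "comm Stop t \<pi> T e \<Theta>" using that by cases auto
    with comm show ?case by blast
  qed auto
  then show "run_atest Stop t \<nu> \<Longrightarrow> \<nu> = return_pmf None" by blast
qed

text \<open>Invariant for the induction on outcomes. It quantifies over all ways to read the state
  as a configuration, because the successors are read with a new context, template and
  clock.\<close>

definition realized :: "name \<Rightarrow> state \<Rightarrow> real \<Rightarrow> bool" where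
  "realized \<omega>0 s r \<longleftrightarrow> outcome_state \<omega>0 s r \<and> (\<forall>K \<omega> z j u t N A h. s = K (config z j u t) \<longrightarrow>
    observing \<omega>0 \<omega> K \<longrightarrow>
    fits N z \<omega> t \<longrightarrow> uses_atest A N \<longrightarrow> depth_atest A \<le> j \<longrightarrow> same_trans u (atest_state A z \<omega> h) \<longrightarrow> (\<forall>p.
      0 \<le> h p \<and> h p \<le> 1) \<longrightarrow>
    (\<exists>\<nu>. run_atest A t \<nu> \<and> r = reward h \<nu>))"

lemma same_trans_refl [simp]: "same_trans s s"
  by (simp add: same_trans_def)

lemma real_of_Prob: "0 < r \<Longrightarrow> r \<le> 1 \<Longrightarrow> real_of_prob (Prob r) = r"
  by (simp add: Prob_inverse)

lemma outcome_state_succeeds: "outcome_state \<omega> s r \<Longrightarrow> succeeds \<omega> s \<Longrightarrow> r = 1"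
  by (cases rule: outcome_state.cases) auto

text \<open>Extends the invariant from states to the probabilistic layer: an outcome averages over
  the states of the test, and this average is followed through each \<open>Mix\<close> down to
  leaves and actions.\<close>

lemma run_of_outcomeP:
  assumes K: "observing \<omega>0 \<omega> K" and fit: "fits N z \<omega> t"
  shows "implements T z \<omega> h U \<Longrightarrow> uses_ptest T N \<Longrightarrow> depth_ptest T \<le> j \<Longrightarrow> (\<forall>p. 0 \<le> h p \<and> h p \<le> 1) \<Longrightarrow>
    (\<And>u. u \<in> set_pmf U \<Longrightarrow> realized \<omega>0 (K (config z j u t)) (p u)) \<Longrightarrow>
    finite (set_pmf U) \<and> (\<exists>\<nu>. run_ptest T t \<nu> \<and> expectation U p = reward h \<nu>)"
proof (induction T arbitrary: U h rule: ptest.induct[where ?P2.0 = "\<lambda>_. True"])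
  case Leaf
  \<comment> \<open>The failing component of a leaf is itself a configuration, that of the template
    \<open>Stop\<close>, whose runs all have reward 0.\<close>
  have zero: "p Zero = 0" if "Zero \<in> set_pmf U"
  proof -
    have "\<exists>\<nu>. run_atest Stop t \<nu> \<and> p Zero = reward h \<nu>"
      using Leaf.prems(5)[OF that] K fit Leaf.prems(4) unfolding realized_def
      by (elim conjE allE[of _ K] allE[of _ \<omega>] allE[of _ z] allE[of _ j] allE[of _ Zero] allE[of _
        t] allE[of _ N] allE[of _ Stop] allE[of _ h]) simp
    then show ?thesis by (auto dest: run_atest_Stop)
  qed
  have one: "p (Out \<omega> \<omega> (Emb Zero)) = 1" if "Out \<omega> \<omega> (Emb Zero) \<in> set_pmf U"
    using Leaf.prems(5)[OF that] observing_leaf_succeeds[OF K] unfolding realized_def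
      by (auto dest: outcome_state_succeeds)
  have U: "U = interp (leaf_proc \<omega> (h []))" using Leaf.prems(1) by (simp add: implements_def)
  have fU: "finite (set_pmf U)" unfolding U by (rule finite_interp)
  have "expectation U p = h []"
  proof (cases "h [] \<le> 0")
    case True
    then have "U = return_pmf Zero" "h [] = 0" using U Leaf.prems(4)[rule_format, of "[]"]
      by (auto simp: leaf_proc_def)
    with zero show ?thesis by simp
  next
    case False
    then have h: "0 < h []" "h [] \<le> 1" using Leaf.prems(4)[rule_format, of "[]"] by auto
    define V where "V b = return_pmf (if b then Out \<omega> \<omega> (Emb Zero) else Zero)" for b
    have UV: "U = bind_pmf (bernoulli_pmf (h [])) V"
      using U False h by (auto simp: leaf_proc_def real_of_Prob V_def intro!: bind_pmf_cong)
    have "expectation U p = expectation (bernoulli_pmf (h [])) (\<lambda>b. expectation (V b) p)"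
      unfolding UV by (rule expectation_bind) (auto simp: V_def)
    also have "\<dots> = expectation (bernoulli_pmf (h [])) (\<lambda>b. if b then 1 else 0)"
    proof (rule expectation_cong)
      fix b assume b: "b \<in> set_pmf (bernoulli_pmf (h []))"
      have "(if b then Out \<omega> \<omega> (Emb Zero) else Zero) \<in> set_pmf U"
        unfolding UV set_bind_pmf by (rule UN_I[OF b]) (simp add: V_def)
      with one zero show "expectation (V b) p = (if b then 1 else 0)"
        by (cases b) (simp_all add: V_def)
    qed
    finally show ?thesis using h by simp
  qed
  with fU show ?case using run_ptest_run_atest.leaf[of t] by (intro conjI exI[of _
    "return_pmf (Some [])"]) simp_all
next
  case (Mix T1 T2)
  let ?U1 = "interp (ptest_proc T1 z \<omega> (h \<circ> Cons False))" and ?U2 =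
    "interp (ptest_proc T2 z \<omega> (h \<circ> Cons True))"
  have U: "U = bind_pmf coin (\<lambda>b. if b then ?U1 else ?U2)"
    using Mix.prems(1) by (simp add: implements_def real_of_Prob)
  have sub: "set_pmf ?U1 \<subseteq> set_pmf U" "set_pmf ?U2 \<subseteq> set_pmf U" unfolding U by auto
  have "finite (set_pmf ?U1) \<and> (\<exists>\<nu>. run_ptest T1 t \<nu> \<and> expectation ?U1 p =
    reward (h \<circ> Cons False) \<nu>)"
  proof (rule Mix.IH(1)[of "h \<circ> Cons False" ?U1])
    show "realized \<omega>0 (K (config z j u t)) (p u)" if "u \<in> set_pmf ?U1" for u
      using Mix.prems(5) sub that by blast
    show "implements T1 z \<omega> (h \<circ> Cons False) ?U1" unfolding implements_def
      by (rule disjI1) (rule refl)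
  qed (use Mix.prems(2-4) in simp_all)
  moreover have "finite (set_pmf ?U2) \<and> (\<exists>\<nu>. run_ptest T2 t \<nu> \<and> expectation ?U2 p =
    reward (h \<circ> Cons True) \<nu>)"
  proof (rule Mix.IH(2)[of "h \<circ> Cons True" ?U2])
    show "realized \<omega>0 (K (config z j u t)) (p u)" if "u \<in> set_pmf ?U2" for u
      using Mix.prems(5) sub that by blast
    show "implements T2 z \<omega> (h \<circ> Cons True) ?U2" unfolding implements_def
      by (rule disjI1) (rule refl)
  qed (use Mix.prems(2-4) in simp_all)
  ultimately obtain \<mu> \<nu> where *: "run_ptest T1 t \<mu>" "run_ptest T2 t \<nu>"
    "expectation ?U1 p = reward (h \<circ> Cons False) \<mu>"
      "expectation ?U2 p = reward (h \<circ> Cons True) \<nu>" "finite (set_pmf ?U1)" "finite (set_pmf ?U2)"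
        by blast
  have "expectation U p = expectation coin (\<lambda>b. expectation (if b then ?U1 else ?U2) p)"
    unfolding U by (rule expectation_bind) (use * in auto)
  also have "\<dots> = reward h (mix \<mu> \<nu>)"
    using * run_finite(1) by (simp add: reward_mix field_simps)
  finally show ?case using * U by (auto intro: run_ptest_run_atest.mix)
next
  case (Act A)
  then obtain u where u: "U = return_pmf u" "same_trans u (atest_state A z \<omega> h)"
    by (auto simp: implements_def)
  then have "realized \<omega>0 (K (config z j u t)) (p u)" using Act.prems(5) by simp
  with K fit Act.prems u have "\<exists>\<nu>. run_atest A t \<nu> \<and> p u = reward h \<nu>" unfolding realized_def
    by (elim conjE allE[of _ K] allE[of _ \<omega>] allE[of _ z] allE[of _ j] allE[of _ u] allE[of _ t]
      allE[of _ N] allE[of _ A] allE[of _ h]) simp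
  with u show ?case by (auto intro: run_ptest_run_atest.act)
qed simp_all

lemma finite_implements: "implements T z \<omega> h U \<Longrightarrow> finite (set_pmf U)"
  by (auto simp: implements_def finite_interp)

lemma finite_config_dist [simp]: "finite (set_pmf U) \<Longrightarrow> finite (set_pmf D) \<Longrightarrow>
  finite (set_pmf (config_dist z j U D))"
  by (simp add: config_dist_def)

text \<open>Averages over the tested side outside and over the test inside, the order in which runs
  are composed.\<close>

lemma config_dist_bind: "config_dist z j U \<Theta> = bind_pmf \<Theta> (\<lambda>t. map_pmf (\<lambda>u. config z j u t) U)"
proof -
  have "config_dist z j U \<Theta> = bind_pmf U (\<lambda>u. bind_pmf \<Theta> (\<lambda>t. return_pmf (config z j u t)))"
    by (simp add: config_dist_def par_dist_def pair_pmf_def config_def map_bind_pmf bind_map_pmf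
      bind_return_pmf bind_assoc_pmf)
  also have "\<dots> = bind_pmf \<Theta> (\<lambda>t. bind_pmf U (\<lambda>u. return_pmf (config z j u t)))"
    by (rule bind_commute_pmf)
  finally show ?thesis by (simp add: map_pmf_def)
qed

text \<open>Each internal step is classified, and the runs found for the successors are joined by
  the corresponding rule. The restriction of a private name moves from the configuration into the
  context \<open>K\<close>.\<close>

lemma realized_if_outcome: "outcome_state \<omega>0 s r \<Longrightarrow> realized \<omega>0 s r"
  and "outcome_dist \<omega>0 \<Delta> r \<Longrightarrow> \<exists>p. (\<forall>s\<in>set_pmf \<Delta>. realized \<omega>0 s (p s)) \<and> r = (\<Sum>s\<in>set_pmf \<Delta>.
    pmf \<Delta> s * p s)"
proof (induction rule: outcome_state_outcome_dist.inducts)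
  case (success s)
  then show ?case unfolding realized_def
    by (auto intro: outcome_state_outcome_dist.success dest: observing_not_succeeds)
next
  case (step s \<Delta> r)
  show ?case unfolding realized_def
  proof (intro conjI allI impI)
    have tr: "late_trans s Tau \<Delta>" using step by blast
    show "outcome_state \<omega>0 s r" using step by (blast intro: outcome_state_outcome_dist.step)
    fix K \<omega> z j u t N A h
    assume s: "s = K (config z j u t)" and K: "observing \<omega>0 \<omega> K" and fit: "fits N z \<omega> t" and A:
      "uses_atest A N" "depth_atest A \<le> j" "same_trans u (atest_state A z \<omega> h)"
      and h: "\<forall>p. 0 \<le> h p \<and> h p \<le> 1"
    from step obtain p where p: "\<And>s. s \<in> set_pmf \<Delta> \<Longrightarrow> realized \<omega>0 s (p s)"
      "r = (\<Sum>s\<in>set_pmf \<Delta>. pmf \<Delta> s * p s)" by blast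
    have "\<Delta> \<in> map_pmf K ` taus (config z j u t)"
      using tr K unfolding s late_trans_Tau_iff observing_def by blast
    then obtain X where X: "\<Delta> = map_pmf K X" "X \<in> taus (config z j u t)" by blast
    have fin: "finite (set_pmf \<Delta>)" using X fin_taus by simp
    have "r = expectation \<Delta> p" using p(2) expectation_sum[OF fin] by simp
    then have r: "r = expectation X (p \<circ> K)" by (simp add: X(1) comp_def)
    from X(2) fit A show "\<exists>\<nu>. run_atest A t \<nu> \<and> r = reward h \<nu>"
    proof (cases rule: config_step_cases)
      case (tau \<Theta>)
      have XT: "X = map_pmf (config z j u) \<Theta>" unfolding tau(2) config_dist_bind
        by (simp add: map_pmf_def[of _ \<Theta>])
      have "\<exists>\<nu>. run_atest A t' \<nu> \<and> p (K (config z j u t')) = reward h \<nu>" if "t' \<in> set_pmf \<Theta>" for t'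
      proof -
        have "realized \<omega>0 (K (config z j u t')) (p (K (config z j u t')))" using p(1) X XT that
          by simp
        moreover have "fits N z \<omega> t'" using fit fn_taus[OF tau(1)] that
          by (auto simp: fits_def fn_dist_def)
        ultimately show ?thesis using K A h unfolding realized_def
          by (elim conjE allE[of _ K] allE[of _ \<omega>] allE[of _ z] allE[of _ j] allE[of _ u] allE[of _
            t'] allE[of _ N] allE[of _ A] allE[of _ h]) simp
      qed
      then obtain f where f: "\<And>t'. t' \<in> set_pmf \<Theta> \<Longrightarrow> run_atest A t' (f t') \<and>
        p (K (config z j u t')) = reward h (f t')" by metis
      have "reward h (bind_pmf \<Theta> f) = expectation \<Theta> (\<lambda>t'. reward h (f t'))"
        by (rule reward_bind[OF fin_taus[OF tau(1)]]) (use f run_finite in blast)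
      also have "\<dots> = r" unfolding r XT using f by (auto intro!: expectation_cong)
      finally show ?thesis using run_ptest_run_atest.tau[OF tau(1), of A f] f by (intro exI[of _
        "bind_pmf \<Theta> f"]) simp
    next
      case (comm \<pi> T e \<Theta> U i)
      let ?K = "K \<circ> shift_res e"
      let ?cfg = "\<lambda>u t. config (shift_name e z) i u t"
      have XT: "X = bind_pmf \<Theta> (\<lambda>t. map_pmf (\<lambda>u. shift_res e (?cfg u t)) U)"
        unfolding comm(4) config_dist_bind by (simp add: map_bind_pmf map_pmf_comp)
      have finT: "finite (set_pmf \<Theta>)" by (rule comm_finite[OF comm(1)])
      have "\<exists>\<nu>. run_ptest T t' \<nu> \<and> expectation U (\<lambda>u. p (?K (?cfg u t'))) =
        reward (h \<circ> append \<pi>) \<nu>" if t': "t' \<in> set_pmf \<Theta>" for t'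
      proof -
        have "finite (set_pmf U) \<and> (\<exists>\<nu>. run_ptest T t' \<nu> \<and> expectation U (\<lambda>u. p (?K (?cfg u t'))) =
          reward (h \<circ> append \<pi>) \<nu>)"
        proof (rule run_of_outcomeP[OF observing_shift_name[OF K] comm_fits[OF comm(1) A(1) fit
          t']])
          show "uses_ptest T (shift_names e N)" by (rule comm_uses_ptest[OF comm(1) A(1)])
          show "realized \<omega>0 ((K \<circ> shift_res e) (?cfg u t')) (p (?K (?cfg u t')))" if
            "u \<in> set_pmf U" for u
            using p(1) t' that unfolding X(1) XT by force
        qed (use comm h in auto)
        then show ?thesis by blast
      qed
      then obtain f where f: "\<And>t'. t' \<in> set_pmf \<Theta> \<Longrightarrow> run_ptest T t' (f t') \<and>
          expectation U (\<lambda>u. p (?K (?cfg u t'))) = reward (h \<circ> append \<pi>) (f t')" by metis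
      have "reward h (pre \<pi> (bind_pmf \<Theta> f)) = expectation \<Theta> (\<lambda>t'. reward (h \<circ> append \<pi>) (f t'))"
        unfolding reward_pre by (rule reward_bind[OF finT]) (use f run_finite in blast)
      also have "\<dots> = expectation \<Theta> (\<lambda>t'. expectation U (\<lambda>u. p (?K (?cfg u t'))))"
        using f by (auto intro!: expectation_cong)
      also have "\<dots> = r" unfolding r XT
        by (subst expectation_bind[OF finT]) (use finite_implements[OF comm(2)] in auto)
      finally show ?thesis using run_ptest_run_atest.comm[OF comm(1), of f] f by (intro exI[of _
        "pre \<pi> (bind_pmf \<Theta> f)"]) simp
    qed
  qed
next
  case (fail s)
  show ?case unfolding realized_def
  proof (intro conjI allI impI)
    show "outcome_state \<omega>0 s 0" by (rule outcome_state_outcome_dist.fail[OF fail])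
    fix K \<omega> z j u t N A h
    assume s: "s = K (config z j u t)" and K: "observing \<omega>0 \<omega> K" and fit: "fits N z \<omega> t" and A:
      "uses_atest A N" "depth_atest A \<le> j" "same_trans u (atest_state A z \<omega> h)"
    have no: "taus (config z j u t) = {}" using fail(2) K
      unfolding s late_trans_Tau_iff observing_def by auto
    have "taus t = {}" using no config_tau_step by blast
    moreover have "\<nexists>\<pi> T e \<Theta>. comm A t \<pi> T e \<Theta>" using no config_comm_step[OF _ fit A]
      by (metis empty_iff)
    ultimately show "\<exists>\<nu>. run_atest A t \<nu> \<and> 0 = reward h \<nu>" by (intro exI[of _
      "return_pmf None"]) (simp add: run_ptest_run_atest.dead)
  qed
next
  case (average \<Delta> p)
  then show ?case by blast
qed

text \<open>Internal steps decrease the size, so every computation ends.\<close>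

lemma exists_outcome: "\<exists>r. outcome_state \<omega> s r"
proof (induction "size s" arbitrary: s rule: less_induct)
  case less
  consider "succeeds \<omega> s" | "\<not> succeeds \<omega> s" "taus s = {}" | \<Delta> where "\<not> succeeds \<omega> s" "\<Delta> \<in> taus s"
    by blast
  then show ?case
  proof cases
    case 1 then show ?thesis by (blast intro: outcome_state_outcome_dist.success)
  next
    case 2 then show ?thesis using outcome_state_outcome_dist.fail late_trans_Tau_iff
      by (metis empty_iff)
  next
    case (3 \<Delta>)
    have "\<forall>s'\<in>set_pmf \<Delta>. \<exists>r. outcome_state \<omega> s' r" using less size_taus[OF 3(2)] by blast
    then obtain p where "\<And>s'. s' \<in> set_pmf \<Delta> \<Longrightarrow> outcome_state \<omega> s' (p s')" by metis
    then have "outcome_dist \<omega> \<Delta> (\<Sum>s\<in>set_pmf \<Delta>. pmf \<Delta> s * p s)"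
      by (rule outcome_state_outcome_dist.average)
    with 3 show ?thesis using outcome_state_outcome_dist.step late_trans_Tau_iff by blast
  qed
qed

lemma outcome_dist_return: "outcome_state \<omega> s r \<Longrightarrow> outcome_dist \<omega> (return_pmf s) r"
  using outcome_state_outcome_dist.average[of "return_pmf s" \<omega> "\<lambda>_. r"] by simp

lemma outcome_distE:
  assumes "outcome_dist \<omega> \<Delta> r" "finite (set_pmf \<Delta>)"
  obtains p where "\<And>s. s \<in> set_pmf \<Delta> \<Longrightarrow> outcome_state \<omega> s (p s)" "r = expectation \<Delta> p"
  using assms by (auto simp: outcome_dist.simps[of \<omega> \<Delta>] expectation_sum)

lemma outcome_distI:
  assumes "\<And>s. s \<in> set_pmf \<Delta> \<Longrightarrow> outcome_state \<omega> s (p s)" "finite (set_pmf \<Delta>)"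
  shows "outcome_dist \<omega> \<Delta> (expectation \<Delta> p)"
  using outcome_state_outcome_dist.average[of \<Delta> \<omega> p] assms by (simp add: expectation_sum)

text \<open>An outcome assigns one value to each state, but a state may occur in several
  \<open>F i\<close> with different values. Selecting an extremal value for each state leaves only
  an inequality. The factor \<sigma> is later 1 or -1, which covers both directions.\<close>

lemma outcome_dist_bind:
  fixes \<sigma> :: real
  assumes q: "finite (set_pmf q)" and F: "\<And>i. i \<in> set_pmf q \<Longrightarrow> finite (set_pmf (F i))"
    and \<rho>: "\<And>i. i \<in> set_pmf q \<Longrightarrow> outcome_dist \<omega> (F i) (\<rho> i)"
  shows "\<exists>r. outcome_dist \<omega> (bind_pmf q F) r \<and> \<sigma> * r \<le> \<sigma> * expectation q \<rho>"
proof -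
  have "\<exists>p. (\<forall>s\<in>set_pmf (F i). outcome_state \<omega> s (p s)) \<and> \<rho> i = expectation (F i) p" if
    "i \<in> set_pmf q" for i
    using outcome_distE[OF \<rho>[OF that] F[OF that]] by metis
  then obtain p where p: "\<And>i s. i \<in> set_pmf q \<Longrightarrow> s \<in> set_pmf (F i) \<Longrightarrow> outcome_state \<omega> s (p i s)"
    "\<And>i. i \<in> set_pmf q \<Longrightarrow> \<rho> i = expectation (F i) (p i)" by metis
  define I where "I s = {i \<in> set_pmf q. s \<in> set_pmf (F i)}" for s
  have I: "finite (I s)" for s using q by (simp add: I_def)
  have "\<exists>i\<in>I s. \<forall>k\<in>I s. \<sigma> * p i s \<le> \<sigma> * p k s" if "I s \<noteq> {}" for s
    using finite_has_minimal2 arg_min_if_finite[OF I that, of "\<lambda>i. \<sigma> * p i s"] by (meson not_less)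
  \<comment> \<open>\<open>c s\<close> is a component in which the value at \<open>s\<close>,
    multiplied by \<sigma>, is smallest.\<close>
  then obtain c where c: "\<And>s. I s \<noteq> {} \<Longrightarrow> c s \<in> I s \<and> (\<forall>k\<in>I s. \<sigma> * p (c s) s \<le> \<sigma> * p k s)" by metis
  define p' where "p' s = p (c s) s" for s
  have out: "outcome_state \<omega> s (p' s)" if "s \<in> set_pmf (bind_pmf q F)" for s
  proof -
    have "I s \<noteq> {}" using that by (auto simp: I_def)
    from c[OF this] p(1) show ?thesis unfolding p'_def I_def by blast
  qed
  have "outcome_dist \<omega> (bind_pmf q F) (expectation (bind_pmf q F) p')"
    using out q F by (intro outcome_distI) auto
  moreover have "\<sigma> * expectation (bind_pmf q F) p' \<le> \<sigma> * expectation q \<rho>"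
  proof -
    have "\<sigma> * expectation (bind_pmf q F) p' = expectation q (\<lambda>i. expectation (F i) (\<lambda>s. \<sigma> * p' s))"
      using expectation_bind[OF q F, where f = p'] by simp
    also have "\<dots> \<le> expectation q (\<lambda>i. expectation (F i) (\<lambda>s. \<sigma> * p i s))"
    proof (intro expectation_mono q F)
      fix i s assume "i \<in> set_pmf q" "s \<in> set_pmf (F i)"
      then have "i \<in> I s" by (simp add: I_def)
      with c[of s] show "\<sigma> * p' s \<le> \<sigma> * p i s" unfolding p'_def by blast
    qed
    also have "\<dots> = \<sigma> * expectation q \<rho>"
      using p(2) by (simp add: expectation_cong[of q \<rho>])
    finally show ?thesis .
  qed
  ultimately show ?thesis by blast
qed

text \<open>This direction yields only an inequality: a run may resolve equal configurations
  differently, for instance in the two parts of a \<open>Mix\<close>, while an outcome may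
  not.\<close>

lemma outcome_of_run:
  fixes \<sigma> :: real
  shows "run_ptest T t \<nu> \<Longrightarrow> (\<And>K \<omega> z j U N h. observing \<omega>0 \<omega> K \<Longrightarrow> fits N z \<omega> t \<Longrightarrow> uses_ptest T N \<Longrightarrow>
    depth_ptest T \<le> j \<Longrightarrow>
      implements T z \<omega> h U \<Longrightarrow> (\<forall>p. 0 \<le> h p \<and> h p \<le> 1) \<Longrightarrow>
      \<exists>r. outcome_dist \<omega>0 (map_pmf (\<lambda>u. K (config z j u t)) U) r \<and> \<sigma> * r \<le> \<sigma> * reward h \<nu>)"
    and "run_atest A t \<nu> \<Longrightarrow> (\<And>K \<omega> z j u N h. observing \<omega>0 \<omega> K \<Longrightarrow> fits N z \<omega> t \<Longrightarrow> uses_atest A N \<Longrightarrow>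
      depth_atest A \<le> j \<Longrightarrow>
      same_trans u (atest_state A z \<omega> h) \<Longrightarrow> (\<forall>p. 0 \<le> h p \<and> h p \<le> 1) \<Longrightarrow>
      \<exists>r. outcome_state \<omega>0 (K (config z j u t)) r \<and> \<sigma> * r \<le> \<sigma> * reward h \<nu>)"
proof (induction rule: run_ptest_run_atest.inducts)
  case (leaf t)
  let ?F = "\<lambda>u. K (config z j u t)"
  have U: "U = interp (leaf_proc \<omega> (h []))" using leaf.prems by (simp add: implements_def)
  have zero: "outcome_state \<omega>0 (?F Zero) 0"
  proof -
    obtain r where r: "outcome_state \<omega>0 (?F Zero) r" using exists_outcome by blast
    have "\<exists>\<nu>. run_atest Stop t \<nu> \<and> r = reward h \<nu>"
      using realized_if_outcome[OF r] leaf.prems unfolding realized_def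
      by (elim conjE allE[of _ K] allE[of _ \<omega>] allE[of _ z] allE[of _ j] allE[of _ Zero] allE[of _
        t] allE[of _ N] allE[of _ Stop] allE[of _ h]) simp
    with r show ?thesis by (auto dest: run_atest_Stop)
  qed
  have one: "outcome_state \<omega>0 (?F (Out \<omega> \<omega> (Emb Zero))) 1"
    by (rule outcome_state_outcome_dist.success) (rule observing_leaf_succeeds[OF leaf.prems(1)])
  show ?case
  proof (cases "h [] \<le> 0")
    case True
    then have "U = return_pmf Zero" "h [] = 0" using U leaf.prems(6)[rule_format, of "[]"]
      by (auto simp: leaf_proc_def)
    with zero show ?thesis by (auto intro!: exI[of _ 0] outcome_dist_return)
  next
    case False
    then have h: "0 < h []" "h [] \<le> 1" using leaf.prems(6)[rule_format, of "[]"] by auto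
    let ?q = "bernoulli_pmf (h [])"
    let ?G = "\<lambda>b. return_pmf (?F (if b then Out \<omega> \<omega> (Emb Zero) else Zero))"
    have "\<exists>r. outcome_dist \<omega>0 (bind_pmf ?q ?G) r \<and> \<sigma> * r \<le> \<sigma> * expectation ?q (\<lambda>b.
      if b then 1 else 0)"
      by (rule outcome_dist_bind) (use zero one in \<open>auto intro!: outcome_dist_return\<close>)
    moreover have "map_pmf ?F U = bind_pmf ?q ?G"
      using U False h by (auto simp: leaf_proc_def real_of_Prob map_bind_pmf intro!: bind_pmf_cong)
    ultimately show ?thesis using h by simp
  qed
next
  case (mix T t \<mu> T' \<nu>)
  note prems = mix.prems
  let ?F = "\<lambda>u. K (config z j u t)"
  let ?U1 = "interp (ptest_proc T z \<omega> (h \<circ> Cons False))" and ?U2 =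
    "interp (ptest_proc T' z \<omega> (h \<circ> Cons True))"
  have U: "U = bind_pmf coin (\<lambda>b. if b then ?U1 else ?U2)"
    using prems(5) by (simp add: implements_def real_of_Prob)
  have "\<exists>r. outcome_dist \<omega>0 (map_pmf ?F ?U1) r \<and> \<sigma> * r \<le> \<sigma> * reward (h \<circ> Cons False) \<mu>"
    by (rule mix.IH(1)) (use prems in \<open>auto simp: implements_def\<close>)
  moreover have "\<exists>r. outcome_dist \<omega>0 (map_pmf ?F ?U2) r \<and> \<sigma> * r \<le> \<sigma> * reward (h \<circ> Cons True) \<nu>"
    by (rule mix.IH(2)) (use prems in \<open>auto simp: implements_def\<close>)
  ultimately obtain r1 r2 where r1: "outcome_dist \<omega>0 (map_pmf ?F ?U1) r1"
    "\<sigma> * r1 \<le> \<sigma> * reward (h \<circ> Cons False) \<mu>"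
    and r2: "outcome_dist \<omega>0 (map_pmf ?F ?U2) r2" "\<sigma> * r2 \<le> \<sigma> * reward (h \<circ> Cons True) \<nu>" by blast
  have "\<exists>r. outcome_dist \<omega>0 (bind_pmf coin (\<lambda>b. map_pmf ?F (if b then ?U1 else ?U2))) r \<and>
      \<sigma> * r \<le> \<sigma> * expectation coin (\<lambda>b. if b then r1 else r2)"
    by (rule outcome_dist_bind) (use r1 r2 in \<open>auto simp: finite_interp\<close>)
  moreover have "\<sigma> * expectation coin (\<lambda>b. if b then r1 else r2) \<le> \<sigma> * reward h (mix \<mu> \<nu>)"
    using r1(2) r2(2) mix.hyps run_finite(1) by (simp add: reward_mix field_simps)
  ultimately show ?case unfolding U map_bind_pmf by (auto intro: order_trans)
next
  case (act A t \<mu>)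
  from act.prems(5) obtain u where u: "U = return_pmf u" "same_trans u (atest_state A z \<omega> h)"
    by (auto simp: implements_def)
  have "\<exists>r. outcome_state \<omega>0 (K (config z j u t)) r \<and> \<sigma> * r \<le> \<sigma> * reward h \<mu>"
    by (rule act.IH) (use act.prems u in simp_all)
  with u show ?case by (auto intro: outcome_dist_return)
next
  case (tau \<Delta> t A f)
  note K = tau.prems(1) and fit = tau.prems(2) and A = tau.prems(3-5) and h = tau.prems(6)
  have fin: "finite (set_pmf \<Delta>)" by (rule fin_taus[OF tau.hyps(1)])
  have "\<exists>r. outcome_state \<omega>0 (K (config z j u t')) r \<and> \<sigma> * r \<le> \<sigma> * reward h (f t')" if
    "t' \<in> set_pmf \<Delta>" for t'
  proof (rule tau.IH[OF that K _ A h])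
    show "fits N z \<omega> t'" using fit fn_taus[OF tau.hyps(1)] that by (auto simp: fits_def fn_dist_def)
  qed
  then obtain \<rho> where \<rho>: "\<And>t'. t' \<in> set_pmf \<Delta> \<Longrightarrow> outcome_state \<omega>0 (K (config z j u t')) (\<rho> t') \<and>
    \<sigma> * \<rho> t' \<le> \<sigma> * reward h (f t')" by metis
  let ?X = "bind_pmf \<Delta> (\<lambda>t'. return_pmf (K (config z j u t')))"
  have "\<exists>r. outcome_dist \<omega>0 ?X r \<and> \<sigma> * r \<le> \<sigma> * expectation \<Delta> \<rho>"
    by (rule outcome_dist_bind[OF fin]) (use \<rho> in \<open>auto intro: outcome_dist_return\<close>)
  then obtain r where r: "outcome_dist \<omega>0 ?X r" "\<sigma> * r \<le> \<sigma> * expectation \<Delta> \<rho>" by blast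
  have "?X = map_pmf K (config_dist z j (return_pmf u) \<Delta>)"
    by (simp add: config_dist_bind map_bind_pmf)
  then have "late_trans (K (config z j u t)) Tau ?X"
    using K config_tau_step[OF tau.hyps(1), of z j u] unfolding late_trans_Tau_iff observing_def
      by auto
  then have "outcome_state \<omega>0 (K (config z j u t)) r"
    using r(1) observing_not_succeeds[OF K fit A(1,3)] by (intro outcome_state_outcome_dist.step)
  moreover have "\<sigma> * expectation \<Delta> \<rho> \<le> \<sigma> * reward h (bind_pmf \<Delta> f)"
  proof -
    have "\<sigma> * expectation \<Delta> \<rho> = expectation \<Delta> (\<lambda>t. \<sigma> * \<rho> t)" by simp
    also have "\<dots> \<le> expectation \<Delta> (\<lambda>t. \<sigma> * reward h (f t))"
      by (rule expectation_mono[OF fin]) (use \<rho> in blast)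
    also have "\<dots> = \<sigma> * reward h (bind_pmf \<Delta> f)"
      by (subst reward_bind[OF fin]) (use tau.hyps run_finite(2) in auto)
    finally show ?thesis .
  qed
  ultimately show ?case using r(2) by (auto intro: order_trans)
next
  case (comm A t \<pi> T e \<Theta> f)
  note K = comm.prems(1) and fit = comm.prems(2) and A = comm.prems(3-5) and h = comm.prems(6)
  have fin: "finite (set_pmf \<Theta>)" by (rule comm_finite[OF comm.hyps(1)])
  obtain U i where U: "implements T (shift_name e z) (shift_name e \<omega>) (h \<circ> append \<pi>) U"
    "depth_ptest T \<le> i"
      "map_pmf (shift_res e) (config_dist (shift_name e z) i U \<Theta>) \<in> taus (config z j u t)"
    using config_comm_step[OF comm.hyps(1) fit A] by blast
  let ?G = "\<lambda>t'. map_pmf (\<lambda>u. (K \<circ> shift_res e) (config (shift_name e z) i u t')) U"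
  have "\<exists>r. outcome_dist \<omega>0 (?G t') r \<and> \<sigma> * r \<le> \<sigma> * reward (h \<circ> append \<pi>) (f t')" if t':
    "t' \<in> set_pmf \<Theta>" for t'
    by (rule comm.IH[OF t' observing_shift_name[OF K] comm_fits[OF comm.hyps(1) A(1) fit t']
      comm_uses_ptest[OF comm.hyps(1) A(1)] U(2,1)])
      (use h in simp)
  then obtain \<rho> where \<rho>: "\<And>t'. t' \<in> set_pmf \<Theta> \<Longrightarrow> outcome_dist \<omega>0 (?G t') (\<rho> t') \<and>
    \<sigma> * \<rho> t' \<le> \<sigma> * reward (h \<circ> append \<pi>) (f t')" by metis
  have "\<exists>r. outcome_dist \<omega>0 (bind_pmf \<Theta> ?G) r \<and> \<sigma> * r \<le> \<sigma> * expectation \<Theta> \<rho>"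
    by (rule outcome_dist_bind[OF fin]) (use \<rho> finite_implements[OF U(1)] in auto)
  then obtain r where r: "outcome_dist \<omega>0 (bind_pmf \<Theta> ?G) r" "\<sigma> * r \<le> \<sigma> * expectation \<Theta> \<rho>" by blast
  have "bind_pmf \<Theta> ?G = map_pmf K (map_pmf (shift_res e) (config_dist (shift_name e z) i U \<Theta>))"
    by (simp add: config_dist_bind map_bind_pmf map_pmf_comp)
  then have "late_trans (K (config z j u t)) Tau (bind_pmf \<Theta> ?G)"
    using K U(3) unfolding late_trans_Tau_iff observing_def by auto
  then have "outcome_state \<omega>0 (K (config z j u t)) r"
    using r(1) observing_not_succeeds[OF K fit A(1,3)] by (intro outcome_state_outcome_dist.step)
  moreover have "\<sigma> * expectation \<Theta> \<rho> \<le> \<sigma> * reward h (pre \<pi> (bind_pmf \<Theta> f))"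
  proof -
    have "\<sigma> * expectation \<Theta> \<rho> = expectation \<Theta> (\<lambda>t. \<sigma> * \<rho> t)" by simp
    also have "\<dots> \<le> expectation \<Theta> (\<lambda>t. \<sigma> * reward (h \<circ> append \<pi>) (f t))"
      by (rule expectation_mono[OF fin]) (use \<rho> in blast)
    also have "\<dots> = \<sigma> * reward h (pre \<pi> (bind_pmf \<Theta> f))"
      unfolding reward_pre by (subst reward_bind[OF fin]) (use comm.hyps run_finite(1) in auto)
    finally show ?thesis .
  qed
  ultimately show ?case using r(2) by (auto intro: order_trans)
next
  case (dead t A)
  note K = dead.prems(1) and fit = dead.prems(2) and A = dead.prems(3-5)
  have "taus (config z j u t) = {}"
  proof (rule ccontr)
    assume "taus (config z j u t) \<noteq> {}"
    then obtain X where "X \<in> taus (config z j u t)" by blast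
    then show False using dead.hyps by (cases rule: config_step_cases[OF _ fit A]) auto
  qed
  then have "outcome_state \<omega>0 (K (config z j u t)) 0"
    using K observing_not_succeeds[OF K fit A(1,3)] by (intro outcome_state_outcome_dist.fail)
      (auto simp: late_trans_Tau_iff observing_def)
  then show ?case by (intro exI[of _ 0]) simp
qed


section \<open>From scalar to vector outcomes\<close>

lemma finite_summands: "finite (summands A)"
proof (induction A rule: atest.induct[where ?P1.0 = "\<lambda>_. True"])
  case (Plus A B)
  have "summands (Plus A B) = (\<lambda>(\<pi>, x). (False # \<pi>, x)) ` summands A \<union> (\<lambda>(\<pi>, x). (True # \<pi>,
    x)) ` summands B"
    by (auto simp: image_iff)
  with Plus show ?case by simp
qed simp_all

lemma finite_comm: "finite {(\<pi>, T, e, \<Theta>). comm A t \<pi> T e \<Theta>}"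
proof -
  define C where "C \<pi> x = (case x of
      Tick T \<Rightarrow> {(\<pi>, T, False, return_pmf t)}
    | Snd a w T \<Rightarrow> (\<lambda>(a, D). (\<pi>, T, False, ren_dist (inst w) D)) ` ins t
    | SndNew a T \<Rightarrow> (\<lambda>(a, D). (\<pi>, T, True, D)) ` ins t
    | RcvEq a b T \<Rightarrow> (\<lambda>(a, c, D). (\<pi> @ [False], Act (Tick T), False, D)) ` outs t \<union>
        (\<lambda>(a, c, D). (\<pi> @ [True], Act (Tick Leaf), False, D)) ` outs t \<union>
        (\<lambda>(a, D). (\<pi> @ [True], Act (Tick Leaf), True, D)) ` bouts t
    | RcvNew a ns T \<Rightarrow> (\<lambda>(a, c, D). (\<pi> @ [True], Act (Tick Leaf), False, D)) ` outs t \<union>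
        (\<lambda>(a, D). (\<pi> @ [False], Act (Tick T), True, D)) ` bouts t
    | _ \<Rightarrow> {})" for \<pi> x
  have "(\<pi>, T, e, \<Theta>) \<in> (\<Union>(\<pi>, x)\<in>summands A. C \<pi> x)" if "comm A t \<pi> T e \<Theta>" for \<pi> T e \<Theta>
    using that by cases (force simp: C_def simp del: map_pmf_comp)+
  then have "{(\<pi>, T, e, \<Theta>). comm A t \<pi> T e \<Theta>} \<subseteq> (\<Union>(\<pi>, x)\<in>summands A. C \<pi> x)" by auto
  moreover have "finite (C \<pi> x)" for \<pi> x
    unfolding C_def by (cases x) (simp_all add: finite_ins finite_outs finite_bouts)
  ultimately show ?thesis by (elim finite_subset) (auto intro!: finite_UN_I finite_summands)
qed

lemma size_summands: "(\<pi>, x) \<in> summands A \<Longrightarrow> size x \<le> size A"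
  by (induction A arbitrary: \<pi> rule: atest.induct[where ?P1.0 = "\<lambda>_. True"]) fastforce+

text \<open>Every communication makes the tested state smaller, except a tick, which makes the
  template smaller.\<close>

lemma comm_size:
  assumes "comm A t \<pi> T e \<Theta>" "t' \<in> set_pmf \<Theta>"
  shows "size t' < size t \<or> t' = t \<and> size T < size A"
  using assms(1)
proof cases
  case tick
  with assms(2) size_summands[OF tick(3)] show ?thesis by simp
qed (use assms(2) in \<open>auto dest: size_ins size_outs size_bouts\<close>)

text \<open>Resolutions matter only on the support, so they may be drawn from a finite product of
  finite sets.\<close>

lemma bind_pmf_restrict: "bind_pmf p f = bind_pmf p (restrict f (set_pmf p))"
  by (rule bind_pmf_cong) simp_all

text \<open>Lexicographic induction on the sizes of tested state and template; internal steps and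
  communications branch finitely.\<close>

lemma finite_runs: "finite {\<nu>. run_ptest T t \<nu>}"
proof (induction "size t" arbitrary: t T rule: less_induct)
  case (less t)
  note small = less.hyps
  show ?case
  proof (induction "size T" arbitrary: T rule: less_induct)
    case (less T)
    show ?case
    proof (cases T)
      case Leaf
      then have "{\<nu>. run_ptest T t \<nu>} \<subseteq> {return_pmf (Some [])}" by (auto elim: run_ptest.cases)
      then show ?thesis by (rule finite_subset) simp
    next
      case (Mix U V)
      then have "{\<nu>. run_ptest T t \<nu>} \<subseteq> (\<lambda>(\<mu>, \<nu>). mix \<mu> \<nu>) ` ({\<nu>. run_ptest U t \<nu>} \<times> {\<nu>.
        run_ptest V t \<nu>})"
        by (auto elim: run_ptest.cases)
      then show ?thesis by (rule finite_subset) (use Mix less in simp)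
    next
      case (Act A)
      let ?C = "{(\<pi>, T, e, \<Theta>). comm A t \<pi> T e \<Theta>}"
      let ?X = "(\<Union>\<Delta>\<in>taus t. bind_pmf \<Delta> ` PiE (set_pmf \<Delta>) (\<lambda>t'. {\<nu>. run_ptest (Act A) t' \<nu>}))"
      let ?Y = "(\<Union>(\<pi>, T, e, \<Theta>)\<in>?C. (\<lambda>f. pre \<pi> (bind_pmf \<Theta> f)) ` PiE (set_pmf \<Theta>) (\<lambda>t'. {\<nu>.
        run_ptest T t' \<nu>}))"
      have sub: "\<nu> \<in> ?X \<union> ?Y \<union> {return_pmf None}" if "run_atest A t \<nu>" for \<nu>
        using that
      proof cases
        case (tau \<Delta> f)
        then have "restrict f (set_pmf \<Delta>) \<in> PiE (set_pmf \<Delta>) (\<lambda>t'. {\<nu>. run_ptest (Act A) t' \<nu>})"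
          by (auto intro: run_ptest_run_atest.act)
        moreover have "\<nu> = bind_pmf \<Delta> (restrict f (set_pmf \<Delta>))" unfolding tau(1)
          by (rule bind_pmf_restrict)
        ultimately have "\<nu> \<in> bind_pmf \<Delta> ` PiE (set_pmf \<Delta>) (\<lambda>t'. {\<nu>. run_ptest (Act A) t' \<nu>})"
          by (intro image_eqI)
        then have "\<nu> \<in> ?X" by (rule UN_I[OF tau(2)])
        then show ?thesis by simp
      next
        case (comm \<pi> T e \<Theta> f)
        then have "restrict f (set_pmf \<Theta>) \<in> PiE (set_pmf \<Theta>) (\<lambda>t'. {\<nu>. run_ptest T t' \<nu>})" by auto
        moreover have "\<nu> = pre \<pi> (bind_pmf \<Theta> (restrict f (set_pmf \<Theta>)))" unfolding comm(1)
          using bind_pmf_restrict by metis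
        ultimately have "\<nu> \<in> (\<lambda>f. pre \<pi> (bind_pmf \<Theta> f)) ` PiE (set_pmf \<Theta>) (\<lambda>t'. {\<nu>.
          run_ptest T t' \<nu>})" by (intro image_eqI)
        moreover have "(\<pi>, T, e, \<Theta>) \<in> ?C" using comm(2) by simp
        ultimately have "\<nu> \<in> ?Y" by (intro UN_I[of "(\<pi>, T, e, \<Theta>)"]) simp_all
        then show ?thesis by simp
      qed simp
      have "run_ptest (Act A) t \<nu> \<Longrightarrow> run_atest A t \<nu>" for \<nu> by (auto elim: run_ptest.cases)
      then have "{\<nu>. run_ptest T t \<nu>} \<subseteq> ?X \<union> ?Y \<union> {return_pmf None}" unfolding Act
        by (intro subsetI sub) simp
      moreover have "finite ?X"
        by (intro finite_UN_I finite_taus finite_imageI finite_PiE) (auto intro: fin_taus small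
          size_taus)
      moreover have "finite ?Y"
      proof (intro finite_UN_I finite_comm)
        fix x assume "x \<in> ?C"
        then obtain \<pi> U e \<Theta> where x: "x = (\<pi>, U, e, \<Theta>)" and c: "comm A t \<pi> U e \<Theta>" by blast
        have "finite {\<nu>. run_ptest U t' \<nu>}" if "t' \<in> set_pmf \<Theta>" for t'
          using comm_size[OF c that] small less Act by auto
        then show "finite (case x of (\<pi>, T, e, \<Theta>) \<Rightarrow> (\<lambda>f.
          pre \<pi> (bind_pmf \<Theta> f)) ` PiE (set_pmf \<Theta>) (\<lambda>t'. {\<nu>. run_ptest T t' \<nu>}))"
          unfolding x prod.case by (intro finite_imageI finite_PiE comm_finite[OF c])
      qed
      ultimately show ?thesis by (meson finite.emptyI finite.insertI finite_UnI finite_subset)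
    qed
  qed
qed

text \<open>The weights are functions on the whole index type, pinned to 0 outside \<open>I\<close>,
  so that Tychonoff's theorem applies to the product topology.\<close>

lemma compact_simplex:
  assumes "finite I"
  shows "compact {w :: 'i \<Rightarrow> real. (\<forall>i. w i \<in> (if i \<in> I then {0..1} else {0})) \<and> sum w I = 1}"
proof -
  let ?K = "PiE UNIV (\<lambda>i. if i \<in> I then {0..1} else {0 :: real})"
  have "compactin (product_topology (\<lambda>i. euclidean) UNIV) ?K"
    by (subst compactin_PiE) auto
  then have "compact ?K" unfolding euclidean_product_topology by simp
  moreover have "closed {w :: 'i \<Rightarrow> real. sum w I = 1}"
    by (intro closed_Collect_eq continuous_intros continuous_on_sum
      continuous_on_product_coordinates)
  ultimately have "compact (?K \<inter> {w. sum w I = 1})" by (rule compact_Int_closed)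
  moreover have "?K \<inter> {w. sum w I = 1} = {w :: 'i \<Rightarrow> real. (\<forall>i.
    w i \<in> (if i \<in> I then {0..1} else {0})) \<and> sum w I = 1}"
    by (auto simp: PiE_def Pi_def)
  ultimately show ?thesis by simp
qed

text \<open>Bounds the objective after a step by a quadratic expression in the step, which avoids
  differentiating the positive part.\<close>

lemma pos_part_square: "(max 0 (d + x))\<^sup>2 \<le> (max 0 d + x :: real)\<^sup>2"
proof (cases "0 \<le> d")
  case True
  then show ?thesis by (auto simp: max_def)
next
  case False
  then show ?thesis by (auto simp: max_def intro!: power_mono)
qed

text \<open>A theorem of the alternative. The weights minimize the sum of squared excesses over
  \<open>c\<close>. At the minimum, the vector \<open>g\<close> of excesses defines a supporting
  hyperplane of the set of combinations; were it nonzero, a multiple of it would be an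
  \<open>h\<close> that violates the hypothesis.\<close>

lemma finite_minimax:
  fixes x :: "'i \<Rightarrow> 'p \<Rightarrow> real"
  assumes I: "finite I" "I \<noteq> {}" and P: "finite P"
    and h: "\<And>h. (\<forall>p. 0 \<le> h p \<and> h p \<le> 1) \<Longrightarrow> \<exists>i\<in>I. (\<Sum>p\<in>P. h p * x i p) \<le> (\<Sum>p\<in>P. h p * c p)"
  shows "\<exists>w. (\<forall>i\<in>I. 0 \<le> w i) \<and> sum w I = 1 \<and> (\<forall>p\<in>P. (\<Sum>i\<in>I. w i * x i p) \<le> c p)"
proof -
  define W where "W = {w :: 'i \<Rightarrow> real. (\<forall>i. w i \<in> (if i \<in> I then {0..1} else {0})) \<and> sum w I = 1}"
  define \<phi> where "\<phi> w = (\<Sum>p\<in>P. (max 0 ((\<Sum>i\<in>I. w i * x i p) - c p))\<^sup>2)" for w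
  obtain i0 where i0: "i0 \<in> I" using I(2) by blast
  have "(\<lambda>i. if i = i0 then 1 else 0) \<in> W" using i0 I(1) by (auto simp: W_def)
  then have "W \<noteq> {}" by blast
  moreover have "continuous_on W \<phi>" unfolding \<phi>_def
    by (intro continuous_intros continuous_on_sum continuous_on_subset[OF
      continuous_on_product_coordinates]) auto
  ultimately obtain w where w: "w \<in> W" and min: "\<And>v. v \<in> W \<Longrightarrow> \<phi> w \<le> \<phi> v"
    using continuous_attains_inf[of W \<phi>] compact_simplex[OF I(1)] unfolding W_def[symmetric]
      by blast
  define o' where "o' p = (\<Sum>i\<in>I. w i * x i p)" for p
  define g where "g p = max 0 (o' p - c p)" for p
  have wI: "0 \<le> w i" "w i \<le> 1" if "i \<in> I" for i using w that by (auto simp: W_def split: if_splits)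
  have w0: "w i = 0" if "i \<notin> I" for i using w that by (auto simp: W_def split: if_splits)
  have w1: "sum w I = 1" using w by (simp add: W_def)
  have \<phi>w: "\<phi> w = (\<Sum>p\<in>P. (g p)\<^sup>2)" by (simp add: \<phi>_def g_def o'_def)
  \<comment> \<open>First-order optimality: moving from the minimum towards the vertex
    \<open>i\<close> cannot decrease the objective.\<close>
  have step: "0 \<le> (\<Sum>p\<in>P. g p * (x i p - o' p))" if i: "i \<in> I" for i
  proof (rule ccontr)
    assume "\<not> 0 \<le> (\<Sum>p\<in>P. g p * (x i p - o' p))"
    then have neg: "(\<Sum>p\<in>P. g p * (x i p - o' p)) < 0" by simp
    define S where "S = (\<Sum>p\<in>P. g p * (x i p - o' p))"
    define Q where "Q = (\<Sum>p\<in>P. (x i p - o' p)\<^sup>2)"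
    have Q: "0 \<le> Q" unfolding Q_def by (intro sum_nonneg) simp
    \<comment> \<open>Short enough for the quadratic term \<open>\<epsilon> * Q\<close>, at most
      \<open>- S\<close>, to be outweighed by the linear term \<open>2 * S\<close>; the 1 added to
      \<open>Q\<close> avoids a division by 0.\<close>
    define \<epsilon> where "\<epsilon> = min 1 (- S / (Q + 1))"
    have S: "S < 0" using neg S_def by simp
    have \<epsilon>: "0 < \<epsilon>" "\<epsilon> \<le> 1" using S Q divide_pos_pos[of "- S" "Q + 1"] by (auto simp: \<epsilon>_def)
    define v where "v k = (1 - \<epsilon>) * w k + (if k = i then \<epsilon> else 0)" for k
    have vsum: "(\<Sum>k\<in>I. v k * y k) = (1 - \<epsilon>) * (\<Sum>k\<in>I. w k * y k) + \<epsilon> * y i" for y :: "'i \<Rightarrow> real"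
    proof -
      have "(\<Sum>k\<in>I. v k * y k) = (\<Sum>k\<in>I. (1 - \<epsilon>) * (w k * y k) + (if k = i then \<epsilon> * y i else 0))"
        by (rule sum.cong) (auto simp: v_def algebra_simps)
      then show ?thesis using I(1) i by (simp add: sum.distrib sum_distrib_left)
    qed
    have v1: "sum v I = 1" using vsum[of "\<lambda>_. 1"] w1 by simp
    have "v k \<in> (if k \<in> I then {0..1} else {0})" for k
    proof (cases "k \<in> I")
      case True
      have pos: "0 \<le> v l" if "l \<in> I" for l using \<epsilon> wI that by (simp add: v_def)
      have "v k \<le> sum v I" using True pos I(1) by (intro member_le_sum) auto
      with True pos v1 show ?thesis by simp
    next
      case False
      then show ?thesis using i w0 by (auto simp: v_def)
    qed
    then have "v \<in> W" using v1 by (simp add: W_def)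
    then have "\<phi> w \<le> \<phi> v" by (rule min)
    also have "\<phi> v = (\<Sum>p\<in>P. (max 0 ((o' p - c p) + \<epsilon> * (x i p - o' p)))\<^sup>2)"
      unfolding \<phi>_def vsum by (simp add: o'_def algebra_simps)
    also have "\<dots> \<le> (\<Sum>p\<in>P. (g p + \<epsilon> * (x i p - o' p))\<^sup>2)"
      unfolding g_def by (intro sum_mono pos_part_square)
    also have "\<dots> = \<phi> w + 2 * \<epsilon> * S + \<epsilon>\<^sup>2 * Q"
      unfolding \<phi>w S_def Q_def sum_distrib_left sum.distrib[symmetric]
      by (rule sum.cong) (auto simp: power2_eq_square algebra_simps)
    finally have "0 \<le> \<epsilon> * (2 * S + \<epsilon> * Q)" by (simp add: power2_eq_square algebra_simps)
    then have "0 \<le> 2 * S + \<epsilon> * Q" using \<epsilon> by (simp add: zero_le_mult_iff)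
    moreover have "\<epsilon> * Q \<le> - S"
    proof -
      have "\<epsilon> * Q \<le> (- S / (Q + 1)) * Q" using Q by (intro mult_right_mono) (simp_all add: \<epsilon>_def)
      also have "\<dots> \<le> - S" using S Q by (simp add: field_simps mult_nonpos_nonneg)
      finally show ?thesis .
    qed
    ultimately show False using S by linarith
  qed
  have "\<forall>p\<in>P. o' p \<le> c p"
  proof (rule ccontr)
    assume "\<not> (\<forall>p\<in>P. o' p \<le> c p)"
    then obtain p0 where p0: "p0 \<in> P" "0 < g p0" by (auto simp: g_def)
    define M where "M = (\<Sum>p\<in>P. g p)"
    have g0: "0 \<le> g p" for p by (simp add: g_def)
    have M: "g p \<le> M" if "p \<in> P" for p unfolding M_def using g0 P that by (intro member_le_sum) auto
    then have M0: "0 < M" using p0 by (meson order_less_le_trans)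
    \<comment> \<open>Dividing by the sum \<open>M\<close> brings the excesses into the unit
      interval.\<close>
    define h where "h p = (if p \<in> P then g p / M else 0)" for p
    have "\<forall>p. 0 \<le> h p \<and> h p \<le> 1" using g0 M M0 by (auto simp: h_def)
    from assms(4)[OF this] obtain i where i: "i \<in> I" "(\<Sum>p\<in>P. h p * x i p) \<le> (\<Sum>p\<in>P. h p * c p)"
      by blast
    have hg: "(\<Sum>p\<in>P. h p * y p) = (\<Sum>p\<in>P. g p * y p) / M" for y
      unfolding sum_divide_distrib by (rule sum.cong) (auto simp: h_def)
    have "(\<Sum>p\<in>P. g p * x i p) \<le> (\<Sum>p\<in>P. g p * c p)" using i(2) M0 unfolding hg
      by (simp add: divide_right_mono divide_le_cancel)
    moreover have "(\<Sum>p\<in>P. g p * o' p) \<le> (\<Sum>p\<in>P. g p * x i p)" using step[OF i(1)]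
      by (simp add: algebra_simps sum_subtractf)
    \<comment> \<open>Where \<open>g\<close> is positive it equals the difference of
      \<open>o'\<close> and \<open>c\<close>; elsewhere the summands of both sides vanish.\<close>
    moreover have "(\<Sum>p\<in>P. g p * o' p) = (\<Sum>p\<in>P. g p * c p) + (\<Sum>p\<in>P. (g p)\<^sup>2)"
      unfolding sum.distrib[symmetric] by (rule sum.cong) (auto simp: g_def max_def
        power2_eq_square algebra_simps)
    moreover have "0 < (\<Sum>p\<in>P. (g p)\<^sup>2)" using p0 P by (intro sum_pos2[of _ p0]) auto
    ultimately show False by linarith
  qed
  then show ?thesis using wI w1 by (intro exI[of _ w]) (auto simp: o'_def)
qed

text \<open>Only leaves are compared. The weight of \<open>None\<close> is left free, so a run may
  get stuck more often than its target.\<close>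

definition dominated :: "path option pmf \<Rightarrow> path option pmf \<Rightarrow> bool" where
  "dominated \<mu> \<nu> \<longleftrightarrow> (\<forall>p. pmf \<mu> (Some p) \<le> pmf \<nu> (Some p))"

lemma reward_sum:
  assumes "finite P" "finite (set_pmf \<mu>)" "\<And>p. Some p \<in> set_pmf \<mu> \<Longrightarrow> p \<in> P"
  shows "reward h \<mu> = (\<Sum>p\<in>P. h p * pmf \<mu> (Some p))"
proof -
  have "reward h \<mu> = (\<Sum>x\<in>insert None (Some ` P). pmf \<mu> x * case_option 0 h x)"
    unfolding reward_def using assms
    by (subst integral_measure_pmf[of "insert None (Some ` P)"]) (auto simp: not_None_eq image_iff
      split: option.splits)
  also have "\<dots> = (\<Sum>p\<in>P. h p * pmf \<mu> (Some p))"
    using assms(1) by (simp add: sum.reindex mult.commute)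
  finally show ?thesis .
qed

text \<open>The coordinates are the finitely many leaves that occur, the points are the members of
  \<open>S\<close>, and the weights found become a distribution over \<open>S\<close>.\<close>

lemma pmf_minimax:
  assumes "finite S" "S \<noteq> {}" and fin: "\<And>\<nu>. \<nu> \<in> S \<Longrightarrow> finite (set_pmf \<nu>)" "finite (set_pmf v)"
    and h: "\<And>h. (\<forall>p. 0 \<le> h p \<and> h p \<le> 1) \<Longrightarrow> \<exists>\<nu>\<in>S. reward h \<nu> \<le> reward h v"
  shows "\<exists>w. set_pmf w \<subseteq> S \<and> dominated (bind_pmf w id) v"
proof -
  define P where "P = {p. Some p \<in> set_pmf v \<union> (\<Union>\<nu>\<in>S. set_pmf \<nu>)}"
  have "P = Some -` (set_pmf v \<union> (\<Union>\<nu>\<in>S. set_pmf \<nu>))" by (auto simp: P_def)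
  then have P: "finite P" using assms by (simp add: finite_vimageI)
  have "\<exists>w. (\<forall>\<nu>\<in>S. 0 \<le> w \<nu>) \<and> sum w S = 1 \<and> (\<forall>p\<in>P. (\<Sum>\<nu>\<in>S. w \<nu> * pmf \<nu> (Some p)) \<le> pmf v (Some p))"
  proof (rule finite_minimax[OF assms(1,2) P])
    fix h :: "path \<Rightarrow> real" assume "\<forall>p. 0 \<le> h p \<and> h p \<le> 1"
    from h[OF this] obtain \<nu> where \<nu>: "\<nu> \<in> S" "reward h \<nu> \<le> reward h v" by blast
    moreover have "reward h \<nu> = (\<Sum>p\<in>P. h p * pmf \<nu> (Some p))"
      by (rule reward_sum[OF P fin(1)[OF \<nu>(1)]]) (use \<nu>(1) in \<open>auto simp: P_def\<close>)
    moreover have "reward h v = (\<Sum>p\<in>P. h p * pmf v (Some p))"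
      by (rule reward_sum[OF P fin(2)]) (auto simp: P_def)
    ultimately show "\<exists>\<nu>\<in>S. (\<Sum>p\<in>P. h p * pmf \<nu> (Some p)) \<le> (\<Sum>p\<in>P. h p * pmf v (Some p))" by auto
  qed
  then obtain w where w: "\<And>\<nu>. \<nu> \<in> S \<Longrightarrow> 0 \<le> w \<nu>" "sum w S = 1"
    "\<And>p. p \<in> P \<Longrightarrow> (\<Sum>\<nu>\<in>S. w \<nu> * pmf \<nu> (Some p)) \<le> pmf v (Some p)" by blast
  define w' where "w' \<nu> = (if \<nu> \<in> S then w \<nu> else 0)" for \<nu>
  define W where "W = embed_pmf w'"
  have "(\<integral>\<^sup>+ \<nu>. ennreal (w' \<nu>) \<partial>count_space UNIV) = (\<Sum>\<nu>\<in>S. ennreal (w' \<nu>))"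
    by (rule nn_integral_count_space'[OF assms(1)]) (auto simp: w'_def)
  also have "\<dots> = ennreal (\<Sum>\<nu>\<in>S. w' \<nu>)" using w(1) by (intro sum_ennreal) (auto simp: w'_def)
  also have "(\<Sum>\<nu>\<in>S. w' \<nu>) = 1" using w(2) by (simp add: w'_def)
  finally have "(\<integral>\<^sup>+ \<nu>. ennreal (w' \<nu>) \<partial>count_space UNIV) = 1" by simp
  then have W: "pmf W \<nu> = w' \<nu>" for \<nu> unfolding W_def using w(1)
    by (intro pmf_embed_pmf) (auto simp: w'_def)
  have WS: "set_pmf W \<subseteq> S" using W by (auto simp: set_pmf_iff w'_def split: if_splits)
  moreover have "dominated (bind_pmf W id) v"
    unfolding dominated_def
  proof
    fix p
    have "pmf (bind_pmf W id) (Some p) = (\<Sum>\<nu>\<in>S. w \<nu> * pmf \<nu> (Some p))"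
      unfolding pmf_bind by (subst integral_measure_pmf[OF assms(1)]) (use WS in \<open>auto simp: W
        w'_def\<close>)
    also have "\<dots> \<le> pmf v (Some p)"
    proof (cases "p \<in> P")
      case False
      then have "(\<Sum>\<nu>\<in>S. w \<nu> * pmf \<nu> (Some p)) = 0" by (intro sum.neutral) (auto simp: P_def
        set_pmf_iff)
      then show ?thesis by simp
    qed (rule w(3))
    finally show "pmf (bind_pmf W id) (Some p) \<le> pmf v (Some p)" .
  qed
  ultimately show ?thesis by blast
qed

text \<open>Convex closure of runs: copies of one state may be resolved differently, as happens when
  the minimax argument mixes runs.\<close>

definition crun :: "ptest \<Rightarrow> state pmf \<Rightarrow> path option pmf \<Rightarrow> bool" where
  "crun T \<Theta> \<mu> \<longleftrightarrow> (\<exists>q. finite (set_pmf q) \<and> \<Theta> = map_pmf fst q \<and> \<mu> = bind_pmf q snd \<and>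
    (\<forall>(t, \<nu>)\<in>set_pmf q. run_ptest T t \<nu>))"

lemma crun_dominated:
  assumes \<Theta>: "finite (set_pmf \<Theta>)" and v: "finite (set_pmf v)"
    and h: "\<And>h. (\<forall>p. 0 \<le> h p \<and> h p \<le> 1) \<Longrightarrow>
      \<exists>f. (\<forall>t\<in>set_pmf \<Theta>. run_ptest T t (f t)) \<and> reward h (bind_pmf \<Theta> f) \<le> reward h v"
  shows "\<exists>\<mu>. crun T \<Theta> \<mu> \<and> dominated \<mu> v"
proof -
  let ?F = "PiE (set_pmf \<Theta>) (\<lambda>t. {\<nu>. run_ptest T t \<nu>})"
  let ?S = "bind_pmf \<Theta> ` ?F"
  have ex: "\<exists>\<nu>\<in>?S. reward h \<nu> \<le> reward h v" if "\<forall>p. 0 \<le> h p \<and> h p \<le> 1" for h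
  proof -
    from h[OF that] obtain f where f: "\<forall>t\<in>set_pmf \<Theta>. run_ptest T t (f t)"
      "reward h (bind_pmf \<Theta> f) \<le> reward h v" by blast
    have "restrict f (set_pmf \<Theta>) \<in> ?F" using f(1) by auto
    with f(2) show ?thesis using bind_pmf_restrict[of \<Theta> f] by (metis image_eqI)
  qed
  have "\<exists>w. set_pmf w \<subseteq> ?S \<and> dominated (bind_pmf w id) v"
  proof (rule pmf_minimax[OF _ _ _ v ex])
    show "finite ?S" by (intro finite_imageI finite_PiE \<Theta> finite_runs)
    show "?S \<noteq> {}" using ex[of "\<lambda>_. 0"] by auto
    show "finite (set_pmf \<nu>)" if "\<nu> \<in> ?S" for \<nu> using that \<Theta> run_finite(1)
      by (fastforce simp: PiE_iff)
  qed
  then obtain w where w: "set_pmf w \<subseteq> ?S" "dominated (bind_pmf w id) v" by blast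
  then have "\<forall>\<nu>\<in>set_pmf w. \<exists>f\<in>?F. \<nu> = bind_pmf \<Theta> f" by blast
  then obtain F where F: "\<And>\<nu>. \<nu> \<in> set_pmf w \<Longrightarrow> F \<nu> \<in> ?F \<and> \<nu> = bind_pmf \<Theta> (F \<nu>)" by metis
  have finw: "finite (set_pmf w)" by (rule finite_subset[OF w(1)]) (intro finite_imageI finite_PiE
    \<Theta> finite_runs)
  \<comment> \<open>A run is drawn from \<open>w\<close> and a state from \<Theta>; each state is
    paired with its resolution in that run.\<close>
  let ?q = "bind_pmf w (\<lambda>\<nu>. map_pmf (\<lambda>t. (t, F \<nu> t)) \<Theta>)"
  have "crun T \<Theta> (bind_pmf ?q snd)"
    unfolding crun_def
  proof (intro exI[of _ ?q] conjI refl)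
    show "finite (set_pmf ?q)" using finw \<Theta> by simp
    show "\<Theta> = map_pmf fst ?q" by (simp add: map_bind_pmf map_pmf_comp)
    show "\<forall>(t, \<nu>)\<in>set_pmf ?q. run_ptest T t \<nu>" using F by (fastforce simp: PiE_iff)
  qed
  moreover have "bind_pmf ?q snd = bind_pmf w id"
    unfolding bind_assoc_pmf bind_map_pmf by (rule bind_pmf_cong) (use F in auto)
  ultimately show ?thesis using w(2) by auto
qed

definition clocked :: "name \<Rightarrow> name \<Rightarrow> (path \<Rightarrow> real) \<Rightarrow> atest \<Rightarrow> proc" where
  "clocked z \<omega> h A = Emb (Par (clock z (depth_atest A)) (atest_state A z \<omega> h))"

section \<open>Applying a clocked template to a process\<close>

lemma foldr_res_dist: "foldr res_dist xs D = map_pmf (foldr res xs) D"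
  by (induction xs) (simp_all add: res_dist_def map_pmf_comp comp_def)

lemma observing_foldr: "\<omega> \<notin> set xs \<Longrightarrow> observing \<omega> \<omega> (foldr res xs)"
proof (induction xs rule: rev_induct)
  case Nil
  then show ?case using observing_id by (simp add: id_def)
next
  case (snoc x xs)
  then have "observing \<omega> \<omega> (foldr res xs \<circ> res x)" by (intro observing_res) auto
  then show ?case by (simp add: comp_def)
qed

lemma apply_clocked:
  "apply_test \<omega> (clocked z \<omega> h A) P = {r. outcome_dist \<omega> (bind_pmf (interp P) (\<lambda>t. return_pmf
      (foldr res (sorted_list_of_set (fn_proc (clocked z \<omega> h A) \<union> fn_proc P - {\<omega>})) (config z
        (depth_atest A) (atest_state A z \<omega> h) t)))) r}"
  unfolding apply_test_def foldr_res_dist outcomes_dist_def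
  by (simp add: clocked_def par_dist_def config_def pair_return_pmf1 map_pmf_comp
    map_pmf_def[symmetric])

lemma observing_apply: "observing \<omega> \<omega> (foldr res (sorted_list_of_set (fn_proc T \<union> fn_proc P -
  {\<omega>})))"
  by (rule observing_foldr) simp

lemma fits_interp: "z \<notin> N \<Longrightarrow> \<omega> \<notin> N \<Longrightarrow> z \<noteq> \<omega> \<Longrightarrow> fn_proc P \<subseteq> N \<Longrightarrow> t \<in> set_pmf (interp P) \<Longrightarrow> fits N z \<omega> t"
  using fn_interp[of P] by (auto simp: fits_def fn_dist_def)

lemma apply_clocked_run:
  assumes A: "uses_atest A N" and N: "z \<notin> N" "\<omega> \<notin> N" "z \<noteq> \<omega>" "fn_proc P \<subseteq> N" and h:
    "\<forall>p. 0 \<le> h p \<and> h p \<le> 1"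
    and r: "r \<in> apply_test \<omega> (clocked z \<omega> h A) P"
  shows "\<exists>f. (\<forall>t\<in>set_pmf (interp P). run_atest A t (f t)) \<and> r = reward h (bind_pmf (interp P) f)"
proof -
  define K where "K = foldr res (sorted_list_of_set (fn_proc (clocked z \<omega> h A) \<union> fn_proc P - {\<omega>}))"
  have K: "observing \<omega> \<omega> K" unfolding K_def by (rule observing_apply)
  let ?F = "\<lambda>t. return_pmf (K (config z (depth_atest A) (atest_state A z \<omega> h) t))"
  have od: "outcome_dist \<omega> (bind_pmf (interp P) ?F) r" using r unfolding apply_clocked K_def by simp
  have "finite (set_pmf (bind_pmf (interp P) ?F))" by (simp add: finite_interp)
  from outcome_distE[OF od this] obtain p where p: "\<And>s. s \<in> set_pmf (bind_pmf (interp P) ?F) \<Longrightarrow>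
    outcome_state \<omega> s (p s)" "r = expectation (bind_pmf (interp P) ?F) p"
    by blast
  have "\<exists>\<nu>. run_atest A t \<nu> \<and> p (K (config z (depth_atest A) (atest_state A z \<omega> h) t)) =
    reward h \<nu>" if t: "t \<in> set_pmf (interp P)" for t
  proof -
    have "realized \<omega> (K (config z (depth_atest A) (atest_state A z \<omega> h) t)) (p (K (config z
      (depth_atest A) (atest_state A z \<omega> h) t)))"
      by (rule realized_if_outcome, rule p(1)) (use t in auto)
    with K fits_interp[OF N t] A h show ?thesis unfolding realized_def
      by (elim conjE allE[of _ K] allE[of _ \<omega>] allE[of _ z] allE[of _ "depth_atest A"] allE[of _
        "atest_state A z \<omega> h"] allE[of _ t] allE[of _ N] allE[of _ A] allE[of _ h]) simp
  qed
  then obtain f where f: "\<And>t. t \<in> set_pmf (interp P) \<Longrightarrow> run_atest A t (f t) \<and>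
    p (K (config z (depth_atest A) (atest_state A z \<omega> h) t)) = reward h (f t)" by metis
  have "r = expectation (interp P) (\<lambda>t. reward h (f t))"
    unfolding p(2) by (subst expectation_bind) (use f in \<open>auto simp: finite_interp intro!:
      expectation_cong\<close>)
  also have "\<dots> = reward h (bind_pmf (interp P) f)"
    by (rule reward_bind[symmetric]) (use f run_finite(2) finite_interp in auto)
  finally show ?thesis using f by blast
qed

text \<open>With \<sigma> equal to 1 the reward bounds the outcome from above, with -1 from
  below.\<close>

lemma run_apply_clocked:
  fixes \<sigma> :: real
  assumes A: "uses_atest A N" and N: "z \<notin> N" "\<omega> \<notin> N" "z \<noteq> \<omega>" "fn_proc P \<subseteq> N" and h:
    "\<forall>p. 0 \<le> h p \<and> h p \<le> 1"
    and f: "\<And>t. t \<in> set_pmf (interp P) \<Longrightarrow> run_atest A t (f t)"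
  shows "\<exists>r\<in>apply_test \<omega> (clocked z \<omega> h A) P. \<sigma> * r \<le> \<sigma> * reward h (bind_pmf (interp P) f)"
proof -
  define K where "K = foldr res (sorted_list_of_set (fn_proc (clocked z \<omega> h A) \<union> fn_proc P - {\<omega>}))"
  have K: "observing \<omega> \<omega> K" unfolding K_def by (rule observing_apply)
  let ?C = "\<lambda>t. K (config z (depth_atest A) (atest_state A z \<omega> h) t)"
  have "\<exists>r. outcome_state \<omega> (?C t) r \<and> \<sigma> * r \<le> \<sigma> * reward h (f t)" if t: "t \<in> set_pmf (interp P)"
    for t
    by (rule outcome_of_run(2)[OF f[OF t] K fits_interp[OF N t] A]) (use h in simp_all)
  then obtain \<rho> where \<rho>: "\<And>t. t \<in> set_pmf (interp P) \<Longrightarrow> outcome_state \<omega> (?C t) (\<rho> t) \<and>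
    \<sigma> * \<rho> t \<le> \<sigma> * reward h (f t)" by metis
  have "\<exists>r. outcome_dist \<omega> (bind_pmf (interp P) (\<lambda>t. return_pmf (?C t))) r \<and>
    \<sigma> * r \<le> \<sigma> * expectation (interp P) \<rho>"
    by (rule outcome_dist_bind) (use \<rho> finite_interp in \<open>auto intro: outcome_dist_return\<close>)
  then obtain r where r: "outcome_dist \<omega> (bind_pmf (interp P) (\<lambda>t. return_pmf (?C t))) r"
    "\<sigma> * r \<le> \<sigma> * expectation (interp P) \<rho>" by blast
  have "\<sigma> * expectation (interp P) \<rho> = expectation (interp P) (\<lambda>t. \<sigma> * \<rho> t)" by simp
  also have "\<dots> \<le> expectation (interp P) (\<lambda>t. \<sigma> * reward h (f t))"
    by (rule expectation_mono[OF finite_interp]) (use \<rho> in blast)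
  also have "\<dots> = \<sigma> * reward h (bind_pmf (interp P) f)"
    by (subst reward_bind[OF finite_interp]) (use f run_finite(2) in auto)
  finally show ?thesis using r unfolding apply_clocked K_def by (intro bexI[of _ r]) simp_all
qed

section \<open>Templates yield admissible tests\<close>

lemma test_ren:
  "test_proc \<omega> P \<Longrightarrow> inj f \<Longrightarrow> test_proc (f \<omega>) (ren_proc f P)"
  "test_state \<omega> s \<Longrightarrow> inj f \<Longrightarrow> test_state (f \<omega>) (ren_state f s)"
proof (induction P and s arbitrary: \<omega> f and \<omega> f)
  case (Inp a P)
  then show ?case using Inp.IH[of "Suc \<omega>" "lift_ren f"] by (simp add: inj_lift_ren inj_eq)
next
  case (Res s)
  then show ?case using Res.IH[of "Suc \<omega>" "lift_ren f"] by (simp add: inj_lift_ren)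
qed (simp_all add: inj_eq)

lemma test_tick: "z \<noteq> \<omega> \<Longrightarrow> test_proc \<omega> P \<Longrightarrow> test_state \<omega> (tick z P)"
  using test_ren(1)[of \<omega> P Suc] by (simp add: tick_def)

lemma test_leaf_proc: "test_proc \<omega> (leaf_proc \<omega> r)"
  by (simp add: leaf_proc_def)

lemma test_clock: "z \<noteq> \<omega> \<Longrightarrow> test_state \<omega> (clock z j)"
  by (induction j) simp_all

lemma test_mismatches: "c \<noteq> \<omega> \<Longrightarrow> \<omega> \<notin> set ns \<Longrightarrow> test_state \<omega> s \<Longrightarrow> test_state \<omega> (mismatches c ns s)"
  by (induction ns) auto

lemma test_matchany: "c \<noteq> \<omega> \<Longrightarrow> \<omega> \<notin> set ns \<Longrightarrow> test_state \<omega> s \<Longrightarrow> test_state \<omega> (matchany c ns s)"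
  by (induction ns) auto

lemma test_tr:
  "uses_ptest T N \<Longrightarrow> z \<noteq> \<omega> \<Longrightarrow> \<omega> \<notin> N \<Longrightarrow> test_proc \<omega> (ptest_proc T z \<omega> h)"
  "uses_atest A N \<Longrightarrow> z \<noteq> \<omega> \<Longrightarrow> \<omega> \<notin> N \<Longrightarrow> test_state \<omega> (atest_state A z \<omega> h)"
proof (induction T and A arbitrary: N z \<omega> h and N z \<omega> h)
  case (RcvEq a b T)
  have "test_proc \<omega> (ptest_proc T z \<omega> (h \<circ> Cons False))"
    by (rule RcvEq.IH) (use RcvEq.prems in auto)
  then have "test_proc (Suc \<omega>) (ren_proc Suc (ptest_proc T z \<omega> (h \<circ> Cons False)))"
    by (rule test_ren) simp
  then have "test_state (Suc \<omega>) (tick (Suc z) (ren_proc Suc (ptest_proc T z \<omega> (h \<circ> Cons False))))"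
    "test_state (Suc \<omega>) (tick (Suc z) (leaf_proc (Suc \<omega>) (h [True])))"
    using RcvEq.prems by (auto intro!: test_tick test_leaf_proc)
  with RcvEq.prems show ?case by (auto simp: body_eq_def)
next
  case (RcvNew a ns T)
  have "test_proc (Suc \<omega>) (ptest_proc T (Suc z) (Suc \<omega>) (h \<circ> Cons False))"
    by (rule RcvNew.IH) (use RcvNew.prems in auto)
  then have "test_state (Suc \<omega>) (tick (Suc z) (ptest_proc T (Suc z) (Suc \<omega>) (h \<circ> Cons False)))"
    "test_state (Suc \<omega>) (tick (Suc z) (leaf_proc (Suc \<omega>) (h [True])))"
    using RcvNew.prems by (auto intro!: test_tick test_leaf_proc)
  with RcvNew.prems show ?case by (auto simp: body_new_def intro!: test_mismatches test_matchany)
next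
  case (SndNew a T)
  have "test_proc (Suc \<omega>) (ptest_proc T (Suc z) (Suc \<omega>) h)"
    by (rule SndNew.IH) (use SndNew.prems in auto)
  then show ?case using SndNew.prems by auto
qed (auto intro: test_tick test_leaf_proc)

lemma test_clocked: "uses_atest A N \<Longrightarrow> z \<noteq> \<omega> \<Longrightarrow> \<omega> \<notin> N \<Longrightarrow> test_proc \<omega> (clocked z \<omega> h A)"
  by (simp add: clocked_def test_clock test_tr)

text \<open>If every sum offers a tick, a run cannot get stuck, whatever the tested state does.
  Refusals need templates without this property, since they are detected by getting stuck.\<close>

primrec live_ptest :: "ptest \<Rightarrow> bool" and live_atest :: "atest \<Rightarrow> bool" where
  "live_ptest Leaf \<longleftrightarrow> True"
| "live_ptest (Mix T U) \<longleftrightarrow> live_ptest T \<and> live_ptest U"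
| "live_ptest (Act A) \<longleftrightarrow> live_atest A \<and> (\<exists>\<pi> T. (\<pi>, Tick T) \<in> summands A)"
| "live_atest Stop \<longleftrightarrow> True"
| "live_atest (Plus A B) \<longleftrightarrow> live_atest A \<and> live_atest B"
| "live_atest (Tick T) \<longleftrightarrow> live_ptest T"
| "live_atest (Snd a w T) \<longleftrightarrow> live_ptest T"
| "live_atest (SndNew a T) \<longleftrightarrow> live_ptest T"
| "live_atest (RcvEq a b T) \<longleftrightarrow> live_ptest T"
| "live_atest (RcvNew a ns T) \<longleftrightarrow> live_ptest T"

lemma live_atest_summands: "live_atest A \<Longrightarrow> (\<pi>, x) \<in> summands A \<Longrightarrow> live_atest x"
  by (induction A arbitrary: \<pi> rule: atest.induct[where ?P1.0 = "\<lambda>_. True"]) auto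

lemma comm_live: "comm A t \<pi> T e \<Theta> \<Longrightarrow> live_atest A \<Longrightarrow> live_ptest T"
  by (induction rule: comm.induct; drule (1) live_atest_summands[rotated]; simp)

lemma None_in_pre [simp]: "None \<in> set_pmf (pre \<pi> \<mu>) \<longleftrightarrow> None \<in> set_pmf \<mu>"
  by (force simp: pre_def)

lemma live_run:
  "run_ptest T t \<nu> \<Longrightarrow> live_ptest T \<Longrightarrow> None \<notin> set_pmf \<nu>"
  "run_atest A t \<nu> \<Longrightarrow> live_ptest (Act A) \<Longrightarrow> None \<notin> set_pmf \<nu>"
proof (induction rule: run_ptest_run_atest.inducts)
  case (mix T t \<mu> U \<nu>)
  then show ?case by (auto simp: mix_def split: if_splits)
next
  case (comm A t \<pi> T e \<Theta> f)
  then show ?case using comm_live by auto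
next
  case (dead t A)
  then show ?case using comm.tick by fastforce
qed auto

text \<open>Without weight on \<open>None\<close>, the leaves carry total weight 1.\<close>

lemma reward_total:
  assumes "None \<notin> set_pmf \<mu>" "finite (set_pmf \<mu>)"
  shows "reward (\<lambda>p. 1 - h p) \<mu> = 1 - reward h \<mu>"
proof -
  have "reward (\<lambda>p. 1 - h p) \<mu> = expectation \<mu> (\<lambda>x. 1 - case_option 0 h x)"
    unfolding reward_def
  proof (rule expectation_cong)
    fix i assume "i \<in> set_pmf \<mu>"
    with assms(1) show "case_option 0 (\<lambda>p. 1 - h p) i = 1 - case_option 0 h i" by (cases i) auto
  qed
  then show ?thesis unfolding reward_def using assms(2) by (simp add: integrable_measure_pmf_finite)
qed

text \<open>For each \<open>h\<close>, the run of \<open>Q\<close> gives an outcome at most its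
  reward, the preorder an outcome of \<open>P\<close> below it, and that one comes from a run.
  Minimax then removes the dependence on \<open>h\<close>.\<close>

lemma must_testing:
  assumes pmust: "pmust \<omega> P Q" and A: "uses_atest A N" and N: "z \<notin> N" "\<omega> \<notin> N" "z \<noteq> \<omega>"
    "fn_proc P \<subseteq> N" "fn_proc Q \<subseteq> N"
    and f: "\<And>t. t \<in> set_pmf (interp Q) \<Longrightarrow> run_atest A t (f t)"
  shows "\<exists>\<mu>. crun (Act A) (interp P) \<mu> \<and> dominated \<mu> (bind_pmf (interp Q) f)"
proof (rule crun_dominated[OF finite_interp])
  show "finite (set_pmf (bind_pmf (interp Q) f))" using f run_finite(2)
    by (auto simp: finite_interp)
  fix h :: "path \<Rightarrow> real" assume h: "\<forall>p. 0 \<le> h p \<and> h p \<le> 1"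
  obtain r where r: "r \<in> apply_test \<omega> (clocked z \<omega> h A) Q" "r \<le> reward h (bind_pmf (interp Q) f)"
    using run_apply_clocked[OF A N(1,2,3,5) h f, of 1] by auto
  obtain r' where r': "r' \<in> apply_test \<omega> (clocked z \<omega> h A) P" "r' \<le> r"
    using pmust r(1) test_clocked[OF A N(3,2)] unfolding pmust_def smyth_le_def by blast
  from apply_clocked_run[OF A N(1-4) h r'(1)] r(2) r'(2)
  show "\<exists>g. (\<forall>t\<in>set_pmf (interp P). run_ptest (Act A) t (g t)) \<and>
    reward h (bind_pmf (interp P) g) \<le> reward h (bind_pmf (interp Q) f)"
    by (meson order_trans run_ptest_run_atest.act order_refl)
qed

lemma may_testing:
  assumes pmay: "pmay \<omega> P Q" and A: "uses_atest A N" "live_ptest (Act A)" and N: "z \<notin> N" "\<omega> \<notin> N"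
    "z \<noteq> \<omega>" "fn_proc P \<subseteq> N" "fn_proc Q \<subseteq> N"
    and f: "\<And>t. t \<in> set_pmf (interp P) \<Longrightarrow> run_atest A t (f t)"
  shows "\<exists>\<mu>. crun (Act A) (interp Q) \<mu> \<and> dominated \<mu> (bind_pmf (interp P) f)"
proof (rule crun_dominated[OF finite_interp])
  show fin: "finite (set_pmf (bind_pmf (interp P) f))" using f run_finite(2)
    by (auto simp: finite_interp)
  fix h :: "path \<Rightarrow> real" assume h: "\<forall>p. 0 \<le> h p \<and> h p \<le> 1"
  let ?h = "\<lambda>p. 1 - h p"
  have h': "\<forall>p. 0 \<le> ?h p \<and> ?h p \<le> 1" using h by simp
  \<comment> \<open>Here \<sigma> is -1: the outcome must lie above the reward for the Hoare order
    to be applicable.\<close>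
  obtain r where r: "r \<in> apply_test \<omega> (clocked z \<omega> ?h A) P" "reward ?h (bind_pmf (interp P) f) \<le> r"
    using run_apply_clocked[OF A(1) N(1-4) h' f, of "- 1"] by auto
  obtain r' where r': "r' \<in> apply_test \<omega> (clocked z \<omega> ?h A) Q" "r \<le> r'"
    using pmay r(1) test_clocked[OF A(1) N(3,2)] unfolding pmay_def hoare_le_def by blast
  obtain g where g: "\<forall>t\<in>set_pmf (interp Q). run_atest A t (g t)"
    "r' = reward ?h (bind_pmf (interp Q) g)"
    using apply_clocked_run[OF A(1) N(1,2,3,5) h' r'(1)] by blast
  have "reward ?h (bind_pmf (interp P) f) = 1 - reward h (bind_pmf (interp P) f)"
  proof (rule reward_total[OF _ fin])
    have "None \<notin> set_pmf (f t)" if "t \<in> set_pmf (interp P)" for t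
      by (rule live_run(2)[OF f[OF that] A(2)])
    then show "None \<notin> set_pmf (bind_pmf (interp P) f)" by auto
  qed
  moreover have "reward ?h (bind_pmf (interp Q) g) = 1 - reward h (bind_pmf (interp Q) g)"
  proof (rule reward_total)
    have "None \<notin> set_pmf (g t)" "finite (set_pmf (g t))" if "t \<in> set_pmf (interp Q)" for t
      using g(1) that live_run(2)[OF _ A(2)] run_finite(2) by blast+
    then show "None \<notin> set_pmf (bind_pmf (interp Q) g)" "finite (set_pmf (bind_pmf (interp Q) g))"
      by (auto simp: finite_interp)
  qed
  ultimately have "reward h (bind_pmf (interp Q) g) \<le> reward h (bind_pmf (interp P) f)"
    using r(2) r'(2) g(2) by simp
  with g(1) show "\<exists>g. (\<forall>t\<in>set_pmf (interp Q). run_ptest (Act A) t (g t)) \<and>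
    reward h (bind_pmf (interp Q) g) \<le> reward h (bind_pmf (interp P) f)"
    by (meson run_ptest_run_atest.act)
qed


section \<open>Characteristic tests\<close>

lemma crun_bind:
  fixes p :: "'i pmf"
  assumes "finite (set_pmf p)" and "\<And>i. i \<in> set_pmf p \<Longrightarrow> crun T (\<Theta> i) (\<mu> i)"
  shows "crun T (bind_pmf p \<Theta>) (bind_pmf p \<mu>)"
proof -
  have "\<forall>i\<in>set_pmf p. \<exists>q. finite (set_pmf q) \<and> \<Theta> i = map_pmf fst q \<and> \<mu> i = bind_pmf q snd \<and> (\<forall>(t,
    \<nu>)\<in>set_pmf q. run_ptest T t \<nu>)"
    using assms(2) unfolding crun_def by blast
  then obtain q where q: "\<And>i. i \<in> set_pmf p \<Longrightarrow> finite (set_pmf (q i)) \<and> \<Theta> i = map_pmf fst (q i) \<and>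
      \<mu> i = bind_pmf (q i) snd \<and> (\<forall>(t, \<nu>)\<in>set_pmf (q i). run_ptest T t \<nu>)" by metis
  show ?thesis unfolding crun_def
    by (intro exI[of _ "bind_pmf p q"])
      (use q assms(1) in \<open>auto simp: map_bind_pmf bind_assoc_pmf cong: bind_pmf_cong\<close>)
qed

lemma crun_return: "run_ptest T t \<nu> \<Longrightarrow> crun T (return_pmf t) \<nu>"
  unfolding crun_def by (intro exI[of _ "return_pmf (t, \<nu>)"]) (simp add: bind_return_pmf)

lemma crun_runs: "finite (set_pmf \<Theta>) \<Longrightarrow> (\<And>t. t \<in> set_pmf \<Theta> \<Longrightarrow> run_ptest T t (f t)) \<Longrightarrow>
  crun T \<Theta> (bind_pmf \<Theta> f)"
  using crun_bind[of \<Theta> T return_pmf f] by (simp add: crun_return bind_return_pmf')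

text \<open>A run once the initial internal steps of the tested state are over: the template moves
  next, or everything is stuck.\<close>

inductive stop :: "atest \<Rightarrow> state \<Rightarrow> path option pmf \<Rightarrow> bool" where
  comm: "comm A t \<pi> T e \<Theta> \<Longrightarrow> (\<And>t'. t' \<in> set_pmf \<Theta> \<Longrightarrow> run_ptest T t' (f t')) \<Longrightarrow>
    stop A t (pre \<pi> (bind_pmf \<Theta> f))"
| dead: "taus t = {} \<Longrightarrow> (\<nexists>\<pi> T e \<Theta>. comm A t \<pi> T e \<Theta>) \<Longrightarrow> stop A t (return_pmf None)"

text \<open>Branches leave the internal phase after different numbers of steps; idling evens this
  out, so that all phases together form one weak move.\<close>

lemma run_decompose:
  "run_ptest T t \<nu> \<Longrightarrow> True"
  "run_atest A t \<nu> \<Longrightarrow> \<exists>q. finite (set_pmf q) \<and> weak_tau (return_pmf t) (map_pmf fst q) \<and> \<nu> =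
    bind_pmf q snd \<and>
    (\<forall>(t', \<nu>')\<in>set_pmf q. stop A t' \<nu>')"
proof (induction rule: run_ptest_run_atest.inducts)
  case (tau \<Delta> t A f)
  then obtain q where q: "\<And>t'. t' \<in> set_pmf \<Delta> \<Longrightarrow> finite (set_pmf (q t')) \<and>
    weak_tau (return_pmf t') (map_pmf fst (q t')) \<and>
      f t' = bind_pmf (q t') snd \<and> (\<forall>(t', \<nu>')\<in>set_pmf (q t'). stop A t' \<nu>')" by metis
  have fin: "finite (set_pmf \<Delta>)" by (rule fin_taus[OF tau(1)])
  have "weak_tau (return_pmf t) \<Delta>" by (rule weak_tau_step[OF tau(1)])
  also have "weak_tau \<Delta> (bind_pmf \<Delta> (\<lambda>t'. map_pmf fst (q t')))"
    using weak_tau_bind[OF fin, of return_pmf "\<lambda>t'. map_pmf fst (q t')"] q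
      by (simp add: bind_return_pmf')
  finally show ?case
    by (intro exI[of _ "bind_pmf \<Delta> q"])
      (use q fin in \<open>auto simp: map_bind_pmf bind_assoc_pmf cong: bind_pmf_cong\<close>)
next
  case (comm A t \<pi> T e \<Theta> f)
  then show ?case
    by (intro exI[of _ "return_pmf (t, pre \<pi> (bind_pmf \<Theta> f))"]) (auto simp: bind_return_pmf intro:
      stop.comm)
next
  case (dead t A)
  then show ?case by (intro exI[of _ "return_pmf (t, return_pmf None)"]) (auto simp:
    bind_return_pmf intro: stop.dead)
qed simp_all

lemma crun_decompose:
  assumes "crun (Act A) \<Theta> \<mu>"
  shows "\<exists>q. finite (set_pmf q) \<and> weak_tau \<Theta> (map_pmf fst q) \<and> \<mu> = bind_pmf q snd \<and> (\<forall>(t,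
    \<nu>)\<in>set_pmf q. stop A t \<nu>)"
proof -
  obtain p where p: "finite (set_pmf p)" "\<Theta> = map_pmf fst p" "\<mu> = bind_pmf p snd"
    "\<And>t \<nu>. (t, \<nu>) \<in> set_pmf p \<Longrightarrow> run_ptest (Act A) t \<nu>"
    using assms unfolding crun_def by blast
  have "\<exists>q. finite (set_pmf q) \<and> weak_tau (return_pmf (fst x)) (map_pmf fst q) \<and> snd x =
    bind_pmf q snd \<and>
      (\<forall>(t', \<nu>')\<in>set_pmf q. stop A t' \<nu>')" if x: "x \<in> set_pmf p" for x
  proof -
    have "run_atest A (fst x) (snd x)" using p(4)[of "fst x" "snd x"] x
      by (auto elim: run_ptest.cases)
    then show ?thesis by (rule run_decompose(2))
  qed
  then obtain q where q: "\<And>x. x \<in> set_pmf p \<Longrightarrow> finite (set_pmf (q x)) \<and>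
    weak_tau (return_pmf (fst x)) (map_pmf fst (q x)) \<and>
      snd x = bind_pmf (q x) snd \<and> (\<forall>(t', \<nu>')\<in>set_pmf (q x). stop A t' \<nu>')" by metis
  have "weak_tau (bind_pmf p (\<lambda>x. return_pmf (fst x))) (bind_pmf p (\<lambda>x. map_pmf fst (q x)))"
    by (rule weak_tau_bind[OF p(1)]) (use q in auto)
  then have "weak_tau \<Theta> (bind_pmf p (\<lambda>x. map_pmf fst (q x)))" unfolding p(2)
    by (simp add: map_pmf_def)
  then show ?thesis
    by (intro exI[of _ "bind_pmf p q"])
      (use q p(1,3) in \<open>auto simp: map_bind_pmf bind_assoc_pmf cong: bind_pmf_cong\<close>)
qed

lemma pre_Nil [simp]: "pre [] \<mu> = \<mu>"
proof -
  have "map_option ((@) []) x = x" for x :: "path option" by (cases x) simp_all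
  then have "map_option ((@) []) = (id :: path option \<Rightarrow> _)" by (simp add: fun_eq_iff)
  then show ?thesis by (simp add: pre_def)
qed

lemma pre_bind: "pre \<pi> (bind_pmf p f) = bind_pmf p (\<lambda>x. pre \<pi> (f x))"
  by (simp add: pre_def map_bind_pmf)

lemma Some_in_pre: "Some p \<in> set_pmf (pre \<pi> \<mu>) \<longleftrightarrow> (\<exists>p'. p = \<pi> @ p' \<and> Some p' \<in> set_pmf \<mu>)"
  by (force simp: pre_def)

lemma pmf_pre [simp]: "pmf (pre \<pi> \<mu>) (Some (\<pi> @ p)) = pmf \<mu> (Some p)"
proof -
  have "inj (map_option ((@) \<pi>))" by (rule option.inj_map) (simp add: inj_def)
  from pmf_map_inj'[OF this, of \<mu> "Some p"] show ?thesis by (simp add: pre_def)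
qed

lemma dom_pre: "dominated (pre \<pi> \<mu>) (pre \<pi> \<nu>) \<Longrightarrow> dominated \<mu> \<nu>"
  unfolding dominated_def by (metis pmf_pre)

lemma dom_support: "dominated \<mu> \<nu> \<Longrightarrow> Some p \<in> set_pmf \<mu> \<Longrightarrow> Some p \<in> set_pmf \<nu>"
  unfolding dominated_def set_pmf_iff by (metis pmf_nonneg order_antisym)

lemma live_run_Some:
  assumes "run_ptest T t \<nu>" "live_ptest T"
  shows "\<exists>p. Some p \<in> set_pmf \<nu>"
  using live_run(1)[OF assms] set_pmf_not_empty[of \<nu>] by (metis all_not_in_conv option.exhaust)

text \<open>A live continuation certainly reaches a leaf and thereby betrays the communication by an
  address below \<pi>.\<close>

lemma comm_Some:
  assumes "comm A t \<pi> T e \<Theta>" "\<And>t'. t' \<in> set_pmf \<Theta> \<Longrightarrow> run_ptest T t' (f t')" "live_ptest T"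
  shows "\<exists>p. Some (\<pi> @ p) \<in> set_pmf (pre \<pi> (bind_pmf \<Theta> f))"
proof -
  obtain t' where t': "t' \<in> set_pmf \<Theta>" using set_pmf_not_empty by fast
  then obtain p where "Some p \<in> set_pmf (f t')" using live_run_Some[OF assms(2) assms(3)] by blast
  with t' show ?thesis by (auto simp: Some_in_pre)
qed

text \<open>The target puts weight only on leaves below \<open>\<pi>\<^sub>0\<close>. Any other
  communication has a live continuation and would reach a leaf elsewhere, and getting stuck is
  excluded by the last assumption. So every branch performs the intended communication, and together
  they make one lifted step.\<close>

lemma crun_probe:
  assumes run: "crun (Act A) \<Theta> \<mu>" "dominated \<mu> (pre \<pi>\<^sub>0 v)"
    and comm: "\<And>t \<pi> T e \<Xi>. comm A t \<pi> T e \<Xi> \<Longrightarrow> \<pi> = \<pi>\<^sub>0 \<and> T = T\<^sub>0 \<and> R t \<Xi> \<or> live_ptest T \<and> (\<forall>p p'.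
      \<pi> @ p \<noteq> \<pi>\<^sub>0 @ p')"
    and tick: "\<And>t. \<exists>\<pi> T e \<Xi>. comm A t \<pi> T e \<Xi>"
  shows "\<exists>\<Theta>\<^sub>1 \<Theta>\<^sub>2 \<mu>'. weak_tau \<Theta> \<Theta>\<^sub>1 \<and> lift_rel R \<Theta>\<^sub>1 \<Theta>\<^sub>2 \<and> crun T\<^sub>0 \<Theta>\<^sub>2 \<mu>' \<and> dominated \<mu>' v"
proof -
  obtain q where q: "finite (set_pmf q)" "weak_tau \<Theta> (map_pmf fst q)" "\<mu> = bind_pmf q snd"
    "\<And>t \<nu>. (t, \<nu>) \<in> set_pmf q \<Longrightarrow> stop A t \<nu>" using crun_decompose[OF run(1)] by blast
  have "\<exists>\<Xi> f. R (fst x) \<Xi> \<and> finite (set_pmf \<Xi>) \<and> (\<forall>t'\<in>set_pmf \<Xi>. run_ptest T\<^sub>0 t' (f t')) \<and> snd x =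
    pre \<pi>\<^sub>0 (bind_pmf \<Xi> f)"
    if x: "x \<in> set_pmf q" for x
  proof -
    have "stop A (fst x) (snd x)" using q(4)[of "fst x" "snd x"] x by simp
    then show ?thesis
    proof cases
      case (comm \<pi> T e \<Xi> f)
      from assms(3)[OF comm(2)] show ?thesis
      proof (elim disjE conjE)
        assume "\<pi> = \<pi>\<^sub>0" "T = T\<^sub>0" "R (fst x) \<Xi>"
        then show ?thesis using comm comm_finite[OF comm(2)] by blast
      next
        assume "live_ptest T" and ne: "\<forall>p p'. \<pi> @ p \<noteq> \<pi>\<^sub>0 @ p'"
        then obtain p where "Some (\<pi> @ p) \<in> set_pmf (snd x)" using comm_Some[OF comm(2,3)] comm(1)
          by auto
        then have "Some (\<pi> @ p) \<in> set_pmf \<mu>" using x unfolding q(3) by auto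
        then have "Some (\<pi> @ p) \<in> set_pmf (pre \<pi>\<^sub>0 v)" by (rule dom_support[OF run(2)])
        with ne show ?thesis by (auto simp: Some_in_pre)
      qed
    next
      case dead
      with tick show ?thesis by blast
    qed
  qed
  then obtain \<Xi> f where f: "\<And>x. x \<in> set_pmf q \<Longrightarrow> R (fst x) (\<Xi> x) \<and> finite (set_pmf (\<Xi> x)) \<and>
      (\<forall>t'\<in>set_pmf (\<Xi> x). run_ptest T\<^sub>0 t' (f x t')) \<and> snd x =
        pre \<pi>\<^sub>0 (bind_pmf (\<Xi> x) (f x))" by metis
  let ?\<mu> = "bind_pmf q (\<lambda>x. bind_pmf (\<Xi> x) (f x))"
  have "lift_rel R (bind_pmf q (\<lambda>x. return_pmf (fst x))) (bind_pmf q \<Xi>)"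
    by (rule lift_rel_bind[OF q(1)], rule lift_rel.point) (use f in blast)
  then have "lift_rel R (map_pmf fst q) (bind_pmf q \<Xi>)" by (simp add: map_pmf_def)
  moreover have "crun T\<^sub>0 (bind_pmf q \<Xi>) ?\<mu>"
    by (rule crun_bind[OF q(1)], rule crun_runs) (use f in blast)+
  moreover have "\<mu> = pre \<pi>\<^sub>0 ?\<mu>" unfolding q(3) pre_bind using f
    by (auto simp: pre_bind intro!: bind_pmf_cong)
  then have "dominated ?\<mu> v" using run(2) dom_pre by simp
  ultimately show ?thesis using q(2) by blast
qed

lemma comm_Tick: "comm (Tick T) t \<pi> U e \<Xi> \<longleftrightarrow> \<pi> = [] \<and> U = T \<and> e = False \<and> \<Xi> = return_pmf t"
proof
  assume "comm (Tick T) t \<pi> U e \<Xi>"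
  then show "\<pi> = [] \<and> U = T \<and> e = False \<and> \<Xi> = return_pmf t" by cases auto
qed (auto intro: comm.tick)

lemma lift_rel_eq: "lift_rel (\<lambda>t \<Xi>. \<Xi> = return_pmf t) \<Theta> \<Theta>' \<Longrightarrow> \<Theta>' = \<Theta>"
proof -
  assume "lift_rel (\<lambda>t \<Xi>. \<Xi> = return_pmf t) \<Theta> \<Theta>'"
  then obtain q where "\<Theta> = map_pmf fst q" "\<Theta>' = bind_pmf q snd"
    "\<forall>(s, \<Xi>)\<in>set_pmf q. \<Xi> = return_pmf s"
    unfolding lift_rel_coupling by blast
  moreover from this(3) have "\<forall>x\<in>set_pmf q. snd x = return_pmf (fst x)" by auto
  ultimately show ?thesis by (simp add: map_pmf_def cong: bind_pmf_cong)
qed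

text \<open>The tested state may make internal steps before the tick, and these form the weak move
  after which \<open>T\<close> starts.\<close>

lemma crun_Tick:
  assumes "crun (Act (Tick T)) \<Theta> \<mu>" "dominated \<mu> v"
  shows "\<exists>\<Theta>' \<mu>'. weak_tau \<Theta> \<Theta>' \<and> crun T \<Theta>' \<mu>' \<and> dominated \<mu>' v"
proof -
  have "\<exists>\<Theta>\<^sub>1 \<Theta>\<^sub>2 \<mu>'. weak_tau \<Theta> \<Theta>\<^sub>1 \<and> lift_rel (\<lambda>t \<Xi>. \<Xi> = return_pmf t) \<Theta>\<^sub>1 \<Theta>\<^sub>2 \<and> crun T \<Theta>\<^sub>2 \<mu>' \<and>
    dominated \<mu>' v"
    by (rule crun_probe[where \<pi>\<^sub>0 = "[]"]) (use assms in \<open>auto simp: comm_Tick\<close>)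
  then show ?thesis using lift_rel_eq by blast
qed

lemma run_atest_Tick: "run_ptest T t \<nu> \<Longrightarrow> run_atest (Tick T) t \<nu>"
  using run_ptest_run_atest.comm[of "Tick T" t "[]" T False "return_pmf t" "\<lambda>_. \<nu>"]
    by (simp add: comm_Tick bind_return_pmf)

text \<open>Some template is characteristic for \<Phi>, relative to reference runs \<open>f\<close>
  from \<Delta> that provide the target. Liveness is demanded in the may case, where rewards have to
  be complemented.\<close>

definition testable :: "bool \<Rightarrow> name set \<Rightarrow> state pmf \<Rightarrow> (state pmf \<Rightarrow> bool) \<Rightarrow> bool" where
  "testable must N \<Delta> \<Phi> \<longleftrightarrow> (\<exists>T f. uses_ptest T N \<and> (must \<or> live_ptest T) \<and> (\<forall>s\<in>set_pmf \<Delta>.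
    run_ptest T s (f s)) \<and>
    (\<forall>\<Theta> \<mu>. finite (set_pmf \<Theta>) \<longrightarrow> fn_dist \<Theta> \<subseteq> N \<longrightarrow> crun T \<Theta> \<mu> \<longrightarrow> dominated \<mu> (bind_pmf \<Delta> f) \<longrightarrow> \<Phi> \<Theta>))"

lemma charI:
  assumes "uses_ptest T N" "must \<or> live_ptest T" "\<And>s. s \<in> set_pmf \<Delta> \<Longrightarrow> run_ptest T s (f s)"
    "\<And>\<Theta> \<mu>. finite (set_pmf \<Theta>) \<Longrightarrow> fn_dist \<Theta> \<subseteq> N \<Longrightarrow> crun T \<Theta> \<mu> \<Longrightarrow> dominated \<mu> (bind_pmf \<Delta> f) \<Longrightarrow> \<Phi> \<Theta>"
  shows "testable must N \<Delta> \<Phi>"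
  unfolding testable_def using assms by blast

lemma charE:
  assumes "testable must N \<Delta> \<Phi>"
  obtains T f where "uses_ptest T N" "must \<or> live_ptest T" "\<forall>s\<in>set_pmf \<Delta>. run_ptest T s (f s)"
    "\<forall>\<Theta> \<mu>. finite (set_pmf \<Theta>) \<longrightarrow> fn_dist \<Theta> \<subseteq> N \<longrightarrow> crun T \<Theta> \<mu> \<longrightarrow> dominated \<mu> (bind_pmf \<Delta> f) \<longrightarrow> \<Phi> \<Theta>"
  using assms unfolding testable_def by blast

lemma testable_mono: "testable must N \<Delta> \<Phi> \<Longrightarrow> (\<And>\<Theta>. finite (set_pmf \<Theta>) \<Longrightarrow> fn_dist \<Theta> \<subseteq> N \<Longrightarrow> \<Phi> \<Theta> \<Longrightarrow> \<Psi> \<Theta>) \<Longrightarrow>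
  testable must N \<Delta> \<Psi>"
  unfolding testable_def by blast

lemma testable_top: "testable must N \<Delta> (\<lambda>_. True)"
  by (rule charI[where T = Leaf]) (auto intro: run_ptest_run_atest.leaf)

lemma pmf_mix: "pmf (mix \<mu> \<nu>) (Some (b # p)) = pmf (if b then \<nu> else \<mu>) (Some p) / 2"
proof -
  have *: "pmf (pre [b] \<mu>) (Some (c # p)) = (if b = c then pmf \<mu> (Some p) else 0)" for b c \<mu>
    using pmf_pre[of "[b]" \<mu> p] by (auto simp: set_pmf_iff[symmetric] Some_in_pre pmf_eq_0_set_pmf)
  show ?thesis unfolding mix_def pmf_bind by (auto simp: * field_simps)
qed

lemma dom_mix: "dominated (mix \<mu> \<nu>) (mix \<mu>' \<nu>') \<Longrightarrow> dominated \<mu> \<mu>' \<and> dominated \<nu> \<nu>'"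
proof -
  assume *: "dominated (mix \<mu> \<nu>) (mix \<mu>' \<nu>')"
  have "pmf (mix \<mu> \<nu>) (Some (b # p)) \<le> pmf (mix \<mu>' \<nu>') (Some (b # p))" for b p
    using * unfolding dominated_def by blast
  from this[of False] this[of True] show ?thesis by (simp add: pmf_mix dominated_def)
qed

lemma mix_bind: "bind_pmf p (\<lambda>x. mix (f x) (g x)) = mix (bind_pmf p f) (bind_pmf p g)"
  unfolding mix_def by (subst bind_commute_pmf) (auto simp: pre_bind intro!: bind_pmf_cong)

lemma crun_Mix:
  assumes "crun (Mix T U) \<Theta> \<mu>"
  shows "\<exists>\<mu>\<^sub>1 \<mu>\<^sub>2. \<mu> = mix \<mu>\<^sub>1 \<mu>\<^sub>2 \<and> crun T \<Theta> \<mu>\<^sub>1 \<and> crun U \<Theta> \<mu>\<^sub>2"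
proof -
  obtain q where q: "finite (set_pmf q)" "\<Theta> = map_pmf fst q" "\<mu> = bind_pmf q snd"
    "\<And>t \<nu>. (t, \<nu>) \<in> set_pmf q \<Longrightarrow> run_ptest (Mix T U) t \<nu>"
    using assms unfolding crun_def by blast
  have "\<exists>\<nu>\<^sub>1 \<nu>\<^sub>2. snd x = mix \<nu>\<^sub>1 \<nu>\<^sub>2 \<and> run_ptest T (fst x) \<nu>\<^sub>1 \<and> run_ptest U (fst x) \<nu>\<^sub>2" if
    "x \<in> set_pmf q" for x
  proof -
    have "run_ptest (Mix T U) (fst x) (snd x)" using q(4)[of "fst x" "snd x"] that by simp
    then show ?thesis by cases blast
  qed
  then obtain f g where fg: "\<And>x. x \<in> set_pmf q \<Longrightarrow> snd x = mix (f x) (g x) \<and>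
    run_ptest T (fst x) (f x) \<and> run_ptest U (fst x) (g x)" by metis
  have "crun T (bind_pmf q (\<lambda>x. return_pmf (fst x))) (bind_pmf q f)"
    "crun U (bind_pmf q (\<lambda>x. return_pmf (fst x))) (bind_pmf q g)"
    by (rule crun_bind[OF q(1)], rule crun_return, use fg in blast)+
  then have "crun T \<Theta> (bind_pmf q f)" "crun U \<Theta> (bind_pmf q g)" unfolding q(2)
    by (simp_all add: map_pmf_def)
  moreover have "\<mu> = mix (bind_pmf q f) (bind_pmf q g)"
    unfolding q(3) mix_bind[symmetric] using fg by (auto intro!: bind_pmf_cong)
  ultimately show ?thesis by blast
qed

text \<open>\<open>Mix\<close> keeps the leaves of the two templates apart, and the factor 1/2 is
  common to run and target, so that domination splits.\<close>

lemma testable_conj: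
  assumes "testable must N \<Delta> \<Phi>" "testable must N \<Delta> \<Psi>"
  shows "testable must N \<Delta> (\<lambda>\<Theta>. \<Phi> \<Theta> \<and> \<Psi> \<Theta>)"
proof -
  obtain T f where T: "uses_ptest T N" "must \<or> live_ptest T" "\<forall>s\<in>set_pmf \<Delta>. run_ptest T s (f s)"
    "\<forall>\<Theta> \<mu>. finite (set_pmf \<Theta>) \<longrightarrow> fn_dist \<Theta> \<subseteq> N \<longrightarrow> crun T \<Theta> \<mu> \<longrightarrow> dominated \<mu> (bind_pmf \<Delta> f) \<longrightarrow> \<Phi> \<Theta>"
    by (rule charE[OF assms(1)])
  note T = T(1,2) T(3,4)[rule_format]
  obtain U g where U: "uses_ptest U N" "must \<or> live_ptest U" "\<forall>s\<in>set_pmf \<Delta>. run_ptest U s (g s)"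
    "\<forall>\<Theta> \<mu>. finite (set_pmf \<Theta>) \<longrightarrow> fn_dist \<Theta> \<subseteq> N \<longrightarrow> crun U \<Theta> \<mu> \<longrightarrow> dominated \<mu> (bind_pmf \<Delta> g) \<longrightarrow> \<Psi> \<Theta>"
    by (rule charE[OF assms(2)])
  note U = U(1,2) U(3,4)[rule_format]
  show ?thesis
  proof (rule charI[where T = "Mix T U" and f = "\<lambda>s. mix (f s) (g s)"])
    fix \<Theta> \<mu> assume *: "finite (set_pmf \<Theta>)" "fn_dist \<Theta> \<subseteq> N" "crun (Mix T U) \<Theta> \<mu>"
      "dominated \<mu> (bind_pmf \<Delta> (\<lambda>s. mix (f s) (g s)))"
    from crun_Mix[OF *(3)] obtain \<mu>\<^sub>1 \<mu>\<^sub>2 where "\<mu> = mix \<mu>\<^sub>1 \<mu>\<^sub>2" "crun T \<Theta> \<mu>\<^sub>1" "crun U \<Theta> \<mu>\<^sub>2"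
      by blast
    moreover from this have "dominated \<mu>\<^sub>1 (bind_pmf \<Delta> f)" "dominated \<mu>\<^sub>2 (bind_pmf \<Delta> g)"
      using dom_mix *(4) unfolding mix_bind by blast+
    ultimately show "\<Phi> \<Theta> \<and> \<Psi> \<Theta>" using T(4) U(4) *(1,2) by blast
  qed (use T U in \<open>auto intro: run_ptest_run_atest.mix\<close>)
qed

lemma testable_ball: "finite X \<Longrightarrow> (\<And>x. x \<in> X \<Longrightarrow> testable must N \<Delta> (\<Phi> x)) \<Longrightarrow> testable must N \<Delta> (\<lambda>\<Theta>.
  \<forall>x\<in>X. \<Phi> x \<Theta>)"
proof (induction X rule: finite_induct)
  case empty
  then show ?case using testable_top by simp
next
  case (insert x X)
  then have "testable must N \<Delta> (\<lambda>\<Theta>. \<Phi> x \<Theta> \<and> (\<forall>x\<in>X. \<Phi> x \<Theta>))" by (intro testable_conj) auto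
  then show ?case by simp
qed

text \<open>In the reference run \<open>s\<close> makes its internal step before the tick, and the
  template then meets \<Delta>. The tested distribution answers with the weak move before its own
  tick.\<close>

lemma testable_tau:
  assumes "\<Delta> \<in> taus s" "testable must N \<Delta> \<Phi>"
  shows "testable must N (return_pmf s) (after_tau \<Phi>)"
proof -
  obtain T f where T: "uses_ptest T N" "must \<or> live_ptest T" "\<forall>s\<in>set_pmf \<Delta>. run_ptest T s (f s)"
    "\<forall>\<Theta> \<mu>. finite (set_pmf \<Theta>) \<longrightarrow> fn_dist \<Theta> \<subseteq> N \<longrightarrow> crun T \<Theta> \<mu> \<longrightarrow> dominated \<mu> (bind_pmf \<Delta> f) \<longrightarrow> \<Phi> \<Theta>"
    by (rule charE[OF assms(2)])
  note T = T(1,2) T(3,4)[rule_format]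
  show ?thesis
  proof (rule charI[where T = "Act (Tick T)" and f = "\<lambda>_. bind_pmf \<Delta> f"])
    show "run_ptest (Act (Tick T)) s' (bind_pmf \<Delta> f)" if "s' \<in> set_pmf (return_pmf s)" for s'
      using that T(3) by (intro run_ptest_run_atest.act run_ptest_run_atest.tau[OF assms(1),
        THEN back_subst[of "\<lambda>s. run_atest _ s _"]] run_atest_Tick) auto
    fix \<Theta> \<mu> assume *: "finite (set_pmf \<Theta>)" "fn_dist \<Theta> \<subseteq> N" "crun (Act (Tick T)) \<Theta> \<mu>"
      "dominated \<mu> (bind_pmf (return_pmf s) (\<lambda>_. bind_pmf \<Delta> f))"
    from crun_Tick[OF *(3,4)] obtain \<Theta>' \<mu>' where "weak_tau \<Theta> \<Theta>'" "crun T \<Theta>' \<mu>'"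
      "dominated \<mu>' (bind_pmf \<Delta> f)" by (auto simp: bind_return_pmf)
    then show "\<exists>\<Theta>'. weak_tau \<Theta> \<Theta>' \<and> \<Phi> \<Theta>'"
      using T(4)[of \<Theta>' \<mu>'] weak_tau_finite[of \<Theta> \<Theta>'] weak_tau_fn[of \<Theta> \<Theta>'] *(1,2) by blast
  qed (use T in auto)
qed

text \<open>The reference run communicates at once, so all of its leaves lie below
  \<open>\<pi>\<^sub>0\<close>.\<close>

lemma testable_probe:
  assumes D: "\<And>s'. s' \<in> set_pmf D \<Longrightarrow> run_ptest T\<^sub>0 s' (f s')" and c: "comm A s \<pi>\<^sub>0 T\<^sub>0 e D"
    and A: "uses_atest A N" "must \<or> live_ptest (Act A)"
    and comm: "\<And>t \<pi> T e \<Xi>. comm A t \<pi> T e \<Xi> \<Longrightarrow> \<pi> = \<pi>\<^sub>0 \<and> T = T\<^sub>0 \<and> R t \<Xi> \<or> live_ptest T \<and> (\<forall>p p'.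
      \<pi> @ p \<noteq> \<pi>\<^sub>0 @ p')"
    and tick: "\<And>t. \<exists>\<pi> T e \<Xi>. comm A t \<pi> T e \<Xi>"
    and \<Phi>: "\<And>\<Theta> \<Theta>\<^sub>1 \<Theta>\<^sub>2 \<mu>. finite (set_pmf \<Theta>) \<Longrightarrow> fn_dist \<Theta> \<subseteq> N \<Longrightarrow> weak_tau \<Theta> \<Theta>\<^sub>1 \<Longrightarrow> lift_rel R \<Theta>\<^sub>1 \<Theta>\<^sub>2 \<Longrightarrow>
      crun T\<^sub>0 \<Theta>\<^sub>2 \<mu> \<Longrightarrow> dominated \<mu> (bind_pmf D f) \<Longrightarrow> \<Phi> \<Theta>"
  shows "testable must N (return_pmf s) \<Phi>"
proof (rule charI[where T = "Act A" and f = "\<lambda>_. pre \<pi>\<^sub>0 (bind_pmf D f)"])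
  show "run_ptest (Act A) s' (pre \<pi>\<^sub>0 (bind_pmf D f))" if "s' \<in> set_pmf (return_pmf s)" for s'
    using that c D by (auto intro!: run_ptest_run_atest.act run_ptest_run_atest.comm)
  fix \<Theta> \<mu> assume *: "finite (set_pmf \<Theta>)" "fn_dist \<Theta> \<subseteq> N" "crun (Act A) \<Theta> \<mu>"
    "dominated \<mu> (bind_pmf (return_pmf s) (\<lambda>_. pre \<pi>\<^sub>0 (bind_pmf D f)))"
  have "dominated \<mu> (pre \<pi>\<^sub>0 (bind_pmf D f))" using *(4) by (simp add: bind_return_pmf)
  have "\<exists>\<Theta>\<^sub>1 \<Theta>\<^sub>2 \<mu>'. weak_tau \<Theta> \<Theta>\<^sub>1 \<and> lift_rel R \<Theta>\<^sub>1 \<Theta>\<^sub>2 \<and> crun T\<^sub>0 \<Theta>\<^sub>2 \<mu>' \<and>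
    dominated \<mu>' (bind_pmf D f)"
    by (rule crun_probe[OF *(3) \<open>dominated \<mu> (pre \<pi>\<^sub>0 (bind_pmf D f))\<close>]) (rule comm, assumption,
      rule tick)
  then obtain \<Theta>\<^sub>1 \<Theta>\<^sub>2 \<mu>' where
    "weak_tau \<Theta> \<Theta>\<^sub>1" "lift_rel R \<Theta>\<^sub>1 \<Theta>\<^sub>2" "crun T\<^sub>0 \<Theta>\<^sub>2 \<mu>'" "dominated \<mu>' (bind_pmf D f)" by blast
  then show "\<Phi> \<Theta>" using \<Phi> *(1,2) by blast
qed (use A in auto)

section \<open>Communications of a sum and of its summands\<close>

lemma comm_smdsD:
  assumes "comm A t \<pi> T e \<Xi>"
  shows "\<exists>\<rho> x \<pi>'. (\<rho>, x) \<in> summands A \<and> \<pi> = \<rho> @ \<pi>' \<and> comm x t \<pi>' T e \<Xi>"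
  using assms
proof cases
  case tick
  then show ?thesis by (intro exI[of _ \<pi>] exI[of _ "Tick T"] exI[of _ "[]"]) (auto intro: comm.tick)
next
  case (snd a w D)
  then show ?thesis by (intro exI[of _ \<pi>] exI[of _ "Snd a w T"] exI[of _
    "[]"]) (auto simp del: map_pmf_comp intro: comm.snd)
next
  case (snd_new a)
  then show ?thesis by (intro exI[of _ \<pi>] exI[of _ "SndNew a T"] exI[of _
    "[]"]) (auto intro: comm.snd_new)
next
  case (rcv_hit \<rho> a b U)
  then show ?thesis using comm.rcv_hit[of "[]" a b U "RcvEq a b U"] by (intro exI[of _ \<rho>] exI[of _
    "RcvEq a b U"] exI[of _ "[False]"]) auto
next
  case (rcv_miss \<rho> a b U c)
  then show ?thesis using comm.rcv_miss[of "[]" a b U "RcvEq a b U"] by (intro exI[of _ \<rho>] exI[of _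
    "RcvEq a b U"] exI[of _ "[True]"]) auto
next
  case (rcv_open \<rho> a b U)
  then show ?thesis using comm.rcv_open[of "[]" a b U "RcvEq a b U"] by (intro exI[of _ \<rho>] exI[of _
    "RcvEq a b U"] exI[of _ "[True]"]) auto
next
  case (new_old \<rho> a ns U c)
  then show ?thesis using comm.new_old[of "[]" a ns U "RcvNew a ns U"]
    by (intro exI[of _ \<rho>] exI[of _ "RcvNew a ns U"] exI[of _ "[True]"]) auto
next
  case (new_open \<rho> a ns U)
  then show ?thesis using comm.new_open[of "[]" a ns U "RcvNew a ns U"]
    by (intro exI[of _ \<rho>] exI[of _ "RcvNew a ns U"] exI[of _ "[False]"]) auto
qed

lemma comm_smdsI:
  assumes "(\<rho>, x) \<in> summands A" "comm x t \<pi> T e \<Xi>"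
  shows "comm A t (\<rho> @ \<pi>) T e \<Xi>"
proof -
  have *: "y = x \<and> \<sigma> = []" if "(\<sigma>, y) \<in> summands x" for \<sigma> y using that summands_basic[OF assms(1)]
    by auto
  from assms(2) show ?thesis
  proof cases
    case tick then show ?thesis using *[OF tick(3)] assms(1) by (auto intro: comm.tick)
  next
    case (snd a w D) then show ?thesis using *[OF snd(3)] assms(1)
      by (auto simp del: map_pmf_comp intro: comm.snd)
  next
    case (snd_new a) then show ?thesis using *[OF snd_new(2)] assms(1) by (auto intro: comm.snd_new)
  next
    case (rcv_hit \<sigma> a b U) then show ?thesis using *[OF rcv_hit(4)] assms(1) comm.rcv_hit[of \<rho> a b
      U A] by auto
  next
    case (rcv_miss \<sigma> a b U c) then show ?thesis using *[OF rcv_miss(4)] assms(1) comm.rcv_miss[of \<rho>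
      a b U A] by auto
  next
    case (rcv_open \<sigma> a b U) then show ?thesis using *[OF rcv_open(4)] assms(1) comm.rcv_open[of \<rho> a
      b U A] by auto
  next
    case (new_old \<sigma> a ns U c) then show ?thesis using *[OF new_old(4)] assms(1) comm.new_old[of \<rho> a
      ns U A] by auto
  next
    case (new_open \<sigma> a ns U) then show ?thesis using *[OF new_open(4)] assms(1) comm.new_open[of \<rho>
      a ns U A] by auto
  qed
qed

text \<open>The tick is a way out that is always open: it prevents deadlock, and its leaf betrays a
  tested state that avoids the intended communication.\<close>

abbreviation probe :: "atest \<Rightarrow> atest" where
  "probe x \<equiv> Plus (Tick Leaf) x"

lemma comm_probe:
  assumes "summands x = {([], x)}"
  shows "comm (probe x) t \<pi> T e \<Xi> \<longleftrightarrow> comm (Tick Leaf) t (tl \<pi>) T e \<Xi> \<and> \<pi> = [False] \<or>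
    (\<exists>\<rho>. \<pi> = True # \<rho> \<and> comm x t \<rho> T e \<Xi>)"
proof
  assume "comm (probe x) t \<pi> T e \<Xi>"
  from comm_smdsD[OF this] assms show "comm (Tick Leaf) t (tl \<pi>) T e \<Xi> \<and> \<pi> = [False] \<or>
    (\<exists>\<rho>. \<pi> = True # \<rho> \<and> comm x t \<rho> T e \<Xi>)"
    by (auto simp: comm_Tick)
next
  have 1: "([False], Tick Leaf) \<in> summands (probe x)" by simp
  have 2: "([True], x) \<in> summands (probe x)" using assms by simp
  assume "comm (Tick Leaf) t (tl \<pi>) T e \<Xi> \<and> \<pi> = [False] \<or> (\<exists>\<rho>. \<pi> = True # \<rho> \<and> comm x t \<rho> T e \<Xi>)"
  then show "comm (probe x) t \<pi> T e \<Xi>"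
    using comm_smdsI[OF 1, of t "[]"] comm_smdsI[OF 2] by auto
qed

lemma tick_probe: "\<exists>\<pi> T e \<Xi>. comm (probe x) t \<pi> T e \<Xi>"
  using comm.tick[of "[False]" Leaf "probe x" t] by auto

lemma live_probe: "live_atest x \<Longrightarrow> live_ptest (Act (probe x))"
  by auto

text \<open>In the address, \<open>True\<close> selects the reception and \<open>False\<close> the
  intended object. A different or extruded object leads to the leaf at \<open>[True, True]\<close>,
  outside the target.\<close>

lemma testable_out:
  assumes s: "(a, b, D) \<in> outs s" and N: "fn_state s \<subseteq> N" and D: "testable must N D \<Phi>"
  shows "testable must N (return_pmf s) (after_step (out_step a b) (after_tau \<Phi>))"
proof -
  obtain T f where T: "uses_ptest T N" "must \<or> live_ptest T" "\<forall>s\<in>set_pmf D. run_ptest T s (f s)"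
    "\<forall>\<Theta> \<mu>. finite (set_pmf \<Theta>) \<longrightarrow> fn_dist \<Theta> \<subseteq> N \<longrightarrow> crun T \<Theta> \<mu> \<longrightarrow> dominated \<mu> (bind_pmf D f) \<longrightarrow> \<Phi> \<Theta>"
    by (rule charE[OF D])
  note T = T(1,2) T(3,4)[rule_format]
  let ?x = "RcvEq a b T"
  have x: "summands ?x = {([], ?x)}" by simp
  show ?thesis
  proof (rule testable_probe[where A = "probe ?x" and \<pi>\<^sub>0 = "[True, False]" and T\<^sub>0 =
    "Act (Tick T)" and D = D and f = f and e = False and R = "out_step a b"])
    show "run_ptest (Act (Tick T)) s' (f s')" if "s' \<in> set_pmf D" for s' using T(3) that
      by (intro run_ptest_run_atest.act run_atest_Tick)
    show "comm (probe ?x) s [True, False] (Act (Tick T)) False D"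
      unfolding comm_probe[OF x] using comm.rcv_hit[of "[]" a b T ?x D s] s by simp
    show "uses_atest (probe ?x) N" using T(1) fn_outs[OF s] N by auto
    show "must \<or> live_ptest (Act (probe ?x))" using T(2) live_probe by auto
    show "\<pi> = [True, False] \<and> T' = Act (Tick T) \<and> out_step a b t \<Xi> \<or> live_ptest T' \<and> (\<forall>p p'.
      \<pi> @ p \<noteq> [True, False] @ p')"
      if "comm (probe ?x) t \<pi> T' e \<Xi>" for t \<pi> T' e \<Xi>
      using that unfolding comm_probe[OF x] comm_Tick
    proof (elim disjE exE conjE)
      fix \<rho> assume \<pi>: "\<pi> = True # \<rho>" and "comm ?x t \<rho> T' e \<Xi>"
      from this(2) show ?thesis by cases (use \<pi> in \<open>auto simp: out_step_def\<close>)
    qed simp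
    fix \<Theta> \<Theta>\<^sub>1 \<Theta>\<^sub>2 \<mu>
    assume *: "finite (set_pmf \<Theta>)" "fn_dist \<Theta> \<subseteq> N" "weak_tau \<Theta> \<Theta>\<^sub>1"
      "lift_rel (out_step a b) \<Theta>\<^sub>1 \<Theta>\<^sub>2"
      "crun (Act (Tick T)) \<Theta>\<^sub>2 \<mu>" "dominated \<mu> (bind_pmf D f)"
    from crun_Tick[OF *(5,6)] obtain \<Theta>\<^sub>3 \<mu>' where **: "weak_tau \<Theta>\<^sub>2 \<Theta>\<^sub>3" "crun T \<Theta>\<^sub>3 \<mu>'"
      "dominated \<mu>' (bind_pmf D f)" by blast
    have "finite (set_pmf \<Theta>\<^sub>2)" by (rule lift_rel_image_finite[OF *(4)]) (auto simp: out_step_def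
      dest: fin_outs)
    moreover have "fn_dist \<Theta>\<^sub>2 \<subseteq> N" using fn_lift_out_step[OF *(4)] weak_tau_fn[OF *(3)] *(2)
      by blast
    ultimately have "\<Phi> \<Theta>\<^sub>3" using T(4)[OF _ _ **(2,3)] weak_tau_finite[OF **(1)] weak_tau_fn[OF
      **(1)] by blast
    with *(3,4) **(1) show "after_step (out_step a b) (after_tau \<Phi>) \<Theta>" by blast
  qed (rule tick_probe)
qed

text \<open>Free outputs have objects in \<open>N\<close> and are caught by the comparison; only an
  extruded name passes, and the continuation sees it as index 0.\<close>

lemma testable_bout:
  assumes s: "(a, D) \<in> bouts s" and N: "finite N" "fn_state s \<subseteq> N" and D:
    "testable must (insert 0 (Suc ` N)) D \<Phi>"
  shows "testable must N (return_pmf s) (after_step (bout_step a) (after_tau \<Phi>))"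
proof -
  let ?N = "insert 0 (Suc ` N)"
  obtain T f where T: "uses_ptest T ?N" "must \<or> live_ptest T" "\<forall>s\<in>set_pmf D. run_ptest T s (f s)"
    "\<forall>\<Theta> \<mu>. finite (set_pmf \<Theta>) \<longrightarrow> fn_dist \<Theta> \<subseteq> ?N \<longrightarrow> crun T \<Theta> \<mu> \<longrightarrow> dominated \<mu> (bind_pmf D f) \<longrightarrow> \<Phi> \<Theta>"
    by (rule charE[OF D])
  note T = T(1,2) T(3,4)[rule_format]
  let ?x = "RcvNew a (sorted_list_of_set N) T"
  have x: "summands ?x = {([], ?x)}" by simp
  show ?thesis
  proof (rule testable_probe[where A = "probe ?x" and \<pi>\<^sub>0 = "[True, False]" and T\<^sub>0 =
    "Act (Tick T)" and D = D and f = f and e = True and R = "bout_step a"])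
    show "run_ptest (Act (Tick T)) s' (f s')" if "s' \<in> set_pmf D" for s' using T(3) that
      by (intro run_ptest_run_atest.act run_atest_Tick)
    show "comm (probe ?x) s [True, False] (Act (Tick T)) True D"
      unfolding comm_probe[OF x] using comm.new_open[of "[]" a "sorted_list_of_set N" T ?x D s] s
        by simp
    show "uses_atest (probe ?x) N" using T(1) fn_bouts[OF s] N by auto
    show "must \<or> live_ptest (Act (probe ?x))" using T(2) live_probe by auto
    show "\<pi> = [True, False] \<and> T' = Act (Tick T) \<and> bout_step a t \<Xi> \<or> live_ptest T' \<and> (\<forall>p p'.
      \<pi> @ p \<noteq> [True, False] @ p')"
      if "comm (probe ?x) t \<pi> T' e \<Xi>" for t \<pi> T' e \<Xi>
      using that unfolding comm_probe[OF x] comm_Tick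
    proof (elim disjE exE conjE)
      fix \<rho> assume \<pi>: "\<pi> = True # \<rho>" and "comm ?x t \<rho> T' e \<Xi>"
      from this(2) show ?thesis by cases (use \<pi> in \<open>auto simp: bout_step_def\<close>)
    qed simp
    fix \<Theta> \<Theta>\<^sub>1 \<Theta>\<^sub>2 \<mu>
    assume *: "finite (set_pmf \<Theta>)" "fn_dist \<Theta> \<subseteq> N" "weak_tau \<Theta> \<Theta>\<^sub>1" "lift_rel (bout_step a) \<Theta>\<^sub>1 \<Theta>\<^sub>2"
      "crun (Act (Tick T)) \<Theta>\<^sub>2 \<mu>" "dominated \<mu> (bind_pmf D f)"
    from crun_Tick[OF *(5,6)] obtain \<Theta>\<^sub>3 \<mu>' where **: "weak_tau \<Theta>\<^sub>2 \<Theta>\<^sub>3" "crun T \<Theta>\<^sub>3 \<mu>'"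
      "dominated \<mu>' (bind_pmf D f)" by blast
    have "finite (set_pmf \<Theta>\<^sub>2)" by (rule lift_rel_image_finite[OF *(4)]) (auto simp: bout_step_def
      dest: fin_bouts)
    moreover have "fn_dist \<Theta>\<^sub>2 \<subseteq> ?N" using fn_lift_bout_step[OF *(4)] weak_tau_fn[OF *(3)] *(2)
      by blast
    ultimately have "\<Phi> \<Theta>\<^sub>3" using T(4)[OF _ _ **(2,3)] weak_tau_finite[OF **(1)] weak_tau_fn[OF
      **(1)] by blast
    with *(3,4) **(1) show "after_step (bout_step a) (after_tau \<Phi>) \<Theta>" by blast
  qed (rule tick_probe)
qed

text \<open>A private name is sent, which the tested state cannot know: this is the generic received
  name.\<close>

lemma testable_in_new:
  assumes s: "(a, D) \<in> ins s" and N: "fn_state s \<subseteq> N" and D: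
    "testable must (insert 0 (Suc ` N)) D \<Phi>"
  shows "testable must N (return_pmf s) (after_step (in_step a) \<Phi>)"
proof -
  let ?N = "insert 0 (Suc ` N)"
  obtain T f where T: "uses_ptest T ?N" "must \<or> live_ptest T" "\<forall>s\<in>set_pmf D. run_ptest T s (f s)"
    "\<forall>\<Theta> \<mu>. finite (set_pmf \<Theta>) \<longrightarrow> fn_dist \<Theta> \<subseteq> ?N \<longrightarrow> crun T \<Theta> \<mu> \<longrightarrow> dominated \<mu> (bind_pmf D f) \<longrightarrow> \<Phi> \<Theta>"
    by (rule charE[OF D])
  note T = T(1,2) T(3,4)[rule_format]
  let ?x = "SndNew a T"
  have x: "summands ?x = {([], ?x)}" by simp
  show ?thesis
  proof (rule testable_probe[where A = "probe ?x" and \<pi>\<^sub>0 = "[True]" and T\<^sub>0 = T and D = D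
    and f = f and e = True and R = "in_step a"])
    show "run_ptest T s' (f s')" if "s' \<in> set_pmf D" for s' using T(3) that .
    show "comm (probe ?x) s [True] T True D"
      unfolding comm_probe[OF x] using comm.snd_new[of "[]" a T ?x D s] s by simp
    show "uses_atest (probe ?x) N" using T(1) fn_ins[OF s] N by auto
    show "must \<or> live_ptest (Act (probe ?x))" using T(2) live_probe by auto
    show "\<pi> = [True] \<and> T' = T \<and> in_step a t \<Xi> \<or> live_ptest T' \<and> (\<forall>p p'. \<pi> @ p \<noteq> [True] @ p')"
      if "comm (probe ?x) t \<pi> T' e \<Xi>" for t \<pi> T' e \<Xi>
      using that unfolding comm_probe[OF x] comm_Tick
    proof (elim disjE exE conjE)
      fix \<rho> assume \<pi>: "\<pi> = True # \<rho>" and "comm ?x t \<rho> T' e \<Xi>"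
      from this(2) show ?thesis by cases (use \<pi> in \<open>auto simp: in_step_def\<close>)
    qed simp
    fix \<Theta> \<Theta>\<^sub>1 \<Theta>\<^sub>2 \<mu>
    assume *: "finite (set_pmf \<Theta>)" "fn_dist \<Theta> \<subseteq> N" "weak_tau \<Theta> \<Theta>\<^sub>1" "lift_rel (in_step a) \<Theta>\<^sub>1 \<Theta>\<^sub>2"
      "crun T \<Theta>\<^sub>2 \<mu>" "dominated \<mu> (bind_pmf D f)"
    have "finite (set_pmf \<Theta>\<^sub>2)" by (rule lift_rel_image_finite[OF *(4)]) (auto simp: in_step_def
      dest: fin_ins)
    moreover have "fn_dist \<Theta>\<^sub>2 \<subseteq> ?N" using fn_lift_in_step[OF *(4)] weak_tau_fn[OF *(3)] *(2)
      by blast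
    ultimately have "\<Phi> \<Theta>\<^sub>2" using T(4)[OF _ _ *(5,6)] by blast
    with *(3,4) show "after_step (in_step a) \<Phi> \<Theta>" by blast
  qed (rule tick_probe)
qed

text \<open>The test meets a derivative only after it has been opened with the sent name; this
  recovers the open derivatives behind it.\<close>

lemma lift_rel_factor:
  assumes "lift_rel (\<lambda>t \<Xi>. \<exists>E. R t E \<and> \<Xi> = ren_dist g E) \<Theta>\<^sub>1 \<Theta>\<^sub>2"
  shows "\<exists>\<Theta>'. lift_rel R \<Theta>\<^sub>1 \<Theta>' \<and> \<Theta>\<^sub>2 = ren_dist g \<Theta>'"
proof -
  obtain q where q: "finite (set_pmf q)" "\<Theta>\<^sub>1 = map_pmf fst q" "\<Theta>\<^sub>2 = bind_pmf q snd"
    "\<forall>(t, \<Xi>)\<in>set_pmf q. \<exists>E. R t E \<and> \<Xi> = ren_dist g E" using assms unfolding lift_rel_coupling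
      by blast
  then have "\<forall>x\<in>set_pmf q. \<exists>E. R (fst x) E \<and> snd x = ren_dist g E" by auto
  then obtain E where E: "\<And>x. x \<in> set_pmf q \<Longrightarrow> R (fst x) (E x) \<and> snd x = ren_dist g (E x)" by metis
  have "lift_rel R (bind_pmf q (\<lambda>x. return_pmf (fst x))) (bind_pmf q E)"
    by (rule lift_rel_bind[OF q(1)], rule lift_rel.point) (use E in blast)
  then have "lift_rel R \<Theta>\<^sub>1 (bind_pmf q E)" unfolding q(2) by (simp add: map_pmf_def)
  moreover have "\<Theta>\<^sub>2 = ren_dist g (bind_pmf q E)" unfolding q(3) map_bind_pmf using E
    by (auto intro!: bind_pmf_cong)
  ultimately show ?thesis by blast
qed

text \<open>Each known name needs a test of its own, since a received name equal to a known one may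
  decide comparisons otherwise than the generic name does.\<close>

lemma testable_in:
  assumes s: "(a, D) \<in> ins s" and N: "fn_state s \<subseteq> N" and w: "w \<in> N" and D:
    "testable must N (ren_dist (inst w) D) \<Phi>"
  shows "testable must N (return_pmf s) (after_step (in_step a) (\<lambda>\<Theta>. \<Phi> (ren_dist (inst w) \<Theta>)))"
proof -
  let ?D = "ren_dist (inst w) D"
  obtain T f where T: "uses_ptest T N" "must \<or> live_ptest T" "\<forall>s\<in>set_pmf ?D. run_ptest T s (f s)"
    "\<forall>\<Theta> \<mu>. finite (set_pmf \<Theta>) \<longrightarrow> fn_dist \<Theta> \<subseteq> N \<longrightarrow> crun T \<Theta> \<mu> \<longrightarrow> dominated \<mu> (bind_pmf ?D f) \<longrightarrow> \<Phi> \<Theta>"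
    by (rule charE[OF D])
  note T = T(1,2) T(3,4)[rule_format]
  let ?x = "Snd a w T"
  let ?R = "\<lambda>t \<Xi>. \<exists>E. in_step a t E \<and> \<Xi> = ren_dist (inst w) E"
  have x: "summands ?x = {([], ?x)}" by simp
  show ?thesis
  proof (rule testable_probe[where A = "probe ?x" and \<pi>\<^sub>0 = "[True]" and T\<^sub>0 = T and D = ?D
    and f = f and e = False and R = ?R])
    show "run_ptest T s' (f s')" if "s' \<in> set_pmf ?D" for s' using T(3) that .
    show "comm (probe ?x) s [True] T False ?D"
      unfolding comm_probe[OF x] using comm.snd[of "[]" a w T ?x D s] s by simp
    show "uses_atest (probe ?x) N" using T(1) fn_ins[OF s] N w by auto
    show "must \<or> live_ptest (Act (probe ?x))" using T(2) live_probe by auto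
    show "\<pi> = [True] \<and> T' = T \<and> ?R t \<Xi> \<or> live_ptest T' \<and> (\<forall>p p'. \<pi> @ p \<noteq> [True] @ p')"
      if "comm (probe ?x) t \<pi> T' e \<Xi>" for t \<pi> T' e \<Xi>
      using that unfolding comm_probe[OF x] comm_Tick
    proof (elim disjE exE conjE)
      fix \<rho> assume \<pi>: "\<pi> = True # \<rho>" and "comm ?x t \<rho> T' e \<Xi>"
      from this(2) show ?thesis by cases (use \<pi> in \<open>auto simp: in_step_def simp del: map_pmf_comp\<close>)
    qed simp
    fix \<Theta> \<Theta>\<^sub>1 \<Theta>\<^sub>2 \<mu>
    assume *: "finite (set_pmf \<Theta>)" "fn_dist \<Theta> \<subseteq> N" "weak_tau \<Theta> \<Theta>\<^sub>1" "lift_rel ?R \<Theta>\<^sub>1 \<Theta>\<^sub>2"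
      "crun T \<Theta>\<^sub>2 \<mu>" "dominated \<mu> (bind_pmf ?D f)"
    obtain \<Xi> where \<Xi>: "lift_rel (in_step a) \<Theta>\<^sub>1 \<Xi>" "\<Theta>\<^sub>2 = ren_dist (inst w) \<Xi>"
      using lift_rel_factor[OF *(4)] by blast
    have "finite (set_pmf \<Xi>)" by (rule lift_rel_image_finite[OF \<Xi>(1)]) (auto simp: in_step_def
      dest: fin_ins)
    then have "finite (set_pmf \<Theta>\<^sub>2)" unfolding \<Xi>(2) by simp
    moreover have "fn_dist \<Xi> \<subseteq> insert 0 (Suc ` N)" using fn_lift_in_step[OF \<Xi>(1)] weak_tau_fn[OF
      *(3)] *(2) by blast
    then have "fn_dist \<Theta>\<^sub>2 \<subseteq> N" unfolding \<Xi>(2) using w by auto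
    ultimately have "\<Phi> \<Theta>\<^sub>2" using T(4)[OF _ _ *(5,6)] by blast
    with *(3) \<Xi> show "after_step (in_step a) (\<lambda>\<Theta>. \<Phi> (ren_dist (inst w) \<Theta>)) \<Theta>" by blast
  qed (rule tick_probe)
qed

primrec plus_list :: "atest list \<Rightarrow> atest" where
  "plus_list [] = Stop"
| "plus_list (x # xs) = Plus x (plus_list xs)"

text \<open>Address of summand number \<open>i\<close> in a right-nested sum. The closing
  \<open>False\<close> makes keys prefix-free, so that addresses below different summands never
  meet.\<close>

definition key :: "nat \<Rightarrow> path" where
  "key i = replicate i True @ [False]"

lemma key_append_eq: "key i @ p = key j @ p' \<longleftrightarrow> i = j \<and> p = p'"
proof (induction i arbitrary: j)
  case 0
  then show ?case by (cases j) (auto simp: key_def)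
next
  case (Suc i)
  then show ?case by (cases j) (auto simp: key_def)
qed

lemma summands_plus_list:
  "(\<And>x. x \<in> set xs \<Longrightarrow> summands x = {([], x)}) \<Longrightarrow>
    (\<pi>, y) \<in> summands (plus_list xs) \<longleftrightarrow> (\<exists>i<length xs. \<pi> = key i \<and> y = xs ! i)"
proof (induction xs arbitrary: \<pi>)
  case (Cons x xs)
  have k: "key 0 = [False]" "True # key i = key (Suc i)" for i by (simp_all add: key_def)
  have "summands x = {([], x)}" using Cons.prems by simp
  moreover have IH: "(\<rho>, y) \<in> summands (plus_list xs) \<longleftrightarrow> (\<exists>i<length xs. \<rho> = key i \<and> y = xs ! i)"
    for \<rho>
    using Cons by simp
  ultimately show ?case
    unfolding plus_list.simps mem_summands_Plus length_Cons Ex_less_Suc2 k(2)[symmetric]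
      by (auto simp: k(1))
qed simp

lemma uses_atest_plus_list: "uses_atest (plus_list xs) N \<longleftrightarrow> (\<forall>x\<in>set xs. uses_atest x N)"
  and live_atest_plus_list: "live_atest (plus_list xs) \<longleftrightarrow> (\<forall>x\<in>set xs. live_atest x)"
  by (induction xs) auto

text \<open>The test offers a partner for those ports over \<open>N\<close> that \<open>s\<close>
  lacks, and no tick. As \<open>s\<close> gets stuck, its target gives no weight to any leaf. A run
  below the target must then end stuck everywhere, in states without internal steps and without
  those ports; ports outside \<open>N\<close> cannot occur.\<close>

lemma testable_ref:
  assumes N: "finite N" "fn_state s \<subseteq> N" and s: "taus s = {}"
  shows "testable True N (return_pmf s) 
    (after_tau (\<lambda>\<Theta>. \<forall>t\<in>set_pmf \<Theta>. taus t = {} \<and> (\<forall>\<mu>. barb t \<mu> \<longrightarrow> barb s \<mu>)))"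
proof -
  define ns where "ns = sorted_list_of_set N"
  have ns: "set ns = N" using N(1) by (simp add: ns_def)
  define xs where "xs = map (\<lambda>a. Snd a a Leaf) (filter (\<lambda>a. \<not> barb s (Name a)) ns) @
    map (\<lambda>a. RcvEq a a Leaf) (filter (\<lambda>a. \<not> barb s (Coname a)) ns)"
  let ?A = "plus_list xs"
  have xs: "x \<in> set xs \<longleftrightarrow> (\<exists>a\<in>N. x = Snd a a Leaf \<and> \<not> barb s (Name a) \<or> x = RcvEq a a Leaf \<and>
    \<not> barb s (Coname a))" for x
    unfolding xs_def using ns by (auto simp del: barb.simps)
  then have basic: "summands x = {([], x)}" if "x \<in> set xs" for x using that by auto
  have mem: "y \<in> set xs" if "(\<pi>, y) \<in> summands ?A" for \<pi> y
    using that summands_plus_list[OF basic, of xs] by auto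
  have comm: "\<exists>\<pi> T e \<Xi>. comm ?A t \<pi> T e \<Xi>" if "x \<in> set xs" "comm x t \<pi> T e \<Xi>" for x t \<pi> T e \<Xi>
  proof -
    obtain i where "i < length xs" "x = xs ! i" using \<open>x \<in> set xs\<close> by (auto simp: in_set_conv_nth)
    then have "(key i, x) \<in> summands ?A" using summands_plus_list[OF basic, of xs] by auto
    from comm_smdsI[OF this that(2)] show ?thesis by blast
  qed
  have dead: "\<nexists>\<pi> T e \<Xi>. comm ?A s \<pi> T e \<Xi>"
  proof clarify
    fix \<pi> T e \<Xi> assume "comm ?A s \<pi> T e \<Xi>"
    then obtain x \<pi>' where "x \<in> set xs" "comm x s \<pi>' T e \<Xi>" using comm_smdsD mem by blast
    from this(2) show False
      by cases (use \<open>x \<in> set xs\<close> xs in \<open>auto simp: barb_iff simp del: barb.simps\<close>)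
  qed
  have live: "live_ptest T" if "comm ?A t \<pi> T e \<Xi>" for t \<pi> T e \<Xi>
    by (rule comm_live[OF that]) (auto simp: live_atest_plus_list xs)
  show ?thesis
  proof (rule charI[where T = "Act ?A" and f = "\<lambda>_. return_pmf None"])
    show "uses_ptest (Act ?A) N" by (auto simp: uses_atest_plus_list xs)
    show "run_ptest (Act ?A) s' (return_pmf None)" if "s' \<in> set_pmf (return_pmf s)" for s'
      using that s dead by (auto intro!: run_ptest_run_atest.act run_ptest_run_atest.dead)
    fix \<Theta> \<mu> assume *: "finite (set_pmf \<Theta>)" "fn_dist \<Theta> \<subseteq> N" "crun (Act ?A) \<Theta> \<mu>"
      "dominated \<mu> (bind_pmf (return_pmf s) (\<lambda>_. return_pmf None))"
    obtain q where q: "finite (set_pmf q)" "weak_tau \<Theta> (map_pmf fst q)" "\<mu> = bind_pmf q snd"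
      "\<And>t \<nu>. (t, \<nu>) \<in> set_pmf q \<Longrightarrow> stop ?A t \<nu>" using crun_decompose[OF *(3)] by blast
    have none: "Some p \<notin> set_pmf \<mu>" for p using dom_support[OF *(4), of p]
      by (auto simp: bind_return_pmf)
    have "taus t = {} \<and> (\<forall>\<mu>. barb t \<mu> \<longrightarrow> barb s \<mu>)" if t: "t \<in> set_pmf (map_pmf fst q)" for t
    proof -
      obtain \<nu> where \<nu>: "(t, \<nu>) \<in> set_pmf q" using t by auto
      have "taus t = {} \<and> (\<nexists>\<pi> T e \<Xi>. comm ?A t \<pi> T e \<Xi>)"
        using q(4)[OF \<nu>]
      proof cases
        case (comm \<pi> T e \<Xi> f)
        then obtain p where "Some (\<pi> @ p) \<in> set_pmf \<nu>" using comm_Some[OF comm(2,3)] live by blast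
        with \<nu> none[of "\<pi> @ p"] show ?thesis unfolding q(3) by force
      qed blast
      moreover have tN: "fn_state t \<subseteq> N" using t weak_tau_fn[OF q(2)] *(2) unfolding fn_dist_def
        by blast
      moreover have "barb s (Name a)" if a: "barb t (Name a)" and no: "\<nexists>\<pi> T e \<Xi>. comm ?A t \<pi> T e \<Xi>"
        for a
      proof (rule ccontr)
        assume "\<not> barb s (Name a)"
        obtain D where D: "(a, D) \<in> ins t" using a unfolding barb_iff by blast
        then have "a \<in> N" using fn_ins[OF D] tN by blast
        then have "Snd a a Leaf \<in> set xs" using \<open>\<not> barb s (Name a)\<close> unfolding xs by blast
        from no comm[OF this comm.snd[of "[]" a a Leaf "Snd a a Leaf" D t]] D show False by simp
      qed
      moreover have "barb s (Coname a)" if a: "barb t (Coname a)" and no: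
        "\<nexists>\<pi> T e \<Xi>. comm ?A t \<pi> T e \<Xi>" for a
      proof (rule ccontr)
        assume ns: "\<not> barb s (Coname a)"
        from a consider b D where "(a, b, D) \<in> outs t" | D where "(a, D) \<in> bouts t"
          unfolding barb_iff by blast
        then show False
        proof cases
          case (1 b D)
          then have "a \<in> N" using fn_outs[OF 1] tN by blast
          then have x: "RcvEq a a Leaf \<in> set xs" using ns unfolding xs by blast
          \<comment> \<open>Every object is accepted, as a hit or as a miss; what counts is that a
            communication is possible.\<close>
          have "\<exists>\<pi> T e \<Xi>. comm (RcvEq a a Leaf) t \<pi> T e \<Xi>"
            using comm.rcv_hit[of "[]" a a Leaf "RcvEq a a Leaf" D t] comm.rcv_miss[of
              "[]" a a Leaf "RcvEq a a Leaf" b D t] 1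
            by (cases "b = a") auto
          with no comm[OF x] show False by blast
        next
          case (2 D)
          then have "a \<in> N" using fn_bouts[OF 2] tN by blast
          then have x: "RcvEq a a Leaf \<in> set xs" using ns unfolding xs by blast
          from no comm[OF x comm.rcv_open[of "[]" a a Leaf "RcvEq a a Leaf" D t]] 2 show False
            by simp
        qed
      qed
      ultimately show ?thesis by (metis port.exhaust)
    qed
    with q(2) show "after_tau (\<lambda>\<Theta>. \<forall>t\<in>set_pmf \<Theta>. taus t = {} \<and> (\<forall>\<mu>. barb t \<mu> \<longrightarrow> barb s \<mu>)) \<Theta>"
      by blast
  qed simp
qed

section \<open>Comparison and disintegration of finite distributions\<close>

lemma pmf_le_eq:
  assumes fin: "finite (set_pmf p)" and le: "\<And>x. x \<in> set_pmf p \<Longrightarrow> pmf q x \<le> pmf p x" and sub: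
    "set_pmf q \<subseteq> set_pmf p"
  shows "q = p"
proof (rule pmf_eqI)
  fix x
  have "(\<Sum>x\<in>set_pmf p. pmf p x) = 1" "(\<Sum>x\<in>set_pmf p. pmf q x) = 1"
    using fin sub by (simp_all add: sum_pmf_eq_1)
  then have "(\<Sum>x\<in>set_pmf p. pmf p x - pmf q x) = 0" by (simp add: sum_subtractf)
  then have "\<forall>x\<in>set_pmf p. pmf p x - pmf q x = 0" using le fin
    by (subst (asm) sum_nonneg_eq_0_iff) auto
  then show "pmf q x = pmf p x"
  proof (cases "x \<in> set_pmf p")
    case False
    then have "x \<notin> set_pmf q" using sub by blast
    with False show ?thesis by (simp add: set_pmf_iff)
  qed simp
qed

lemma pmf_bind_unique:
  assumes fin: "finite (set_pmf p)" and 0: "\<And>i. i \<in> set_pmf p \<Longrightarrow> i \<noteq> j \<Longrightarrow> pmf (F i) x = 0"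
  shows "pmf (bind_pmf p F) x = pmf p j * pmf (F j) x"
proof -
  have "pmf (bind_pmf p F) x = (\<Sum>i\<in>insert j (set_pmf p). pmf p i * pmf (F i) x)"
    unfolding pmf_bind using fin by (subst integral_measure_pmf[of "insert j (set_pmf p)"]) auto
  also have "\<dots> = (\<Sum>i\<in>insert j (set_pmf p). if i = j then pmf p j * pmf (F j) x else 0)"
    by (rule sum.cong) (use 0 in auto)
  finally show ?thesis using fin by simp
qed

text \<open>Disintegration along \<open>c\<close>: the value of \<open>c\<close> is drawn, and then
  a point of its fibre.\<close>

lemma bind_map_cond_pmf:
  "bind_pmf (map_pmf c q) (\<lambda>s. cond_pmf q {x. c x = s}) = q"
proof (rule bind_cond_pmf_cancel)
  fix x y assume "x \<in> set_pmf (map_pmf c q)" "y \<in> set_pmf q" "c y = x"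
  then have "{x'. c y = x'} = {x}" by auto
  then show "measure (measure_pmf q) {y. c y = x} = measure (measure_pmf (map_pmf c q)) {x. c y =
    x}"
    by (simp add: vimage_def)
qed auto

text \<open>There is one branch for each state in the support of \<Delta>. The branch that a run
  chooses for a part of the tested distribution pairs this part with a state, and these pairs make
  up the lifting.\<close>

lemma testable_dist:
  assumes fin: "finite (set_pmf \<Delta>)" and testable: "\<And>s. s \<in> set_pmf \<Delta> \<Longrightarrow>
    testable must N (return_pmf s) (\<Phi> s)"
  shows "testable must N \<Delta> (after_tau (lift_rel \<Phi> \<Delta>))"
proof -
  define passes where "passes s T v \<longleftrightarrow> uses_ptest T N \<and> (must \<or> live_ptest T) \<and> run_ptest T s v \<and>
    (\<forall>\<Theta> \<mu>. finite (set_pmf \<Theta>) \<longrightarrow> fn_dist \<Theta> \<subseteq> N \<longrightarrow> crun T \<Theta> \<mu> \<longrightarrow> dominated \<mu> v \<longrightarrow> \<Phi> s \<Theta>)" for s T v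
  have "\<exists>T v. uses_ptest T N \<and> (must \<or> live_ptest T) \<and> run_ptest T s v \<and>
    (\<forall>\<Theta> \<mu>. finite (set_pmf \<Theta>) \<longrightarrow> fn_dist \<Theta> \<subseteq> N \<longrightarrow> crun T \<Theta> \<mu> \<longrightarrow> dominated \<mu> v \<longrightarrow> \<Phi> s \<Theta>)"
    if "s \<in> set_pmf \<Delta>" for s
    using testable[OF that] unfolding testable_def by (auto simp: bind_return_pmf)
  then have "\<forall>s\<in>set_pmf \<Delta>. \<exists>T v. passes s T v" by (simp add: passes_def)
  then obtain T where "\<forall>s\<in>set_pmf \<Delta>. \<exists>v. passes s (T s) v" by (rule bchoice[THEN exE])
  then obtain v where "\<forall>s\<in>set_pmf \<Delta>. passes s (T s) (v s)" by (rule bchoice[THEN exE])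
  then have T: "\<And>s. s \<in> set_pmf \<Delta> \<Longrightarrow> uses_ptest (T s) N" "\<And>s. s \<in> set_pmf \<Delta> \<Longrightarrow> must \<or>
    live_ptest (T s)"
    "\<And>s. s \<in> set_pmf \<Delta> \<Longrightarrow> run_ptest (T s) s (v s)"
    "\<And>s \<Theta> \<mu>. s \<in> set_pmf \<Delta> \<Longrightarrow> finite (set_pmf \<Theta>) \<Longrightarrow> fn_dist \<Theta> \<subseteq> N \<Longrightarrow> crun (T s) \<Theta> \<mu> \<Longrightarrow>
      dominated \<mu> (v s) \<Longrightarrow> \<Phi> s \<Theta>"
    unfolding passes_def by blast+
  obtain ss where ss: "set ss = set_pmf \<Delta>" "distinct ss" using finite_distinct_list[OF fin] by blast
  define branch where "branch s = Tick (Mix Leaf (T s))" for s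
  define A where "A = plus_list (map branch ss)"
  have "\<exists>i<length ss. ss ! i = s" if "s \<in> set_pmf \<Delta>" for s using that ss(1)
    by (metis in_set_conv_nth)
  then obtain ix where ix: "\<And>s. s \<in> set_pmf \<Delta> \<Longrightarrow> ix s < length ss \<and> ss ! ix s = s" by metis
  have ix_inj: "s = s'" if "ix s = ix s'" "s \<in> set_pmf \<Delta>" "s' \<in> set_pmf \<Delta>" for s s' using ix that
    by metis
  have summands: "(\<pi>, y) \<in> summands A \<longleftrightarrow> (\<exists>s\<in>set_pmf \<Delta>. \<pi> = key (ix s) \<and> y = branch s)" for \<pi> y
  proof -
    have "(\<pi>, y) \<in> summands A \<longleftrightarrow> (\<exists>i<length ss. \<pi> = key i \<and> y = branch (ss ! i))"
    proof -
      have "summands x = {([], x)}" if "x \<in> set (map branch ss)" for x using that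
        by (auto simp: branch_def)
      from summands_plus_list[of "map branch ss", OF this] show ?thesis unfolding A_def by auto
    qed
    also have "\<dots> \<longleftrightarrow> (\<exists>s\<in>set_pmf \<Delta>. \<pi> = key (ix s) \<and> y = branch s)"
      using ix ss nth_mem by (metis distinct_conv_nth)
    finally show ?thesis .
  qed
  have commA: "comm A t \<pi> U e \<Xi> \<longleftrightarrow> (\<exists>s\<in>set_pmf \<Delta>. \<pi> = key (ix s) \<and> U = Mix Leaf (T s) \<and> e = False \<and>
    \<Xi> = return_pmf t)" for t \<pi> U e \<Xi>
  proof
    assume "comm A t \<pi> U e \<Xi>"
    from comm_smdsD[OF this] show "\<exists>s\<in>set_pmf \<Delta>. \<pi> = key (ix s) \<and> U = Mix Leaf (T s) \<and> e = False \<and>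
      \<Xi> = return_pmf t"
      by (auto simp: summands branch_def comm_Tick)
  next
    assume "\<exists>s\<in>set_pmf \<Delta>. \<pi> = key (ix s) \<and> U = Mix Leaf (T s) \<and> e = False \<and> \<Xi> = return_pmf t"
    moreover from this have "(\<pi>, Tick U) \<in> summands A" unfolding summands branch_def by blast
    ultimately show "comm A t \<pi> U e \<Xi>" using comm.tick[of \<pi> U A t] by auto
  qed
  define leaf where "leaf = return_pmf (Some ([] :: path))"
  define G where "G m s = pre (key (ix s)) (mix leaf (m s))" for m s
  \<comment> \<open>Keys separate the branches, so an address has the weight of its branch times its
    weight inside the branch, halved by \<open>Mix\<close>.\<close>
  have pmfG: "pmf (bind_pmf p (G m)) (Some (key (ix s) @ b # \<rho>)) =
    pmf p s * (pmf (if b then m s else leaf) (Some \<rho>) / 2)"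
    if "finite (set_pmf p)" "set_pmf p \<subseteq> set_pmf \<Delta>" "s \<in> set_pmf \<Delta>" for p m s b \<rho>
  proof (subst pmf_bind_unique[OF that(1), of s])
    fix i assume i: "i \<in> set_pmf p" "i \<noteq> s"
    then have "ix i \<noteq> ix s" using ix_inj that by blast
    then have "Some (key (ix s) @ b # \<rho>) \<notin> set_pmf (G m i)"
      by (auto simp: G_def Some_in_pre key_append_eq)
    then show "pmf (G m i) (Some (key (ix s) @ b # \<rho>)) = 0" by (simp add: set_pmf_iff)
  qed (simp add: G_def pmf_mix)
  show ?thesis
  proof (rule charI[where T = "Act A" and f = "G v"])
    show "uses_ptest (Act A) N" using T(1) ss(1) by (auto simp: A_def uses_atest_plus_list
      branch_def)
    show "must \<or> live_ptest (Act A)"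
    proof (cases must)
      case False
      obtain s where "s \<in> set_pmf \<Delta>" using set_pmf_not_empty by fast
      then have "(key (ix s), Tick (Mix Leaf (T s))) \<in> summands A" unfolding summands branch_def
        by blast
      moreover have "live_atest A" using T(2) False ss(1)
        by (auto simp: A_def live_atest_plus_list branch_def)
      ultimately show ?thesis by auto
    qed simp
    show "run_ptest (Act A) s (G v s)" if s: "s \<in> set_pmf \<Delta>" for s
    proof -
      have "comm A s (key (ix s)) (Mix Leaf (T s)) False (return_pmf s)" using s unfolding commA
        by blast
      moreover have "run_ptest (Mix Leaf (T s)) s (mix leaf (v s))" unfolding leaf_def
        by (intro run_ptest_run_atest.mix run_ptest_run_atest.leaf T(3) s)
      ultimately show ?thesis
        using run_ptest_run_atest.comm[of A s "key (ix s)" _ False "return_pmf s"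
          "\<lambda>_. mix leaf (v s)"]
        by (auto simp: G_def bind_return_pmf intro: run_ptest_run_atest.act)
    qed
    fix \<Theta> \<mu> assume *: "finite (set_pmf \<Theta>)" "fn_dist \<Theta> \<subseteq> N" "crun (Act A) \<Theta> \<mu>"
      "dominated \<mu> (bind_pmf \<Delta> (G v))"
    obtain q where q: "finite (set_pmf q)" "weak_tau \<Theta> (map_pmf fst q)" "\<mu> = bind_pmf q snd"
      "\<And>t \<nu>. (t, \<nu>) \<in> set_pmf q \<Longrightarrow> stop A t \<nu>" using crun_decompose[OF *(3)] by blast
    have "\<exists>s\<in>set_pmf \<Delta>. \<exists>\<nu>. snd x = pre (key (ix s)) (mix leaf \<nu>) \<and> run_ptest (T s) (fst x) \<nu>"
      if x: "x \<in> set_pmf q" for x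
    proof -
      have "stop A (fst x) (snd x)" using q(4)[of "fst x" "snd x"] x by simp
      then show ?thesis
      proof cases
        case (comm \<pi> U e \<Xi> f)
        then obtain s where s: "s \<in> set_pmf \<Delta>" "\<pi> = key (ix s)" "U = Mix Leaf (T s)"
          "\<Xi> = return_pmf (fst x)"
          using comm(2) unfolding commA by blast
        then have "run_ptest (Mix Leaf (T s)) (fst x) (f (fst x))" using comm(3) by simp
        then obtain \<mu>\<^sub>1 \<nu> where "f (fst x) = mix \<mu>\<^sub>1 \<nu>" "run_ptest Leaf (fst x) \<mu>\<^sub>1"
          "run_ptest (T s) (fst x) \<nu>" by cases blast
        moreover from this(2) have "\<mu>\<^sub>1 = leaf" unfolding leaf_def by cases
        ultimately show ?thesis using comm(1) s by (auto simp: bind_return_pmf)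
      next
        case dead
        obtain s where "s \<in> set_pmf \<Delta>" using set_pmf_not_empty by fast
        with dead commA show ?thesis by blast
      qed
    qed
    \<comment> \<open>\<open>c\<close> is the branch entered, and \<open>m\<close> is the run of the
      test found there.\<close>
    then obtain c m where cm: "\<And>x. x \<in> set_pmf q \<Longrightarrow> c x \<in> set_pmf \<Delta> \<and> snd x =
      pre (key (ix (c x))) (mix leaf (m x)) \<and> run_ptest (T (c x)) (fst x) (m x)"
      by metis
    \<comment> \<open>\<open>p\<close> gives the weight that enters each branch, \<open>Q\<close>
      the conditional distribution of what enters, and \<open>M\<close> the combined run of the test
      in the branch.\<close>
    define p where "p = map_pmf c q"
    define Q where "Q s = cond_pmf q {x. c x = s}" for s
    define M where "M s = bind_pmf (Q s) m" for s
    have pq: "bind_pmf p Q = q" unfolding p_def Q_def by (rule bind_map_cond_pmf)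
    have p: "finite (set_pmf p)" "set_pmf p \<subseteq> set_pmf \<Delta>" using q(1) cm by (auto simp: p_def)
    have setQ: "set_pmf (Q s) = {x \<in> set_pmf q. c x = s}" if "s \<in> set_pmf p" for s
    proof -
      have "set_pmf q \<inter> {x. c x = s} \<noteq> {}" using that by (auto simp: p_def)
      then show ?thesis unfolding Q_def by (simp add: set_cond_pmf Int_def)
    qed
    have \<mu>: "\<mu> = bind_pmf p (G M)"
    proof -
      have "\<mu> = bind_pmf p (\<lambda>s. bind_pmf (Q s) snd)" unfolding q(3) bind_assoc_pmf[symmetric] pq ..
      also have "\<dots> = bind_pmf p (G M)"
      proof (rule bind_pmf_cong[OF refl])
        fix s assume s: "s \<in> set_pmf p"
        have "bind_pmf (Q s) snd = bind_pmf (Q s) (\<lambda>x. pre (key (ix s)) (mix leaf (m x)))"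
          by (rule bind_pmf_cong[OF refl]) (use cm setQ[OF s] in auto)
        also have "\<dots> = G M s" unfolding G_def M_def pre_bind[symmetric] mix_bind by simp
        finally show "bind_pmf (Q s) snd = G M s" .
      qed
      finally show ?thesis .
    qed
    \<comment> \<open>The leaf next to each test carries half the weight of its branch. So no branch
      outweighs its target, and equality follows because both distributions have total weight
      1.\<close>
    have "p = \<Delta>"
    proof (rule pmf_le_eq[OF fin _ p(2)])
      fix s assume s: "s \<in> set_pmf \<Delta>"
      have "pmf \<mu> (Some (key (ix s) @ [False])) \<le> pmf (bind_pmf \<Delta> (G v)) (Some (key (ix s) @
        [False]))"
        using *(4) unfolding dominated_def by blast
      then show "pmf p s \<le> pmf \<Delta> s" unfolding \<mu> pmfG[OF p s] pmfG[OF fin subset_refl s]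
        by (simp add: leaf_def)
    qed
    \<comment> \<open>The equal weights of the branches cancel, and domination passes to the test
      inside each branch.\<close>
    have dom: "dominated (M s) (v s)" if s: "s \<in> set_pmf \<Delta>" for s
      unfolding dominated_def
    proof
      fix \<rho>
      have "pmf \<mu> (Some (key (ix s) @ True # \<rho>)) \<le> pmf (bind_pmf \<Delta> (G v)) (Some (key (ix s) @ True
        # \<rho>))"
        using *(4) unfolding dominated_def by blast
      then have "pmf \<Delta> s * (pmf (M s) (Some \<rho>) / 2) \<le> pmf \<Delta> s * (pmf (v s) (Some \<rho>) / 2)"
        unfolding \<mu> pmfG[OF p s] pmfG[OF fin subset_refl s] \<open>p = \<Delta>\<close> by simp
      then show "pmf (M s) (Some \<rho>) \<le> pmf (v s) (Some \<rho>)" using s by (simp add: pmf_positive)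
    qed
    have finQ: "finite (set_pmf (Q s))" if "s \<in> set_pmf \<Delta>" for s using setQ[of s] that q(1) \<open>p = \<Delta>\<close>
      by simp
    have "lift_rel \<Phi> (bind_pmf \<Delta> return_pmf) (bind_pmf \<Delta> (\<lambda>s. map_pmf fst (Q s)))"
    proof (rule lift_rel_bind[OF fin], rule lift_rel.point, rule T(4))
      fix s assume s: "s \<in> set_pmf \<Delta>"
      then have Qs: "set_pmf (Q s) = {x \<in> set_pmf q. c x = s}" using setQ \<open>p = \<Delta>\<close> by simp
      show "finite (set_pmf (map_pmf fst (Q s)))" using finQ[OF s] by simp
      have "fn_dist (map_pmf fst (Q s)) \<subseteq> fn_dist (map_pmf fst q)" unfolding fn_dist_def using Qs
        by auto
      then show "fn_dist (map_pmf fst (Q s)) \<subseteq> N" using weak_tau_fn[OF q(2)] *(2) by blast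
      have "crun (T s) (bind_pmf (Q s) (\<lambda>x. return_pmf (fst x))) (bind_pmf (Q s) m)"
        by (rule crun_bind[OF finQ[OF s]], rule crun_return) (use cm Qs in auto)
      then show "crun (T s) (map_pmf fst (Q s)) (M s)" by (simp add: M_def map_pmf_def)
    qed (use dom in auto)
    moreover have "bind_pmf \<Delta> (\<lambda>s. map_pmf fst (Q s)) = map_pmf fst q"
      using pq unfolding \<open>p = \<Delta>\<close> by (metis map_bind_pmf)
    ultimately show "\<exists>\<Theta>'. weak_tau \<Theta> \<Theta>' \<and> lift_rel \<Phi> \<Delta> \<Theta>'" using q(2)
      by (auto simp: bind_return_pmf')
  qed
qed

text \<open>Derivatives of \<open>s\<close> are smaller, so they have tests by induction, over
  \<open>N\<close> or, below a binder, over \<open>N\<close> shifted and extended by index 0; hence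
  \<open>N\<close> varies in the induction. The finitely many obligations of \<open>matches\<close>
  are then combined.\<close>

lemma testable_psim:
  "finite N \<Longrightarrow> fn_state s \<subseteq> N \<Longrightarrow> testable must N (return_pmf s) (psim must s)"
proof (induction "size s" arbitrary: s N rule: less_induct)
  case less
  have dist: "testable must M D (simulates_dist must D)"
    if "finite (set_pmf D)" "\<And>t. t \<in> set_pmf D \<Longrightarrow> size t < size s" "fn_dist D \<subseteq> M" "finite M" for D M
    by (rule testable_dist[OF that(1)], rule less.hyps) (use that in \<open>auto simp: fn_dist_def\<close>)
  let ?N = "insert 0 (Suc ` N)"
  have N: "finite ?N" "fn_state s \<subseteq> N" using less.prems by auto
  let ?ref = "\<lambda>\<Theta>. \<forall>t\<in>set_pmf \<Theta>. taus t = {} \<and> (\<forall>\<mu>. barb t \<mu> \<longrightarrow> barb s \<mu>)"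
  let ?C = "testable must N (return_pmf s)"
  have 1: "?C (\<lambda>\<Theta>. \<forall>\<Delta>\<in>taus s. simulates_dist must \<Delta> \<Theta>)"
  proof (rule testable_ball[OF finite_taus])
    fix \<Delta> assume \<Delta>: "\<Delta> \<in> taus s"
    have "?C (after_tau (simulates_dist must \<Delta>))"
      by (rule testable_tau[OF \<Delta> dist]) (use \<Delta> N less.prems(1) fn_taus[OF \<Delta>] in \<open>auto dest:
        fin_taus size_taus\<close>)
    \<comment> \<open>The weak move before the tick and the one demanded by the derivative
      compose.\<close>
    then show "?C (simulates_dist must \<Delta>)" by (rule testable_mono) (blast intro: weak_tau_trans)
  qed
  have 2: "?C (\<lambda>\<Theta>. \<forall>(a, b, \<Delta>)\<in>outs s. after_step (out_step a b) (simulates_dist must \<Delta>) \<Theta>)"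
  proof (rule testable_ball[OF finite_outs], clarify)
    fix a b D assume D: "(a, b, D) \<in> outs s"
    have "?C (after_step (out_step a b) (after_tau (simulates_dist must D)))"
      by (rule testable_out[OF D N(2) dist]) (use D N less.prems(1) fn_outs[OF D] in \<open>auto dest:
        fin_outs size_outs\<close>)
    then show "?C (after_step (out_step a b) (simulates_dist must D))"
      by (rule testable_mono) (blast intro: weak_tau_trans)
  qed
  have 3: "?C (\<lambda>\<Theta>. \<forall>(a, \<Delta>)\<in>bouts s. after_step (bout_step a) (simulates_dist must \<Delta>) \<Theta>)"
  proof (rule testable_ball[OF finite_bouts], clarify)
    fix a D assume D: "(a, D) \<in> bouts s"
    have sub: "fn_dist D \<subseteq> ?N" using fn_bouts[OF D] N(2) by blast
    have "?C (after_step (bout_step a) (after_tau (simulates_dist must D)))"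
      by (rule testable_bout[OF D less.prems(1) N(2) dist[OF fin_bouts[OF D] size_bouts[OF D] sub
        N(1)]])
    then show "?C (after_step (bout_step a) (simulates_dist must D))"
      by (rule testable_mono) (blast intro: weak_tau_trans)
  qed
  have 4: "?C (\<lambda>\<Theta>. \<forall>(a, \<Delta>)\<in>ins s. \<forall>w\<in>N. after_step (in_step a)
      (\<lambda>\<Theta>. simulates_dist must (ren_dist (inst w) \<Delta>) (ren_dist (inst w) \<Theta>)) \<Theta>)"
  proof (rule testable_ball[OF finite_ins], clarify, rule testable_ball[OF less.prems(1)])
    fix a D w assume D: "(a, D) \<in> ins s" and w: "w \<in> N"
    have "fn_dist D \<subseteq> ?N" using fn_ins[OF D] N(2) by blast
    then have sub: "fn_dist (ren_dist (inst w) D) \<subseteq> N" using w by auto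
    have fin: "finite (set_pmf (ren_dist (inst w) D))" using fin_ins[OF D] by simp
    have sz: "size t < size s" if "t \<in> set_pmf (ren_dist (inst w) D)" for t
      using that size_ins[OF D] by auto
    show "?C (after_step (in_step a) (\<lambda>\<Theta>. simulates_dist must (ren_dist (inst w) D) (ren_dist (inst
      w) \<Theta>)))"
      by (rule testable_in[OF D N(2) w dist[OF fin sz sub less.prems(1)]])
  qed
  have 5: "?C (\<lambda>\<Theta>. \<forall>(a, \<Delta>)\<in>ins s. after_step (in_step a) (simulates_dist must \<Delta>) \<Theta>)"
  proof (rule testable_ball[OF finite_ins], clarify)
    fix a D assume D: "(a, D) \<in> ins s"
    have sub: "fn_dist D \<subseteq> ?N" using fn_ins[OF D] N(2) by blast
    show "?C (after_step (in_step a) (simulates_dist must D))"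
      by (rule testable_in_new[OF D N(2) dist[OF fin_ins[OF D] size_ins[OF D] sub N(1)]])
  qed
  have 6: "?C (\<lambda>\<Theta>. must \<longrightarrow> taus s = {} \<longrightarrow> after_tau ?ref \<Theta>)"
  proof (cases "must \<and> taus s = {}")
    case True
    then have "must = True" by simp
    with True testable_ref[OF less.prems, of] show ?thesis by (simp del: barb.simps)
  next
    case False
    from testable_top show ?thesis by (rule testable_mono) (use False in blast)
  qed
  have "?C (matches must N s)"
    unfolding matches_def[abs_def]
    by (rule testable_mono[OF testable_conj[OF 1 testable_conj[OF 2 testable_conj[OF 3
      testable_conj[OF 4 testable_conj[OF 5 6]]]]]])
      (simp add: case_prod_unfold)
  then show ?case
    by (rule testable_mono) (rule psim_if_matches, use less.prems in auto)
qed

text \<open>The roles are opposite in the two parts: for may the characteristic template belongs to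
  \<open>P\<close> and is run on \<open>Q\<close>, for must it belongs to \<open>Q\<close> and is
  run on \<open>P\<close>.\<close>

theorem theorem5:
  fixes \<omega> :: name and P Q :: proc
  assumes "\<omega> \<notin> fn_proc P" and "\<omega> \<notin> fn_proc Q"
  shows "(pmay \<omega> P Q \<longrightarrow> P \<sqsubseteq>\<^sub>S Q) \<and> (pmust \<omega> P Q \<longrightarrow> P \<sqsubseteq>\<^sub>F\<^sub>S Q)"
proof -
  define N where "N = fn_proc P \<union> fn_proc Q"
  have N: "finite N" "fn_proc P \<subseteq> N" "fn_proc Q \<subseteq> N" "\<omega> \<notin> N" using assms by (auto simp: N_def)
  obtain z where z: "z \<notin> insert \<omega> N" using ex_fresh[of "insert \<omega> N"] N(1) by auto
  then have zN: "z \<notin> N" "z \<noteq> \<omega>" by auto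
  have testable: "testable must N (interp R) (simulates_dist must (interp R))"
    if "fn_proc R \<subseteq> N" for must R
    by (rule testable_dist[OF finite_interp], rule testable_psim[OF N(1)]) (use that fn_interp[of
      R] in \<open>auto simp: fn_dist_def\<close>)
  \<comment> \<open>The clocked test is built from an \<open>atest\<close>, whereas the template for
    a distribution is a \<open>ptest\<close>. A leading tick mediates, and the weak move before it
    is absorbed by the one in the definition of the preorder.\<close>
  have pass: "after_tau \<Phi> (interp R)"
    if T: "\<forall>\<Theta> \<mu>. finite (set_pmf \<Theta>) \<longrightarrow> fn_dist \<Theta> \<subseteq> N \<longrightarrow> crun T \<Theta> \<mu> \<longrightarrow> dominated \<mu> v \<longrightarrow> \<Phi> \<Theta>"
      and R: "fn_proc R \<subseteq> N" and \<mu>: "crun (Act (Tick T)) (interp R) \<mu>" "dominated \<mu> v" for T v R \<mu> \<Phi>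
  proof -
    from crun_Tick[OF \<mu>] obtain \<Theta> \<mu>' where *: "weak_tau (interp R) \<Theta>" "crun T \<Theta> \<mu>'"
      "dominated \<mu>' v" by blast
    have "fn_dist \<Theta> \<subseteq> N" using weak_tau_fn[OF *(1)] fn_interp[of R] R by blast
    with T * weak_tau_finite[OF *(1) finite_interp] show ?thesis by blast
  qed
  show ?thesis
  proof (intro conjI impI)
    assume pmay: "pmay \<omega> P Q"
    obtain T f where T: "uses_ptest T N" "False \<or> live_ptest T"
      "\<forall>s\<in>set_pmf (interp P). run_ptest T s (f s)"
      "\<forall>\<Theta> \<mu>. finite (set_pmf \<Theta>) \<longrightarrow> fn_dist \<Theta> \<subseteq> N \<longrightarrow> crun T \<Theta> \<mu> \<longrightarrow> dominated \<mu> (bind_pmf (interp P) f) \<longrightarrow>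
        simulates_dist False (interp P) \<Theta>"
      by (rule charE[OF testable[OF N(2)]])
    have "\<exists>\<mu>. crun (Act (Tick T)) (interp Q) \<mu> \<and> dominated \<mu> (bind_pmf (interp P) f)"
      by (rule may_testing[OF pmay _ _ zN(1) N(4) zN(2) N(2,3)]) (use T in \<open>auto intro:
        run_atest_Tick\<close>)
    then have "after_tau (simulates_dist False (interp P)) (interp Q)"
      using pass[OF T(4) N(3)] by blast
    then show "P \<sqsubseteq>\<^sub>S Q" unfolding sim_preorder_def psim_def if_False using weak_tau_trans by blast
  next
    assume pmust: "pmust \<omega> P Q"
    obtain T f where T: "uses_ptest T N" "True \<or> live_ptest T"
      "\<forall>s\<in>set_pmf (interp Q). run_ptest T s (f s)"
      "\<forall>\<Theta> \<mu>. finite (set_pmf \<Theta>) \<longrightarrow> fn_dist \<Theta> \<subseteq> N \<longrightarrow> crun T \<Theta> \<mu> \<longrightarrow> dominated \<mu> (bind_pmf (interp Q) f) \<longrightarrow>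
        simulates_dist True (interp Q) \<Theta>"
      by (rule charE[OF testable[OF N(3)]])
    have "\<exists>\<mu>. crun (Act (Tick T)) (interp P) \<mu> \<and> dominated \<mu> (bind_pmf (interp Q) f)"
      by (rule must_testing[OF pmust _ zN(1) N(4) zN(2) N(2,3)]) (use T in \<open>auto intro:
        run_atest_Tick\<close>)
    then have "after_tau (simulates_dist True (interp Q)) (interp P)"
      using pass[OF T(4) N(2)] by blast
    then show "P \<sqsubseteq>\<^sub>F\<^sub>S Q" unfolding fsim_preorder_def psim_def if_True using weak_tau_trans by blast
  qed
qed

end
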